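(* Let $p$ be a prime, $G$ a profinite group, $\chi\colon G\to A$ a surjective continuous homomorphism onto a nonzero quotient $A$ of $\mathbb{Z}_p$, $n\ge1$, and $R$ a nonzero quotient of $A$ with $A=\mathbb{Z}_p$ or $n|R|<p|A|$. Let $H$ be the coimage of $\chi$, $\Omega=R[[H]]$, $I$ its augmentation ideal, $h\in H$ the element with $\chi(h)=1$, $x=[h]-1$ (so $\Omega/I^j\cong R[x]/(x^j)$ for $j\le n+1$ and $I^n/I^{n+1}=Rx^n$). Let $T$ be a compact $R[[G]]$-module finitely generated over $R$, and $f=\sum_{k=0}^{n-1}\lambda_kx^k\in Z^1(G,T\otimes_R\Omega/I^n)$ with $\lambda_k\colon G\to T$, and $\lambda=\lambda_0$ (the image of $f$ in $Z^1(G,T)$). Then $$\Psi^{(n)}([f])=(\chi^{(n)},\lambda)_{\rho_{x^n}}\cdot x^n,$$ where $\rho_{x^n}$ is the proper defining system relative to $\binom{\chi}{n}^{\mathrm{mat}}$ attached to $f$.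
   Context: $G$ acts on $\Omega$ through $H$ by left multiplication and on $T\otimes_R\Omega/I^m$ diagonally. $\Psi^{(n)}\colon H^1(G,T\otimes_R\Omega/I^n)\to H^2(G,T)\otimes_RI^n/I^{n+1}$ is the connecting map of $0\to T\otimes I^n/I^{n+1}\to T\otimes\Omega/I^{n+1}\to T\otimes\Omega/I^n\to0$, identifying $H^2(G,T\otimes Rx^n)$ with $H^2(G,T)\cdot x^n$. $\binom{c}{n}^{\mathrm{mat}}$ is the $(n+1)\times(n+1)$ upper-triangular matrix over $R$ with $(i,j)$-entry $\binom{c}{j-i}$; $\binom{\chi}{n}^{\mathrm{mat}}\colon G\to\mathrm{U}_{n+1}(R)$, $g\mapsto\binom{\chi(g)}{n}^{\mathrm{mat}}$ is a well-defined homomorphism under the hypotheses. Let $\mathcal U$ be the group of $(n+2)\times(n+2)$ matrices $\begin{pmatrix}P&v\\0&1\end{pmatrix}$, $P\in\mathrm{U}_{n+1}(R)$, $v\in T^{n+1}$ (a column), $G$ acting on $v$, and $\mathcal U'$ its quotient by the matrices with $P=1$ and $v$ zero outside its first entry. The proper defining system relative to $\binom{\chi}{n}^{\mathrm{mat}}$ attached to $f$ is the $1$-cocycle $\rho_{x^n}\colon G\to\mathcal U'$ (i.e. $\rho(gh)=\rho(g)\cdot g\rho(h)$) with upper-left block $\binom{\chi}{n}^{\mathrm{mat}}$ and $(n+1-k,n+2)$-entry $\lambda_k$ for $0\le k\le n-1$. For such $\rho$ with lift $\tilde\rho$ having $(1,n+2)$-entry $0$ and entries $\rho_{i,j}$,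 the Massey product $(\chi^{(n)},\lambda)_\rho$ ($n$ copies of $\chi$, then $\lambda=\rho_{n+1,n+2}$) is the class in $H^2(G,T)$ of $(g,h)\mapsto\sum_{i=2}^{n+1}\rho_{1,i}(g)\,g\rho_{i,n+2}(h)$. *)

theory Defs
  imports "HOL-Analysis.Analysis" "HOL-Algebra.Module" "HOL-Algebra.QuotRing"
    "HOL-Algebra.Ideal_Product"
begin

section \<open>Topological groups, rings and modules\<close>

record 'g topgroup = "'g monoid" +
  grp_top :: "'g topology"

record 'r topring = "'r ring" +
  ring_top :: "'r topology"

record ('r, 'm) topmodule = "('r, 'm) module" +
  mod_top :: "'m topology"

record ('r, 'm, 'g) gmodule = "('r, 'm) topmodule" +
  act :: "'g \<Rightarrow> 'm \<Rightarrow> 'm"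

definition profinite_group :: "('g, 'x) topgroup_scheme \<Rightarrow> bool" where
  "profinite_group G \<longleftrightarrow> group G \<and> topspace (grp_top G) = carrier G \<and>
     continuous_map (prod_topology (grp_top G) (grp_top G)) (grp_top G) (\<lambda>(g, h). g \<otimes>\<^bsub>G\<^esub> h) \<and>
     continuous_map (grp_top G) (grp_top G) (\<lambda>g. inv\<^bsub>G\<^esub> g) \<and>
     compact_space (grp_top G) \<and> Hausdorff_space (grp_top G) \<and>
     (\<forall>S. connectedin (grp_top G) S \<longrightarrow> (\<exists>a. S \<subseteq> {a}))"

definition quot_topology :: "'a topology \<Rightarrow> ('a \<Rightarrow> 'b) \<Rightarrow> 'b topology" where
  "quot_topology X f =
     topology (\<lambda>U. U \<subseteq> f ` topspace X \<and> openin X {x \<in> topspace X. f x \<in> U})"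

definition quot_topgroup :: "('g, 'x) topgroup_scheme \<Rightarrow> 'g set \<Rightarrow> 'g set topgroup" where
  "quot_topgroup G K =
     \<lparr>carrier = carrier (G Mod K), mult = mult (G Mod K), one = one (G Mod K),
      grp_top = quot_topology (grp_top G) (\<lambda>g. K #>\<^bsub>G\<^esub> g)\<rparr>"

text \<open>\<open>C\<close> is, via \<open>q\<close>, a quotient of the topological ring \<open>B\<close>.\<close>

definition topring_quotient ::
    "('b, 'x) topring_scheme \<Rightarrow> ('c, 'y) topring_scheme \<Rightarrow> ('b \<Rightarrow> 'c) \<Rightarrow> bool" where
  "topring_quotient B C q \<longleftrightarrow> cring C \<and> topspace (ring_top C) = carrier C \<and>
     q \<in> ring_hom B C \<and> quotient_map (ring_top B) (ring_top C) q"

text \<open>Compact left modules over a (not necessarily commutative) topological ring; the library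
  locale for modules is restricted to commutative rings.\<close>

definition compact_module ::
    "('r, 'x) topring_scheme \<Rightarrow> ('r, 'm, 'y) topmodule_scheme \<Rightarrow> bool" where
  "compact_module S M \<longleftrightarrow> abelian_group M \<and>
     (\<forall>a\<in>carrier S. \<forall>m\<in>carrier M. a \<odot>\<^bsub>M\<^esub> m \<in> carrier M) \<and>
     (\<forall>a\<in>carrier S. \<forall>b\<in>carrier S. \<forall>m\<in>carrier M.
        (a \<oplus>\<^bsub>S\<^esub> b) \<odot>\<^bsub>M\<^esub> m = (a \<odot>\<^bsub>M\<^esub> m) \<oplus>\<^bsub>M\<^esub> (b \<odot>\<^bsub>M\<^esub> m)) \<and>
     (\<forall>a\<in>carrier S. \<forall>m\<in>carrier M. \<forall>m'\<in>carrier M.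
        a \<odot>\<^bsub>M\<^esub> (m \<oplus>\<^bsub>M\<^esub> m') = (a \<odot>\<^bsub>M\<^esub> m) \<oplus>\<^bsub>M\<^esub> (a \<odot>\<^bsub>M\<^esub> m')) \<and>
     (\<forall>a\<in>carrier S. \<forall>b\<in>carrier S. \<forall>m\<in>carrier M.
        (a \<otimes>\<^bsub>S\<^esub> b) \<odot>\<^bsub>M\<^esub> m = a \<odot>\<^bsub>M\<^esub> (b \<odot>\<^bsub>M\<^esub> m)) \<and>
     (\<forall>m\<in>carrier M. \<one>\<^bsub>S\<^esub> \<odot>\<^bsub>M\<^esub> m = m) \<and>
     topspace (mod_top M) = carrier M \<and>
     continuous_map (prod_topology (mod_top M) (mod_top M)) (mod_top M) (\<lambda>(m, m'). m \<oplus>\<^bsub>M\<^esub> m') \<and>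
     continuous_map (mod_top M) (mod_top M) (\<lambda>m. \<ominus>\<^bsub>M\<^esub> m) \<and>
     continuous_map (prod_topology (ring_top S) (mod_top M)) (mod_top M) (\<lambda>(a, m). a \<odot>\<^bsub>M\<^esub> m) \<and>
     compact_space (mod_top M) \<and> Hausdorff_space (mod_top M)"

definition fin_gen_over :: "('r, 'x) ring_scheme \<Rightarrow> ('r, 'm, 'y) module_scheme \<Rightarrow> bool" where
  "fin_gen_over R M \<longleftrightarrow> (\<exists>S. finite S \<and> S \<subseteq> carrier M \<and>
     (\<forall>m\<in>carrier M. \<exists>r\<in>S \<rightarrow> carrier R. m = (\<Oplus>\<^bsub>M\<^esub>s\<in>S. r s \<odot>\<^bsub>M\<^esub> s)))"


section \<open>The \<open>p\<close>-adic integers and binomial coefficients\<close>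

text \<open>\<open>Zp p\<close> is the inverse limit of the rings of residues \<open>{0..<p^k}\<close>.\<close>

definition Zp_carrier :: "nat \<Rightarrow> (nat \<Rightarrow> int) set" where
  "Zp_carrier p = {a. \<forall>k. a k \<in> {0..<int p ^ k} \<and> a (Suc k) mod int p ^ k = a k}"

definition Zp :: "nat \<Rightarrow> (nat \<Rightarrow> int) topring" where
  "Zp p = \<lparr>carrier = Zp_carrier p,
     mult = (\<lambda>a b k. (a k * b k) mod int p ^ k), one = (\<lambda>k. 1 mod int p ^ k),
     zero = (\<lambda>k. 0), add = (\<lambda>a b k. (a k + b k) mod int p ^ k),
     ring_top = subtopology (product_topology (\<lambda>_. discrete_topology UNIV) UNIV) (Zp_carrier p)\<rparr>"

text \<open>The \<open>p\<close>-adic integer \<open>c (c - 1) \<dots> (c - k + 1) / k!\<close>.\<close>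

definition Zp_binom :: "nat \<Rightarrow> (nat \<Rightarrow> int) \<Rightarrow> nat \<Rightarrow> (nat \<Rightarrow> int)" where
  "Zp_binom p c k = (THE b. b \<in> carrier (Zp p) \<and>
     [(fact k :: nat)] \<cdot>\<^bsub>Zp p\<^esub> b =
       (\<Otimes>\<^bsub>Zp p\<^esub>i\<in>{..<k}. c \<ominus>\<^bsub>Zp p\<^esub> ([i] \<cdot>\<^bsub>Zp p\<^esub> \<one>\<^bsub>Zp p\<^esub>)))"

text \<open>For quotients \<open>q: Zp \<rightarrow> A\<close> and \<open>\<pi>: A \<rightarrow> R\<close>, the common image in \<open>R\<close> of the
  binomial coefficients of all \<open>p\<close>-adic lifts of \<open>c \<in> A\<close>.\<close>

definition quot_binom ::
    "nat \<Rightarrow> ((nat \<Rightarrow> int) \<Rightarrow> 'a) \<Rightarrow> ('a \<Rightarrow> 'r) \<Rightarrow> 'a \<Rightarrow> nat \<Rightarrow> 'r" where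
  "quot_binom p q \<pi> c k =
     the_elem ((\<lambda>z. \<pi> (q (Zp_binom p z k))) ` {z \<in> carrier (Zp p). q z = c})"

definition binom_mat ::
    "('r, 'x) ring_scheme \<Rightarrow> nat \<Rightarrow> ((nat \<Rightarrow> int) \<Rightarrow> 'a) \<Rightarrow> ('a \<Rightarrow> 'r) \<Rightarrow> nat \<Rightarrow> 'a
       \<Rightarrow> (nat \<times> nat \<Rightarrow> 'r)" where
  "binom_mat R p q \<pi> n c = (\<lambda>(i, j) \<in> {1..n+1} \<times> {1..n+1}.
     if i \<le> j then quot_binom p q \<pi> c (j - i) else \<zero>\<^bsub>R\<^esub>)"


section \<open>Completed group rings\<close>

text \<open>The group ring of a finite group.\<close>

definition group_ring :: "('r, 'x) ring_scheme \<Rightarrow> ('q, 'y) monoid_scheme \<Rightarrow> ('q \<Rightarrow> 'r) ring" where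
  "group_ring R Q =
     \<lparr>carrier = carrier Q \<rightarrow>\<^sub>E carrier R,
      mult = (\<lambda>a b. \<lambda>u\<in>carrier Q. \<Oplus>\<^bsub>R\<^esub>v\<in>carrier Q. a v \<otimes>\<^bsub>R\<^esub> b (inv\<^bsub>Q\<^esub> v \<otimes>\<^bsub>Q\<^esub> u)),
      one = (\<lambda>u\<in>carrier Q. if u = \<one>\<^bsub>Q\<^esub> then \<one>\<^bsub>R\<^esub> else \<zero>\<^bsub>R\<^esub>),
      zero = (\<lambda>u\<in>carrier Q. \<zero>\<^bsub>R\<^esub>),
      add = (\<lambda>a b. \<lambda>u\<in>carrier Q. a u \<oplus>\<^bsub>R\<^esub> b u)\<rparr>"

definition open_normals :: "('g, 'x) topgroup_scheme \<Rightarrow> 'g set set" where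
  "open_normals G = {N. normal N G \<and> openin (grp_top G) N}"

text \<open>\<open>R[[G]]\<close> as the inverse limit of the rings \<open>R[G/N]\<close> over the open normal subgroups \<open>N\<close>.
  For \<open>N \<subseteq> M\<close> the transition map \<open>R[G/N] \<rightarrow> R[G/M]\<close> adds up the coefficients of the
  cosets of \<open>N\<close> lying in a given coset of \<open>M\<close>.\<close>

definition cgr_carrier ::
    "('r, 'x) topring_scheme \<Rightarrow> ('g, 'y) topgroup_scheme \<Rightarrow> ('g set \<Rightarrow> 'g set \<Rightarrow> 'r) set" where
  "cgr_carrier R G = {a \<in> (\<Pi>\<^sub>E N\<in>open_normals G. carrier (group_ring R (G Mod N))).
     \<forall>N\<in>open_normals G. \<forall>M\<in>open_normals G. N \<subseteq> M \<longrightarrow>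
       (\<forall>C\<in>carrier (G Mod M). a M C = (\<Oplus>\<^bsub>R\<^esub>D\<in>{D \<in> carrier (G Mod N). D \<subseteq> C}. a N D))}"

definition completed_group_ring ::
    "('r, 'x) topring_scheme \<Rightarrow> ('g, 'y) topgroup_scheme \<Rightarrow> ('g set \<Rightarrow> 'g set \<Rightarrow> 'r) topring" where
  "completed_group_ring R G =
     \<lparr>carrier = cgr_carrier R G,
      mult = (\<lambda>a b. \<lambda>N\<in>open_normals G. a N \<otimes>\<^bsub>group_ring R (G Mod N)\<^esub> b N),
      one = (\<lambda>N\<in>open_normals G. \<one>\<^bsub>group_ring R (G Mod N)\<^esub>),
      zero = (\<lambda>N\<in>open_normals G. \<zero>\<^bsub>group_ring R (G Mod N)\<^esub>),
      add = (\<lambda>a b. \<lambda>N\<in>open_normals G. a N \<oplus>\<^bsub>group_ring R (G Mod N)\<^esub> b N),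
      ring_top = subtopology
        (product_topology (\<lambda>N. product_topology (\<lambda>_. ring_top R) (carrier (G Mod N))) (open_normals G))
        (cgr_carrier R G)\<rparr>"

definition cgr_elt ::
    "('r, 'x) topring_scheme \<Rightarrow> ('g, 'y) topgroup_scheme \<Rightarrow> 'g \<Rightarrow> ('g set \<Rightarrow> 'g set \<Rightarrow> 'r)" where
  "cgr_elt R G g = (\<lambda>N\<in>open_normals G. \<lambda>C\<in>carrier (G Mod N).
     if C = N #>\<^bsub>G\<^esub> g then \<one>\<^bsub>R\<^esub> else \<zero>\<^bsub>R\<^esub>)"

definition cgr_const ::
    "('r, 'x) topring_scheme \<Rightarrow> ('g, 'y) topgroup_scheme \<Rightarrow> 'r \<Rightarrow> ('g set \<Rightarrow> 'g set \<Rightarrow> 'r)" where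
  "cgr_const R G r = (\<lambda>N\<in>open_normals G. \<lambda>C\<in>carrier (G Mod N). if C = N then r else \<zero>\<^bsub>R\<^esub>)"

text \<open>The augmentation of \<open>a\<close> is its component at \<open>N = G\<close>, an element of \<open>R[G/G] = R\<close>.\<close>

definition aug_ideal ::
    "('r, 'x) topring_scheme \<Rightarrow> ('g, 'y) topgroup_scheme \<Rightarrow> ('g set \<Rightarrow> 'g set \<Rightarrow> 'r) set" where
  "aug_ideal R G =
     {a \<in> carrier (completed_group_ring R G). a (carrier G) (carrier G) = \<zero>\<^bsub>R\<^esub>}"

primrec ideal_pow :: "('a, 'x) ring_scheme \<Rightarrow> 'a set \<Rightarrow> nat \<Rightarrow> 'a set" where
  "ideal_pow S I 0 = carrier S"
| "ideal_pow S I (Suc k) = ideal_prod S (ideal_pow S I k) I"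

abbreviation aug_pow ::
    "('r, 'x) topring_scheme \<Rightarrow> ('g, 'y) topgroup_scheme \<Rightarrow> nat \<Rightarrow> ('g set \<Rightarrow> 'g set \<Rightarrow> 'r) set" where
  "aug_pow R G j \<equiv> ideal_pow (completed_group_ring R G) (aug_ideal R G) j"

text \<open>\<open>\<Omega>/I^j\<close> and its submodule \<open>I^n/I^(n+1) \<subseteq> \<Omega>/I^(n+1)\<close> as \<open>R\<close>-modules,
  where \<open>\<Omega> = R[[H]]\<close>.\<close>

definition omega_quot ::
    "('r, 'x) topring_scheme \<Rightarrow> ('h, 'y) topgroup_scheme \<Rightarrow> nat
       \<Rightarrow> ('r, ('h set \<Rightarrow> 'h set \<Rightarrow> 'r) set) module" where
  "omega_quot R H j = (let \<Omega> = completed_group_ring R H; J = aug_pow R H j in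
     \<lparr>carrier = carrier (\<Omega> Quot J), mult = mult (\<Omega> Quot J), one = one (\<Omega> Quot J),
      zero = zero (\<Omega> Quot J), add = add (\<Omega> Quot J),
      smult = (\<lambda>r X. (J +>\<^bsub>\<Omega>\<^esub> cgr_const R H r) \<otimes>\<^bsub>\<Omega> Quot J\<^esub> X)\<rparr>)"

definition aug_graded ::
    "('r, 'x) topring_scheme \<Rightarrow> ('h, 'y) topgroup_scheme \<Rightarrow> nat
       \<Rightarrow> ('r, ('h set \<Rightarrow> 'h set \<Rightarrow> 'r) set) module" where
  "aug_graded R H n = (omega_quot R H (Suc n))
     \<lparr>carrier := (\<lambda>w. aug_pow R H (Suc n) +>\<^bsub>completed_group_ring R H\<^esub> w) ` aug_pow R H n\<rparr>"

text \<open>\<open>g \<in> G\<close> acts on \<open>\<Omega>/I^j\<close>, for \<open>H = G/K\<close>, by multiplication by the class of \<open>gK\<close>.\<close>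

definition omega_act ::
    "('r, 'x) topring_scheme \<Rightarrow> ('g, 'y) topgroup_scheme \<Rightarrow> 'g set \<Rightarrow> nat \<Rightarrow> 'g
       \<Rightarrow> ('g set set \<Rightarrow> 'g set set \<Rightarrow> 'r) set \<Rightarrow> ('g set set \<Rightarrow> 'g set set \<Rightarrow> 'r) set" where
  "omega_act R G K j g X =
     (let H = quot_topgroup G K; \<Omega> = completed_group_ring R H; J = aug_pow R H j in
       (J +>\<^bsub>\<Omega>\<^esub> cgr_elt R H (K #>\<^bsub>G\<^esub> g)) \<otimes>\<^bsub>\<Omega> Quot J\<^esub> X)"

text \<open>An \<open>R[[G]]\<close>-module viewed as an \<open>R\<close>-module with \<open>G\<close>-action.\<close>

definition coeff_module ::
    "('r, 'x) topring_scheme \<Rightarrow> ('g, 'y) topgroup_scheme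
       \<Rightarrow> ('g set \<Rightarrow> 'g set \<Rightarrow> 'r, 'm, 'z) topmodule_scheme \<Rightarrow> ('r, 'm, 'g) gmodule" where
  "coeff_module R G M =
     \<lparr>carrier = carrier M, mult = mult M, one = one M, zero = zero M, add = add M,
      smult = (\<lambda>r m. cgr_const R G r \<odot>\<^bsub>M\<^esub> m), mod_top = mod_top M,
      act = (\<lambda>g m. cgr_elt R G g \<odot>\<^bsub>M\<^esub> m)\<rparr>"


section \<open>Quotient modules and tensor products\<close>

definition quot_module :: "('r, 'm, 'x) module_scheme \<Rightarrow> 'm set \<Rightarrow> ('r, 'm set) module" where
  "quot_module M N =
     \<lparr>carrier = a_rcosets\<^bsub>M\<^esub> N, mult = undefined, one = undefined, zero = N, add = set_add M,
      smult = (\<lambda>r X. \<Union>x\<in>X. N +>\<^bsub>M\<^esub> (r \<odot>\<^bsub>M\<^esub> x))\<rparr>"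

definition free_module :: "('r, 'x) ring_scheme \<Rightarrow> 's set \<Rightarrow> ('r, 's \<Rightarrow> 'r) module" where
  "free_module R S =
     \<lparr>carrier = {a \<in> S \<rightarrow>\<^sub>E carrier R. finite {s \<in> S. a s \<noteq> \<zero>\<^bsub>R\<^esub>}},
      mult = undefined, one = undefined, zero = (\<lambda>s\<in>S. \<zero>\<^bsub>R\<^esub>),
      add = (\<lambda>a b. \<lambda>s\<in>S. a s \<oplus>\<^bsub>R\<^esub> b s),
      smult = (\<lambda>r a. \<lambda>s\<in>S. r \<otimes>\<^bsub>R\<^esub> a s)\<rparr>"

definition free_gen :: "('r, 'x) ring_scheme \<Rightarrow> 's set \<Rightarrow> 's \<Rightarrow> 's \<Rightarrow> 'r" where
  "free_gen R S s = (\<lambda>u\<in>S. if u = s then \<one>\<^bsub>R\<^esub> else \<zero>\<^bsub>R\<^esub>)"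

definition tensor_relators ::
    "('r, 'x) ring_scheme \<Rightarrow> ('r, 'm, 'y) module_scheme \<Rightarrow> ('r, 'n, 'z) module_scheme
       \<Rightarrow> ('m \<times> 'n \<Rightarrow> 'r) set" where
  "tensor_relators R M N =
     (let S = carrier M \<times> carrier N; F = free_module R S; e = free_gen R S in
       {e (m \<oplus>\<^bsub>M\<^esub> m', n) \<ominus>\<^bsub>F\<^esub> (e (m, n) \<oplus>\<^bsub>F\<^esub> e (m', n)) | m m' n.
          m \<in> carrier M \<and> m' \<in> carrier M \<and> n \<in> carrier N} \<union>
       {e (m, n \<oplus>\<^bsub>N\<^esub> n') \<ominus>\<^bsub>F\<^esub> (e (m, n) \<oplus>\<^bsub>F\<^esub> e (m, n')) | m n n'.
          m \<in> carrier M \<and> n \<in> carrier N \<and> n' \<in> carrier N} \<union>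
       {e (r \<odot>\<^bsub>M\<^esub> m, n) \<ominus>\<^bsub>F\<^esub> (r \<odot>\<^bsub>F\<^esub> e (m, n)) | r m n.
          r \<in> carrier R \<and> m \<in> carrier M \<and> n \<in> carrier N} \<union>
       {e (m, r \<odot>\<^bsub>N\<^esub> n) \<ominus>\<^bsub>F\<^esub> (r \<odot>\<^bsub>F\<^esub> e (m, n)) | r m n.
          r \<in> carrier R \<and> m \<in> carrier M \<and> n \<in> carrier N})"

definition tensor_kernel ::
    "('r, 'x) ring_scheme \<Rightarrow> ('r, 'm, 'y) module_scheme \<Rightarrow> ('r, 'n, 'z) module_scheme
       \<Rightarrow> ('m \<times> 'n \<Rightarrow> 'r) set" where
  "tensor_kernel R M N =
     \<Inter>{S. submodule S R (free_module R (carrier M \<times> carrier N)) \<and> tensor_relators R M N \<subseteq> S}"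

definition tensor ::
    "('r, 'x) ring_scheme \<Rightarrow> ('r, 'm, 'y) module_scheme \<Rightarrow> ('r, 'n, 'z) module_scheme
       \<Rightarrow> ('r, ('m \<times> 'n \<Rightarrow> 'r) set) module" where
  "tensor R M N = quot_module (free_module R (carrier M \<times> carrier N)) (tensor_kernel R M N)"

definition pure_tensor ::
    "('r, 'x) ring_scheme \<Rightarrow> ('r, 'm, 'y) module_scheme \<Rightarrow> ('r, 'n, 'z) module_scheme
       \<Rightarrow> 'm \<Rightarrow> 'n \<Rightarrow> ('m \<times> 'n \<Rightarrow> 'r) set" where
  "pure_tensor R M N m n = tensor_kernel R M N
     +>\<^bsub>free_module R (carrier M \<times> carrier N)\<^esub> free_gen R (carrier M \<times> carrier N) (m, n)"

text \<open>The homomorphism \<open>M \<otimes> N \<rightarrow> K\<close> induced by a bilinear map \<open>\<beta>\<close>.\<close>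

definition tensor_lift ::
    "('r, 'x) ring_scheme \<Rightarrow> ('r, 'm, 'y) module_scheme \<Rightarrow> ('r, 'n, 'z) module_scheme
       \<Rightarrow> ('r, 'k, 'w) module_scheme \<Rightarrow> ('m \<Rightarrow> 'n \<Rightarrow> 'k) \<Rightarrow> ('m \<times> 'n \<Rightarrow> 'r) set \<Rightarrow> 'k" where
  "tensor_lift R M N K \<beta> = (THE \<phi>. \<phi> \<in> extensional (carrier (tensor R M N)) \<and>
     \<phi> \<in> hom (add_monoid (tensor R M N)) (add_monoid K) \<and>
     (\<forall>m\<in>carrier M. \<forall>n\<in>carrier N. \<phi> (pure_tensor R M N m n) = \<beta> m n))"

text \<open>For \<open>N\<close> finitely generated over \<open>R\<close>, the tensor product carries the quotient topology
  from the surjection \<open>T^k \<rightarrow> T \<otimes> N\<close> given by any \<open>k\<close> generators of \<open>N\<close>. Independently of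
  generators, it is the finest topology making all the maps
  \<open>T^k \<rightarrow> T \<otimes> N\<close>, \<open>t \<mapsto> \<Sum> t_i \<otimes> \<nu>_i\<close>, continuous.\<close>

definition tensor_topology ::
    "('r, 'x) ring_scheme \<Rightarrow> ('r, 'm, 'y) topmodule_scheme \<Rightarrow> ('r, 'n, 'z) module_scheme
       \<Rightarrow> ('m \<times> 'n \<Rightarrow> 'r) set topology" where
  "tensor_topology R T N = topology (\<lambda>U. U \<subseteq> carrier (tensor R T N) \<and>
     (\<forall>k::nat. \<forall>\<nu>\<in>{..<k} \<rightarrow> carrier N.
        openin (product_topology (\<lambda>_. mod_top T) {..<k})
          {t \<in> {..<k} \<rightarrow>\<^sub>E topspace (mod_top T).
             (\<Oplus>\<^bsub>tensor R T N\<^esub>i\<in>{..<k}. pure_tensor R T N (t i) (\<nu> i)) \<in> U}))"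

text \<open>\<open>T \<otimes> N\<close> with the diagonal action, where \<open>a\<close> is the action on \<open>N\<close>.\<close>

definition tensor_gmodule ::
    "('r, 'x) ring_scheme \<Rightarrow> ('r, 'm, 'g, 'y) gmodule_scheme \<Rightarrow> ('r, 'n, 'z) module_scheme
       \<Rightarrow> ('g \<Rightarrow> 'n \<Rightarrow> 'n) \<Rightarrow> ('r, ('m \<times> 'n \<Rightarrow> 'r) set, 'g) gmodule" where
  "tensor_gmodule R T N a =
     \<lparr>carrier = carrier (tensor R T N), mult = undefined, one = undefined,
      zero = zero (tensor R T N), add = add (tensor R T N), smult = smult (tensor R T N),
      mod_top = tensor_topology R T N,
      act = (\<lambda>g. tensor_lift R T N (tensor R T N) (\<lambda>t n. pure_tensor R T N (act T g t) (a g n)))\<rparr>"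


section \<open>Continuous cohomology\<close>

definition C1 :: "('g, 'x) topgroup_scheme \<Rightarrow> ('r, 'm, 'g, 'y) gmodule_scheme \<Rightarrow> ('g \<Rightarrow> 'm) set" where
  "C1 G M = {f \<in> extensional (carrier G). continuous_map (grp_top G) (mod_top M) f}"

definition C2 ::
    "('g, 'x) topgroup_scheme \<Rightarrow> ('r, 'm, 'g, 'y) gmodule_scheme \<Rightarrow> ('g \<times> 'g \<Rightarrow> 'm) set" where
  "C2 G M = {c \<in> extensional (carrier G \<times> carrier G).
     continuous_map (prod_topology (grp_top G) (grp_top G)) (mod_top M) c}"

definition coboundary0 ::
    "('g, 'x) topgroup_scheme \<Rightarrow> ('r, 'm, 'g, 'y) gmodule_scheme \<Rightarrow> 'm \<Rightarrow> 'g \<Rightarrow> 'm" where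
  "coboundary0 G M m = (\<lambda>g\<in>carrier G. act M g m \<ominus>\<^bsub>M\<^esub> m)"

definition coboundary1 ::
    "('g, 'x) topgroup_scheme \<Rightarrow> ('r, 'm, 'g, 'y) gmodule_scheme \<Rightarrow> ('g \<Rightarrow> 'm) \<Rightarrow> 'g \<times> 'g \<Rightarrow> 'm" where
  "coboundary1 G M f = (\<lambda>(g, h)\<in>carrier G \<times> carrier G.
     (act M g (f h) \<ominus>\<^bsub>M\<^esub> f (g \<otimes>\<^bsub>G\<^esub> h)) \<oplus>\<^bsub>M\<^esub> f g)"

definition Z1 :: "('g, 'x) topgroup_scheme \<Rightarrow> ('r, 'm, 'g, 'y) gmodule_scheme \<Rightarrow> ('g \<Rightarrow> 'm) set" where
  "Z1 G M = {f \<in> C1 G M. \<forall>g\<in>carrier G. \<forall>h\<in>carrier G.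
     f (g \<otimes>\<^bsub>G\<^esub> h) = f g \<oplus>\<^bsub>M\<^esub> act M g (f h)}"

definition Z2 ::
    "('g, 'x) topgroup_scheme \<Rightarrow> ('r, 'm, 'g, 'y) gmodule_scheme \<Rightarrow> ('g \<times> 'g \<Rightarrow> 'm) set" where
  "Z2 G M = {c \<in> C2 G M. \<forall>g\<in>carrier G. \<forall>h\<in>carrier G. \<forall>k\<in>carrier G.
     act M g (c (h, k)) \<oplus>\<^bsub>M\<^esub> c (g, h \<otimes>\<^bsub>G\<^esub> k) = c (g \<otimes>\<^bsub>G\<^esub> h, k) \<oplus>\<^bsub>M\<^esub> c (g, h)}"

definition fun_module :: "('r, 'm, 'x) module_scheme \<Rightarrow> 's set \<Rightarrow> ('s \<Rightarrow> 'm) set \<Rightarrow> ('r, 's \<Rightarrow> 'm) module" where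
  "fun_module M S F =
     \<lparr>carrier = F, mult = undefined, one = undefined, zero = (\<lambda>s\<in>S. \<zero>\<^bsub>M\<^esub>),
      add = (\<lambda>f f'. \<lambda>s\<in>S. f s \<oplus>\<^bsub>M\<^esub> f' s), smult = (\<lambda>r f. \<lambda>s\<in>S. r \<odot>\<^bsub>M\<^esub> f s)\<rparr>"

definition B1 :: "('g, 'x) topgroup_scheme \<Rightarrow> ('r, 'm, 'g, 'y) gmodule_scheme \<Rightarrow> ('g \<Rightarrow> 'm) set" where
  "B1 G M = coboundary0 G M ` carrier M"

definition B2 ::
    "('g, 'x) topgroup_scheme \<Rightarrow> ('r, 'm, 'g, 'y) gmodule_scheme \<Rightarrow> ('g \<times> 'g \<Rightarrow> 'm) set" where
  "B2 G M = coboundary1 G M ` C1 G M"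

definition H2 ::
    "('g, 'x) topgroup_scheme \<Rightarrow> ('r, 'm, 'g, 'y) gmodule_scheme \<Rightarrow> ('r, ('g \<times> 'g \<Rightarrow> 'm) set) module" where
  "H2 G M = quot_module (fun_module M (carrier G \<times> carrier G) (Z2 G M)) (B2 G M)"

definition class1 ::
    "('g, 'x) topgroup_scheme \<Rightarrow> ('r, 'm, 'g, 'y) gmodule_scheme \<Rightarrow> ('g \<Rightarrow> 'm) \<Rightarrow> ('g \<Rightarrow> 'm) set" where
  "class1 G M f = B1 G M +>\<^bsub>fun_module M (carrier G) (Z1 G M)\<^esub> f"

definition class2 ::
    "('g, 'x) topgroup_scheme \<Rightarrow> ('r, 'm, 'g, 'y) gmodule_scheme
       \<Rightarrow> ('g \<times> 'g \<Rightarrow> 'm) \<Rightarrow> ('g \<times> 'g \<Rightarrow> 'm) set" where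
  "class2 G M c = B2 G M +>\<^bsub>fun_module M (carrier G \<times> carrier G) (Z2 G M)\<^esub> c"

definition H2_map ::
    "('g, 'x) topgroup_scheme \<Rightarrow> ('r, 'k, 'g, 'z) gmodule_scheme
       \<Rightarrow> ('m \<Rightarrow> 'k) \<Rightarrow> ('g \<times> 'g \<Rightarrow> 'm) set \<Rightarrow> ('g \<times> 'g \<Rightarrow> 'k) set" where
  "H2_map G K \<phi> X = the_elem ((\<lambda>c. class2 G K (\<lambda>s\<in>carrier G \<times> carrier G. \<phi> (c s))) ` X)"

text \<open>The connecting map \<open>H^1(G, M'') \<rightarrow> H^2(G, M')\<close> of an exact sequence
  \<open>0 \<rightarrow> M' \<rightarrow> M \<rightarrow> M'' \<rightarrow> 0\<close> with maps \<open>i\<close> and \<open>j\<close>: lift a cocycle in the class \<open>z\<close> to a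
  continuous cochain \<open>b\<close> in \<open>M\<close> and pull its coboundary back to \<open>M'\<close>.\<close>

definition connecting ::
    "('g, 'x) topgroup_scheme \<Rightarrow> ('r, 'm1, 'g, 'y1) gmodule_scheme \<Rightarrow> ('r, 'm, 'g, 'y) gmodule_scheme
       \<Rightarrow> ('m1 \<Rightarrow> 'm) \<Rightarrow> ('m \<Rightarrow> 'm2) \<Rightarrow> ('g \<Rightarrow> 'm2) set \<Rightarrow> ('g \<times> 'g \<Rightarrow> 'm1) set" where
  "connecting G M' M i j z = the_elem {class2 G M' a | a b.
     a \<in> Z2 G M' \<and> b \<in> C1 G M \<and> (\<lambda>g\<in>carrier G. j (b g)) \<in> z \<and>
     (\<lambda>s\<in>carrier G \<times> carrier G. i (a s)) = coboundary1 G M b}"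


section \<open>The connecting map \<open>\<Psi>^(n)\<close>\<close>

text \<open>\<open>T \<otimes> \<Omega>/I^j\<close> and \<open>T \<otimes> I^n/I^(n+1)\<close> for \<open>\<Omega> = R[[G/K]]\<close>.\<close>

abbreviation T_omega ::
    "('r, 'x) topring_scheme \<Rightarrow> ('g, 'y) topgroup_scheme \<Rightarrow> 'g set \<Rightarrow> ('r, 'm, 'g, 'z) gmodule_scheme
       \<Rightarrow> nat \<Rightarrow> ('r, ('m \<times> ('g set set \<Rightarrow> 'g set set \<Rightarrow> 'r) set \<Rightarrow> 'r) set, 'g) gmodule" where
  "T_omega R G K T j \<equiv>
     tensor_gmodule R T (omega_quot R (quot_topgroup G K) j) (omega_act R G K j)"

abbreviation T_graded ::
    "('r, 'x) topring_scheme \<Rightarrow> ('g, 'y) topgroup_scheme \<Rightarrow> 'g set \<Rightarrow> ('r, 'm, 'g, 'z) gmodule_scheme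
       \<Rightarrow> nat \<Rightarrow> ('r, ('m \<times> ('g set set \<Rightarrow> 'g set set \<Rightarrow> 'r) set \<Rightarrow> 'r) set, 'g) gmodule" where
  "T_graded R G K T n \<equiv>
     tensor_gmodule R T (aug_graded R (quot_topgroup G K) n) (omega_act R G K (Suc n))"

definition T_incl ::
    "('r, 'x) topring_scheme \<Rightarrow> ('g, 'y) topgroup_scheme \<Rightarrow> 'g set \<Rightarrow> ('r, 'm, 'g, 'z) gmodule_scheme
       \<Rightarrow> nat \<Rightarrow> ('m \<times> ('g set set \<Rightarrow> 'g set set \<Rightarrow> 'r) set \<Rightarrow> 'r) set
       \<Rightarrow> ('m \<times> ('g set set \<Rightarrow> 'g set set \<Rightarrow> 'r) set \<Rightarrow> 'r) set" where
  "T_incl R G K T n = (let H = quot_topgroup G K in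
     tensor_lift R T (aug_graded R H n) (T_omega R G K T (Suc n))
       (pure_tensor R T (omega_quot R H (Suc n))))"

text \<open>The projection \<open>\<Omega>/I^(n+1) \<rightarrow> \<Omega>/I^n\<close> sends a coset \<open>X\<close> of \<open>I^(n+1)\<close> to \<open>I^n + X\<close>.\<close>

definition T_proj ::
    "('r, 'x) topring_scheme \<Rightarrow> ('g, 'y) topgroup_scheme \<Rightarrow> 'g set \<Rightarrow> ('r, 'm, 'g, 'z) gmodule_scheme
       \<Rightarrow> nat \<Rightarrow> ('m \<times> ('g set set \<Rightarrow> 'g set set \<Rightarrow> 'r) set \<Rightarrow> 'r) set
       \<Rightarrow> ('m \<times> ('g set set \<Rightarrow> 'g set set \<Rightarrow> 'r) set \<Rightarrow> 'r) set" where
  "T_proj R G K T n = (let H = quot_topgroup G K in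
     tensor_lift R T (omega_quot R H (Suc n)) (T_omega R G K T n)
       (\<lambda>t X. pure_tensor R T (omega_quot R H n) t
                (aug_pow R H n <+>\<^bsub>completed_group_ring R H\<^esub> X)))"

text \<open>The canonical map \<open>H^2(G, T) \<otimes> I^n/I^(n+1) \<rightarrow> H^2(G, T \<otimes> I^n/I^(n+1))\<close>.\<close>

definition H2_tensor_map ::
    "('r, 'x) topring_scheme \<Rightarrow> ('g, 'y) topgroup_scheme \<Rightarrow> 'g set \<Rightarrow> ('r, 'm, 'g, 'z) gmodule_scheme
       \<Rightarrow> nat \<Rightarrow> (('g \<times> 'g \<Rightarrow> 'm) set \<times> ('g set set \<Rightarrow> 'g set set \<Rightarrow> 'r) set \<Rightarrow> 'r) set
       \<Rightarrow> ('g \<times> 'g \<Rightarrow> ('m \<times> ('g set set \<Rightarrow> 'g set set \<Rightarrow> 'r) set \<Rightarrow> 'r) set) set" where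
  "H2_tensor_map R G K T n = (let N = aug_graded R (quot_topgroup G K) n in
     tensor_lift R (H2 G T) N (H2 G (T_graded R G K T n))
       (\<lambda>X m. H2_map G (T_graded R G K T n) (\<lambda>t. pure_tensor R T N t m) X))"

definition Psi ::
    "('r, 'x) topring_scheme \<Rightarrow> ('g, 'y) topgroup_scheme \<Rightarrow> 'g set \<Rightarrow> ('r, 'm, 'g, 'z) gmodule_scheme
       \<Rightarrow> nat \<Rightarrow> ('g \<Rightarrow> ('m \<times> ('g set set \<Rightarrow> 'g set set \<Rightarrow> 'r) set \<Rightarrow> 'r) set) set
       \<Rightarrow> (('g \<times> 'g \<Rightarrow> 'm) set \<times> ('g set set \<Rightarrow> 'g set set \<Rightarrow> 'r) set \<Rightarrow> 'r) set" where
  "Psi R G K T n z =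
     inv_into (carrier (tensor R (H2 G T) (aug_graded R (quot_topgroup G K) n)))
       (H2_tensor_map R G K T n)
       (connecting G (T_graded R G K T n) (T_omega R G K T (Suc n))
          (T_incl R G K T n) (T_proj R G K T n) z)"


section \<open>Defining systems and Massey products\<close>

definition unitriangular :: "('r, 'x) ring_scheme \<Rightarrow> nat \<Rightarrow> (nat \<times> nat \<Rightarrow> 'r) set" where
  "unitriangular R m = {P \<in> {1..m} \<times> {1..m} \<rightarrow>\<^sub>E carrier R.
     (\<forall>i\<in>{1..m}. P (i, i) = \<one>\<^bsub>R\<^esub>) \<and> (\<forall>i\<in>{1..m}. \<forall>j\<in>{1..m}. j < i \<longrightarrow> P (i, j) = \<zero>\<^bsub>R\<^esub>)}"

text \<open>The pair \<open>(P, v)\<close> stands for the block matrix with rows \<open>(P v)\<close> and \<open>(0 1)\<close>, of size \<open>m + 1\<close>;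
  thus \<open>v i\<close> is its \<open>(i, m + 1)\<close>-entry.\<close>

definition block_group ::
    "('r, 'x) topring_scheme \<Rightarrow> ('r, 'm, 'y) topmodule_scheme \<Rightarrow> nat
       \<Rightarrow> ((nat \<times> nat \<Rightarrow> 'r) \<times> (nat \<Rightarrow> 'm)) topgroup" where
  "block_group R T m =
     \<lparr>carrier = unitriangular R m \<times> ({1..m} \<rightarrow>\<^sub>E carrier T),
      mult = (\<lambda>(P, v) (Q, w).
        (\<lambda>(i, j)\<in>{1..m} \<times> {1..m}. \<Oplus>\<^bsub>R\<^esub>k\<in>{1..m}. P (i, k) \<otimes>\<^bsub>R\<^esub> Q (k, j),
         \<lambda>i\<in>{1..m}. (\<Oplus>\<^bsub>T\<^esub>k\<in>{1..m}. P (i, k) \<odot>\<^bsub>T\<^esub> w k) \<oplus>\<^bsub>T\<^esub> v i)),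
      one = (\<lambda>(i, j)\<in>{1..m} \<times> {1..m}. if i = j then \<one>\<^bsub>R\<^esub> else \<zero>\<^bsub>R\<^esub>, \<lambda>i\<in>{1..m}. \<zero>\<^bsub>T\<^esub>),
      grp_top = subtopology
        (prod_topology (product_topology (\<lambda>_. ring_top R) ({1..m} \<times> {1..m}))
                       (product_topology (\<lambda>_. mod_top T) {1..m}))
        (unitriangular R m \<times> ({1..m} \<rightarrow>\<^sub>E carrier T))\<rparr>"

definition block_corner ::
    "('r, 'x) topring_scheme \<Rightarrow> ('r, 'm, 'y) topmodule_scheme \<Rightarrow> nat
       \<Rightarrow> ((nat \<times> nat \<Rightarrow> 'r) \<times> (nat \<Rightarrow> 'm)) set" where
  "block_corner R T m = {u \<in> carrier (block_group R T m).
     fst u = fst \<one>\<^bsub>block_group R T m\<^esub> \<and> (\<forall>i\<in>{2..m}. snd u i = \<zero>\<^bsub>T\<^esub>)}"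

definition block_quot ::
    "('r, 'x) topring_scheme \<Rightarrow> ('r, 'm, 'y) topmodule_scheme \<Rightarrow> nat
       \<Rightarrow> ((nat \<times> nat \<Rightarrow> 'r) \<times> (nat \<Rightarrow> 'm)) set topgroup" where
  "block_quot R T m = quot_topgroup (block_group R T m) (block_corner R T m)"

definition block_act ::
    "('r, 'm, 'g, 'y) gmodule_scheme \<Rightarrow> nat \<Rightarrow> 'g
       \<Rightarrow> (nat \<times> nat \<Rightarrow> 'r) \<times> (nat \<Rightarrow> 'm) \<Rightarrow> (nat \<times> nat \<Rightarrow> 'r) \<times> (nat \<Rightarrow> 'm)" where
  "block_act T m g u = (fst u, \<lambda>i\<in>{1..m}. act T g (snd u i))"

text \<open>Proper defining systems relative to \<open>\<theta>: G \<rightarrow> U_(n+1)(R)\<close>: continuous 1-cocycles with values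
  in the quotient by the corner subgroup and with upper-left block \<open>\<theta>\<close>.\<close>

definition proper_defining_system ::
    "('r, 'x) topring_scheme \<Rightarrow> ('g, 'y) topgroup_scheme \<Rightarrow> ('r, 'm, 'g, 'z) gmodule_scheme \<Rightarrow> nat
       \<Rightarrow> ('g \<Rightarrow> (nat \<times> nat \<Rightarrow> 'r)) \<Rightarrow> ('g \<Rightarrow> ((nat \<times> nat \<Rightarrow> 'r) \<times> (nat \<Rightarrow> 'm)) set) \<Rightarrow> bool" where
  "proper_defining_system R G T n \<theta> \<rho> \<longleftrightarrow>
     continuous_map (grp_top G) (grp_top (block_quot R T (n+1))) \<rho> \<and>
     (\<forall>g\<in>carrier G. \<rho> g \<in> carrier (block_quot R T (n+1))) \<and>
     (\<forall>g\<in>carrier G. \<forall>h\<in>carrier G.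
        \<rho> (g \<otimes>\<^bsub>G\<^esub> h) = \<rho> g \<otimes>\<^bsub>block_quot R T (n+1)\<^esub> (block_act T (n+1) g ` \<rho> h)) \<and>
     (\<forall>g\<in>carrier G. \<forall>u\<in>\<rho> g. fst u = \<theta> g)"

text \<open>The cocycle with upper-left block \<open>\<theta>\<close> and \<open>(n+1-k, n+2)\<close>-entry \<open>\<lambda>_k\<close> for \<open>k < n\<close>.\<close>

definition attached_system ::
    "('r, 'x) topring_scheme \<Rightarrow> ('r, 'm, 'g, 'z) gmodule_scheme \<Rightarrow> nat
       \<Rightarrow> ('g \<Rightarrow> (nat \<times> nat \<Rightarrow> 'r)) \<Rightarrow> (nat \<Rightarrow> 'g \<Rightarrow> 'm)
       \<Rightarrow> 'g \<Rightarrow> ((nat \<times> nat \<Rightarrow> 'r) \<times> (nat \<Rightarrow> 'm)) set" where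
  "attached_system R T n \<theta> lam g = block_corner R T (n+1) #>\<^bsub>block_group R T (n+1)\<^esub>
     (\<theta> g, \<lambda>i\<in>{1..n+1}. if i = 1 then \<zero>\<^bsub>T\<^esub> else lam (n + 1 - i) g)"

definition corner_zero_lift ::
    "('r, 'm, 'y) module_scheme \<Rightarrow> ((nat \<times> nat \<Rightarrow> 'r) \<times> (nat \<Rightarrow> 'm)) set
       \<Rightarrow> (nat \<times> nat \<Rightarrow> 'r) \<times> (nat \<Rightarrow> 'm)" where
  "corner_zero_lift T X = (THE u. u \<in> X \<and> snd u 1 = \<zero>\<^bsub>T\<^esub>)"

definition massey_product ::
    "('g, 'y) topgroup_scheme \<Rightarrow> ('r, 'm, 'g, 'z) gmodule_scheme \<Rightarrow> nat
       \<Rightarrow> ('g \<Rightarrow> ((nat \<times> nat \<Rightarrow> 'r) \<times> (nat \<Rightarrow> 'm)) set) \<Rightarrow> ('g \<times> 'g \<Rightarrow> 'm) set" where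
  "massey_product G T n \<rho> = class2 G T (\<lambda>(g, h)\<in>carrier G \<times> carrier G.
     \<Oplus>\<^bsub>T\<^esub>i\<in>{2..n+1}. fst (corner_zero_lift T (\<rho> g)) (1, i)
                      \<odot>\<^bsub>T\<^esub> act T g (snd (corner_zero_lift T (\<rho> h)) i))"

end

theory Submission
  imports Defs "HOL-Number_Theory.Cong" "HOL-Algebra.Multiplicative_Group"
begin

text \<open>
  A lift \<open>b(g) = \<Sum>k<n. lam k g \<otimes> x^k\<close> of \<open>f\<close> to \<open>T \<otimes> \<Omega>/I^(n+1)\<close> has a coboundary concentrated in the
  coordinate of \<open>x^n\<close>, so \<open>\<Psi>^(n)([f])\<close> is read off from that coordinate. Since \<open>g\<close> acts on \<open>\<Omega>/I^(n+1)\<close> as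
  multiplication by \<open>(1 + x)^\<chi>(g) = \<Sum>k. binom(\<chi>(g), k) x^k\<close>, the coordinate is
  \<open>\<Sum>l<n. binom(\<chi>(g), n - l) g lam l h\<close>, which is the Massey cochain of the attached system; the lower
  coordinates of the cocycle condition on \<open>f\<close> say that the attached system is a cocycle.

  The expansion of \<open>(1 + x)^z\<close> for \<open>p\<close>-adic \<open>z\<close> rests on \<open>1, x, \<dots>, x^n\<close> being a basis of \<open>\<Omega>/I^(n+1)\<close>. For
  finite \<open>A\<close> of order \<open>p^a\<close> this is where the bound on \<open>n\<close> enters: the annihilator of \<open>x\<close> is generated
  by the norm element, whose coefficients are the binomials \<open>p^a choose k + 1\<close>, and the bound makes those
  with \<open>k < n\<close> vanish in \<open>R\<close>.
\<close>

section \<open>Modules and tensor products\<close>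

subsection \<open>Finite sums and additive maps\<close>

lemma (in abelian_monoid) finsum_swap:
  assumes "finite A" "finite B" "\<And>i j. i \<in> A \<Longrightarrow> j \<in> B \<Longrightarrow> f i j \<in> carrier G"
  shows "(\<Oplus>i\<in>A. \<Oplus>j\<in>B. f i j) = (\<Oplus>j\<in>B. \<Oplus>i\<in>A. f i j)"
  using assms(1,3)
proof (induction A rule: finite_induct)
  case (insert a A)
  have "(\<Oplus>i\<in>insert a A. \<Oplus>j\<in>B. f i j) = (\<Oplus>j\<in>B. f a j \<oplus> (\<Oplus>i\<in>A. f i j))"
    using insert by (subst finsum_addf) auto
  also have "\<dots> = (\<Oplus>j\<in>B. \<Oplus>i\<in>insert a A. f i j)"
    using insert by (intro finsum_cong') (auto intro!: finsum_insert[symmetric])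
  finally show ?case .
qed simp

lemma (in abelian_monoid) finsum_fibres:
  assumes "finite A" "finite B" "f ` A \<subseteq> B" "g \<in> A \<rightarrow> carrier G"
  shows "(\<Oplus>v\<in>B. \<Oplus>d\<in>{d \<in> A. f d = v}. g d) = (\<Oplus>d\<in>A. g d)"
proof -
  have "(\<Oplus>d\<in>(\<Union>v\<in>B. {d \<in> A. f d = v}). g d) = (\<Oplus>v\<in>B. \<Oplus>d\<in>{d \<in> A. f d = v}. g d)"
    by (rule add.finprod_UN_disjoint) (use assms in \<open>auto simp: pairwise_def disjnt_def\<close>)
  moreover have "(\<Union>v\<in>B. {d \<in> A. f d = v}) = A"
    using assms(3) by auto
  ultimately show ?thesis by simp
qed

lemma (in abelian_monoid) finsum_reindex_bij:
  assumes "bij_betw k A B" "g \<in> B \<rightarrow> carrier G"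
  shows "(\<Oplus>v\<in>B. g v) = (\<Oplus>v\<in>A. g (k v))"
  using finsum_reindex[of g k A] assms by (auto simp: bij_betw_def)

lemma (in abelian_monoid) finsum_delta:
  assumes "finite A" "i \<in> A \<Longrightarrow> f i \<in> carrier G" "\<And>j. j \<in> A \<Longrightarrow> j \<noteq> i \<Longrightarrow> f j = \<zero>"
  shows "(\<Oplus>j\<in>A. f j) = (if i \<in> A then f i else \<zero>)"
proof -
  have "f j \<in> carrier G" if "j \<in> A" for j
    using assms(2,3) that by (cases "j = i") auto
  then have "(\<Oplus>j\<in>A. f j) = (\<Oplus>j\<in>A \<inter> {i}. f j)"
    using assms by (intro add.finprod_mono_neutral_cong_right) auto
  also have "\<dots> = (if i \<in> A then f i else \<zero>)"
    using assms by (cases "i \<in> A") auto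
  finally show ?thesis .
qed

lemma additive_finsum:
  assumes "abelian_monoid M" "abelian_monoid P" "finite A" "f \<in> A \<rightarrow> carrier M"
    and "\<And>a. a \<in> carrier M \<Longrightarrow> \<phi> a \<in> carrier P" "\<phi> \<zero>\<^bsub>M\<^esub> = \<zero>\<^bsub>P\<^esub>"
    and "\<And>a b. a \<in> carrier M \<Longrightarrow> b \<in> carrier M \<Longrightarrow> \<phi> (a \<oplus>\<^bsub>M\<^esub> b) = \<phi> a \<oplus>\<^bsub>P\<^esub> \<phi> b"
  shows "\<phi> (\<Oplus>\<^bsub>M\<^esub>i\<in>A. f i) = (\<Oplus>\<^bsub>P\<^esub>i\<in>A. \<phi> (f i))"
  using assms(3,4)
proof (induction A rule: finite_induct)
  case empty
  then show ?case
    using assms by (simp add: abelian_monoid.finsum_empty)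
next
  case (insert a A)
  have "\<phi> (\<Oplus>\<^bsub>M\<^esub>i\<in>insert a A. f i) = \<phi> (f a \<oplus>\<^bsub>M\<^esub> (\<Oplus>\<^bsub>M\<^esub>i\<in>A. f i))"
    using insert assms(1) by (subst abelian_monoid.finsum_insert) auto
  also have "\<dots> = \<phi> (f a) \<oplus>\<^bsub>P\<^esub> (\<Oplus>\<^bsub>P\<^esub>i\<in>A. \<phi> (f i))"
    using insert assms by (subst assms(7)) (auto intro!: abelian_monoid.finsum_closed)
  also have "\<dots> = (\<Oplus>\<^bsub>P\<^esub>i\<in>insert a A. \<phi> (f i))"
    using insert assms by (subst abelian_monoid.finsum_insert) (auto simp: Pi_iff)
  finally show ?case .
qed

lemma additive_group_hom:
  assumes "abelian_group M" "abelian_group P"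
    and "\<And>a. a \<in> carrier M \<Longrightarrow> \<phi> a \<in> carrier P"
    and "\<And>a b. a \<in> carrier M \<Longrightarrow> b \<in> carrier M \<Longrightarrow> \<phi> (a \<oplus>\<^bsub>M\<^esub> b) = \<phi> a \<oplus>\<^bsub>P\<^esub> \<phi> b"
  shows "group_hom (add_monoid M) (add_monoid P) \<phi>"
  using assms abelian_group.a_group[OF assms(1)] abelian_group.a_group[OF assms(2)]
  by (auto simp: group_hom_def group_hom_axioms_def hom_def)

lemma additive_zero:
  assumes "abelian_group M" "abelian_group P"
    and "\<And>a. a \<in> carrier M \<Longrightarrow> \<phi> a \<in> carrier P"
    and "\<And>a b. a \<in> carrier M \<Longrightarrow> b \<in> carrier M \<Longrightarrow> \<phi> (a \<oplus>\<^bsub>M\<^esub> b) = \<phi> a \<oplus>\<^bsub>P\<^esub> \<phi> b"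
  shows "\<phi> \<zero>\<^bsub>M\<^esub> = \<zero>\<^bsub>P\<^esub>"
  using group_hom.hom_one[OF additive_group_hom[of M P \<phi>]] assms by simp

lemma additive_uminus:
  assumes "abelian_group M" "abelian_group P"
    and "\<And>a. a \<in> carrier M \<Longrightarrow> \<phi> a \<in> carrier P"
    and "\<And>a b. a \<in> carrier M \<Longrightarrow> b \<in> carrier M \<Longrightarrow> \<phi> (a \<oplus>\<^bsub>M\<^esub> b) = \<phi> a \<oplus>\<^bsub>P\<^esub> \<phi> b"
    and "a \<in> carrier M"
  shows "\<phi> (\<ominus>\<^bsub>M\<^esub> a) = \<ominus>\<^bsub>P\<^esub> \<phi> a"
  using group_hom.hom_inv[OF additive_group_hom[of M P \<phi>]] assms by (simp add: a_inv_def)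

lemma additive_minus:
  assumes "abelian_group M" "abelian_group P"
    and "\<And>a. a \<in> carrier M \<Longrightarrow> \<phi> a \<in> carrier P"
    and "\<And>a b. a \<in> carrier M \<Longrightarrow> b \<in> carrier M \<Longrightarrow> \<phi> (a \<oplus>\<^bsub>M\<^esub> b) = \<phi> a \<oplus>\<^bsub>P\<^esub> \<phi> b"
    and "a \<in> carrier M" "b \<in> carrier M"
  shows "\<phi> (a \<ominus>\<^bsub>M\<^esub> b) = \<phi> a \<ominus>\<^bsub>P\<^esub> \<phi> b"
  using assms additive_uminus[of M P \<phi> b] by (simp add: a_minus_def abelian_group.a_inv_closed)

lemma (in abelian_group) minus_eq_zero_iff:
  assumes "a \<in> carrier G" "b \<in> carrier G"
  shows "a \<ominus> b = \<zero> \<longleftrightarrow> a = b"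
  using assms by (metis a_minus_def add.inv_closed add.inv_inv add.inv_equality add.r_inv)

lemma (in abelian_group) minus_add_cancel:
  assumes "a \<in> carrier G" "b \<in> carrier G"
  shows "(a \<ominus> b) \<oplus> b = a"
  using assms by (simp add: a_minus_def a_assoc l_neg)

lemma (in abelian_group) add_minus_cancel:
  assumes "a \<in> carrier G" "b \<in> carrier G"
  shows "a \<oplus> (b \<ominus> a) = b"
  using assms minus_add_cancel[of b a] by (simp add: a_comm)

lemma finsum_eq_of_add_monoid_eq:
  assumes "carrier M = carrier P" "add M = add P" "zero M = zero P"
  shows "finsum M f A = finsum P f A"
  unfolding finsum_def finprod_def using assms by simp

subsection \<open>Linear maps\<close>

definition module_hom :: "('r, 'x) ring_scheme \<Rightarrow> ('r, 'm, 'y) module_scheme \<Rightarrow>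
    ('r, 'k, 'z) module_scheme \<Rightarrow> ('m \<Rightarrow> 'k) set" where
  "module_hom R M P = {\<phi> \<in> carrier M \<rightarrow> carrier P.
     (\<forall>a\<in>carrier M. \<forall>b\<in>carrier M. \<phi> (a \<oplus>\<^bsub>M\<^esub> b) = \<phi> a \<oplus>\<^bsub>P\<^esub> \<phi> b) \<and>
     (\<forall>r\<in>carrier R. \<forall>a\<in>carrier M. \<phi> (r \<odot>\<^bsub>M\<^esub> a) = r \<odot>\<^bsub>P\<^esub> \<phi> a)}"

lemma module_homI:
  assumes "\<And>a. a \<in> carrier M \<Longrightarrow> \<phi> a \<in> carrier P"
    and "\<And>a b. a \<in> carrier M \<Longrightarrow> b \<in> carrier M \<Longrightarrow> \<phi> (a \<oplus>\<^bsub>M\<^esub> b) = \<phi> a \<oplus>\<^bsub>P\<^esub> \<phi> b"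
    and "\<And>r a. r \<in> carrier R \<Longrightarrow> a \<in> carrier M \<Longrightarrow> \<phi> (r \<odot>\<^bsub>M\<^esub> a) = r \<odot>\<^bsub>P\<^esub> \<phi> a"
  shows "\<phi> \<in> module_hom R M P"
  using assms by (auto simp: module_hom_def)

lemma module_homD:
  assumes "\<phi> \<in> module_hom R M P"
  shows "a \<in> carrier M \<Longrightarrow> \<phi> a \<in> carrier P"
    and "a \<in> carrier M \<Longrightarrow> b \<in> carrier M \<Longrightarrow> \<phi> (a \<oplus>\<^bsub>M\<^esub> b) = \<phi> a \<oplus>\<^bsub>P\<^esub> \<phi> b"
    and "r \<in> carrier R \<Longrightarrow> a \<in> carrier M \<Longrightarrow> \<phi> (r \<odot>\<^bsub>M\<^esub> a) = r \<odot>\<^bsub>P\<^esub> \<phi> a"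
  using assms by (auto simp: module_hom_def)

lemma module_abelian_monoid: "module R M \<Longrightarrow> abelian_monoid M"
  by (simp add: module_def abelian_group_def)

lemma module_hom_zero:
  assumes "module R M" "module R P" "\<phi> \<in> module_hom R M P"
  shows "\<phi> \<zero>\<^bsub>M\<^esub> = \<zero>\<^bsub>P\<^esub>"
  using assms by (intro additive_zero) (auto simp: module.axioms(2) module_homD)

lemma module_hom_minus:
  assumes "module R M" "module R P" "\<phi> \<in> module_hom R M P" "a \<in> carrier M" "b \<in> carrier M"
  shows "\<phi> (a \<ominus>\<^bsub>M\<^esub> b) = \<phi> a \<ominus>\<^bsub>P\<^esub> \<phi> b"
  using assms by (intro additive_minus) (auto simp: module.axioms(2) module_homD)

lemma module_hom_finsum:
  assumes "module R M" "module R P" "\<phi> \<in> module_hom R M P" "finite A" "f \<in> A \<rightarrow> carrier M"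
  shows "\<phi> (\<Oplus>\<^bsub>M\<^esub>i\<in>A. f i) = (\<Oplus>\<^bsub>P\<^esub>i\<in>A. \<phi> (f i))"
  using assms module_hom_zero[OF assms(1-3)] module_homD[OF assms(3)]
  by (intro additive_finsum) (auto simp: module_abelian_monoid)

lemma module_hom_kernel_submodule:
  assumes "module R M" "module R P" "\<phi> \<in> module_hom R M P"
  shows "submodule {a \<in> carrier M. \<phi> a = \<zero>\<^bsub>P\<^esub>} R M"
proof -
  interpret M: module R M by fact
  interpret P: module R P by fact
  have "\<phi> (\<ominus>\<^bsub>M\<^esub> a) = \<ominus>\<^bsub>P\<^esub> \<phi> a" if "a \<in> carrier M" for a
    using that assms module_homD[OF assms(3)]
    by (intro additive_uminus) (auto simp: module.axioms(2))
  then show ?thesis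
    by (intro M.submoduleI) (use module_homD[OF assms(3)] module_hom_zero[OF assms] in auto)
qed

lemma module_hom_image_submodule:
  assumes "module R M" "module R P" "\<phi> \<in> module_hom R M P"
  shows "submodule (\<phi> ` carrier M) R P"
proof -
  interpret M: module R M by fact
  interpret P: module R P by fact
  note D = module_homD[OF assms(3)]
  have "\<ominus>\<^bsub>P\<^esub> \<phi> a \<in> \<phi> ` carrier M" if "a \<in> carrier M" for a
    using that D by (intro image_eqI[of _ _ "\<ominus>\<^bsub>M\<^esub> a"])
      (auto intro!: additive_uminus[symmetric] M.M.abelian_group_axioms P.M.abelian_group_axioms)
  moreover have "\<zero>\<^bsub>P\<^esub> \<in> \<phi> ` carrier M"
    by (intro image_eqI[of _ _ "\<zero>\<^bsub>M\<^esub>"]) (auto simp: module_hom_zero[OF assms])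
  moreover have "\<phi> a \<oplus>\<^bsub>P\<^esub> \<phi> b \<in> \<phi> ` carrier M" if "a \<in> carrier M" "b \<in> carrier M" for a b
    using that by (intro image_eqI[of _ _ "a \<oplus>\<^bsub>M\<^esub> b"]) (auto simp: D)
  moreover have "r \<odot>\<^bsub>P\<^esub> \<phi> a \<in> \<phi> ` carrier M" if "r \<in> carrier R" "a \<in> carrier M" for r a
    using that by (intro image_eqI[of _ _ "r \<odot>\<^bsub>M\<^esub> a"]) (auto simp: D)
  ultimately show ?thesis
    by (intro P.submoduleI) (use D(1) in auto)
qed

text \<open>Equational axioms may be checked after applying maps into known structures that jointly
  separate points.\<close>

lemma abelian_group_of_separating_maps:
  assumes P: "\<And>i. i \<in> I \<Longrightarrow> abelian_group (P i)"
    and zero: "\<zero>\<^bsub>M\<^esub> \<in> carrier M" "\<And>i. i \<in> I \<Longrightarrow> \<phi> i \<zero>\<^bsub>M\<^esub> = \<zero>\<^bsub>P i\<^esub>"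
    and closed: "\<And>a b. a \<in> carrier M \<Longrightarrow> b \<in> carrier M \<Longrightarrow> a \<oplus>\<^bsub>M\<^esub> b \<in> carrier M"
    and uminus: "\<And>a. a \<in> carrier M \<Longrightarrow> \<exists>b\<in>carrier M. \<forall>i\<in>I. \<phi> i b = \<ominus>\<^bsub>P i\<^esub> \<phi> i a"
    and maps: "\<And>i a. i \<in> I \<Longrightarrow> a \<in> carrier M \<Longrightarrow> \<phi> i a \<in> carrier (P i)"
    and add: "\<And>i a b. i \<in> I \<Longrightarrow> a \<in> carrier M \<Longrightarrow> b \<in> carrier M \<Longrightarrow> \<phi> i (a \<oplus>\<^bsub>M\<^esub> b) = \<phi> i a \<oplus>\<^bsub>P i\<^esub> \<phi> i b"
    and sep: "\<And>a b. a \<in> carrier M \<Longrightarrow> b \<in> carrier M \<Longrightarrow> (\<And>i. i \<in> I \<Longrightarrow> \<phi> i a = \<phi> i b) \<Longrightarrow> a = b"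
  shows "abelian_group M"
proof (rule abelian_groupI)
  note monoid = abelian_group.axioms(1)[OF P]
  fix a assume a: "a \<in> carrier M"
  show "\<zero>\<^bsub>M\<^esub> \<oplus>\<^bsub>M\<^esub> a = a"
    using a zero by (intro sep) (auto simp: closed add maps abelian_monoid.l_zero[OF monoid])
  obtain b where b: "b \<in> carrier M" "\<And>i. i \<in> I \<Longrightarrow> \<phi> i b = \<ominus>\<^bsub>P i\<^esub> \<phi> i a"
    using uminus[OF a] by blast
  have "b \<oplus>\<^bsub>M\<^esub> a = \<zero>\<^bsub>M\<^esub>"
    using a b zero by (intro sep) (auto simp: closed add maps abelian_group.l_neg[OF P])
  then show "\<exists>b\<in>carrier M. b \<oplus>\<^bsub>M\<^esub> a = \<zero>\<^bsub>M\<^esub>"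
    using b(1) by blast
  fix b assume b: "b \<in> carrier M"
  show "a \<oplus>\<^bsub>M\<^esub> b = b \<oplus>\<^bsub>M\<^esub> a"
    using a b by (intro sep) (auto simp: closed add maps abelian_monoid.a_comm[OF monoid])
  fix c assume "c \<in> carrier M"
  then show "a \<oplus>\<^bsub>M\<^esub> b \<oplus>\<^bsub>M\<^esub> c = a \<oplus>\<^bsub>M\<^esub> (b \<oplus>\<^bsub>M\<^esub> c)"
    using a b by (intro sep) (auto simp: closed add maps abelian_monoid.a_assoc[OF monoid])
qed (auto intro: closed zero)

lemma cring_of_separating_maps:
  assumes P: "\<And>i. i \<in> I \<Longrightarrow> cring (P i)"
    and zero: "\<zero>\<^bsub>S\<^esub> \<in> carrier S" "\<And>i. i \<in> I \<Longrightarrow> \<phi> i \<zero>\<^bsub>S\<^esub> = \<zero>\<^bsub>P i\<^esub>"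
    and one: "\<one>\<^bsub>S\<^esub> \<in> carrier S"
    and add: "\<And>a b. a \<in> carrier S \<Longrightarrow> b \<in> carrier S \<Longrightarrow> a \<oplus>\<^bsub>S\<^esub> b \<in> carrier S"
    and mult: "\<And>a b. a \<in> carrier S \<Longrightarrow> b \<in> carrier S \<Longrightarrow> a \<otimes>\<^bsub>S\<^esub> b \<in> carrier S"
    and uminus: "\<And>a. a \<in> carrier S \<Longrightarrow> \<exists>b\<in>carrier S. \<forall>i\<in>I. \<phi> i b = \<ominus>\<^bsub>P i\<^esub> \<phi> i a"
    and hom: "\<And>i. i \<in> I \<Longrightarrow> \<phi> i \<in> ring_hom S (P i)"
    and sep: "\<And>a b. a \<in> carrier S \<Longrightarrow> b \<in> carrier S \<Longrightarrow> (\<And>i. i \<in> I \<Longrightarrow> \<phi> i a = \<phi> i b) \<Longrightarrow> a = b"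
  shows "cring S"
proof -
  note D = ring_hom_closed[OF hom] ring_hom_add[OF hom] ring_hom_mult[OF hom] ring_hom_one[OF hom]
  note ring = cring.axioms(1)[OF P] and comm = cring.axioms(2)[OF P]
  have "abelian_group S"
    by (rule abelian_group_of_separating_maps[where I = I and P = P and \<phi> = \<phi>])
      (auto simp: D zero add intro: ring.is_abelian_group[OF ring] uminus sep)
  moreover have "comm_monoid S"
    by (rule comm_monoidI; (rule one mult; assumption)?; rule sep)
      (auto simp: D one mult comm_monoid.m_comm[OF comm]
        monoid.m_assoc[OF comm_monoid.axioms(1)[OF comm]] monoid.l_one[OF comm_monoid.axioms(1)[OF comm]])
  moreover have "(a \<oplus>\<^bsub>S\<^esub> b) \<otimes>\<^bsub>S\<^esub> c = a \<otimes>\<^bsub>S\<^esub> c \<oplus>\<^bsub>S\<^esub> b \<otimes>\<^bsub>S\<^esub> c"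
    if abc: "a \<in> carrier S" "b \<in> carrier S" "c \<in> carrier S" for a b c
  proof (rule sep)
    fix i assume i: "i \<in> I"
    interpret P: cring "P i" by (rule P[OF i])
    show "\<phi> i ((a \<oplus>\<^bsub>S\<^esub> b) \<otimes>\<^bsub>S\<^esub> c) = \<phi> i (a \<otimes>\<^bsub>S\<^esub> c \<oplus>\<^bsub>S\<^esub> b \<otimes>\<^bsub>S\<^esub> c)"
      using abc i by (simp add: D add mult P.l_distr)
  qed (use abc in \<open>auto intro: add mult\<close>)
  ultimately show ?thesis
    by (rule cringI)
qed

lemma module_of_separating_maps:
  assumes R: "cring R" and P: "\<And>i. i \<in> I \<Longrightarrow> module R (P i)"
    and zero: "\<zero>\<^bsub>M\<^esub> \<in> carrier M" "\<And>i. i \<in> I \<Longrightarrow> \<phi> i \<zero>\<^bsub>M\<^esub> = \<zero>\<^bsub>P i\<^esub>"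
    and add: "\<And>a b. a \<in> carrier M \<Longrightarrow> b \<in> carrier M \<Longrightarrow> a \<oplus>\<^bsub>M\<^esub> b \<in> carrier M"
    and smult: "\<And>r a. r \<in> carrier R \<Longrightarrow> a \<in> carrier M \<Longrightarrow> r \<odot>\<^bsub>M\<^esub> a \<in> carrier M"
    and hom: "\<And>i. i \<in> I \<Longrightarrow> \<phi> i \<in> module_hom R M (P i)"
    and sep: "\<And>a b. a \<in> carrier M \<Longrightarrow> b \<in> carrier M \<Longrightarrow> (\<And>i. i \<in> I \<Longrightarrow> \<phi> i a = \<phi> i b) \<Longrightarrow> a = b"
  shows "module R M"
proof -
  interpret R: cring R by (rule R)
  note D = module_homD[OF hom]
  have "\<exists>b\<in>carrier M. \<forall>i\<in>I. \<phi> i b = \<ominus>\<^bsub>P i\<^esub> \<phi> i a" if "a \<in> carrier M" for a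
    using that
    by (intro bexI[of _ "\<ominus>\<^bsub>R\<^esub> \<one>\<^bsub>R\<^esub> \<odot>\<^bsub>M\<^esub> a"] smult ballI)
      (auto simp: D module.smult_l_minus[OF P] module.smult_one[OF P])
  then have "abelian_group M"
    by (intro abelian_group_of_separating_maps[where I = I and P = P and \<phi> = \<phi>])
      (auto simp: D add zero intro: module.axioms(2)[OF P] sep)
  then show ?thesis
    by (rule moduleI[OF R])
      (auto intro!: sep simp: add smult D module.smult_l_distr[OF P] module.smult_r_distr[OF P]
        module.smult_assoc1[OF P] module.smult_one[OF P])
qed

definition regular_module :: "('r, 'x) ring_scheme \<Rightarrow> ('r, 'r) module" where
  "regular_module R = \<lparr>carrier = carrier R, mult = mult R, one = one R, zero = zero R, add = add R,
     smult = mult R\<rparr>"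

lemma (in cring) regular_module_is_module: "module R (regular_module R)"
proof (rule moduleI[OF is_cring])
  show "abelian_group (regular_module R)"
    by (rule abelian_groupI) (auto simp: regular_module_def a_ac intro: l_neg)
qed (auto simp: regular_module_def l_distr r_distr m_assoc)

subsection \<open>Quotient modules\<close>

lemma (in abelian_group) abelian_subgroup_of_subgroup:
  "subgroup N (add_monoid G) \<Longrightarrow> abelian_subgroup N G"
  by (intro abelian_subgroupI3 abelian_group_axioms) (simp add: additive_subgroup_def)

lemma (in abelian_group) coset_eq_iff:
  assumes "subgroup N (add_monoid G)" "a \<in> carrier G" "b \<in> carrier G"
  shows "N +> a = N +> b \<longleftrightarrow> a \<ominus> b \<in> N"
proof -
  note N = abelian_subgroup_of_subgroup[OF assms(1)]
  have "a \<in> N +> b \<longleftrightarrow> a \<ominus> b \<in> N"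
    using abelian_subgroup.a_rcos_module[OF N assms(3,2)] by (simp add: a_minus_def)
  then show ?thesis
    using abelian_subgroup.a_repr_independence'[OF N _ assms(3)]
      abelian_subgroup.a_rcos_self[OF N assms(2)] by metis
qed

lemma (in abelian_group) coset_add:
  assumes "subgroup N (add_monoid G)" "a \<in> carrier G" "b \<in> carrier G"
  shows "(N +> a) <+> (N +> b) = N +> (a \<oplus> b)"
  by (rule abelian_subgroup.a_rcos_sum[OF abelian_subgroup_of_subgroup[OF assms(1)] assms(2,3)])

lemma a_rcosets_eq_image: "a_rcosets\<^bsub>M\<^esub> N = (\<lambda>a. N +>\<^bsub>M\<^esub> a) ` carrier M"
  unfolding A_RCOSETS_def' a_r_coset_def' by (auto simp: a_r_coset_def')

lemma quot_module_simps:
  "carrier (quot_module M N) = (\<lambda>a. N +>\<^bsub>M\<^esub> a) ` carrier M"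
  "zero (quot_module M N) = N"
  "add (quot_module M N) = set_add M"
  "smult (quot_module M N) = (\<lambda>r X. \<Union>x\<in>X. N +>\<^bsub>M\<^esub> (r \<odot>\<^bsub>M\<^esub> x))"
  by (simp_all add: quot_module_def a_rcosets_eq_image)

lemma (in module) quot_module_add:
  assumes "submodule N R M" "a \<in> carrier M" "b \<in> carrier M"
  shows "(N +>\<^bsub>M\<^esub> a) \<oplus>\<^bsub>quot_module M N\<^esub> (N +>\<^bsub>M\<^esub> b) = N +>\<^bsub>M\<^esub> (a \<oplus>\<^bsub>M\<^esub> b)"
  using M.coset_add[OF submodule.axioms(1)[OF assms(1)] assms(2,3)] by (simp add: quot_module_simps)

lemma (in module) quot_module_smult:
  assumes N: "submodule N R M" and "r \<in> carrier R" "a \<in> carrier M"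
  shows "r \<odot>\<^bsub>quot_module M N\<^esub> (N +>\<^bsub>M\<^esub> a) = N +>\<^bsub>M\<^esub> (r \<odot>\<^bsub>M\<^esub> a)"
proof -
  note sub = submodule.axioms(1)[OF N]
  have "N +>\<^bsub>M\<^esub> (r \<odot>\<^bsub>M\<^esub> x) = N +>\<^bsub>M\<^esub> (r \<odot>\<^bsub>M\<^esub> a)" if x: "x \<in> N +>\<^bsub>M\<^esub> a" for x
  proof -
    obtain y where y: "y \<in> N" "x = y \<oplus>\<^bsub>M\<^esub> a"
      using x unfolding a_r_coset_def' by blast
    have y_carrier: "y \<in> carrier M"
      using y submoduleE(1)[OF N] by auto
    have "r \<odot>\<^bsub>M\<^esub> x \<ominus>\<^bsub>M\<^esub> r \<odot>\<^bsub>M\<^esub> a = r \<odot>\<^bsub>M\<^esub> y"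
      using y y_carrier assms by (simp add: smult_r_distr a_minus_def M.a_assoc M.r_neg)
    then show ?thesis
      using y y_carrier assms submoduleE(4)[OF N] by (subst M.coset_eq_iff[OF sub]) auto
  qed
  moreover have "a \<in> N +>\<^bsub>M\<^esub> a"
    by (rule abelian_subgroup.a_rcos_self[OF M.abelian_subgroup_of_subgroup[OF sub] assms(3)])
  ultimately show ?thesis unfolding quot_module_simps by blast
qed

lemma (in module) quot_module_zero:
  "submodule N R M \<Longrightarrow> \<zero>\<^bsub>quot_module M N\<^esub> = N +>\<^bsub>M\<^esub> \<zero>\<^bsub>M\<^esub>"
  using M.a_coset_add_zero[of N] submoduleE(1)[of N] by (simp add: quot_module_simps)

lemma (in module) quot_module_is_module:
  assumes N: "submodule N R M"
  shows "module R (quot_module M N)"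
proof -
  let ?Q = "quot_module M N"
  have mem: "N +>\<^bsub>M\<^esub> a \<in> carrier ?Q" if "a \<in> carrier M" for a
    using that by (simp add: quot_module_simps)
  have "abelian_group ?Q"
  proof (rule abelian_groupI)
    fix X assume "X \<in> carrier ?Q"
    then obtain a where a: "a \<in> carrier M" "X = N +>\<^bsub>M\<^esub> a"
      by (auto simp: quot_module_simps)
    have "(N +>\<^bsub>M\<^esub> (\<ominus>\<^bsub>M\<^esub> a)) \<oplus>\<^bsub>?Q\<^esub> X = \<zero>\<^bsub>?Q\<^esub>"
      using a by (simp add: quot_module_add[OF N] quot_module_zero[OF N] M.l_neg)
    then show "\<exists>Y\<in>carrier ?Q. Y \<oplus>\<^bsub>?Q\<^esub> X = \<zero>\<^bsub>?Q\<^esub>"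
      using mem[of "\<ominus>\<^bsub>M\<^esub> a"] a by blast
  qed (unfold quot_module_simps(1) quot_module_zero[OF N],
      ((elim imageE)?, simp add: quot_module_add[OF N] M.a_ac)+)
  then show ?thesis
    by (rule moduleI[OF R.is_cring]; unfold quot_module_simps(1); elim imageE)
      (simp_all add: quot_module_add[OF N] quot_module_smult[OF N] smult_l_distr smult_r_distr smult_assoc1)
qed

lemma (in module) quot_module_lift:
  assumes P: "module R P" and N: "submodule N R M" and E: "E \<in> module_hom R M P"
    and ker: "\<And>a. a \<in> N \<Longrightarrow> E a = \<zero>\<^bsub>P\<^esub>"
  obtains \<phi> where "\<phi> \<in> module_hom R (quot_module M N) P"
    "\<phi> \<in> extensional (carrier (quot_module M N))"
    "\<And>a. a \<in> carrier M \<Longrightarrow> \<phi> (N +>\<^bsub>M\<^esub> a) = E a"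
proof -
  interpret P: module R P by (rule P)
  note D = module_homD[OF E]
  have "E ` (N +>\<^bsub>M\<^esub> a) = {E a}" if a: "a \<in> carrier M" for a
  proof -
    have "E (y \<oplus>\<^bsub>M\<^esub> a) = E a" if "y \<in> N" for y
      using that a submoduleE(1)[OF N] ker[OF that] D by auto
    moreover have "a \<in> N +>\<^bsub>M\<^esub> a"
      using M.abelian_subgroup_of_subgroup[OF submodule.axioms(1)[OF N]] a
      by (rule abelian_subgroup.a_rcos_self)
    ultimately show ?thesis by (auto simp: a_r_coset_def')
  qed
  moreover define \<phi> where "\<phi> = (\<lambda>X\<in>carrier (quot_module M N). the_elem (E ` X))"
  ultimately have val: "\<phi> (N +>\<^bsub>M\<^esub> a) = E a" if "a \<in> carrier M" for a
    using that by (simp add: quot_module_simps)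
  have "\<phi> \<in> module_hom R (quot_module M N) P"
    by (rule module_homI; unfold quot_module_simps(1); elim imageE)
      (simp_all add: quot_module_add[OF N] quot_module_smult[OF N] D val)
  then show ?thesis
    by (rule that) (use val in \<open>auto simp: \<phi>_def\<close>)
qed

subsection \<open>Free modules\<close>

lemma free_module_simps:
  "carrier (free_module R S) = {a \<in> S \<rightarrow>\<^sub>E carrier R. finite {s \<in> S. a s \<noteq> \<zero>\<^bsub>R\<^esub>}}"
  "zero (free_module R S) = (\<lambda>s\<in>S. \<zero>\<^bsub>R\<^esub>)"
  "add (free_module R S) = (\<lambda>a b. \<lambda>s\<in>S. a s \<oplus>\<^bsub>R\<^esub> b s)"
  "smult (free_module R S) = (\<lambda>r a. \<lambda>s\<in>S. r \<otimes>\<^bsub>R\<^esub> a s)"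
  by (simp_all add: free_module_def)

lemma free_module_memI:
  assumes "\<And>s. s \<in> S \<Longrightarrow> c s \<in> carrier R" "finite A" "\<And>s. s \<in> S \<Longrightarrow> s \<notin> A \<Longrightarrow> c s = \<zero>\<^bsub>R\<^esub>"
  shows "(\<lambda>s\<in>S. c s) \<in> carrier (free_module R S)"
proof -
  have "{s \<in> S. (\<lambda>s\<in>S. c s) s \<noteq> \<zero>\<^bsub>R\<^esub>} \<subseteq> A"
    using assms(3) by auto
  then have "finite {s \<in> S. (\<lambda>s\<in>S. c s) s \<noteq> \<zero>\<^bsub>R\<^esub>}"
    using assms(2) finite_subset by blast
  then show ?thesis
    unfolding free_module_simps using assms(1) by (auto simp: PiE_def Pi_def)
qed

lemma free_moduleD:
  assumes "a \<in> carrier (free_module R S)"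
  shows "s \<in> S \<Longrightarrow> a s \<in> carrier R" "finite {s \<in> S. a s \<noteq> \<zero>\<^bsub>R\<^esub>}" "a \<in> extensional S"
  using assms unfolding free_module_simps by (auto simp: PiE_mem PiE_def)

context cring
begin

lemma free_module_is_module: "module R (free_module R S)"
proof (rule module_of_separating_maps[OF is_cring, where I = S and P = "\<lambda>_. regular_module R"
      and \<phi> = "\<lambda>s a. a s"])
  let ?F = "free_module R S"
  fix a b assume a: "a \<in> carrier ?F" and b: "b \<in> carrier ?F"
  have "finite ({s \<in> S. a s \<noteq> \<zero>} \<union> {s \<in> S. b s \<noteq> \<zero>})"
    using free_moduleD(2)[OF a] free_moduleD(2)[OF b] by simp
  then show "a \<oplus>\<^bsub>?F\<^esub> b \<in> carrier ?F"
    unfolding free_module_simps(3)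
    by (rule free_module_memI[rotated]) (use free_moduleD(1)[OF a] free_moduleD(1)[OF b] in auto)
  show "a = b" if "\<And>s. s \<in> S \<Longrightarrow> a s = b s"
    using that free_moduleD(3)[OF a] free_moduleD(3)[OF b] by (intro extensionalityI)
next
  let ?F = "free_module R S"
  fix r a assume r: "r \<in> carrier R" and a: "a \<in> carrier ?F"
  show "r \<odot>\<^bsub>?F\<^esub> a \<in> carrier ?F"
    unfolding free_module_simps(4)
    by (rule free_module_memI[OF _ free_moduleD(2)[OF a]]) (use free_moduleD(1)[OF a] r in auto)
next
  fix s assume s: "s \<in> S"
  show "(\<lambda>a. a s) \<in> module_hom R (free_module R S) (regular_module R)"
    using s by (intro module_homI)
      (simp_all add: regular_module_def free_moduleD(1) free_module_simps(3,4))
qed (simp_all add: regular_module_is_module free_module_simps(1,2), simp_all add: regular_module_def)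

lemma free_gen_closed: "s \<in> S \<Longrightarrow> free_gen R S s \<in> carrier (free_module R S)"
  unfolding free_gen_def by (rule free_module_memI[of _ _ _ "{s}"]) auto

lemma free_module_expand:
  assumes a: "a \<in> carrier (free_module R S)"
  shows "a = (\<Oplus>\<^bsub>free_module R S\<^esub>s\<in>{s \<in> S. a s \<noteq> \<zero>}. a s \<odot>\<^bsub>free_module R S\<^esub> free_gen R S s)"
    (is "a = ?sum")
proof -
  let ?A = "{s \<in> S. a s \<noteq> \<zero>}"
  interpret F: module R "free_module R S" by (rule free_module_is_module)
  note D = free_moduleD[OF a]
  have terms: "(\<lambda>s. a s \<odot>\<^bsub>free_module R S\<^esub> free_gen R S s) \<in> ?A \<rightarrow> carrier (free_module R S)"
    using D(1) by (auto intro!: F.smult_closed free_gen_closed)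
  show ?thesis
  proof (rule extensionalityI[OF D(3)])
    show "?sum \<in> extensional S"
      using F.M.finsum_closed[OF terms] by (rule free_moduleD(3))
    fix t assume t: "t \<in> S"
    have "?sum t = (\<Oplus>s\<in>?A. (a s \<odot>\<^bsub>free_module R S\<^esub> free_gen R S s) t)"
      by (rule additive_finsum[OF F.M.abelian_monoid_axioms abelian_monoid_axioms D(2) terms])
        (use t free_moduleD(1) in \<open>auto simp: free_module_simps(2,3)\<close>)
    also have "\<dots> = (if t \<in> ?A then a t else \<zero>)"
      using t D by (subst finsum_delta[of _ t]) (auto simp: free_module_simps(4) free_gen_def)
    also have "\<dots> = a t"
      using t by auto
    finally show "a t = ?sum t" by simp
  qed
qed

lemma free_module_induct [consumes 1, case_names zero step]:
  assumes a: "a \<in> carrier (free_module R S)" and zero: "Q \<zero>\<^bsub>free_module R S\<^esub>"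
    and step: "\<And>r s b. r \<in> carrier R \<Longrightarrow> s \<in> S \<Longrightarrow> b \<in> carrier (free_module R S) \<Longrightarrow> Q b \<Longrightarrow>
      Q (r \<odot>\<^bsub>free_module R S\<^esub> free_gen R S s \<oplus>\<^bsub>free_module R S\<^esub> b)"
  shows "Q a"
proof -
  interpret F: module R "free_module R S" by (rule free_module_is_module)
  note D = free_moduleD[OF a]
  have "Q (\<Oplus>\<^bsub>free_module R S\<^esub>s\<in>A. a s \<odot>\<^bsub>free_module R S\<^esub> free_gen R S s)" if "finite A" "A \<subseteq> S" for A
    using that
  proof (induction A rule: finite_induct)
    case (insert s A)
    then have "(\<lambda>s. a s \<odot>\<^bsub>free_module R S\<^esub> free_gen R S s) \<in> insert s A \<rightarrow> carrier (free_module R S)"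
      using D(1) by (auto intro!: F.smult_closed free_gen_closed)
    then show ?case
      using insert D(1) by (subst F.M.finsum_insert) (auto simp: Pi_iff intro!: step F.M.finsum_closed)
  qed (simp add: zero)
  from this[OF D(2)] show ?thesis
    by (subst free_module_expand[OF a]) auto
qed

end

definition free_ext :: "('r, 'x) ring_scheme \<Rightarrow> 's set \<Rightarrow> ('r, 'k, 'z) module_scheme \<Rightarrow>
    ('s \<Rightarrow> 'k) \<Rightarrow> ('s \<Rightarrow> 'r) \<Rightarrow> 'k" where
  "free_ext R S P u a = (\<Oplus>\<^bsub>P\<^esub>s\<in>{s \<in> S. a s \<noteq> \<zero>\<^bsub>R\<^esub>}. a s \<odot>\<^bsub>P\<^esub> u s)"

context
  fixes R :: "('r, 'x) ring_scheme" and P :: "('r, 'k, 'z) module_scheme"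
    and S :: "'s set" and u :: "'s \<Rightarrow> 'k"
  assumes P: "module R P" and u: "u \<in> S \<rightarrow> carrier P"
begin

interpretation P: module R P by (rule P)

lemma free_ext_eq:
  assumes "a \<in> carrier (free_module R S)" "finite A" "A \<subseteq> S" "{s \<in> S. a s \<noteq> \<zero>\<^bsub>R\<^esub>} \<subseteq> A"
  shows "free_ext R S P u a = (\<Oplus>\<^bsub>P\<^esub>s\<in>A. a s \<odot>\<^bsub>P\<^esub> u s)"
  unfolding free_ext_def using assms u
  by (intro P.M.add.finprod_mono_neutral_cong_left) (auto simp: free_module_simps PiE_def Pi_def)

lemma free_ext_add:
  assumes a: "a \<in> carrier (free_module R S)" and b: "b \<in> carrier (free_module R S)"
  shows "free_ext R S P u (a \<oplus>\<^bsub>free_module R S\<^esub> b) = free_ext R S P u a \<oplus>\<^bsub>P\<^esub> free_ext R S P u b"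
proof -
  interpret F: module R "free_module R S" by (rule P.R.free_module_is_module)
  note Da = free_moduleD[OF a] and Db = free_moduleD[OF b]
  let ?A = "{s \<in> S. a s \<noteq> \<zero>\<^bsub>R\<^esub>} \<union> {s \<in> S. b s \<noteq> \<zero>\<^bsub>R\<^esub>}"
  have "free_ext R S P u (a \<oplus>\<^bsub>free_module R S\<^esub> b) =
      (\<Oplus>\<^bsub>P\<^esub>s\<in>?A. (a \<oplus>\<^bsub>free_module R S\<^esub> b) s \<odot>\<^bsub>P\<^esub> u s)"
    using Da(2) Db(2) by (intro free_ext_eq F.M.a_closed a b) (auto simp: free_module_simps)
  also have "\<dots> = (\<Oplus>\<^bsub>P\<^esub>s\<in>?A. a s \<odot>\<^bsub>P\<^esub> u s \<oplus>\<^bsub>P\<^esub> b s \<odot>\<^bsub>P\<^esub> u s)"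
    using Da(1) Db(1) u
    by (intro P.M.finsum_cong') (auto simp: free_module_simps P.smult_l_distr Pi_def)
  also have "\<dots> = (\<Oplus>\<^bsub>P\<^esub>s\<in>?A. a s \<odot>\<^bsub>P\<^esub> u s) \<oplus>\<^bsub>P\<^esub> (\<Oplus>\<^bsub>P\<^esub>s\<in>?A. b s \<odot>\<^bsub>P\<^esub> u s)"
    using Da(1) Db(1) u by (intro P.M.finsum_addf) auto
  also have "\<dots> = free_ext R S P u a \<oplus>\<^bsub>P\<^esub> free_ext R S P u b"
    using Da(2) Db(2) by (subst (1 2) free_ext_eq[of _ ?A]) (use a b in auto)
  finally show ?thesis .
qed

lemma free_ext_smult:
  assumes r: "r \<in> carrier R" and a: "a \<in> carrier (free_module R S)"
  shows "free_ext R S P u (r \<odot>\<^bsub>free_module R S\<^esub> a) = r \<odot>\<^bsub>P\<^esub> free_ext R S P u a"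
proof -
  note D = free_moduleD[OF a]
  let ?A = "{s \<in> S. a s \<noteq> \<zero>\<^bsub>R\<^esub>}"
  have "free_ext R S P u (r \<odot>\<^bsub>free_module R S\<^esub> a) =
      (\<Oplus>\<^bsub>P\<^esub>s\<in>?A. (r \<odot>\<^bsub>free_module R S\<^esub> a) s \<odot>\<^bsub>P\<^esub> u s)"
    using D(2) r by (intro free_ext_eq module.smult_closed[OF P.R.free_module_is_module] a)
      (auto simp: free_module_simps)
  also have "\<dots> = (\<Oplus>\<^bsub>P\<^esub>s\<in>?A. r \<odot>\<^bsub>P\<^esub> (a s \<odot>\<^bsub>P\<^esub> u s))"
    using D(1) u r by (intro P.M.finsum_cong') (auto simp: free_module_simps P.smult_assoc1 Pi_def)
  also have "\<dots> = r \<odot>\<^bsub>P\<^esub> free_ext R S P u a"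
    unfolding free_ext_def using D u r by (intro P.finsum_smult_ldistr[symmetric]) auto
  finally show ?thesis .
qed

lemma free_ext_hom: "free_ext R S P u \<in> module_hom R (free_module R S) P"
proof (rule module_homI)
  fix a assume a: "a \<in> carrier (free_module R S)"
  show "free_ext R S P u a \<in> carrier P"
    unfolding free_ext_def using free_moduleD(1)[OF a] u by (intro P.M.finsum_closed) auto
qed (simp_all add: free_ext_add free_ext_smult)

lemma free_ext_gen:
  assumes "s \<in> S"
  shows "free_ext R S P u (free_gen R S s) = u s"
proof -
  have "free_ext R S P u (free_gen R S s) = (\<Oplus>\<^bsub>P\<^esub>t\<in>{s}. free_gen R S s t \<odot>\<^bsub>P\<^esub> u t)"
    using assms by (intro free_ext_eq P.R.free_gen_closed) (auto simp: free_gen_def)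
  then show ?thesis
    using assms u by (auto simp: free_gen_def Pi_def)
qed

end

subsection \<open>Tensor products\<close>

locale tensor_modules = M: module R M + N: module R N
  for R :: "('r, 'x) ring_scheme" and M :: "('r, 'm, 'y) module_scheme"
    and N :: "('r, 'n, 'z) module_scheme"
begin

abbreviation "Free \<equiv> free_module R (carrier M \<times> carrier N)"
abbreviation "gen \<equiv> free_gen R (carrier M \<times> carrier N)"
abbreviation "ker \<equiv> tensor_kernel R M N"
abbreviation "MN \<equiv> tensor R M N"
abbreviation "pure \<equiv> pure_tensor R M N"

lemma gen_closed [simp]: "m \<in> carrier M \<Longrightarrow> n \<in> carrier N \<Longrightarrow> gen (m, n) \<in> carrier Free"
  by (simp add: M.R.free_gen_closed)

lemma relatorI:
  "m \<in> carrier M \<Longrightarrow> m' \<in> carrier M \<Longrightarrow> n \<in> carrier N \<Longrightarrow>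
    gen (m \<oplus>\<^bsub>M\<^esub> m', n) \<ominus>\<^bsub>Free\<^esub> (gen (m, n) \<oplus>\<^bsub>Free\<^esub> gen (m', n)) \<in> tensor_relators R M N"
  "m \<in> carrier M \<Longrightarrow> n \<in> carrier N \<Longrightarrow> n' \<in> carrier N \<Longrightarrow>
    gen (m, n \<oplus>\<^bsub>N\<^esub> n') \<ominus>\<^bsub>Free\<^esub> (gen (m, n) \<oplus>\<^bsub>Free\<^esub> gen (m, n')) \<in> tensor_relators R M N"
  "r \<in> carrier R \<Longrightarrow> m \<in> carrier M \<Longrightarrow> n \<in> carrier N \<Longrightarrow>
    gen (r \<odot>\<^bsub>M\<^esub> m, n) \<ominus>\<^bsub>Free\<^esub> (r \<odot>\<^bsub>Free\<^esub> gen (m, n)) \<in> tensor_relators R M N"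
  "r \<in> carrier R \<Longrightarrow> m \<in> carrier M \<Longrightarrow> n \<in> carrier N \<Longrightarrow>
    gen (m, r \<odot>\<^bsub>N\<^esub> n) \<ominus>\<^bsub>Free\<^esub> (r \<odot>\<^bsub>Free\<^esub> gen (m, n)) \<in> tensor_relators R M N"
  unfolding tensor_relators_def Let_def by blast+

lemma relators_subsetI:
  assumes "\<And>m m' n. m \<in> carrier M \<Longrightarrow> m' \<in> carrier M \<Longrightarrow> n \<in> carrier N \<Longrightarrow>
      gen (m \<oplus>\<^bsub>M\<^esub> m', n) \<ominus>\<^bsub>Free\<^esub> (gen (m, n) \<oplus>\<^bsub>Free\<^esub> gen (m', n)) \<in> A"
    and "\<And>m n n'. m \<in> carrier M \<Longrightarrow> n \<in> carrier N \<Longrightarrow> n' \<in> carrier N \<Longrightarrow>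
      gen (m, n \<oplus>\<^bsub>N\<^esub> n') \<ominus>\<^bsub>Free\<^esub> (gen (m, n) \<oplus>\<^bsub>Free\<^esub> gen (m, n')) \<in> A"
    and "\<And>r m n. r \<in> carrier R \<Longrightarrow> m \<in> carrier M \<Longrightarrow> n \<in> carrier N \<Longrightarrow>
      gen (r \<odot>\<^bsub>M\<^esub> m, n) \<ominus>\<^bsub>Free\<^esub> (r \<odot>\<^bsub>Free\<^esub> gen (m, n)) \<in> A"
    and "\<And>r m n. r \<in> carrier R \<Longrightarrow> m \<in> carrier M \<Longrightarrow> n \<in> carrier N \<Longrightarrow>
      gen (m, r \<odot>\<^bsub>N\<^esub> n) \<ominus>\<^bsub>Free\<^esub> (r \<odot>\<^bsub>Free\<^esub> gen (m, n)) \<in> A"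
  shows "tensor_relators R M N \<subseteq> A"
  unfolding tensor_relators_def Let_def
  by (intro Un_least subsetI; elim CollectE exE conjE; simp only: assms)

sublocale F: module R Free
  by (rule M.R.free_module_is_module)

lemma relators_closed: "tensor_relators R M N \<subseteq> carrier Free"
  by (rule relators_subsetI) simp_all

lemma ker_subset: "submodule S R Free \<Longrightarrow> tensor_relators R M N \<subseteq> S \<Longrightarrow> ker \<subseteq> S"
  unfolding tensor_kernel_def by blast

lemma ker_submodule: "submodule ker R Free"
proof (rule F.submoduleI[OF ker_subset[OF F.carrier_is_submodule relators_closed]])
  have "\<zero>\<^bsub>Free\<^esub> \<in> S" if "submodule S R Free" for S
    using subgroup.one_closed[OF submodule.axioms(1)[OF that]] by simp
  then show "\<zero>\<^bsub>Free\<^esub> \<in> ker"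
    unfolding tensor_kernel_def by blast
qed (use F.submoduleE in \<open>auto simp: tensor_kernel_def\<close>)

lemma tensor_eq: "MN = quot_module Free ker"
  by (simp add: tensor_def)

sublocale MN: module R MN
  unfolding tensor_eq by (rule F.quot_module_is_module[OF ker_submodule])

lemma relator_coset_eq:
  assumes "a \<ominus>\<^bsub>Free\<^esub> b \<in> tensor_relators R M N" "a \<in> carrier Free" "b \<in> carrier Free"
  shows "ker +>\<^bsub>Free\<^esub> a = ker +>\<^bsub>Free\<^esub> b"
  using assms unfolding tensor_kernel_def
  by (subst F.M.coset_eq_iff[OF submodule.axioms(1)[OF ker_submodule[unfolded tensor_kernel_def]]]) auto

lemmas coset_add = F.quot_module_add[OF ker_submodule, folded tensor_eq]
lemmas coset_smult = F.quot_module_smult[OF ker_submodule, folded tensor_eq]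

lemma tensor_carrier: "carrier MN = (\<lambda>a. ker +>\<^bsub>Free\<^esub> a) ` carrier Free"
  by (simp add: tensor_eq quot_module_simps)

lemma pure_closed [simp]: "m \<in> carrier M \<Longrightarrow> n \<in> carrier N \<Longrightarrow> pure m n \<in> carrier MN"
  by (simp add: pure_tensor_def tensor_carrier)

lemma pure_add_left:
  assumes "m \<in> carrier M" "m' \<in> carrier M" "n \<in> carrier N"
  shows "pure (m \<oplus>\<^bsub>M\<^esub> m') n = pure m n \<oplus>\<^bsub>MN\<^esub> pure m' n"
  unfolding pure_tensor_def using assms relator_coset_eq[OF relatorI(1)[OF assms]]
  by (simp add: coset_add)

lemma pure_add_right:
  assumes "m \<in> carrier M" "n \<in> carrier N" "n' \<in> carrier N"
  shows "pure m (n \<oplus>\<^bsub>N\<^esub> n') = pure m n \<oplus>\<^bsub>MN\<^esub> pure m n'"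
  unfolding pure_tensor_def using assms relator_coset_eq[OF relatorI(2)[OF assms]]
  by (simp add: coset_add)

lemma pure_smult_left:
  assumes "r \<in> carrier R" "m \<in> carrier M" "n \<in> carrier N"
  shows "pure (r \<odot>\<^bsub>M\<^esub> m) n = r \<odot>\<^bsub>MN\<^esub> pure m n"
  unfolding pure_tensor_def using assms relator_coset_eq[OF relatorI(3)[OF assms]]
  by (simp add: coset_smult)

lemma pure_smult_right:
  assumes "r \<in> carrier R" "m \<in> carrier M" "n \<in> carrier N"
  shows "pure m (r \<odot>\<^bsub>N\<^esub> n) = r \<odot>\<^bsub>MN\<^esub> pure m n"
  unfolding pure_tensor_def using assms relator_coset_eq[OF relatorI(4)[OF assms]]
  by (simp add: coset_smult)

lemmas pure_bilinear = pure_add_left pure_add_right pure_smult_left pure_smult_right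

lemma pure_zero_left: "n \<in> carrier N \<Longrightarrow> pure \<zero>\<^bsub>M\<^esub> n = \<zero>\<^bsub>MN\<^esub>"
  by (rule additive_zero[OF M.M.abelian_group_axioms MN.M.abelian_group_axioms, of "\<lambda>m. pure m n"])
    (auto simp: pure_add_left)

lemma tensor_induct [consumes 1, case_names pure add]:
  assumes z: "z \<in> carrier MN"
    and pure: "\<And>m n. m \<in> carrier M \<Longrightarrow> n \<in> carrier N \<Longrightarrow> Q (pure m n)"
    and add: "\<And>y z. y \<in> carrier MN \<Longrightarrow> z \<in> carrier MN \<Longrightarrow> Q y \<Longrightarrow> Q z \<Longrightarrow> Q (y \<oplus>\<^bsub>MN\<^esub> z)"
  shows "Q z"
proof -
  have "Q (ker +>\<^bsub>Free\<^esub> a)" if "a \<in> carrier Free" for a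
    using that
  proof (induction a rule: M.R.free_module_induct)
    case zero
    have "ker +>\<^bsub>Free\<^esub> \<zero>\<^bsub>Free\<^esub> = pure \<zero>\<^bsub>M\<^esub> \<zero>\<^bsub>N\<^esub>"
      using F.quot_module_zero[OF ker_submodule] by (simp add: pure_zero_left tensor_eq)
    then show ?case
      using pure by simp
  next
    case (step r s b)
    then obtain m n where s: "s = (m, n)" "m \<in> carrier M" "n \<in> carrier N" by auto
    have "ker +>\<^bsub>Free\<^esub> (r \<odot>\<^bsub>Free\<^esub> gen s \<oplus>\<^bsub>Free\<^esub> b) = pure (r \<odot>\<^bsub>M\<^esub> m) n \<oplus>\<^bsub>MN\<^esub> (ker +>\<^bsub>Free\<^esub> b)"
      using step s by (simp add: coset_add[symmetric] coset_smult[symmetric] pure_smult_left)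
        (simp add: pure_tensor_def)
    moreover have "ker +>\<^bsub>Free\<^esub> b \<in> carrier MN"
      unfolding tensor_carrier using step(3) by (rule imageI)
    ultimately show ?case
      using step s by (simp only:) (intro add pure pure_closed M.smult_closed)
  qed
  then show ?thesis
    using z by (auto simp: tensor_carrier)
qed

lemma tensor_maps_eq:
  assumes "\<And>y z. y \<in> carrier MN \<Longrightarrow> z \<in> carrier MN \<Longrightarrow> \<phi> (y \<oplus>\<^bsub>MN\<^esub> z) = \<phi> y \<oplus>\<^bsub>P\<^esub> \<phi> z"
    and "\<And>y z. y \<in> carrier MN \<Longrightarrow> z \<in> carrier MN \<Longrightarrow> \<psi> (y \<oplus>\<^bsub>MN\<^esub> z) = \<psi> y \<oplus>\<^bsub>P\<^esub> \<psi> z"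
    and "\<And>m n. m \<in> carrier M \<Longrightarrow> n \<in> carrier N \<Longrightarrow> \<phi> (pure m n) = \<psi> (pure m n)"
    and "z \<in> carrier MN"
  shows "\<phi> z = \<psi> z"
  using assms(4) by (induction z rule: tensor_induct) (use assms in auto)

lemma tensor_lift_eqI:
  assumes "\<phi> \<in> extensional (carrier MN)"
    and "\<And>z. z \<in> carrier MN \<Longrightarrow> \<phi> z \<in> carrier P"
    and "\<And>y z. y \<in> carrier MN \<Longrightarrow> z \<in> carrier MN \<Longrightarrow> \<phi> (y \<oplus>\<^bsub>MN\<^esub> z) = \<phi> y \<oplus>\<^bsub>P\<^esub> \<phi> z"
    and "\<And>m n. m \<in> carrier M \<Longrightarrow> n \<in> carrier N \<Longrightarrow> \<phi> (pure m n) = \<beta> m n"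
  shows "tensor_lift R M N P \<beta> = \<phi>"
  unfolding tensor_lift_def
proof (rule the_equality)
  show "\<phi> \<in> extensional (carrier MN) \<and> \<phi> \<in> hom (add_monoid MN) (add_monoid P) \<and>
    (\<forall>m\<in>carrier M. \<forall>n\<in>carrier N. \<phi> (pure m n) = \<beta> m n)"
    using assms by (auto simp: hom_def)
next
  fix \<psi> assume \<psi>: "\<psi> \<in> extensional (carrier MN) \<and> \<psi> \<in> hom (add_monoid MN) (add_monoid P) \<and>
    (\<forall>m\<in>carrier M. \<forall>n\<in>carrier N. \<psi> (pure m n) = \<beta> m n)"
  show "\<psi> = \<phi>"
  proof (rule extensionalityI[OF _ assms(1)])
    fix z assume "z \<in> carrier MN"
    then show "\<psi> z = \<phi> z"
      by (rule tensor_maps_eq[OF _ assms(3), rotated -1]) (use \<psi> assms(4) in \<open>auto simp: hom_def\<close>)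
  qed (use \<psi> in blast)
qed

lemma tensor_lift:
  assumes P: "module R P"
    and closed: "\<And>m n. m \<in> carrier M \<Longrightarrow> n \<in> carrier N \<Longrightarrow> \<beta> m n \<in> carrier P"
    and add_left: "\<And>m m' n. m \<in> carrier M \<Longrightarrow> m' \<in> carrier M \<Longrightarrow> n \<in> carrier N \<Longrightarrow>
      \<beta> (m \<oplus>\<^bsub>M\<^esub> m') n = \<beta> m n \<oplus>\<^bsub>P\<^esub> \<beta> m' n"
    and add_right: "\<And>m n n'. m \<in> carrier M \<Longrightarrow> n \<in> carrier N \<Longrightarrow> n' \<in> carrier N \<Longrightarrow>
      \<beta> m (n \<oplus>\<^bsub>N\<^esub> n') = \<beta> m n \<oplus>\<^bsub>P\<^esub> \<beta> m n'"
    and smult_left: "\<And>r m n. r \<in> carrier R \<Longrightarrow> m \<in> carrier M \<Longrightarrow> n \<in> carrier N \<Longrightarrow>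
      \<beta> (r \<odot>\<^bsub>M\<^esub> m) n = r \<odot>\<^bsub>P\<^esub> \<beta> m n"
    and smult_right: "\<And>r m n. r \<in> carrier R \<Longrightarrow> m \<in> carrier M \<Longrightarrow> n \<in> carrier N \<Longrightarrow>
      \<beta> m (r \<odot>\<^bsub>N\<^esub> n) = r \<odot>\<^bsub>P\<^esub> \<beta> m n"
  shows tensor_lift_hom: "tensor_lift R M N P \<beta> \<in> module_hom R MN P"
    and tensor_lift_pure: "\<And>m n. m \<in> carrier M \<Longrightarrow> n \<in> carrier N \<Longrightarrow>
      tensor_lift R M N P \<beta> (pure m n) = \<beta> m n"
proof -
  interpret P: module R P by (rule P)
  let ?\<beta> = "\<lambda>(m, n). \<beta> m n" and ?S = "carrier M \<times> carrier N"
  have \<beta>: "?\<beta> \<in> ?S \<rightarrow> carrier P" using closed by auto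
  define E where "E = free_ext R ?S P ?\<beta>"
  have E: "E \<in> module_hom R Free P"
    unfolding E_def by (rule free_ext_hom[OF P \<beta>])
  have E_gen: "E (gen (m, n)) = \<beta> m n" if "m \<in> carrier M" "n \<in> carrier N" for m n
    unfolding E_def using free_ext_gen[OF P \<beta>, of "(m, n)"] that by simp
  have "ker \<subseteq> {a \<in> carrier Free. E a = \<zero>\<^bsub>P\<^esub>}"
    by (intro ker_subset module_hom_kernel_submodule[OF F.module_axioms P E] relators_subsetI CollectI conjI)
      (simp_all add: module_homD[OF E] module_hom_minus[OF F.module_axioms P E] E_gen closed
        add_left add_right smult_left smult_right P.M.minus_eq_zero_iff)
  then have "E a = \<zero>\<^bsub>P\<^esub>" if "a \<in> ker" for a
    using that by blast
  from F.quot_module_lift[OF P ker_submodule E this, folded tensor_eq]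
  obtain \<phi> where \<phi>: "\<phi> \<in> module_hom R MN P" "\<phi> \<in> extensional (carrier MN)"
    "\<And>a. a \<in> carrier Free \<Longrightarrow> \<phi> (ker +>\<^bsub>Free\<^esub> a) = E a" by blast
  have pure: "\<phi> (pure m n) = \<beta> m n" if "m \<in> carrier M" "n \<in> carrier N" for m n
    unfolding pure_tensor_def using \<phi>(3) E_gen that by simp
  have "tensor_lift R M N P \<beta> = \<phi>"
    by (rule tensor_lift_eqI[OF \<phi>(2)]) (use module_homD[OF \<phi>(1)] pure in auto)
  with \<phi>(1) pure show "tensor_lift R M N P \<beta> \<in> module_hom R MN P"
    "\<And>m n. m \<in> carrier M \<Longrightarrow> n \<in> carrier N \<Longrightarrow> tensor_lift R M N P \<beta> (pure m n) = \<beta> m n"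
    by auto
qed

end

subsection \<open>Modules with a finite basis\<close>

locale based_module = module R N for R :: "('r, 'x) ring_scheme" and N :: "('r, 'n, 'z) module_scheme" +
  fixes d :: nat and e :: "nat \<Rightarrow> 'n" and eps :: "nat \<Rightarrow> 'n \<Rightarrow> 'r"
  assumes e_closed: "k < d \<Longrightarrow> e k \<in> carrier N"
    and eps_closed: "k < d \<Longrightarrow> \<nu> \<in> carrier N \<Longrightarrow> eps k \<nu> \<in> carrier R"
    and eps_add: "k < d \<Longrightarrow> \<nu> \<in> carrier N \<Longrightarrow> \<mu> \<in> carrier N \<Longrightarrow>
      eps k (\<nu> \<oplus>\<^bsub>N\<^esub> \<mu>) = eps k \<nu> \<oplus>\<^bsub>R\<^esub> eps k \<mu>"
    and eps_smult: "k < d \<Longrightarrow> r \<in> carrier R \<Longrightarrow> \<nu> \<in> carrier N \<Longrightarrow>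
      eps k (r \<odot>\<^bsub>N\<^esub> \<nu>) = r \<otimes>\<^bsub>R\<^esub> eps k \<nu>"
    and eps_e: "k < d \<Longrightarrow> l < d \<Longrightarrow> eps k (e l) = (if k = l then \<one>\<^bsub>R\<^esub> else \<zero>\<^bsub>R\<^esub>)"
    and expand: "\<nu> \<in> carrier N \<Longrightarrow> \<nu> = (\<Oplus>\<^bsub>N\<^esub>k\<in>{..<d}. eps k \<nu> \<odot>\<^bsub>N\<^esub> e k)"

lemma based_module_of_separating_coordinates:
  assumes N: "module R N" and e: "\<And>k. k < d \<Longrightarrow> e k \<in> carrier N"
    and eps: "\<And>k. k < d \<Longrightarrow> eps k \<in> module_hom R N (regular_module R)"
    and dual: "\<And>k l. k < d \<Longrightarrow> l < d \<Longrightarrow> eps k (e l) = (if k = l then \<one>\<^bsub>R\<^esub> else \<zero>\<^bsub>R\<^esub>)"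
    and separating: "\<And>\<nu> \<mu>. \<nu> \<in> carrier N \<Longrightarrow> \<mu> \<in> carrier N \<Longrightarrow> (\<And>k. k < d \<Longrightarrow> eps k \<nu> = eps k \<mu>) \<Longrightarrow> \<nu> = \<mu>"
  shows "based_module R N d e eps"
proof -
  interpret N: module R N by (rule N)
  have eps_simps: "eps k \<nu> \<in> carrier R" "\<mu> \<in> carrier N \<Longrightarrow> eps k (\<nu> \<oplus>\<^bsub>N\<^esub> \<mu>) = eps k \<nu> \<oplus>\<^bsub>R\<^esub> eps k \<mu>"
    "r \<in> carrier R \<Longrightarrow> eps k (r \<odot>\<^bsub>N\<^esub> \<nu>) = r \<otimes>\<^bsub>R\<^esub> eps k \<nu>"
    if "k < d" "\<nu> \<in> carrier N" for k \<nu> \<mu> r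
    using that module_homD[OF eps[OF that(1)]] by (simp_all add: regular_module_def)
  have expand: "\<nu> = (\<Oplus>\<^bsub>N\<^esub>k\<in>{..<d}. eps k \<nu> \<odot>\<^bsub>N\<^esub> e k)" (is "\<nu> = ?sum") if \<nu>: "\<nu> \<in> carrier N" for \<nu>
  proof (rule separating[OF \<nu>])
    have closed: "eps k \<nu> \<odot>\<^bsub>N\<^esub> e k \<in> carrier N" if "k < d" for k
      using that \<nu> by (simp add: eps_simps e)
    then show "?sum \<in> carrier N" by (intro N.M.finsum_closed) auto
    fix l assume l: "l < d"
    have "eps l ?sum = (\<Oplus>\<^bsub>R\<^esub>k\<in>{..<d}. eps l (eps k \<nu> \<odot>\<^bsub>N\<^esub> e k))"
      using closed by (subst module_hom_finsum[OF N N.R.regular_module_is_module eps[OF l]])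
        (auto intro!: finsum_eq_of_add_monoid_eq simp: regular_module_def)
    also have "\<dots> = eps l \<nu>"
      using l \<nu> by (subst N.R.finsum_delta[of _ l]) (auto simp: eps_simps dual e)
    finally show "eps l \<nu> = eps l ?sum" ..
  qed
  show ?thesis
    by (intro based_module.intro based_module_axioms.intro N e eps_simps dual expand)
qed

definition tensor_coord :: "('r, 'x) ring_scheme \<Rightarrow> ('r, 'm, 'y) module_scheme \<Rightarrow>
    ('r, 'n, 'z) module_scheme \<Rightarrow> ('n \<Rightarrow> 'r) \<Rightarrow> ('m \<times> 'n \<Rightarrow> 'r) set \<Rightarrow> 'm" where
  "tensor_coord R M N ep = tensor_lift R M N M (\<lambda>m \<nu>. ep \<nu> \<odot>\<^bsub>M\<^esub> m)"

locale tensor_based = tensor_modules R M N + based_module R N d e eps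
  for R :: "('r, 'x) ring_scheme" and M :: "('r, 'm, 'y) module_scheme"
    and N :: "('r, 'n, 'z) module_scheme" and d e eps
begin

abbreviation "coord k \<equiv> tensor_coord R M N (eps k)"

lemma coord:
  assumes "k < d"
  shows coord_hom: "coord k \<in> module_hom R MN M"
    and coord_pure: "\<And>m \<nu>. m \<in> carrier M \<Longrightarrow> \<nu> \<in> carrier N \<Longrightarrow> coord k (pure m \<nu>) = eps k \<nu> \<odot>\<^bsub>M\<^esub> m"
proof -
  have "eps k \<nu> \<odot>\<^bsub>M\<^esub> (r \<odot>\<^bsub>M\<^esub> m) = r \<odot>\<^bsub>M\<^esub> (eps k \<nu> \<odot>\<^bsub>M\<^esub> m)"
    if "r \<in> carrier R" "m \<in> carrier M" "\<nu> \<in> carrier N" for r m \<nu>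
    using that assms eps_closed by (simp add: M.smult_assoc1[symmetric] M.R.m_comm)
  then show "coord k \<in> module_hom R MN M"
    "\<And>m \<nu>. m \<in> carrier M \<Longrightarrow> \<nu> \<in> carrier N \<Longrightarrow> coord k (pure m \<nu>) = eps k \<nu> \<odot>\<^bsub>M\<^esub> m"
    unfolding tensor_coord_def
    using assms eps_closed eps_add eps_smult
    by (intro tensor_lift_hom tensor_lift_pure M.module_axioms;
        simp add: M.smult_r_distr M.smult_l_distr M.smult_assoc1)+
qed

lemmas coord_closed = module_homD(1)[OF coord_hom]
lemmas coord_add = module_homD(2)[OF coord_hom]

lemma expand_pure:
  assumes "m \<in> carrier M" "\<nu> \<in> carrier N"
  shows "pure m \<nu> = (\<Oplus>\<^bsub>MN\<^esub>k\<in>{..<d}. pure (eps k \<nu> \<odot>\<^bsub>M\<^esub> m) (e k))"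
proof -
  have "pure m \<nu> = pure m (\<Oplus>\<^bsub>N\<^esub>k\<in>{..<d}. eps k \<nu> \<odot>\<^bsub>N\<^esub> e k)"
    using expand[OF assms(2)] by simp
  also have "\<dots> = (\<Oplus>\<^bsub>MN\<^esub>k\<in>{..<d}. pure m (eps k \<nu> \<odot>\<^bsub>N\<^esub> e k))"
    using assms e_closed eps_closed
    by (intro module_hom_finsum[OF N.module_axioms MN.module_axioms, of "pure m"] module_homI)
      (auto simp: pure_bilinear)
  also have "\<dots> = (\<Oplus>\<^bsub>MN\<^esub>k\<in>{..<d}. pure (eps k \<nu> \<odot>\<^bsub>M\<^esub> m) (e k))"
    using assms e_closed eps_closed by (intro MN.M.finsum_cong') (auto simp: pure_bilinear)
  finally show ?thesis .
qed

lemma expand_tensor: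
  assumes "z \<in> carrier MN"
  shows "z = (\<Oplus>\<^bsub>MN\<^esub>k\<in>{..<d}. pure (coord k z) (e k))"
  using assms
proof (induction z rule: tensor_induct)
  case (pure m \<nu>)
  then show ?case
    using e_closed eps_closed
    by (subst expand_pure, simp_all, intro MN.M.finsum_cong') (auto simp: coord_pure)
next
  case (add y z)
  have "(\<Oplus>\<^bsub>MN\<^esub>k\<in>{..<d}. pure (coord k (y \<oplus>\<^bsub>MN\<^esub> z)) (e k)) =
      (\<Oplus>\<^bsub>MN\<^esub>k\<in>{..<d}. pure (coord k y) (e k) \<oplus>\<^bsub>MN\<^esub> pure (coord k z) (e k))"
    using add e_closed coord_closed by (intro MN.M.finsum_cong') (auto simp: coord_add pure_add_left)
  also have "\<dots> = y \<oplus>\<^bsub>MN\<^esub> z"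
    using add e_closed coord_closed by (subst MN.M.finsum_addf) (auto simp flip: add.IH)
  finally show ?case by simp
qed

lemma coord_sum:
  assumes "\<And>k. k < d \<Longrightarrow> t k \<in> carrier M" "l < d"
  shows "coord l (\<Oplus>\<^bsub>MN\<^esub>k\<in>{..<d}. pure (t k) (e k)) = t l"
proof -
  have "coord l (\<Oplus>\<^bsub>MN\<^esub>k\<in>{..<d}. pure (t k) (e k)) = (\<Oplus>\<^bsub>M\<^esub>k\<in>{..<d}. coord l (pure (t k) (e k)))"
    using assms e_closed
    by (intro module_hom_finsum[OF MN.module_axioms M.module_axioms coord_hom]) auto
  also have "\<dots> = t l"
    using assms e_closed by (subst M.M.finsum_delta[of _ l]) (auto simp: coord_pure eps_e)
  finally show ?thesis .
qed

lemma tensor_eqI: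
  assumes "y \<in> carrier MN" "z \<in> carrier MN" "\<And>k. k < d \<Longrightarrow> coord k y = coord k z"
  shows "y = z"
proof -
  have "(\<Oplus>\<^bsub>MN\<^esub>k\<in>{..<d}. pure (coord k y) (e k)) = (\<Oplus>\<^bsub>MN\<^esub>k\<in>{..<d}. pure (coord k z) (e k))"
    using assms by (intro MN.M.finsum_cong') (simp_all add: e_closed coord_closed Pi_def)
  from trans[OF expand_tensor[OF assms(1)] trans[OF this expand_tensor[OF assms(2), symmetric]]]
  show ?thesis .
qed

lemma expand_rank_one:
  assumes "d = 1" "z \<in> carrier MN"
  shows "pure (coord 0 z) (e 0) = z"
  using expand_tensor[OF assms(2)] assms e_closed coord_closed by (simp add: lessThan_Suc)

end

section \<open>Group rings\<close>

definition gr_single :: "('r, 'x) ring_scheme \<Rightarrow> ('q, 'y) monoid_scheme \<Rightarrow> 'r \<Rightarrow> 'q \<Rightarrow> 'q \<Rightarrow> 'r" where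
  "gr_single R Q r v = (\<lambda>u\<in>carrier Q. if u = v then r else \<zero>\<^bsub>R\<^esub>)"

locale finite_group_ring = R: cring R + Q: group Q
  for R :: "('r, 'x) ring_scheme" (structure) and Q :: "('q, 'y) monoid_scheme" +
  assumes finite_group: "finite (carrier Q)"
begin

abbreviation "RQ \<equiv> group_ring R Q"

lemma RQ_carrier: "carrier RQ = carrier Q \<rightarrow>\<^sub>E carrier R"
  by (simp add: group_ring_def)

lemma RQ_eval_closed: "a \<in> carrier RQ \<Longrightarrow> u \<in> carrier Q \<Longrightarrow> a u \<in> carrier R"
  unfolding RQ_carrier by (rule PiE_mem)

lemma RQ_ext:
  assumes "a \<in> carrier RQ" "b \<in> carrier RQ" "\<And>u. u \<in> carrier Q \<Longrightarrow> a u = b u"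
  shows "a = b"
  using assms unfolding RQ_carrier by (rule PiE_ext)

lemma RQ_memI:
  assumes "\<And>u. u \<in> carrier Q \<Longrightarrow> c u \<in> carrier R"
  shows "(\<lambda>u\<in>carrier Q. c u) \<in> carrier RQ"
  unfolding RQ_carrier using assms by (simp add: PiE_def Pi_def)

lemma RQ_add: "u \<in> carrier Q \<Longrightarrow> (a \<oplus>\<^bsub>RQ\<^esub> b) u = a u \<oplus> b u"
  by (simp add: group_ring_def)

lemma RQ_mult: "u \<in> carrier Q \<Longrightarrow>
    (a \<otimes>\<^bsub>RQ\<^esub> b) u = (\<Oplus>v\<in>carrier Q. a v \<otimes> b (inv\<^bsub>Q\<^esub> v \<otimes>\<^bsub>Q\<^esub> u))"
  by (simp add: group_ring_def)

lemma RQ_zero: "u \<in> carrier Q \<Longrightarrow> \<zero>\<^bsub>RQ\<^esub> u = \<zero>"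
  by (simp add: group_ring_def)

lemma RQ_one: "\<one>\<^bsub>RQ\<^esub> = gr_single R Q \<one> \<one>\<^bsub>Q\<^esub>"
  by (simp add: group_ring_def gr_single_def)

lemma single_closed: "r \<in> carrier R \<Longrightarrow> gr_single R Q r v \<in> carrier RQ"
  unfolding gr_single_def by (rule RQ_memI) auto

lemma RQ_add_closed: "a \<in> carrier RQ \<Longrightarrow> b \<in> carrier RQ \<Longrightarrow> a \<oplus>\<^bsub>RQ\<^esub> b \<in> carrier RQ"
  using RQ_memI[of "\<lambda>u. a u \<oplus> b u"] RQ_eval_closed[of a] RQ_eval_closed[of b]
  by (simp add: group_ring_def)

lemma RQ_zero_closed: "\<zero>\<^bsub>RQ\<^esub> \<in> carrier RQ"
  using RQ_memI[of "\<lambda>u. \<zero>"] by (simp add: group_ring_def)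

lemma RQ_mult_closed:
  assumes "a \<in> carrier RQ" "b \<in> carrier RQ"
  shows "a \<otimes>\<^bsub>RQ\<^esub> b \<in> carrier RQ"
proof -
  have "(\<lambda>u\<in>carrier Q. \<Oplus>v\<in>carrier Q. a v \<otimes> b (inv\<^bsub>Q\<^esub> v \<otimes>\<^bsub>Q\<^esub> u)) \<in> carrier RQ"
    using RQ_eval_closed[OF assms(1)] RQ_eval_closed[OF assms(2)]
    by (intro RQ_memI R.finsum_closed) auto
  then show ?thesis by (simp add: group_ring_def)
qed

lemma single_mult:
  assumes "r \<in> carrier R" "v \<in> carrier Q" "b \<in> carrier RQ" "u \<in> carrier Q"
  shows "(gr_single R Q r v \<otimes>\<^bsub>RQ\<^esub> b) u = r \<otimes> b (inv\<^bsub>Q\<^esub> v \<otimes>\<^bsub>Q\<^esub> u)"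
  using assms finite_group unfolding RQ_mult[OF assms(4)]
  by (subst R.finsum_delta[of _ v]) (auto simp: gr_single_def RQ_eval_closed)

lemma single_mult_single:
  assumes "r \<in> carrier R" "s \<in> carrier R" "v \<in> carrier Q" "w \<in> carrier Q"
  shows "gr_single R Q r v \<otimes>\<^bsub>RQ\<^esub> gr_single R Q s w = gr_single R Q (r \<otimes> s) (v \<otimes>\<^bsub>Q\<^esub> w)"
proof (rule RQ_ext)
  fix u assume u: "u \<in> carrier Q"
  have "inv\<^bsub>Q\<^esub> v \<otimes>\<^bsub>Q\<^esub> u = w \<longleftrightarrow> u = v \<otimes>\<^bsub>Q\<^esub> w"
    using assms u by (metis Q.inv_solve_left)
  then show "(gr_single R Q r v \<otimes>\<^bsub>RQ\<^esub> gr_single R Q s w) u = gr_single R Q (r \<otimes> s) (v \<otimes>\<^bsub>Q\<^esub> w) u"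
    using assms u by (subst single_mult) (auto simp: single_closed, auto simp: gr_single_def)
qed (use assms in \<open>auto intro: RQ_mult_closed single_closed\<close>)

lemma single_add:
  assumes "r \<in> carrier R" "s \<in> carrier R"
  shows "gr_single R Q (r \<oplus> s) v = gr_single R Q r v \<oplus>\<^bsub>RQ\<^esub> gr_single R Q s v"
  by (rule RQ_ext) (use assms in \<open>auto simp: single_closed RQ_add_closed RQ_add\<close>, auto simp: gr_single_def)

lemma RQ_assoc:
  assumes a: "a \<in> carrier RQ" and b: "b \<in> carrier RQ" and c: "c \<in> carrier RQ"
  shows "a \<otimes>\<^bsub>RQ\<^esub> b \<otimes>\<^bsub>RQ\<^esub> c = a \<otimes>\<^bsub>RQ\<^esub> (b \<otimes>\<^bsub>RQ\<^esub> c)"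
proof (rule RQ_ext)
  note eval = RQ_eval_closed[OF a] RQ_eval_closed[OF b] RQ_eval_closed[OF c]
  fix u assume u: "u \<in> carrier Q"
  let ?t = "\<lambda>v w. a v \<otimes> b (inv\<^bsub>Q\<^esub> v \<otimes>\<^bsub>Q\<^esub> w) \<otimes> c (inv\<^bsub>Q\<^esub> w \<otimes>\<^bsub>Q\<^esub> u)"
  have inner: "(\<Oplus>w\<in>carrier Q. ?t v w) = a v \<otimes> (b \<otimes>\<^bsub>RQ\<^esub> c) (inv\<^bsub>Q\<^esub> v \<otimes>\<^bsub>Q\<^esub> u)"
    if v: "v \<in> carrier Q" for v
  proof -
    have "bij_betw (\<lambda>w. v \<otimes>\<^bsub>Q\<^esub> w) (carrier Q) (carrier Q)"
      using v by (intro bij_betw_byWitness[of _ "\<lambda>w. inv\<^bsub>Q\<^esub> v \<otimes>\<^bsub>Q\<^esub> w"]) (auto simp: Q.m_assoc[symmetric])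
    then have "(\<Oplus>w\<in>carrier Q. ?t v w) = (\<Oplus>w\<in>carrier Q. ?t v (v \<otimes>\<^bsub>Q\<^esub> w))"
      using eval u v by (intro R.finsum_reindex_bij) auto
    also have "\<dots> = (\<Oplus>w\<in>carrier Q. a v \<otimes> (b w \<otimes> c (inv\<^bsub>Q\<^esub> w \<otimes>\<^bsub>Q\<^esub> (inv\<^bsub>Q\<^esub> v \<otimes>\<^bsub>Q\<^esub> u))))"
      using eval u v
      by (intro R.finsum_cong') (auto simp: R.m_assoc Q.inv_mult_group Q.m_assoc[symmetric])
    also have "\<dots> = a v \<otimes> (b \<otimes>\<^bsub>RQ\<^esub> c) (inv\<^bsub>Q\<^esub> v \<otimes>\<^bsub>Q\<^esub> u)"
      using finite_group eval u v by (subst RQ_mult) (auto intro!: R.finsum_rdistr[symmetric])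
    finally show ?thesis .
  qed
  have "(a \<otimes>\<^bsub>RQ\<^esub> b \<otimes>\<^bsub>RQ\<^esub> c) u = (\<Oplus>w\<in>carrier Q. (\<Oplus>v\<in>carrier Q. ?t v w))"
    unfolding RQ_mult[OF u]
    using finite_group eval u by (intro R.finsum_cong') (auto simp: RQ_mult R.finsum_ldistr)
  also have "\<dots> = (\<Oplus>v\<in>carrier Q. (\<Oplus>w\<in>carrier Q. ?t v w))"
    using finite_group eval u by (intro R.finsum_swap) auto
  also have "\<dots> = (a \<otimes>\<^bsub>RQ\<^esub> (b \<otimes>\<^bsub>RQ\<^esub> c)) u"
    unfolding RQ_mult[OF u, of a] using eval u RQ_eval_closed[OF RQ_mult_closed[OF b c]]
    by (intro R.finsum_cong') (auto simp: inner)
  finally show "(a \<otimes>\<^bsub>RQ\<^esub> b \<otimes>\<^bsub>RQ\<^esub> c) u = (a \<otimes>\<^bsub>RQ\<^esub> (b \<otimes>\<^bsub>RQ\<^esub> c)) u" .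
qed (use assms in \<open>auto intro: RQ_mult_closed\<close>)

lemma RQ_comm:
  assumes "comm_group Q" and a: "a \<in> carrier RQ" and b: "b \<in> carrier RQ"
  shows "a \<otimes>\<^bsub>RQ\<^esub> b = b \<otimes>\<^bsub>RQ\<^esub> a"
proof (rule RQ_ext)
  interpret C: comm_group Q by fact
  note eval = RQ_eval_closed[OF a] RQ_eval_closed[OF b]
  fix u assume u: "u \<in> carrier Q"
  have involution: "inv\<^bsub>Q\<^esub> (inv\<^bsub>Q\<^esub> w \<otimes>\<^bsub>Q\<^esub> u) \<otimes>\<^bsub>Q\<^esub> u = w" if "w \<in> carrier Q" for w
    using that u by (simp add: C.inv_mult Q.m_assoc)
  have bij: "bij_betw (\<lambda>w. inv\<^bsub>Q\<^esub> w \<otimes>\<^bsub>Q\<^esub> u) (carrier Q) (carrier Q)"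
    using u by (intro bij_betw_byWitness[of _ "\<lambda>w. inv\<^bsub>Q\<^esub> w \<otimes>\<^bsub>Q\<^esub> u"]) (auto simp: involution)
  have "(a \<otimes>\<^bsub>RQ\<^esub> b) u = (\<Oplus>v\<in>carrier Q. a v \<otimes> b (inv\<^bsub>Q\<^esub> v \<otimes>\<^bsub>Q\<^esub> u))"
    by (rule RQ_mult[OF u])
  also have "\<dots> = (\<Oplus>w\<in>carrier Q. a (inv\<^bsub>Q\<^esub> w \<otimes>\<^bsub>Q\<^esub> u) \<otimes> b (inv\<^bsub>Q\<^esub> (inv\<^bsub>Q\<^esub> w \<otimes>\<^bsub>Q\<^esub> u) \<otimes>\<^bsub>Q\<^esub> u))"
    using eval u by (intro R.finsum_reindex_bij[OF bij]) auto
  also have "\<dots> = (\<Oplus>w\<in>carrier Q. b w \<otimes> a (inv\<^bsub>Q\<^esub> w \<otimes>\<^bsub>Q\<^esub> u))"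
    using eval u by (intro R.finsum_cong') (auto simp: involution R.m_comm)
  also have "\<dots> = (b \<otimes>\<^bsub>RQ\<^esub> a) u"
    using RQ_mult[OF u] by simp
  finally show "(a \<otimes>\<^bsub>RQ\<^esub> b) u = (b \<otimes>\<^bsub>RQ\<^esub> a) u" .
qed (use assms in \<open>auto intro: RQ_mult_closed\<close>)

lemma RQ_abelian_group: "abelian_group RQ"
proof (rule abelian_group_of_separating_maps[where I = "carrier Q" and P = "\<lambda>_. R" and \<phi> = "\<lambda>u a. a u"])
  fix a assume a: "a \<in> carrier RQ"
  show "\<exists>b\<in>carrier RQ. \<forall>u\<in>carrier Q. b u = \<ominus> a u"
    by (intro bexI[of _ "\<lambda>u\<in>carrier Q. \<ominus> a u"] RQ_memI) (auto simp: RQ_eval_closed[OF a])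
qed (auto simp: RQ_add RQ_zero intro: R.abelian_group_axioms RQ_add_closed RQ_zero_closed RQ_eval_closed RQ_ext)

lemma RQ_distrib:
  assumes a: "a \<in> carrier RQ" and b: "b \<in> carrier RQ" and c: "c \<in> carrier RQ"
  shows "(a \<oplus>\<^bsub>RQ\<^esub> b) \<otimes>\<^bsub>RQ\<^esub> c = a \<otimes>\<^bsub>RQ\<^esub> c \<oplus>\<^bsub>RQ\<^esub> b \<otimes>\<^bsub>RQ\<^esub> c"
proof (rule RQ_ext)
  note eval = RQ_eval_closed[OF a] RQ_eval_closed[OF b] RQ_eval_closed[OF c]
  fix u assume u: "u \<in> carrier Q"
  have "((a \<oplus>\<^bsub>RQ\<^esub> b) \<otimes>\<^bsub>RQ\<^esub> c) u =
      (\<Oplus>v\<in>carrier Q. a v \<otimes> c (inv\<^bsub>Q\<^esub> v \<otimes>\<^bsub>Q\<^esub> u) \<oplus> b v \<otimes> c (inv\<^bsub>Q\<^esub> v \<otimes>\<^bsub>Q\<^esub> u))"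
    unfolding RQ_mult[OF u] using eval u by (intro R.finsum_cong') (auto simp: RQ_add R.l_distr)
  also have "\<dots> = (a \<otimes>\<^bsub>RQ\<^esub> c \<oplus>\<^bsub>RQ\<^esub> b \<otimes>\<^bsub>RQ\<^esub> c) u"
    using eval u by (simp add: RQ_add RQ_mult R.finsum_addf Pi_def)
  finally show "((a \<oplus>\<^bsub>RQ\<^esub> b) \<otimes>\<^bsub>RQ\<^esub> c) u = (a \<otimes>\<^bsub>RQ\<^esub> c \<oplus>\<^bsub>RQ\<^esub> b \<otimes>\<^bsub>RQ\<^esub> c) u" .
qed (use a b c in \<open>auto intro: RQ_mult_closed RQ_add_closed\<close>)

lemma RQ_cring:
  assumes "comm_group Q"
  shows "cring RQ"
proof (rule cringI[OF RQ_abelian_group _ RQ_distrib])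
  have one: "\<one>\<^bsub>RQ\<^esub> \<in> carrier RQ" unfolding RQ_one by (rule single_closed) simp
  have l_one: "\<one>\<^bsub>RQ\<^esub> \<otimes>\<^bsub>RQ\<^esub> a = a" if a: "a \<in> carrier RQ" for a
    by (rule RQ_ext) (use a one RQ_eval_closed[OF a] in \<open>auto simp: RQ_mult_closed RQ_one single_mult\<close>)
  show "comm_monoid RQ"
    by (rule comm_monoidI) (use one l_one RQ_mult_closed RQ_assoc RQ_comm[OF assms] in auto)
qed

end

definition push_forward ::
    "('r, 'x) ring_scheme \<Rightarrow> ('q, 'y) monoid_scheme \<Rightarrow> ('q \<Rightarrow> 'k) \<Rightarrow> ('q \<Rightarrow> 'r) \<Rightarrow> 'k \<Rightarrow> 'r" where
  "push_forward R Q f a c = (\<Oplus>\<^bsub>R\<^esub>d\<in>{d \<in> carrier Q. f d = c}. a d)"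

lemma push_forward_translate:
  assumes "finite_group_ring R Q" "group Q'" "f \<in> hom Q Q'" "b \<in> carrier (group_ring R Q)"
    and "d \<in> carrier Q" "c \<in> carrier Q'"
  shows "push_forward R Q f b (inv\<^bsub>Q'\<^esub> (f d) \<otimes>\<^bsub>Q'\<^esub> c) =
    (\<Oplus>\<^bsub>R\<^esub>u\<in>{u \<in> carrier Q. f u = c}. b (inv\<^bsub>Q\<^esub> d \<otimes>\<^bsub>Q\<^esub> u))"
proof -
  interpret Q: finite_group_ring R Q by fact
  interpret Q': group Q' by fact
  interpret f: group_hom Q Q' f
    by (intro group_hom.intro group_hom_axioms.intro assms(3)) unfold_locales
  let ?F = "\<lambda>c. {d \<in> carrier Q. f d = c}"
  have "bij_betw (\<lambda>u. inv\<^bsub>Q\<^esub> d \<otimes>\<^bsub>Q\<^esub> u) (?F c) (?F (inv\<^bsub>Q'\<^esub> (f d) \<otimes>\<^bsub>Q'\<^esub> c))"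
    using assms(5,6) by (intro bij_betw_byWitness[of _ "\<lambda>u. d \<otimes>\<^bsub>Q\<^esub> u"])
      (auto simp: Q.Q.m_assoc[symmetric] Q'.m_assoc[symmetric])
  then show ?thesis
    unfolding push_forward_def using Q.RQ_eval_closed[OF assms(4)]
    by (intro Q.R.finsum_reindex_bij) auto
qed

lemma push_forward_mult:
  assumes Q: "finite_group_ring R Q" and Q': "finite_group_ring R Q'" and f: "f \<in> hom Q Q'"
    and a: "a \<in> carrier (group_ring R Q)" and b: "b \<in> carrier (group_ring R Q)"
    and a': "a' \<in> carrier (group_ring R Q')" and b': "b' \<in> carrier (group_ring R Q')"
    and push_a: "\<And>c. c \<in> carrier Q' \<Longrightarrow> a' c = push_forward R Q f a c"
    and push_b: "\<And>c. c \<in> carrier Q' \<Longrightarrow> b' c = push_forward R Q f b c"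
    and c: "c \<in> carrier Q'"
  shows "(a' \<otimes>\<^bsub>group_ring R Q'\<^esub> b') c = push_forward R Q f (a \<otimes>\<^bsub>group_ring R Q\<^esub> b) c"
proof -
  interpret Q: finite_group_ring R Q by fact
  interpret Q': finite_group_ring R Q' by fact
  interpret f: group_hom Q Q' f
    by (intro group_hom.intro group_hom_axioms.intro f) unfold_locales
  note eval = Q.RQ_eval_closed[OF a] Q.RQ_eval_closed[OF b] Q'.RQ_eval_closed[OF a'] Q'.RQ_eval_closed[OF b']
  let ?F = "\<lambda>c. {d \<in> carrier Q. f d = c}"
  have "a' v \<otimes>\<^bsub>R\<^esub> b' (inv\<^bsub>Q'\<^esub> v \<otimes>\<^bsub>Q'\<^esub> c) = (\<Oplus>\<^bsub>R\<^esub>d\<in>?F v. a d \<otimes>\<^bsub>R\<^esub> b' (inv\<^bsub>Q'\<^esub> (f d) \<otimes>\<^bsub>Q'\<^esub> c))"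
    if v: "v \<in> carrier Q'" for v
  proof -
    have "a' v \<otimes>\<^bsub>R\<^esub> b' (inv\<^bsub>Q'\<^esub> v \<otimes>\<^bsub>Q'\<^esub> c) = (\<Oplus>\<^bsub>R\<^esub>d\<in>?F v. a d \<otimes>\<^bsub>R\<^esub> b' (inv\<^bsub>Q'\<^esub> v \<otimes>\<^bsub>Q'\<^esub> c))"
      unfolding push_a[OF v] push_forward_def
      using Q.finite_group eval v c by (intro Q.R.finsum_ldistr) auto
    also have "\<dots> = (\<Oplus>\<^bsub>R\<^esub>d\<in>?F v. a d \<otimes>\<^bsub>R\<^esub> b' (inv\<^bsub>Q'\<^esub> (f d) \<otimes>\<^bsub>Q'\<^esub> c))"
      using eval v c by (intro Q.R.finsum_cong') auto
    finally show ?thesis .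
  qed
  then have "(a' \<otimes>\<^bsub>group_ring R Q'\<^esub> b') c =
      (\<Oplus>\<^bsub>R\<^esub>v\<in>carrier Q'. \<Oplus>\<^bsub>R\<^esub>d\<in>?F v. a d \<otimes>\<^bsub>R\<^esub> b' (inv\<^bsub>Q'\<^esub> (f d) \<otimes>\<^bsub>Q'\<^esub> c))"
    unfolding Q'.RQ_mult[OF c] using eval c by (intro Q.R.finsum_cong') auto
  also have "\<dots> = (\<Oplus>\<^bsub>R\<^esub>d\<in>carrier Q. a d \<otimes>\<^bsub>R\<^esub> b' (inv\<^bsub>Q'\<^esub> (f d) \<otimes>\<^bsub>Q'\<^esub> c))"
    using Q.finite_group Q'.finite_group eval c by (intro Q.R.finsum_fibres) auto
  also have "\<dots> = (\<Oplus>\<^bsub>R\<^esub>d\<in>carrier Q. \<Oplus>\<^bsub>R\<^esub>u\<in>?F c. a d \<otimes>\<^bsub>R\<^esub> b (inv\<^bsub>Q\<^esub> d \<otimes>\<^bsub>Q\<^esub> u))"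
    using Q.finite_group eval c push_forward_translate[OF Q Q'.Q.group_axioms f b _ c]
    by (intro Q.R.finsum_cong') (auto simp: push_b Q.R.finsum_rdistr Pi_def)
  also have "\<dots> = (\<Oplus>\<^bsub>R\<^esub>u\<in>?F c. \<Oplus>\<^bsub>R\<^esub>d\<in>carrier Q. a d \<otimes>\<^bsub>R\<^esub> b (inv\<^bsub>Q\<^esub> d \<otimes>\<^bsub>Q\<^esub> u))"
    using Q.finite_group eval by (intro Q.R.finsum_swap) auto
  also have "\<dots> = push_forward R Q f (a \<otimes>\<^bsub>group_ring R Q\<^esub> b) c"
    unfolding push_forward_def using eval by (intro Q.R.finsum_cong') (auto simp: Q.RQ_mult)
  finally show ?thesis .
qed

section \<open>Completed group rings\<close>

lemma (in group) rcos_eq_iff: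
  assumes "subgroup N G" "g \<in> carrier G" "a \<in> carrier G"
  shows "N #> g = N #> a \<longleftrightarrow> g \<otimes> inv a \<in> N"
proof
  assume "N #> g = N #> a"
  then have "g \<in> N #> a" using rcos_self[OF assms(2,1)] by auto
  then show "g \<otimes> inv a \<in> N"
    using subgroup.rcos_module_imp[OF assms(1) is_group assms(3)] by simp
next
  assume "g \<otimes> inv a \<in> N"
  then have "g \<in> N #> a"
    using subgroup.rcos_module_rev[OF assms(1) is_group assms(3,2)] by simp
  then show "N #> g = N #> a"
    using repr_independence[OF _ assms(3,1)] by simp
qed

definition cgr_single ::
    "('r, 'x) topring_scheme \<Rightarrow> ('g, 'y) topgroup_scheme \<Rightarrow> 'r \<Rightarrow> 'g \<Rightarrow> ('g set \<Rightarrow> 'g set \<Rightarrow> 'r)" where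
  "cgr_single R G r g = (\<lambda>N\<in>open_normals G. gr_single R (G Mod N) r (N #>\<^bsub>G\<^esub> g))"

locale cgr_base = G: group G + R: cring R
  for G :: "('g, 'x) topgroup_scheme" and R :: "('r, 'y) topring_scheme" (structure) +
  assumes finite_quotient: "N \<in> open_normals G \<Longrightarrow> finite (carrier (G Mod N))"
    and carrier_open_normal: "carrier G \<in> open_normals G"
begin

abbreviation "CG \<equiv> completed_group_ring R G"
abbreviation "GR N \<equiv> group_ring R (G Mod N)"

lemma open_normal_normal: "N \<in> open_normals G \<Longrightarrow> normal N G"
  by (simp add: open_normals_def)

lemma open_normal_subgroup: "N \<in> open_normals G \<Longrightarrow> subgroup N G"
  by (simp add: open_normal_normal normal_imp_subgroup)

lemma finite_group_ring_Mod: "N \<in> open_normals G \<Longrightarrow> finite_group_ring R (G Mod N)"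
  using finite_quotient normal.factorgroup_is_group[OF open_normal_normal]
  by (simp add: finite_group_ring_def finite_group_ring_axioms_def R.is_cring)

lemma Mod_carrier: "carrier (G Mod N) = (\<lambda>g. N #>\<^bsub>G\<^esub> g) ` carrier G"
  by (auto simp: FactGroup_def RCOSETS_def)

lemma Mod_mult:
  assumes "N \<in> open_normals G" "g \<in> carrier G" "h \<in> carrier G"
  shows "(N #>\<^bsub>G\<^esub> g) <#>\<^bsub>G\<^esub> (N #>\<^bsub>G\<^esub> h) = N #>\<^bsub>G\<^esub> (g \<otimes>\<^bsub>G\<^esub> h)"
  using normal.rcos_sum[OF open_normal_normal] assms by simp

lemma coset_one: "N \<in> open_normals G \<Longrightarrow> N #>\<^bsub>G\<^esub> \<one>\<^bsub>G\<^esub> = N"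
  using G.coset_mult_one[of N] subgroup.subset[OF open_normal_subgroup] by simp

lemma coset_trans:
  assumes "N \<in> open_normals G" "M \<in> open_normals G" "N \<subseteq> M" "g \<in> carrier G"
  shows "(\<Union>d\<in>N #>\<^bsub>G\<^esub> g. M #>\<^bsub>G\<^esub> d) = M #>\<^bsub>G\<^esub> g"
proof -
  have "N #>\<^bsub>G\<^esub> g \<subseteq> M #>\<^bsub>G\<^esub> g"
    using assms(3) by (auto simp: r_coset_def)
  then have "M #>\<^bsub>G\<^esub> d = M #>\<^bsub>G\<^esub> g" if "d \<in> N #>\<^bsub>G\<^esub> g" for d
    using G.repr_independence[OF _ assms(4) open_normal_subgroup[OF assms(2)]] that by auto
  moreover have "g \<in> N #>\<^bsub>G\<^esub> g"
    by (rule G.rcos_self[OF assms(4) open_normal_subgroup[OF assms(1)]])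
  ultimately show ?thesis by blast
qed

lemma coset_trans_hom:
  assumes "N \<in> open_normals G" "M \<in> open_normals G" "N \<subseteq> M"
  shows "(\<lambda>D. \<Union>d\<in>D. M #>\<^bsub>G\<^esub> d) \<in> hom (G Mod N) (G Mod M)"
proof (rule homI)
  fix C D assume "C \<in> carrier (G Mod N)" "D \<in> carrier (G Mod N)"
  then obtain c d where "c \<in> carrier G" "d \<in> carrier G" "C = N #>\<^bsub>G\<^esub> c" "D = N #>\<^bsub>G\<^esub> d"
    by (auto simp: Mod_carrier)
  then show "(\<Union>d\<in>C \<otimes>\<^bsub>G Mod N\<^esub> D. M #>\<^bsub>G\<^esub> d) = (\<Union>d\<in>C. M #>\<^bsub>G\<^esub> d) \<otimes>\<^bsub>G Mod M\<^esub> (\<Union>d\<in>D. M #>\<^bsub>G\<^esub> d)"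
    using assms by (simp add: coset_trans Mod_mult)
next
  fix D assume "D \<in> carrier (G Mod N)"
  then show "(\<Union>d\<in>D. M #>\<^bsub>G\<^esub> d) \<in> carrier (G Mod M)"
    unfolding Mod_carrier by (elim imageE) (simp only: coset_trans[OF assms] imageI)
qed

lemma coset_subset_iff:
  assumes "N \<in> open_normals G" "M \<in> open_normals G" "N \<subseteq> M" "C \<in> carrier (G Mod M)"
    and D: "D \<in> carrier (G Mod N)"
  shows "D \<subseteq> C \<longleftrightarrow> (\<Union>d\<in>D. M #>\<^bsub>G\<^esub> d) = C"
proof -
  obtain g where g: "g \<in> carrier G" "D = N #>\<^bsub>G\<^esub> g"
    using D by (auto simp: Mod_carrier)
  obtain c where c: "c \<in> carrier G" "C = M #>\<^bsub>G\<^esub> c"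
    using assms(4) by (auto simp: Mod_carrier)
  have "N #>\<^bsub>G\<^esub> g \<subseteq> C \<longleftrightarrow> M #>\<^bsub>G\<^esub> g = C"
  proof
    assume "N #>\<^bsub>G\<^esub> g \<subseteq> C"
    then have "g \<in> C"
      using G.rcos_self[OF g(1) open_normal_subgroup[OF assms(1)]] by auto
    then show "M #>\<^bsub>G\<^esub> g = C"
      unfolding c(2) using G.repr_independence[OF _ c(1) open_normal_subgroup[OF assms(2)]] by auto
  next
    assume "M #>\<^bsub>G\<^esub> g = C"
    moreover have "N #>\<^bsub>G\<^esub> g \<subseteq> M #>\<^bsub>G\<^esub> g"
      using assms(3) by (auto simp: r_coset_def)
    ultimately show "N #>\<^bsub>G\<^esub> g \<subseteq> C" by simp
  qed
  then show ?thesis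
    unfolding g(2) coset_trans[OF assms(1-3) g(1)] .
qed

lemma coset_fibre:
  assumes "N \<in> open_normals G" "M \<in> open_normals G" "N \<subseteq> M" "C \<in> carrier (G Mod M)"
  shows "{D \<in> carrier (G Mod N). D \<subseteq> C} = {D \<in> carrier (G Mod N). (\<Union>d\<in>D. M #>\<^bsub>G\<^esub> d) = C}"
  using coset_subset_iff[OF assms] by blast

lemma CG_simps:
  "carrier CG = cgr_carrier R G"
  "N \<in> open_normals G \<Longrightarrow> (a \<oplus>\<^bsub>CG\<^esub> b) N = a N \<oplus>\<^bsub>GR N\<^esub> b N"
  "N \<in> open_normals G \<Longrightarrow> (a \<otimes>\<^bsub>CG\<^esub> b) N = a N \<otimes>\<^bsub>GR N\<^esub> b N"
  "N \<in> open_normals G \<Longrightarrow> \<zero>\<^bsub>CG\<^esub> N = \<zero>\<^bsub>GR N\<^esub>"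
  "N \<in> open_normals G \<Longrightarrow> \<one>\<^bsub>CG\<^esub> N = \<one>\<^bsub>GR N\<^esub>"
  by (simp_all add: completed_group_ring_def)

lemma CG_memI:
  assumes "\<And>N. N \<in> open_normals G \<Longrightarrow> c N \<in> carrier (GR N)"
    and "\<And>N M C. N \<in> open_normals G \<Longrightarrow> M \<in> open_normals G \<Longrightarrow> N \<subseteq> M \<Longrightarrow> C \<in> carrier (G Mod M) \<Longrightarrow>
      c M C = (\<Oplus>D\<in>{D \<in> carrier (G Mod N). D \<subseteq> C}. c N D)"
  shows "(\<lambda>N\<in>open_normals G. c N) \<in> carrier CG"
proof -
  have "(\<lambda>N\<in>open_normals G. c N) \<in> (\<Pi>\<^sub>E N\<in>open_normals G. carrier (GR N))"
    using assms(1) by (simp add: PiE_def Pi_def)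
  then show ?thesis
    unfolding CG_simps(1) cgr_carrier_def
    by (intro CollectI conjI ballI impI) (simp_all only: restrict_apply if_True assms(2))
qed

lemma CG_memD:
  assumes "a \<in> carrier CG"
  shows "N \<in> open_normals G \<Longrightarrow> a N \<in> carrier (GR N)"
    and "N \<in> open_normals G \<Longrightarrow> M \<in> open_normals G \<Longrightarrow> N \<subseteq> M \<Longrightarrow> C \<in> carrier (G Mod M) \<Longrightarrow>
      a M C = (\<Oplus>D\<in>{D \<in> carrier (G Mod N). D \<subseteq> C}. a N D)"
    and "a \<in> extensional (open_normals G)"
  using assms unfolding CG_simps(1) cgr_carrier_def by (auto simp: PiE_mem PiE_def)

lemma CG_eval_closed:
  "a \<in> carrier CG \<Longrightarrow> N \<in> open_normals G \<Longrightarrow> C \<in> carrier (G Mod N) \<Longrightarrow> a N C \<in> carrier R"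
  by (rule finite_group_ring.RQ_eval_closed[OF finite_group_ring_Mod CG_memD(1)])

lemma CG_ext:
  assumes "a \<in> carrier CG" "b \<in> carrier CG" "\<And>N. N \<in> open_normals G \<Longrightarrow> a N = b N"
  shows "a = b"
  using CG_memD(3)[OF assms(1)] CG_memD(3)[OF assms(2)] assms(3) by (rule extensionalityI)

lemma CG_ext_eval:
  assumes "a \<in> carrier CG" "b \<in> carrier CG"
    and "\<And>N C. N \<in> open_normals G \<Longrightarrow> C \<in> carrier (G Mod N) \<Longrightarrow> a N C = b N C"
  shows "a = b"
  by (rule CG_ext[OF assms(1,2)])
    (rule finite_group_ring.RQ_ext[OF finite_group_ring_Mod CG_memD(1)[OF assms(1)]
        CG_memD(1)[OF assms(2)] assms(3)])

lemma finite_cosets: "N \<in> open_normals G \<Longrightarrow> finite {D \<in> carrier (G Mod N). P D}"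
  using finite_quotient by simp

lemma CG_add_closed:
  assumes a: "a \<in> carrier CG" and b: "b \<in> carrier CG"
  shows "a \<oplus>\<^bsub>CG\<^esub> b \<in> carrier CG"
proof -
  have "(\<lambda>N\<in>open_normals G. a N \<oplus>\<^bsub>GR N\<^esub> b N) \<in> carrier CG"
  proof (rule CG_memI)
    fix N assume N: "N \<in> open_normals G"
    interpret F: finite_group_ring R "G Mod N" by (rule finite_group_ring_Mod[OF N])
    show "a N \<oplus>\<^bsub>GR N\<^esub> b N \<in> carrier (GR N)"
      using CG_memD(1)[OF a N] CG_memD(1)[OF b N] by (rule F.RQ_add_closed)
    fix M C assume M: "M \<in> open_normals G" and NM: "N \<subseteq> M" and C: "C \<in> carrier (G Mod M)"
    interpret F': finite_group_ring R "G Mod M" by (rule finite_group_ring_Mod[OF M])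
    have "(a M \<oplus>\<^bsub>GR M\<^esub> b M) C = (\<Oplus>D\<in>{D \<in> carrier (G Mod N). D \<subseteq> C}. a N D \<oplus> b N D)"
      using CG_memD(2)[OF a N M NM C] CG_memD(2)[OF b N M NM C] CG_eval_closed[OF a N] CG_eval_closed[OF b N]
      by (simp add: F'.RQ_add[OF C] R.finsum_addf Pi_def)
    also have "\<dots> = (\<Oplus>D\<in>{D \<in> carrier (G Mod N). D \<subseteq> C}. (a N \<oplus>\<^bsub>GR N\<^esub> b N) D)"
      using CG_eval_closed[OF a N] CG_eval_closed[OF b N] by (intro R.finsum_cong') (auto simp: F.RQ_add)
    finally show "(a M \<oplus>\<^bsub>GR M\<^esub> b M) C = (\<Oplus>D\<in>{D \<in> carrier (G Mod N). D \<subseteq> C}. (a N \<oplus>\<^bsub>GR N\<^esub> b N) D)" .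
  qed
  then show ?thesis by (simp add: completed_group_ring_def)
qed

lemma CG_push_forward:
  assumes "a \<in> carrier CG" "N \<in> open_normals G" "M \<in> open_normals G" "N \<subseteq> M" "C \<in> carrier (G Mod M)"
  shows "a M C = push_forward R (G Mod N) (\<lambda>D. \<Union>d\<in>D. M #>\<^bsub>G\<^esub> d) (a N) C"
  using CG_memD(2)[OF assms] coset_fibre[OF assms(2-5)] by (simp only: push_forward_def)

lemma CG_mult_closed:
  assumes a: "a \<in> carrier CG" and b: "b \<in> carrier CG"
  shows "a \<otimes>\<^bsub>CG\<^esub> b \<in> carrier CG"
proof -
  have "(\<lambda>N\<in>open_normals G. a N \<otimes>\<^bsub>GR N\<^esub> b N) \<in> carrier CG"
  proof (rule CG_memI)
    fix N assume N: "N \<in> open_normals G"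
    interpret F: finite_group_ring R "G Mod N" by (rule finite_group_ring_Mod[OF N])
    show "a N \<otimes>\<^bsub>GR N\<^esub> b N \<in> carrier (GR N)"
      using CG_memD(1)[OF a N] CG_memD(1)[OF b N] by (rule F.RQ_mult_closed)
    fix M C assume M: "M \<in> open_normals G" and NM: "N \<subseteq> M" and C: "C \<in> carrier (G Mod M)"
    show "(a M \<otimes>\<^bsub>GR M\<^esub> b M) C = (\<Oplus>D\<in>{D \<in> carrier (G Mod N). D \<subseteq> C}. (a N \<otimes>\<^bsub>GR N\<^esub> b N) D)"
      unfolding coset_fibre[OF N M NM C] push_forward_def[symmetric]
      by (rule push_forward_mult[OF finite_group_ring_Mod[OF N] finite_group_ring_Mod[OF M]
            coset_trans_hom[OF N M NM] CG_memD(1)[OF a N] CG_memD(1)[OF b N] CG_memD(1)[OF a M]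
            CG_memD(1)[OF b M] CG_push_forward[OF a N M NM] CG_push_forward[OF b N M NM] C])
  qed
  then show ?thesis by (simp add: completed_group_ring_def)
qed

lemma single_component:
  "N \<in> open_normals G \<Longrightarrow> cgr_single R G r g N = gr_single R (G Mod N) r (N #>\<^bsub>G\<^esub> g)"
  by (simp add: cgr_single_def)

lemma single_closed:
  assumes r: "r \<in> carrier R" and g: "g \<in> carrier G"
  shows "cgr_single R G r g \<in> carrier CG"
  unfolding cgr_single_def
proof (rule CG_memI)
  fix N assume N: "N \<in> open_normals G"
  interpret F: finite_group_ring R "G Mod N" by (rule finite_group_ring_Mod[OF N])
  show "gr_single R (G Mod N) r (N #>\<^bsub>G\<^esub> g) \<in> carrier (GR N)"
    using r by (rule F.single_closed)
  fix M C assume M: "M \<in> open_normals G" and NM: "N \<subseteq> M" and C: "C \<in> carrier (G Mod M)"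
  have "(\<Oplus>D\<in>{D \<in> carrier (G Mod N). D \<subseteq> C}. gr_single R (G Mod N) r (N #>\<^bsub>G\<^esub> g) D) =
      (if N #>\<^bsub>G\<^esub> g \<in> {D \<in> carrier (G Mod N). D \<subseteq> C} then gr_single R (G Mod N) r (N #>\<^bsub>G\<^esub> g) (N #>\<^bsub>G\<^esub> g) else \<zero>)"
    using finite_cosets[OF N] r by (intro R.finsum_delta) (auto simp: gr_single_def)
  also have "\<dots> = gr_single R (G Mod M) r (M #>\<^bsub>G\<^esub> g) C"
    unfolding coset_fibre[OF N M NM C]
    using g C by (simp add: coset_trans[OF N M NM g] gr_single_def Mod_carrier)
  finally show "gr_single R (G Mod M) r (M #>\<^bsub>G\<^esub> g) C =
      (\<Oplus>D\<in>{D \<in> carrier (G Mod N). D \<subseteq> C}. gr_single R (G Mod N) r (N #>\<^bsub>G\<^esub> g) D)" by simp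
qed

lemma single_mult:
  assumes "r \<in> carrier R" "s \<in> carrier R" "g \<in> carrier G" "h \<in> carrier G"
  shows "cgr_single R G r g \<otimes>\<^bsub>CG\<^esub> cgr_single R G s h = cgr_single R G (r \<otimes> s) (g \<otimes>\<^bsub>G\<^esub> h)"
proof (rule CG_ext)
  fix N assume N: "N \<in> open_normals G"
  interpret F: finite_group_ring R "G Mod N" by (rule finite_group_ring_Mod[OF N])
  show "(cgr_single R G r g \<otimes>\<^bsub>CG\<^esub> cgr_single R G s h) N = cgr_single R G (r \<otimes> s) (g \<otimes>\<^bsub>G\<^esub> h) N"
    using assms N by (simp add: CG_simps single_component F.single_mult_single Mod_carrier Mod_mult)
qed (use assms in \<open>auto intro: CG_mult_closed single_closed\<close>)

lemma single_add:
  assumes "r \<in> carrier R" "s \<in> carrier R" "g \<in> carrier G"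
  shows "cgr_single R G (r \<oplus> s) g = cgr_single R G r g \<oplus>\<^bsub>CG\<^esub> cgr_single R G s g"
proof (rule CG_ext)
  fix N assume N: "N \<in> open_normals G"
  interpret F: finite_group_ring R "G Mod N" by (rule finite_group_ring_Mod[OF N])
  show "cgr_single R G (r \<oplus> s) g N = (cgr_single R G r g \<oplus>\<^bsub>CG\<^esub> cgr_single R G s g) N"
    using assms N by (simp add: CG_simps single_component F.single_add)
qed (use assms in \<open>auto intro: CG_add_closed single_closed\<close>)

lemma const_eq: "cgr_const R G r = cgr_single R G r \<one>\<^bsub>G\<^esub>"
  unfolding cgr_const_def cgr_single_def by (rule restrict_ext) (simp add: gr_single_def coset_one)

lemma elt_eq: "cgr_elt R G g = cgr_single R G \<one> g"
  unfolding cgr_elt_def cgr_single_def gr_single_def by simp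

lemma CG_one: "\<one>\<^bsub>CG\<^esub> = cgr_single R G \<one> \<one>\<^bsub>G\<^esub>"
proof -
  have "\<one>\<^bsub>CG\<^esub> = (\<lambda>N\<in>open_normals G. \<one>\<^bsub>GR N\<^esub>)" by (simp add: completed_group_ring_def)
  also have "\<dots> = cgr_single R G \<one> \<one>\<^bsub>G\<^esub>"
    unfolding cgr_single_def
    by (rule restrict_ext) (simp add: finite_group_ring.RQ_one[OF finite_group_ring_Mod] coset_one)
  finally show ?thesis .
qed

lemma CG_zero: "\<zero>\<^bsub>CG\<^esub> = cgr_single R G \<zero> \<one>\<^bsub>G\<^esub>"
  unfolding cgr_single_def by (simp add: completed_group_ring_def group_ring_def gr_single_def)

lemma Mod_comm_group:
  assumes "comm_group G" and N: "N \<in> open_normals G"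
  shows "comm_group (G Mod N)"
proof (rule group.group_comm_groupI)
  interpret comm_group G by fact
  show "group (G Mod N)" by (rule normal.factorgroup_is_group[OF open_normal_normal[OF N]])
  fix C D assume "C \<in> carrier (G Mod N)" "D \<in> carrier (G Mod N)"
  then obtain c d where "c \<in> carrier G" "d \<in> carrier G" "C = N #>\<^bsub>G\<^esub> c" "D = N #>\<^bsub>G\<^esub> d"
    by (auto simp: Mod_carrier)
  then show "C \<otimes>\<^bsub>G Mod N\<^esub> D = D \<otimes>\<^bsub>G Mod N\<^esub> C"
    by (simp add: Mod_mult[OF N] m_comm)
qed

lemma CG_cring:
  assumes "comm_group G"
  shows "cring CG"
proof (rule cring_of_separating_maps[where I = "open_normals G" and P = GR and \<phi> = "\<lambda>N a. a N"])
  show GR: "cring (GR N)" if "N \<in> open_normals G" for N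
    by (rule finite_group_ring.RQ_cring[OF finite_group_ring_Mod[OF that] Mod_comm_group[OF assms that]])
  fix a assume a: "a \<in> carrier CG"
  let ?minus_one = "cgr_single R G (\<ominus> \<one>) \<one>\<^bsub>G\<^esub>"
  show "\<exists>b\<in>carrier CG. \<forall>N\<in>open_normals G. b N = \<ominus>\<^bsub>GR N\<^esub> a N"
  proof (intro bexI[of _ "?minus_one \<otimes>\<^bsub>CG\<^esub> a"] ballI)
    show "?minus_one \<otimes>\<^bsub>CG\<^esub> a \<in> carrier CG"
      by (intro CG_mult_closed single_closed a) auto
    fix N assume N: "N \<in> open_normals G"
    interpret F: finite_group_ring R "G Mod N" by (rule finite_group_ring_Mod[OF N])
    interpret RN: cring "GR N" by (rule GR[OF N])
    have "?minus_one N \<oplus>\<^bsub>GR N\<^esub> \<one>\<^bsub>GR N\<^esub> = \<zero>\<^bsub>GR N\<^esub>"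
      using single_add[of "\<ominus> \<one>" \<one> "\<one>\<^bsub>G\<^esub>"] by (simp add: CG_simps(2,4)[OF N, symmetric] CG_simps(5)[OF N, symmetric] CG_one CG_zero R.l_neg)
    then have "?minus_one N = \<ominus>\<^bsub>GR N\<^esub> \<one>\<^bsub>GR N\<^esub>"
      using CG_memD(1)[OF single_closed N, of "\<ominus> \<one>" "\<one>\<^bsub>G\<^esub>"] by (intro RN.minus_equality[symmetric]) auto
    then show "(?minus_one \<otimes>\<^bsub>CG\<^esub> a) N = \<ominus>\<^bsub>GR N\<^esub> a N"
      using CG_memD(1)[OF a N] by (simp add: CG_simps(3)[OF N] RN.l_minus)
  qed
next
  fix N assume "N \<in> open_normals G"
  then show "(\<lambda>a. a N) \<in> ring_hom CG (GR N)"
    by (intro ring_hom_memI) (auto simp: CG_memD(1) CG_simps)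
qed (auto simp: CG_simps(2-5) intro: CG_ext CG_add_closed CG_mult_closed single_closed[of \<zero> "\<one>\<^bsub>G\<^esub>", folded CG_zero]
    single_closed[of \<one> "\<one>\<^bsub>G\<^esub>", folded CG_one])

subsection \<open>The augmentation\<close>

lemma elt_closed: "g \<in> carrier G \<Longrightarrow> cgr_elt R G g \<in> carrier CG"
  by (simp add: elt_eq single_closed)

lemma elt_mult:
  "g \<in> carrier G \<Longrightarrow> h \<in> carrier G \<Longrightarrow> cgr_elt R G (g \<otimes>\<^bsub>G\<^esub> h) = cgr_elt R G g \<otimes>\<^bsub>CG\<^esub> cgr_elt R G h"
  by (simp add: elt_eq single_mult)

lemma elt_one: "cgr_elt R G \<one>\<^bsub>G\<^esub> = \<one>\<^bsub>CG\<^esub>"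
  by (simp add: elt_eq CG_one)

lemma const_closed: "r \<in> carrier R \<Longrightarrow> cgr_const R G r \<in> carrier CG"
  by (simp add: const_eq single_closed)

lemma const_hom: "cgr_const R G \<in> ring_hom R CG"
  by (rule ring_hom_memI) (auto simp: const_eq single_closed single_mult single_add CG_one)

lemma coset_carrier: "g \<in> carrier G \<Longrightarrow> carrier G #>\<^bsub>G\<^esub> g = carrier G"
  using G.coset_join2[OF _ G.subgroup_self] by simp

lemma Mod_carrier_group: "carrier (G Mod carrier G) = {carrier G}"
  unfolding Mod_carrier using coset_carrier G.one_closed by blast

definition augmentation :: "('g set \<Rightarrow> 'g set \<Rightarrow> 'r) \<Rightarrow> 'r" where
  "augmentation a = a (carrier G) (carrier G)"

lemma augmentation_closed: "a \<in> carrier CG \<Longrightarrow> augmentation a \<in> carrier R"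
  unfolding augmentation_def by (rule CG_eval_closed[OF _ carrier_open_normal]) (simp_all add: Mod_carrier_group)

lemma augmentation_single: "g \<in> carrier G \<Longrightarrow> augmentation (cgr_single R G r g) = r"
  unfolding augmentation_def single_component[OF carrier_open_normal] gr_single_def
  by (simp add: coset_carrier Mod_carrier_group)

lemma augmentation_hom: "augmentation \<in> ring_hom CG R"
proof (rule ring_hom_memI)
  interpret F: finite_group_ring R "G Mod carrier G" by (rule finite_group_ring_Mod[OF carrier_open_normal])
  have mem: "carrier G \<in> carrier (G Mod carrier G)" by (simp add: Mod_carrier_group)
  fix a b assume a: "a \<in> carrier CG" and b: "b \<in> carrier CG"
  note closed = CG_eval_closed[OF a carrier_open_normal mem] CG_eval_closed[OF b carrier_open_normal mem]
  show "augmentation (a \<oplus>\<^bsub>CG\<^esub> b) = augmentation a \<oplus> augmentation b"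
    unfolding augmentation_def CG_simps(2)[OF carrier_open_normal] by (rule F.RQ_add[OF mem])
  have "inv\<^bsub>G Mod carrier G\<^esub> carrier G \<otimes>\<^bsub>G Mod carrier G\<^esub> carrier G \<in> carrier (G Mod carrier G)"
    using mem by (intro F.Q.m_closed F.Q.inv_closed)
  then have "inv\<^bsub>G Mod carrier G\<^esub> carrier G \<otimes>\<^bsub>G Mod carrier G\<^esub> carrier G = carrier G"
    unfolding Mod_carrier_group by blast
  then show "augmentation (a \<otimes>\<^bsub>CG\<^esub> b) = augmentation a \<otimes> augmentation b"
    unfolding augmentation_def CG_simps(3)[OF carrier_open_normal] F.RQ_mult[OF mem]
    unfolding Mod_carrier_group using closed by (simp del: mult_FactGroup)
next
  show "augmentation \<one>\<^bsub>CG\<^esub> = \<one>" by (simp add: CG_one augmentation_single)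
qed (rule augmentation_closed)

subsection \<open>Compatible families\<close>

definition compatible :: "('g set \<Rightarrow> 'g set \<Rightarrow> 'r) \<Rightarrow> 'g set \<Rightarrow> 'g set \<Rightarrow> bool" where
  "compatible a N M \<longleftrightarrow> (\<forall>C\<in>carrier (G Mod M). a M C = (\<Oplus>D\<in>{D \<in> carrier (G Mod N). D \<subseteq> C}. a N D))"

lemma compatible_refl:
  assumes N: "N \<in> open_normals G" and a: "\<And>C. C \<in> carrier (G Mod N) \<Longrightarrow> a N C \<in> carrier R"
  shows "compatible a N N"
  unfolding compatible_def
proof
  fix C assume C: "C \<in> carrier (G Mod N)"
  have "{D \<in> carrier (G Mod N). D \<subseteq> C} = {C}"
    unfolding coset_fibre[OF N N order_refl C] using C coset_trans[OF N N order_refl]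
    by (auto simp: Mod_carrier)
  then show "a N C = (\<Oplus>D\<in>{D \<in> carrier (G Mod N). D \<subseteq> C}. a N D)"
    using a[OF C] by simp
qed

lemma coset_projection:
  assumes L: "L \<in> open_normals G" and N: "N \<in> open_normals G" and M: "M \<in> open_normals G"
    and sub: "L \<subseteq> N" "N \<subseteq> M" and C: "C \<in> carrier (G Mod M)" and D: "D \<in> carrier (G Mod L)" "D \<subseteq> C"
  shows "(\<Union>d\<in>D. N #>\<^bsub>G\<^esub> d) \<in> {E \<in> carrier (G Mod N). E \<subseteq> C}"
proof -
  obtain g where g: "g \<in> carrier G" "D = L #>\<^bsub>G\<^esub> g"
    using D(1) by (auto simp: Mod_carrier)
  have "(\<Union>d\<in>D. M #>\<^bsub>G\<^esub> d) = C"
    using D coset_subset_iff[OF L M _ C] sub by auto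
  then have "M #>\<^bsub>G\<^esub> g = C"
    using coset_trans[OF L M _ g(1)] sub by (simp add: g(2))
  then have "(\<Union>d\<in>N #>\<^bsub>G\<^esub> g. M #>\<^bsub>G\<^esub> d) = C" using coset_trans[OF N M sub(2) g(1)] by simp
  then show ?thesis
    unfolding g(2) coset_trans[OF L N sub(1) g(1)] coset_fibre[OF N M sub(2) C]
    using g(1) by (auto simp: Mod_carrier)
qed

lemma compatible_trans:
  assumes L: "L \<in> open_normals G" and N: "N \<in> open_normals G" and M: "M \<in> open_normals G"
    and sub: "L \<subseteq> N" "N \<subseteq> M" and comp: "compatible a L N" "compatible a N M"
    and a: "\<And>D. D \<in> carrier (G Mod L) \<Longrightarrow> a L D \<in> carrier R"
  shows "compatible a L M"
  unfolding compatible_def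
proof
  fix C assume C: "C \<in> carrier (G Mod M)"
  let ?cosets = "\<lambda>N C. {D \<in> carrier (G Mod N). D \<subseteq> C}" and ?\<pi> = "\<lambda>D. \<Union>d\<in>D. N #>\<^bsub>G\<^esub> d"
  have fibre: "{D \<in> ?cosets L C. ?\<pi> D = E} = ?cosets L E" if "E \<in> ?cosets N C" for E
  proof -
    have E: "E \<in> carrier (G Mod N)" "E \<subseteq> C" using that by auto
    show ?thesis
      using coset_fibre[OF L N sub(1) E(1)] E(2) by blast
  qed
  have "?\<pi> ` ?cosets L C \<subseteq> ?cosets N C"
    using coset_projection[OF L N M sub C] by blast
  then have "(\<Oplus>D\<in>?cosets L C. a L D) = (\<Oplus>E\<in>?cosets N C. \<Oplus>D\<in>{D \<in> ?cosets L C. ?\<pi> D = E}. a L D)"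
    using a finite_cosets[OF L] finite_cosets[OF N] by (intro R.finsum_fibres[symmetric]) auto
  also have "\<dots> = (\<Oplus>E\<in>?cosets N C. \<Oplus>D\<in>?cosets L E. a L D)"
    using a by (intro R.finsum_cong' refl arg_cong[where f = "finsum R (a L)"] fibre R.finsum_closed) auto
  also have "\<dots> = (\<Oplus>E\<in>?cosets N C. a N E)"
  proof (rule R.finsum_cong')
    fix E assume "E \<in> ?cosets N C"
    then show "(\<Oplus>D\<in>?cosets L E. a L D) = a N E" using comp(1) by (simp add: compatible_def)
  next
    show "a N \<in> ?cosets N C \<rightarrow> carrier R"
    proof
      fix E assume "E \<in> ?cosets N C"
      then have "a N E = (\<Oplus>D\<in>?cosets L E. a L D)" using comp(1) by (simp add: compatible_def)
      then show "a N E \<in> carrier R" using a by (auto intro: R.finsum_closed)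
    qed
  qed simp
  also have "\<dots> = a M C" using comp(2) C by (simp add: compatible_def)
  finally show "a M C = (\<Oplus>D\<in>?cosets L C. a L D)" by simp
qed

end

section \<open>Topological modules\<close>

subsection \<open>Quotient topologies and profinite groups\<close>

lemma openin_quot_topology:
  "openin (quot_topology X f) U \<longleftrightarrow> U \<subseteq> f ` topspace X \<and> openin X {x \<in> topspace X. f x \<in> U}"
proof -
  have "istopology (\<lambda>U. U \<subseteq> f ` topspace X \<and> openin X {x \<in> topspace X. f x \<in> U})"
    unfolding istopology_def
  proof (intro conjI allI impI)
    fix S T assume S: "S \<subseteq> f ` topspace X \<and> openin X {x \<in> topspace X. f x \<in> S}"
      and T: "T \<subseteq> f ` topspace X \<and> openin X {x \<in> topspace X. f x \<in> T}"
    have "{x \<in> topspace X. f x \<in> S \<inter> T} = {x \<in> topspace X. f x \<in> S} \<inter> {x \<in> topspace X. f x \<in> T}"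
      by auto
    then show "openin X {x \<in> topspace X. f x \<in> S \<inter> T}" using S T by (simp add: openin_Int)
    show "S \<inter> T \<subseteq> f ` topspace X" using S by auto
  next
    fix \<K> assume K: "\<forall>S\<in>\<K>. S \<subseteq> f ` topspace X \<and> openin X {x \<in> topspace X. f x \<in> S}"
    have "{x \<in> topspace X. f x \<in> \<Union>\<K>} = (\<Union>S\<in>\<K>. {x \<in> topspace X. f x \<in> S})" by auto
    then show "openin X {x \<in> topspace X. f x \<in> \<Union>\<K>}" using K by auto
    show "\<Union>\<K> \<subseteq> f ` topspace X" using K by auto
  qed
  then show ?thesis
    by (simp add: quot_topology_def topology_inverse')
qed

lemma topspace_quot_topology: "topspace (quot_topology X f) = f ` topspace X"
proof
  show "topspace (quot_topology X f) \<subseteq> f ` topspace X"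
    using openin_quot_topology[of X f "topspace (quot_topology X f)"] by simp
  have "{x \<in> topspace X. f x \<in> f ` topspace X} = topspace X" by auto
  then have "openin (quot_topology X f) (f ` topspace X)"
    by (simp add: openin_quot_topology)
  then show "f ` topspace X \<subseteq> topspace (quot_topology X f)" by (rule openin_subset)
qed

lemma quotient_map_quot_topology: "quotient_map X (quot_topology X f) f"
  by (simp add: quotient_map_def topspace_quot_topology openin_quot_topology)

lemmas continuous_map_quot_topology = quotient_imp_continuous_map[OF quotient_map_quot_topology]

lemma continuous_map_compose2:
  assumes "continuous_map X Y a" "continuous_map X Z b"
    and "continuous_map (prod_topology Y Z) W (\<lambda>(y, z). f y z)"
  shows "continuous_map X W (\<lambda>x. f (a x) (b x))"
  using continuous_map_compose[OF continuous_map_pairedI[OF assms(1,2)] assms(3)] by (simp add: o_def)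

lemma finite_image_of_open_fibres:
  assumes "compact_space X" "\<And>x. x \<in> topspace X \<Longrightarrow> openin X {y \<in> topspace X. c y = c x}"
  shows "finite (c ` topspace X)"
proof -
  let ?U = "(\<lambda>x. {y \<in> topspace X. c y = c x}) ` topspace X"
  have "topspace X \<subseteq> \<Union>?U" by auto
  moreover have "\<forall>U\<in>?U. openin X U" using assms(2) by auto
  ultimately obtain F where F: "finite F" "F \<subseteq> ?U" "topspace X \<subseteq> \<Union>F"
    using spec[OF assms(1)[unfolded compact_space_alt], of ?U] by (elim impE) auto
  then obtain A where A: "finite A" "A \<subseteq> topspace X" "F = (\<lambda>x. {y \<in> topspace X. c y = c x}) ` A"
    by (meson finite_subset_image)
  have "c ` topspace X \<subseteq> c ` A"
    using F(3) A by auto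
  then show ?thesis using A(1) finite_subset by blast
qed

lemma openin_coset_fibre:
  assumes G: "group G" "topspace (grp_top G) = carrier G"
    and translation: "\<And>a. a \<in> carrier G \<Longrightarrow> continuous_map (grp_top G) (grp_top G) (\<lambda>g. g \<otimes>\<^bsub>G\<^esub> a)"
    and N: "openin (grp_top G) N" "subgroup N G" and a: "a \<in> carrier G"
  shows "openin (grp_top G) {g \<in> carrier G. N #>\<^bsub>G\<^esub> g = N #>\<^bsub>G\<^esub> a}"
proof -
  interpret group G by (rule G(1))
  have "openin (grp_top G) {g \<in> topspace (grp_top G). g \<otimes>\<^bsub>G\<^esub> inv\<^bsub>G\<^esub> a \<in> N}"
    using translation[OF inv_closed[OF a]] N(1) by (rule openin_continuous_map_preimage)
  moreover have "{g \<in> topspace (grp_top G). g \<otimes>\<^bsub>G\<^esub> inv\<^bsub>G\<^esub> a \<in> N} = {g \<in> carrier G. N #>\<^bsub>G\<^esub> g = N #>\<^bsub>G\<^esub> a}"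
    using rcos_eq_iff[OF N(2) _ a] by (auto simp: G(2))
  ultimately show ?thesis by simp
qed

lemma cgr_base_of_compact_group:
  assumes G: "group G" "topspace (grp_top G) = carrier G" "compact_space (grp_top G)"
    and translation: "\<And>a. a \<in> carrier G \<Longrightarrow> continuous_map (grp_top G) (grp_top G) (\<lambda>g. g \<otimes>\<^bsub>G\<^esub> a)"
    and R: "cring R"
  shows "cgr_base G R"
proof (intro cgr_base.intro cgr_base_axioms.intro G(1) R)
  interpret group G by (rule G(1))
  fix N assume "N \<in> open_normals G"
  then have N: "openin (grp_top G) N" "subgroup N G"
    by (auto simp: open_normals_def normal_imp_subgroup)
  have "finite ((\<lambda>g. N #>\<^bsub>G\<^esub> g) ` topspace (grp_top G))"
    using openin_coset_fibre[OF G(1,2) translation N]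
    by (intro finite_image_of_open_fibres[OF G(3)]) (simp add: G(2))
  moreover have "carrier (G Mod N) = (\<lambda>g. N #>\<^bsub>G\<^esub> g) ` topspace (grp_top G)"
    by (auto simp: FactGroup_def RCOSETS_def G(2))
  ultimately show "finite (carrier (G Mod N))" by simp
next
  interpret group G by (rule G(1))
  have "normal (carrier G) G"
    by (simp add: normal_inv_iff subgroup_self)
  moreover have "openin (grp_top G) (carrier G)"
    using openin_topspace[of "grp_top G"] G(2) by simp
  ultimately show "carrier G \<in> open_normals G"
    by (simp add: open_normals_def)
qed

lemma profinite_groupD:
  assumes "profinite_group G"
  shows "group G" "topspace (grp_top G) = carrier G" "compact_space (grp_top G)"
    "continuous_map (prod_topology (grp_top G) (grp_top G)) (grp_top G) (\<lambda>(g, h). g \<otimes>\<^bsub>G\<^esub> h)"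
  using assms by (auto simp: profinite_group_def)

lemma profinite_translation:
  assumes "profinite_group G" "a \<in> carrier G"
  shows "continuous_map (grp_top G) (grp_top G) (\<lambda>g. g \<otimes>\<^bsub>G\<^esub> a)"
  by (rule continuous_map_compose2[OF _ _ profinite_groupD(4)[OF assms(1)]])
    (simp_all add: profinite_groupD(2)[OF assms(1)] assms(2))

lemma profinite_cgr_base: "profinite_group G \<Longrightarrow> cring R \<Longrightarrow> cgr_base G R"
  by (intro cgr_base_of_compact_group profinite_groupD(1-3) profinite_translation)

subsection \<open>Topological modules with a group action\<close>

locale top_gmodule = module R T + G: group G
  for R :: "('r, 'x) topring_scheme" and G :: "('g, 'y) topgroup_scheme"
    and T :: "('r, 'm, 'g, 'z) gmodule_scheme" (structure) +
  assumes act_closed: "g \<in> carrier G \<Longrightarrow> t \<in> carrier T \<Longrightarrow> act T g t \<in> carrier T"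
    and act_add: "g \<in> carrier G \<Longrightarrow> t \<in> carrier T \<Longrightarrow> u \<in> carrier T \<Longrightarrow>
      act T g (t \<oplus> u) = act T g t \<oplus> act T g u"
    and act_smult: "g \<in> carrier G \<Longrightarrow> r \<in> carrier R \<Longrightarrow> t \<in> carrier T \<Longrightarrow>
      act T g (r \<odot> t) = r \<odot> act T g t"
    and act_one: "t \<in> carrier T \<Longrightarrow> act T \<one>\<^bsub>G\<^esub> t = t"
    and act_mult: "g \<in> carrier G \<Longrightarrow> h \<in> carrier G \<Longrightarrow> t \<in> carrier T \<Longrightarrow>
      act T (g \<otimes>\<^bsub>G\<^esub> h) t = act T g (act T h t)"
    and top_T: "topspace (mod_top T) = carrier T"
    and top_G: "topspace (grp_top G) = carrier G"
    and top_R: "topspace (ring_top R) = carrier R"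
    and cont_mult: "continuous_map (prod_topology (grp_top G) (grp_top G)) (grp_top G) (\<lambda>(g, h). g \<otimes>\<^bsub>G\<^esub> h)"
    and cont_add: "continuous_map (prod_topology (mod_top T) (mod_top T)) (mod_top T) (\<lambda>(t, u). t \<oplus> u)"
    and cont_uminus: "continuous_map (mod_top T) (mod_top T) (\<lambda>t. \<ominus> t)"
    and cont_smult: "continuous_map (prod_topology (ring_top R) (mod_top T)) (mod_top T) (\<lambda>(r, t). r \<odot> t)"
    and cont_act: "continuous_map (prod_topology (grp_top G) (mod_top T)) (mod_top T) (\<lambda>(g, t). act T g t)"
begin

lemma continuous_add:
  assumes "continuous_map X (mod_top T) a" "continuous_map X (mod_top T) b"
  shows "continuous_map X (mod_top T) (\<lambda>x. a x \<oplus> b x)"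
  by (rule continuous_map_compose2[OF assms cont_add])

lemma continuous_minus:
  assumes "continuous_map X (mod_top T) a" "continuous_map X (mod_top T) b"
  shows "continuous_map X (mod_top T) (\<lambda>x. a x \<ominus> b x)"
  unfolding a_minus_def
  using continuous_add[OF assms(1) continuous_map_compose[OF assms(2) cont_uminus]] by (simp add: o_def)

lemma continuous_smult:
  assumes "continuous_map X (ring_top R) a" "continuous_map X (mod_top T) b"
  shows "continuous_map X (mod_top T) (\<lambda>x. a x \<odot> b x)"
  by (rule continuous_map_compose2[OF assms cont_smult])

lemma continuous_act:
  assumes "continuous_map X (grp_top G) a" "continuous_map X (mod_top T) b"
  shows "continuous_map X (mod_top T) (\<lambda>x. act T (a x) (b x))"
  by (rule continuous_map_compose2[OF assms cont_act])

lemma continuous_mult: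
  assumes "continuous_map X (grp_top G) a" "continuous_map X (grp_top G) b"
  shows "continuous_map X (grp_top G) (\<lambda>x. a x \<otimes>\<^bsub>G\<^esub> b x)"
  by (rule continuous_map_compose2[OF assms cont_mult])

lemma continuous_const: "t \<in> carrier T \<Longrightarrow> continuous_map X (mod_top T) (\<lambda>x. t)"
  by (simp add: top_T)

lemma continuous_closed: "continuous_map X (mod_top T) a \<Longrightarrow> x \<in> topspace X \<Longrightarrow> a x \<in> carrier T"
  using continuous_map_image_subset_topspace[of X "mod_top T" a] top_T by auto

lemma continuous_finsum:
  assumes "finite A" "\<And>i. i \<in> A \<Longrightarrow> continuous_map X (mod_top T) (\<lambda>x. f i x)"
  shows "continuous_map X (mod_top T) (\<lambda>x. \<Oplus>i\<in>A. f i x)"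
  using assms
proof (induction A rule: finite_induct)
  case empty
  then show ?case by (simp add: top_T)
next
  case (insert i A)
  have "continuous_map X (mod_top T) (\<lambda>x. f i x \<oplus> (\<Oplus>i\<in>A. f i x))"
    using insert by (intro continuous_add) auto
  then show ?case
    by (rule continuous_map_eq)
      (use insert.hyps continuous_closed[OF insert.prems] in \<open>auto intro!: finsum_insert[symmetric]\<close>)
qed

lemma act_zero: "g \<in> carrier G \<Longrightarrow> act T g \<zero> = \<zero>"
  by (rule additive_zero[OF M.abelian_group_axioms M.abelian_group_axioms]) (auto simp: act_closed act_add)

lemma act_minus: "g \<in> carrier G \<Longrightarrow> t \<in> carrier T \<Longrightarrow> u \<in> carrier T \<Longrightarrow>
    act T g (t \<ominus> u) = act T g t \<ominus> act T g u"
  by (rule additive_minus[OF M.abelian_group_axioms M.abelian_group_axioms]) (auto simp: act_closed act_add)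

end

subsection \<open>Modules over a completed group ring\<close>

context cgr_base
begin

lemma continuous_map_into_CG:
  assumes "\<And>x. x \<in> topspace X \<Longrightarrow> F x \<in> carrier CG"
    and "\<And>N C. N \<in> open_normals G \<Longrightarrow> C \<in> carrier (G Mod N) \<Longrightarrow> continuous_map X (ring_top R) (\<lambda>x. F x N C)"
  shows "continuous_map X (ring_top CG) F"
proof -
  have top: "ring_top CG = subtopology (product_topology (\<lambda>N. product_topology (\<lambda>_. ring_top R)
      (carrier (G Mod N))) (open_normals G)) (carrier CG)"
    by (simp add: completed_group_ring_def)
  have "F x N \<in> extensional (carrier (G Mod N))" if "x \<in> topspace X" "N \<in> open_normals G" for x N
    using CG_memD(1)[OF assms(1)[OF that(1)] that(2)]
    by (simp add: finite_group_ring.RQ_carrier[OF finite_group_ring_Mod[OF that(2)]] PiE_def)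
  then show ?thesis
    unfolding top continuous_map_in_subtopology continuous_map_componentwise
    using assms CG_memD(3) by auto
qed

lemma continuous_cgr_const:
  assumes "topspace (ring_top R) = carrier R"
  shows "continuous_map (ring_top R) (ring_top CG) (cgr_const R G)"
proof (rule continuous_map_into_CG)
  fix N C assume "N \<in> open_normals G" "C \<in> carrier (G Mod N)"
  then show "continuous_map (ring_top R) (ring_top R) (\<lambda>r. cgr_const R G r N C)"
    by (cases "C = N") (simp_all add: cgr_const_def assms)
qed (simp add: assms const_eq single_closed)

lemma continuous_cgr_elt:
  assumes top: "topspace (ring_top R) = carrier R" "topspace (grp_top G) = carrier G"
    and translation: "\<And>a. a \<in> carrier G \<Longrightarrow> continuous_map (grp_top G) (grp_top G) (\<lambda>g. g \<otimes>\<^bsub>G\<^esub> a)"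
  shows "continuous_map (grp_top G) (ring_top CG) (cgr_elt R G)"
proof (rule continuous_map_into_CG)
  fix N C assume N: "N \<in> open_normals G" and C: "C \<in> carrier (G Mod N)"
  then have N': "openin (grp_top G) N" "subgroup N G"
    by (auto simp: open_normals_def normal_imp_subgroup)
  let ?f = "\<lambda>g. cgr_elt R G g N C"
  have "openin (grp_top G) {g \<in> topspace (grp_top G). ?f g \<in> U}" for U
  proof (subst openin_subopen, intro ballI)
    fix g assume "g \<in> {g \<in> topspace (grp_top G). ?f g \<in> U}"
    then have g: "g \<in> carrier G" "?f g \<in> U" by (auto simp: top)
    let ?V = "{h \<in> carrier G. N #>\<^bsub>G\<^esub> h = N #>\<^bsub>G\<^esub> g}"
    have "?f h = ?f g" if "h \<in> ?V" for h
      using that N by (simp add: cgr_elt_def)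
    then have "?V \<subseteq> {g \<in> topspace (grp_top G). ?f g \<in> U}"
      using g(2) top by auto
    moreover have "g \<in> ?V" using g(1) by simp
    ultimately show "\<exists>T. openin (grp_top G) T \<and> g \<in> T \<and> T \<subseteq> {g \<in> topspace (grp_top G). ?f g \<in> U}"
      using openin_coset_fibre[OF G.group_axioms top(2) translation N' g(1)] by blast
  qed
  then show "continuous_map (grp_top G) (ring_top R) ?f"
    using N C by (auto simp: continuous_map_def top cgr_elt_def)
qed (simp add: top elt_eq single_closed)

end

lemma compact_moduleD:
  assumes "compact_module S M"
  shows "abelian_group M" "topspace (mod_top M) = carrier M"
    and "\<And>a m. a \<in> carrier S \<Longrightarrow> m \<in> carrier M \<Longrightarrow> a \<odot>\<^bsub>M\<^esub> m \<in> carrier M"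
    and "\<And>a b m. a \<in> carrier S \<Longrightarrow> b \<in> carrier S \<Longrightarrow> m \<in> carrier M \<Longrightarrow>
      (a \<oplus>\<^bsub>S\<^esub> b) \<odot>\<^bsub>M\<^esub> m = a \<odot>\<^bsub>M\<^esub> m \<oplus>\<^bsub>M\<^esub> b \<odot>\<^bsub>M\<^esub> m"
    and "\<And>a m m'. a \<in> carrier S \<Longrightarrow> m \<in> carrier M \<Longrightarrow> m' \<in> carrier M \<Longrightarrow>
      a \<odot>\<^bsub>M\<^esub> (m \<oplus>\<^bsub>M\<^esub> m') = a \<odot>\<^bsub>M\<^esub> m \<oplus>\<^bsub>M\<^esub> a \<odot>\<^bsub>M\<^esub> m'"
    and "\<And>a b m. a \<in> carrier S \<Longrightarrow> b \<in> carrier S \<Longrightarrow> m \<in> carrier M \<Longrightarrow>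
      (a \<otimes>\<^bsub>S\<^esub> b) \<odot>\<^bsub>M\<^esub> m = a \<odot>\<^bsub>M\<^esub> (b \<odot>\<^bsub>M\<^esub> m)"
    and "\<And>m. m \<in> carrier M \<Longrightarrow> \<one>\<^bsub>S\<^esub> \<odot>\<^bsub>M\<^esub> m = m"
    and "continuous_map (prod_topology (mod_top M) (mod_top M)) (mod_top M) (\<lambda>(m, m'). m \<oplus>\<^bsub>M\<^esub> m')"
    and "continuous_map (mod_top M) (mod_top M) (\<lambda>m. \<ominus>\<^bsub>M\<^esub> m)"
    and "continuous_map (prod_topology (ring_top S) (mod_top M)) (mod_top M) (\<lambda>(a, m). a \<odot>\<^bsub>M\<^esub> m)"
  using assms by (auto simp: compact_module_def)

lemma coeff_module_simps:
  "carrier (coeff_module R G M) = carrier M" "zero (coeff_module R G M) = zero M"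
  "add (coeff_module R G M) = add M"
  "smult (coeff_module R G M) = (\<lambda>r m. cgr_const R G r \<odot>\<^bsub>M\<^esub> m)"
  "mod_top (coeff_module R G M) = mod_top M"
  "act (coeff_module R G M) = (\<lambda>g m. cgr_elt R G g \<odot>\<^bsub>M\<^esub> m)"
  by (simp_all add: coeff_module_def)

lemma coeff_module_top_gmodule:
  assumes G: "profinite_group G" and R: "cring R" "topspace (ring_top R) = carrier R"
    and M: "compact_module (completed_group_ring R G) M"
  shows "top_gmodule R G (coeff_module R G M)"
proof -
  interpret C: cgr_base G R by (rule profinite_cgr_base[OF G R(1)])
  note GD = profinite_groupD[OF G] and MD = compact_moduleD[OF M]
  interpret M: abelian_group M by (rule MD(1))
  let ?T = "coeff_module R G M"
  note T_simps = coeff_module_simps[of R G M] C.const_eq C.elt_eq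
  have T_group: "abelian_group ?T"
    by (rule abelian_groupI)
      (use M.a_assoc M.a_comm M.a_closed M.l_zero M.zero_closed in \<open>auto simp: T_simps intro: M.add.l_inv_ex\<close>)
  have T_module: "module R ?T"
    by (rule moduleI[OF R(1) T_group])
      (simp_all add: T_simps C.single_closed MD(3-5,7) MD(6)[symmetric] C.single_add C.single_mult
        C.CG_one[symmetric])
  have uminus: "\<ominus>\<^bsub>?T\<^esub> t = \<ominus>\<^bsub>M\<^esub> t" if "t \<in> carrier M" for t
    using abelian_group.minus_equality[OF T_group, of "\<ominus>\<^bsub>M\<^esub> t" t] that by (simp add: T_simps M.l_neg)
  have cont_act: "continuous_map (prod_topology (grp_top G) (mod_top M)) (mod_top M)
      (\<lambda>x. cgr_elt R G (fst x) \<odot>\<^bsub>M\<^esub> snd x)"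
    by (intro continuous_map_compose2[OF _ _ MD(10)] continuous_map_snd
        continuous_map_compose[OF continuous_map_fst C.continuous_cgr_elt, unfolded o_def]
        R(2) GD(2) profinite_translation[OF G])
  have cont_smult: "continuous_map (prod_topology (ring_top R) (mod_top M)) (mod_top M)
      (\<lambda>x. cgr_const R G (fst x) \<odot>\<^bsub>M\<^esub> snd x)"
    by (intro continuous_map_compose2[OF _ _ MD(10)] continuous_map_snd
        continuous_map_compose[OF continuous_map_fst C.continuous_cgr_const, unfolded o_def] R(2))
  show ?thesis
  proof (intro top_gmodule.intro top_gmodule_axioms.intro T_module GD(1))
    show "continuous_map (mod_top ?T) (mod_top ?T) (\<lambda>t. \<ominus>\<^bsub>?T\<^esub> t)"
      using MD(9) by (simp add: T_simps(5)) (rule continuous_map_eq, auto simp: uminus MD(2))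
  qed (use cont_act cont_smult GD(2,4) R(2) MD(2,8) in \<open>simp_all add: T_simps(1-3,5) case_prod_beta'\<close>,
      simp_all add: T_simps C.single_closed MD(3,5,7) MD(6)[symmetric] C.single_mult C.CG_one[symmetric])
qed

section \<open>Continuous cohomology\<close>

subsection \<open>Cochains, cocycles and coboundaries\<close>

abbreviation pairs :: "('g, 'x) topgroup_scheme \<Rightarrow> ('g \<times> 'g) set" where
  "pairs G \<equiv> carrier G \<times> carrier G"

lemma fun_module_simps:
  "carrier (fun_module M S F) = F" "zero (fun_module M S F) = (\<lambda>s\<in>S. \<zero>\<^bsub>M\<^esub>)"
  "add (fun_module M S F) = (\<lambda>f f'. \<lambda>s\<in>S. f s \<oplus>\<^bsub>M\<^esub> f' s)"
  "smult (fun_module M S F) = (\<lambda>r f. \<lambda>s\<in>S. r \<odot>\<^bsub>M\<^esub> f s)"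
  by (simp_all add: fun_module_def)

lemma fun_module_is_module:
  assumes M: "module R M"
    and F: "\<And>f. f \<in> F \<Longrightarrow> f \<in> extensional S" "\<And>f s. f \<in> F \<Longrightarrow> s \<in> S \<Longrightarrow> f s \<in> carrier M"
    and zero: "(\<lambda>s\<in>S. \<zero>\<^bsub>M\<^esub>) \<in> F"
    and add: "\<And>f f'. f \<in> F \<Longrightarrow> f' \<in> F \<Longrightarrow> (\<lambda>s\<in>S. f s \<oplus>\<^bsub>M\<^esub> f' s) \<in> F"
    and smult: "\<And>r f. r \<in> carrier R \<Longrightarrow> f \<in> F \<Longrightarrow> (\<lambda>s\<in>S. r \<odot>\<^bsub>M\<^esub> f s) \<in> F"
  shows "module R (fun_module M S F)"
proof (rule module_of_separating_maps[where I = S and P = "\<lambda>_. M" and \<phi> = "\<lambda>s f. f s"])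
  fix f f' assume "f \<in> carrier (fun_module M S F)" "f' \<in> carrier (fun_module M S F)"
    and eq: "\<And>s. s \<in> S \<Longrightarrow> f s = f' s"
  then show "f = f'"
    using F(1) by (intro extensionalityI[OF _ _ eq]) (auto simp: fun_module_simps)
qed (auto simp: fun_module_simps module.axioms(1)[OF M] intro!: M zero add smult module_homI intro: F(2))

lemma (in abelian_group) coboundary_identity:
  assumes "a \<in> carrier G" "x \<in> carrier G" "y \<in> carrier G" "z \<in> carrier G" "w \<in> carrier G" "v \<in> carrier G"
  shows "((a \<ominus> x) \<oplus> y) \<oplus> ((x \<ominus> z) \<oplus> v) = ((a \<ominus> z) \<oplus> w) \<oplus> ((y \<ominus> w) \<oplus> v)"
proof -
  have "((a \<ominus> x) \<oplus> y) \<oplus> ((x \<ominus> z) \<oplus> v) = (a \<oplus> y) \<oplus> ((\<ominus> x \<oplus> x) \<oplus> (\<ominus> z \<oplus> v))"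
    using assms by (simp add: a_minus_def a_ac)
  also have "\<dots> = (a \<oplus> y) \<oplus> ((\<ominus> w \<oplus> w) \<oplus> (\<ominus> z \<oplus> v))"
    using assms by (simp add: l_neg)
  also have "\<dots> = ((a \<ominus> z) \<oplus> w) \<oplus> ((y \<ominus> w) \<oplus> v)"
    using assms by (simp add: a_minus_def a_ac)
  finally show ?thesis .
qed

context top_gmodule
begin

lemma topspace_pairs: "topspace (prod_topology (grp_top G) (grp_top G)) = pairs G"
  by (simp add: top_G)

lemma C1_continuous: "f \<in> C1 G T \<Longrightarrow> continuous_map (grp_top G) (mod_top T) f"
  by (simp add: C1_def)

lemma C1_I: "continuous_map (grp_top G) (mod_top T) f \<Longrightarrow> (\<lambda>g\<in>carrier G. f g) \<in> C1 G T"
  unfolding C1_def by (auto intro: continuous_map_eq simp: top_G)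

lemma C1_eval_closed: "f \<in> C1 G T \<Longrightarrow> g \<in> carrier G \<Longrightarrow> f g \<in> carrier T"
  using continuous_closed[OF C1_continuous] top_G by simp

lemma Z1_C1: "f \<in> Z1 G T \<Longrightarrow> f \<in> C1 G T"
  by (simp add: Z1_def)

lemma Z2_I:
  assumes "continuous_map (prod_topology (grp_top G) (grp_top G)) (mod_top T) c"
    and "\<And>g h k. g \<in> carrier G \<Longrightarrow> h \<in> carrier G \<Longrightarrow> k \<in> carrier G \<Longrightarrow>
      act T g (c (h, k)) \<oplus> c (g, h \<otimes>\<^bsub>G\<^esub> k) = c (g \<otimes>\<^bsub>G\<^esub> h, k) \<oplus> c (g, h)"
  shows "(\<lambda>s\<in>pairs G. c s) \<in> Z2 G T"
proof -
  have "continuous_map (prod_topology (grp_top G) (grp_top G)) (mod_top T) (\<lambda>s\<in>pairs G. c s)"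
    by (rule continuous_map_eq[OF assms(1)]) (simp add: top_G)
  then show ?thesis
    unfolding Z2_def C2_def using assms(2) by simp
qed

lemma Z2_D:
  assumes "c \<in> Z2 G T"
  shows "continuous_map (prod_topology (grp_top G) (grp_top G)) (mod_top T) c"
    and "c \<in> extensional (pairs G)"
    and "g \<in> carrier G \<Longrightarrow> h \<in> carrier G \<Longrightarrow> k \<in> carrier G \<Longrightarrow>
      act T g (c (h, k)) \<oplus> c (g, h \<otimes>\<^bsub>G\<^esub> k) = c (g \<otimes>\<^bsub>G\<^esub> h, k) \<oplus> c (g, h)"
  using assms by (auto simp: Z2_def C2_def)

lemma Z2_eval_closed: "c \<in> Z2 G T \<Longrightarrow> s \<in> pairs G \<Longrightarrow> c s \<in> carrier T"
  using continuous_closed[OF Z2_D(1)] topspace_pairs by simp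

lemma Z2_ext:
  assumes "c \<in> Z2 G T" "d \<in> Z2 G T"
    and "\<And>g h. g \<in> carrier G \<Longrightarrow> h \<in> carrier G \<Longrightarrow> c (g, h) = d (g, h)"
  shows "c = d"
  by (rule extensionalityI[OF Z2_D(2)[OF assms(1)] Z2_D(2)[OF assms(2)]]) (use assms(3) in auto)

lemma Z2_zero: "(\<lambda>s\<in>pairs G. \<zero>) \<in> Z2 G T"
  by (rule Z2_I) (auto simp: act_zero top_T)

lemma Z2_add:
  assumes c: "c \<in> Z2 G T" and d: "d \<in> Z2 G T"
  shows "(\<lambda>s\<in>pairs G. c s \<oplus> d s) \<in> Z2 G T"
proof (rule Z2_I)
  show "continuous_map (prod_topology (grp_top G) (grp_top G)) (mod_top T) (\<lambda>s. c s \<oplus> d s)"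
    by (intro continuous_add Z2_D(1) c d)
  fix g h k assume ghk: "g \<in> carrier G" "h \<in> carrier G" "k \<in> carrier G"
  note closed = Z2_eval_closed[OF c] Z2_eval_closed[OF d] act_closed
  have "act T g (c (h, k) \<oplus> d (h, k)) \<oplus> (c (g, h \<otimes>\<^bsub>G\<^esub> k) \<oplus> d (g, h \<otimes>\<^bsub>G\<^esub> k)) =
      (act T g (c (h, k)) \<oplus> c (g, h \<otimes>\<^bsub>G\<^esub> k)) \<oplus> (act T g (d (h, k)) \<oplus> d (g, h \<otimes>\<^bsub>G\<^esub> k))"
    using ghk closed by (simp add: act_add M.a_ac)
  also have "\<dots> = (c (g \<otimes>\<^bsub>G\<^esub> h, k) \<oplus> c (g, h)) \<oplus> (d (g \<otimes>\<^bsub>G\<^esub> h, k) \<oplus> d (g, h))"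
    using Z2_D(3)[OF c ghk] Z2_D(3)[OF d ghk] by simp
  also have "\<dots> = (c (g \<otimes>\<^bsub>G\<^esub> h, k) \<oplus> d (g \<otimes>\<^bsub>G\<^esub> h, k)) \<oplus> (c (g, h) \<oplus> d (g, h))"
    using ghk closed by (simp add: M.a_ac)
  finally show "act T g (c (h, k) \<oplus> d (h, k)) \<oplus> (c (g, h \<otimes>\<^bsub>G\<^esub> k) \<oplus> d (g, h \<otimes>\<^bsub>G\<^esub> k)) =
      (c (g \<otimes>\<^bsub>G\<^esub> h, k) \<oplus> d (g \<otimes>\<^bsub>G\<^esub> h, k)) \<oplus> (c (g, h) \<oplus> d (g, h))" .
qed

lemma Z2_smult:
  assumes r: "r \<in> carrier R" and c: "c \<in> Z2 G T"
  shows "(\<lambda>s\<in>pairs G. r \<odot> c s) \<in> Z2 G T"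
proof (rule Z2_I)
  show "continuous_map (prod_topology (grp_top G) (grp_top G)) (mod_top T) (\<lambda>s. r \<odot> c s)"
    using r by (intro continuous_smult Z2_D(1) c) (simp add: top_R)
  fix g h k assume ghk: "g \<in> carrier G" "h \<in> carrier G" "k \<in> carrier G"
  then show "act T g (r \<odot> c (h, k)) \<oplus> r \<odot> c (g, h \<otimes>\<^bsub>G\<^esub> k) = r \<odot> c (g \<otimes>\<^bsub>G\<^esub> h, k) \<oplus> r \<odot> c (g, h)"
    using Z2_eval_closed[OF c] Z2_D(3)[OF c ghk] r
    by (simp add: act_smult act_closed smult_r_distr[symmetric])
qed

abbreviation "C1_mod \<equiv> fun_module T (carrier G) (C1 G T)"
abbreviation "Z2_mod \<equiv> fun_module T (pairs G) (Z2 G T)"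

lemma C1_module: "module R C1_mod"
proof (rule fun_module_is_module[OF module_axioms])
  fix f f' assume f: "f \<in> C1 G T" and f': "f' \<in> C1 G T"
  show "f \<in> extensional (carrier G)" using f by (simp add: C1_def)
  show "(\<lambda>g\<in>carrier G. f g \<oplus> f' g) \<in> C1 G T"
    by (intro C1_I continuous_add C1_continuous f f')
next
  fix r f assume "r \<in> carrier R" and f: "f \<in> C1 G T"
  then show "(\<lambda>g\<in>carrier G. r \<odot> f g) \<in> C1 G T"
    by (intro C1_I continuous_smult C1_continuous f) (simp add: top_R)
qed (auto intro: C1_I C1_eval_closed simp: top_T)

lemma Z2_module: "module R Z2_mod"
  by (rule fun_module_is_module[OF module_axioms])
    (auto intro: Z2_D(2) Z2_eval_closed Z2_zero Z2_add Z2_smult)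

lemma coboundary1_eval: "g \<in> carrier G \<Longrightarrow> h \<in> carrier G \<Longrightarrow>
    coboundary1 G T f (g, h) = (act T g (f h) \<ominus> f (g \<otimes>\<^bsub>G\<^esub> h)) \<oplus> f g"
  by (simp add: coboundary1_def)

lemma coboundary1_cocycle:
  assumes f: "\<And>g. g \<in> carrier G \<Longrightarrow> f g \<in> carrier T"
    and ghk: "g \<in> carrier G" "h \<in> carrier G" "k \<in> carrier G"
  shows "act T g (coboundary1 G T f (h, k)) \<oplus> coboundary1 G T f (g, h \<otimes>\<^bsub>G\<^esub> k) =
    coboundary1 G T f (g \<otimes>\<^bsub>G\<^esub> h, k) \<oplus> coboundary1 G T f (g, h)"
proof -
  have "act T g (coboundary1 G T f (h, k)) =
      (act T (g \<otimes>\<^bsub>G\<^esub> h) (f k) \<ominus> act T g (f (h \<otimes>\<^bsub>G\<^esub> k))) \<oplus> act T g (f h)"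
    using ghk f by (simp add: coboundary1_eval act_add act_minus act_closed act_mult)
  then show ?thesis
    using ghk f act_closed M.coboundary_identity[of "act T (g \<otimes>\<^bsub>G\<^esub> h) (f k)" "act T g (f (h \<otimes>\<^bsub>G\<^esub> k))"
        "act T g (f h)" "f (g \<otimes>\<^bsub>G\<^esub> h \<otimes>\<^bsub>G\<^esub> k)" "f (g \<otimes>\<^bsub>G\<^esub> h)" "f g"]
    by (simp add: coboundary1_eval G.m_assoc)
qed

lemma coboundary1_Z2:
  assumes f: "f \<in> C1 G T"
  shows "coboundary1 G T f \<in> Z2 G T"
proof -
  let ?D = "\<lambda>s. (act T (fst s) (f (snd s)) \<ominus> f (fst s \<otimes>\<^bsub>G\<^esub> snd s)) \<oplus> f (fst s)"
  have eq: "coboundary1 G T f = (\<lambda>s\<in>pairs G. ?D s)"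
    unfolding coboundary1_def by (rule restrict_ext) (simp add: case_prod_beta)
  note f_comp = continuous_map_compose[OF _ C1_continuous[OF f], unfolded o_def]
  have "continuous_map (prod_topology (grp_top G) (grp_top G)) (mod_top T) ?D"
    by (intro continuous_add continuous_minus continuous_act f_comp continuous_mult
        continuous_map_fst continuous_map_snd)
  then show ?thesis
    unfolding eq
    by (rule Z2_I) (use coboundary1_cocycle[OF C1_eval_closed[OF f]] in \<open>simp add: coboundary1_eval\<close>)
qed

lemma coboundary1_hom: "coboundary1 G T \<in> module_hom R C1_mod Z2_mod"
proof (rule module_homI; unfold fun_module_simps)
  fix f f' assume f: "f \<in> C1 G T" and f': "f' \<in> C1 G T"
  have "(act T g (f h \<oplus> f' h) \<ominus> (f (g \<otimes>\<^bsub>G\<^esub> h) \<oplus> f' (g \<otimes>\<^bsub>G\<^esub> h))) \<oplus> (f g \<oplus> f' g) =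
      ((act T g (f h) \<ominus> f (g \<otimes>\<^bsub>G\<^esub> h)) \<oplus> f g) \<oplus> ((act T g (f' h) \<ominus> f' (g \<otimes>\<^bsub>G\<^esub> h)) \<oplus> f' g)"
    if "g \<in> carrier G" "h \<in> carrier G" for g h
    using that C1_eval_closed[OF f] C1_eval_closed[OF f'] act_closed
    by (simp add: a_minus_def act_add M.minus_add M.a_ac)
  then show "coboundary1 G T (\<lambda>g\<in>carrier G. f g \<oplus> f' g) =
      (\<lambda>s\<in>pairs G. coboundary1 G T f s \<oplus> coboundary1 G T f' s)"
    unfolding coboundary1_def by (intro restrict_ext) auto
next
  fix r f assume r: "r \<in> carrier R" and f: "f \<in> C1 G T"
  have "(act T g (r \<odot> f h) \<ominus> r \<odot> f (g \<otimes>\<^bsub>G\<^esub> h)) \<oplus> r \<odot> f g =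
      r \<odot> ((act T g (f h) \<ominus> f (g \<otimes>\<^bsub>G\<^esub> h)) \<oplus> f g)" if "g \<in> carrier G" "h \<in> carrier G" for g h
    using that C1_eval_closed[OF f] act_closed r
    by (simp add: a_minus_def act_smult smult_r_distr smult_r_minus)
  then show "coboundary1 G T (\<lambda>g\<in>carrier G. r \<odot> f g) = (\<lambda>s\<in>pairs G. r \<odot> coboundary1 G T f s)"
    unfolding coboundary1_def by (intro restrict_ext) auto
qed (rule coboundary1_Z2)

lemma coboundary1_add:
  assumes "f \<in> C1 G T" "f' \<in> C1 G T" "\<And>g. g \<in> carrier G \<Longrightarrow> b g = f g \<oplus> f' g"
    and "g \<in> carrier G" "h \<in> carrier G"
  shows "coboundary1 G T b (g, h) = coboundary1 G T f (g, h) \<oplus> coboundary1 G T f' (g, h)"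
proof -
  have "coboundary1 G T b (g, h) = coboundary1 G T (\<lambda>g\<in>carrier G. f g \<oplus> f' g) (g, h)"
    using assms(3-5) by (simp add: coboundary1_eval)
  then show ?thesis
    using module_homD(2)[OF coboundary1_hom, of f f'] assms by (simp add: fun_module_simps)
qed

lemma coboundary0_C1: "t \<in> carrier T \<Longrightarrow> coboundary0 G T t \<in> C1 G T"
  unfolding coboundary0_def
  by (intro C1_I continuous_minus continuous_act continuous_const) simp_all

lemma coboundary1_coboundary0:
  assumes "t \<in> carrier T" "g \<in> carrier G" "h \<in> carrier G"
  shows "coboundary1 G T (coboundary0 G T t) (g, h) = \<zero>"
proof -
  let ?x = "act T g (act T h t)" and ?y = "act T g t"
  have closed: "?x \<in> carrier T" "?y \<in> carrier T" using assms act_closed by auto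
  have "coboundary1 G T (coboundary0 G T t) (g, h) = (?x \<ominus> ?y \<ominus> (?x \<ominus> t)) \<oplus> (?y \<ominus> t)"
    using assms by (simp add: coboundary1_eval coboundary0_def act_mult act_minus act_closed)
  also have "\<dots> = (?x \<oplus> \<ominus> ?x) \<oplus> ((?y \<oplus> \<ominus> ?y) \<oplus> (t \<oplus> \<ominus> t))"
    using closed assms(1) by (simp add: a_minus_def M.minus_add M.a_ac)
  also have "\<dots> = \<zero>" using closed assms(1) by (simp add: M.r_neg)
  finally show ?thesis .
qed

lemma coboundary1_Z1:
  assumes f: "f \<in> Z1 G T" and gh: "g \<in> carrier G" "h \<in> carrier G"
  shows "coboundary1 G T f (g, h) = \<zero>"
proof -
  have closed: "f g \<in> carrier T" "act T g (f h) \<in> carrier T"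
    using C1_eval_closed[OF Z1_C1[OF f]] act_closed gh by auto
  have "f (g \<otimes>\<^bsub>G\<^esub> h) = f g \<oplus> act T g (f h)"
    using f gh by (simp add: Z1_def)
  then have "coboundary1 G T f (g, h) = (act T g (f h) \<oplus> \<ominus> act T g (f h)) \<oplus> (f g \<oplus> \<ominus> f g)"
    using gh closed by (simp add: coboundary1_eval a_minus_def M.minus_add M.a_ac)
  then show ?thesis using closed by (simp add: M.r_neg)
qed

lemma class1_self:
  assumes f: "f \<in> Z1 G T"
  shows "f \<in> class1 G T f"
proof -
  have "f = (\<lambda>g\<in>carrier G. coboundary0 G T \<zero> g \<oplus> f g)"
  proof (rule extensionalityI[of _ "carrier G"])
    show "f \<in> extensional (carrier G)" using Z1_C1[OF f] by (simp add: C1_def)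
  qed (use C1_eval_closed[OF Z1_C1[OF f]] in \<open>auto simp: coboundary0_def act_zero a_minus_def M.r_neg\<close>)
  then show ?thesis
    unfolding class1_def B1_def a_r_coset_def' fun_module_def using M.zero_closed by auto
qed

lemma class1_E:
  assumes "u \<in> class1 G T f"
  obtains t where "t \<in> carrier T" "\<And>g. g \<in> carrier G \<Longrightarrow> u g = coboundary0 G T t g \<oplus> f g"
  using assms unfolding class1_def B1_def a_r_coset_def' fun_module_def by auto

subsection \<open>The second cohomology module\<close>

lemma B2_submodule: "submodule (B2 G T) R Z2_mod"
  using module_hom_image_submodule[OF C1_module Z2_module coboundary1_hom]
  by (simp add: B2_def fun_module_simps)

lemma H2_module: "module R (H2 G T)"
  unfolding H2_def by (rule module.quot_module_is_module[OF Z2_module B2_submodule])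

lemma H2_carrier: "carrier (H2 G T) = class2 G T ` Z2 G T"
  unfolding H2_def quot_module_simps fun_module_simps(1) class2_def ..

lemma class2_closed: "c \<in> Z2 G T \<Longrightarrow> class2 G T c \<in> carrier (H2 G T)"
  by (simp add: H2_carrier)

lemma H2_add: "c \<in> Z2 G T \<Longrightarrow> d \<in> Z2 G T \<Longrightarrow>
    class2 G T c \<oplus>\<^bsub>H2 G T\<^esub> class2 G T d = class2 G T (\<lambda>s\<in>pairs G. c s \<oplus> d s)"
  using module.quot_module_add[OF Z2_module B2_submodule, of c d]
  unfolding H2_def class2_def by (simp add: fun_module_simps)

lemma H2_smult: "r \<in> carrier R \<Longrightarrow> c \<in> Z2 G T \<Longrightarrow>
    r \<odot>\<^bsub>H2 G T\<^esub> class2 G T c = class2 G T (\<lambda>s\<in>pairs G. r \<odot> c s)"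
  using module.quot_module_smult[OF Z2_module B2_submodule, of r c]
  unfolding H2_def class2_def by (simp add: fun_module_simps)

lemma class2_eqI:
  assumes c: "c \<in> Z2 G T" and d: "d \<in> Z2 G T" and f: "f \<in> C1 G T"
    and eq: "\<And>g h. g \<in> carrier G \<Longrightarrow> h \<in> carrier G \<Longrightarrow>
      c (g, h) = coboundary1 G T f (g, h) \<oplus> d (g, h)"
  shows "class2 G T c = class2 G T d"
proof -
  interpret Z: module R Z2_mod by (rule Z2_module)
  let ?b = "coboundary1 G T f"
  have b: "?b \<in> carrier Z2_mod" and cd: "c \<in> carrier Z2_mod" "d \<in> carrier Z2_mod"
    using coboundary1_Z2[OF f] c d by (simp_all add: fun_module_simps)
  have "c = ?b \<oplus>\<^bsub>Z2_mod\<^esub> d"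
    unfolding fun_module_simps
    by (rule Z2_ext[OF c Z2_add[OF coboundary1_Z2[OF f] d]]) (simp add: eq)
  then have "c \<ominus>\<^bsub>Z2_mod\<^esub> d = ?b"
    using b cd by (simp add: a_minus_def Z.M.a_assoc Z.M.r_neg)
  then show ?thesis
    unfolding class2_def using f
    by (subst Z.M.coset_eq_iff[OF submodule.axioms(1)[OF B2_submodule] cd]) (auto simp: B2_def)
qed

lemma class2_memE:
  assumes "d \<in> class2 G T c"
  obtains f where "f \<in> C1 G T" "\<And>s. s \<in> pairs G \<Longrightarrow> d s = coboundary1 G T f s \<oplus> c s"
    "d \<in> extensional (pairs G)"
proof -
  obtain f where f: "f \<in> C1 G T" "d = (\<lambda>s\<in>pairs G. coboundary1 G T f s \<oplus> c s)"
    using assms unfolding class2_def a_r_coset_def' B2_def fun_module_simps by blast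
  show thesis
    by (rule that[OF f(1)]) (auto simp: f(2))
qed

lemma class2_mem:
  assumes c: "c \<in> Z2 G T" and "d \<in> class2 G T c"
  shows "d \<in> Z2 G T" "class2 G T d = class2 G T c"
proof -
  obtain f where f: "f \<in> C1 G T" "\<And>s. s \<in> pairs G \<Longrightarrow> d s = coboundary1 G T f s \<oplus> c s"
    "d \<in> extensional (pairs G)"
    using class2_memE[OF assms(2)] by blast
  have "d = (\<lambda>s\<in>pairs G. coboundary1 G T f s \<oplus> c s)"
    by (rule extensionalityI[OF f(3)]) (use f(2) in auto)
  then show d: "d \<in> Z2 G T"
    using Z2_add[OF coboundary1_Z2[OF f(1)] c] by simp
  show "class2 G T d = class2 G T c"
    by (rule class2_eqI[OF d c f(1)]) (simp add: f(2))
qed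

lemma class2_self:
  assumes c: "c \<in> Z2 G T"
  shows "c \<in> class2 G T c"
proof -
  interpret Z: module R Z2_mod by (rule Z2_module)
  have "c \<in> carrier Z2_mod" using c by (simp add: fun_module_simps)
  then show ?thesis
    unfolding class2_def
    by (rule abelian_subgroup.a_rcos_self[OF
          Z.M.abelian_subgroup_of_subgroup[OF submodule.axioms(1)[OF B2_submodule]]])
qed

end

subsection \<open>Functoriality and the connecting map\<close>

locale gmodule_hom = M: top_gmodule R G M + P: top_gmodule R G P
  for R :: "('r, 'x) topring_scheme" and G :: "('g, 'y) topgroup_scheme"
    and M :: "('r, 'm, 'g, 'z) gmodule_scheme" and P :: "('r, 'k, 'g, 'w) gmodule_scheme" +
  fixes \<phi> :: "'m \<Rightarrow> 'k"
  assumes hom: "\<phi> \<in> module_hom R M P"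
    and equivariant: "g \<in> carrier G \<Longrightarrow> m \<in> carrier M \<Longrightarrow> \<phi> (act M g m) = act P g (\<phi> m)"
    and continuous: "continuous_map (mod_top M) (mod_top P) \<phi>"
begin

lemmas map_closed = module_homD(1)[OF hom]
lemmas map_add = module_homD(2)[OF hom]
lemmas map_smult = module_homD(3)[OF hom]
lemmas map_minus = module_hom_minus[OF M.module_axioms P.module_axioms hom]
lemmas continuous_comp = continuous_map_compose[OF _ continuous, unfolded o_def]

lemma map_C1: "f \<in> C1 G M \<Longrightarrow> (\<lambda>g\<in>carrier G. \<phi> (f g)) \<in> C1 G P"
  by (intro P.C1_I continuous_comp M.C1_continuous)

lemma map_coboundary1:
  assumes "\<And>g. g \<in> carrier G \<Longrightarrow> f g \<in> carrier M" "g \<in> carrier G" "h \<in> carrier G"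
  shows "\<phi> (coboundary1 G M f (g, h)) = coboundary1 G P (\<lambda>g\<in>carrier G. \<phi> (f g)) (g, h)"
  using assms
  by (simp add: M.coboundary1_eval P.coboundary1_eval map_add map_minus M.act_closed equivariant)

lemma map_Z2:
  assumes c: "c \<in> Z2 G M"
  shows "(\<lambda>s\<in>pairs G. \<phi> (c s)) \<in> Z2 G P"
proof (rule P.Z2_I[OF continuous_comp[OF M.Z2_D(1)[OF c]]])
  fix g h k assume ghk: "g \<in> carrier G" "h \<in> carrier G" "k \<in> carrier G"
  then show "act P g (\<phi> (c (h, k))) \<oplus>\<^bsub>P\<^esub> \<phi> (c (g, h \<otimes>\<^bsub>G\<^esub> k)) = \<phi> (c (g \<otimes>\<^bsub>G\<^esub> h, k)) \<oplus>\<^bsub>P\<^esub> \<phi> (c (g, h))"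
    using M.Z2_D(3)[OF c ghk] M.Z2_eval_closed[OF c]
    by (simp add: equivariant[symmetric] map_add[symmetric] M.act_closed)
qed

lemma class2_map_cong:
  assumes c: "c \<in> Z2 G M" and d: "d \<in> class2 G M c"
  shows "class2 G P (\<lambda>s\<in>pairs G. \<phi> (d s)) = class2 G P (\<lambda>s\<in>pairs G. \<phi> (c s))"
proof -
  obtain f where f: "f \<in> C1 G M" "\<And>s. s \<in> pairs G \<Longrightarrow> d s = coboundary1 G M f s \<oplus>\<^bsub>M\<^esub> c s"
    using M.class2_memE[OF d] by blast
  show ?thesis
  proof (rule P.class2_eqI[OF map_Z2[OF M.class2_mem(1)[OF c d]] map_Z2[OF c] map_C1[OF f(1)]])
    fix g h assume gh: "g \<in> carrier G" "h \<in> carrier G"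
    then show "(\<lambda>s\<in>pairs G. \<phi> (d s)) (g, h) =
        coboundary1 G P (\<lambda>g\<in>carrier G. \<phi> (f g)) (g, h) \<oplus>\<^bsub>P\<^esub> (\<lambda>s\<in>pairs G. \<phi> (c s)) (g, h)"
      using f M.Z2_eval_closed[OF c] M.Z2_eval_closed[OF M.coboundary1_Z2[OF f(1)]]
        map_coboundary1[OF M.C1_eval_closed[OF f(1)] gh]
      by (simp add: map_add)
  qed
qed

lemma H2_map_class2:
  assumes c: "c \<in> Z2 G M"
  shows "H2_map G P \<phi> (class2 G M c) = class2 G P (\<lambda>s\<in>pairs G. \<phi> (c s))"
proof -
  have "(\<lambda>d. class2 G P (\<lambda>s\<in>pairs G. \<phi> (d s))) ` class2 G M c = {class2 G P (\<lambda>s\<in>pairs G. \<phi> (c s))}"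
    using class2_map_cong[OF c] M.class2_self[OF c] by blast
  then show ?thesis unfolding H2_map_def by simp
qed

lemma H2_map_hom: "H2_map G P \<phi> \<in> module_hom R (H2 G M) (H2 G P)"
proof (rule module_homI)
  fix X assume "X \<in> carrier (H2 G M)"
  then obtain c where c: "c \<in> Z2 G M" and X: "X = class2 G M c"
    unfolding M.H2_carrier by blast
  show "H2_map G P \<phi> X \<in> carrier (H2 G P)"
    unfolding X H2_map_class2[OF c] by (rule P.class2_closed[OF map_Z2[OF c]])
next
  fix X Y assume "X \<in> carrier (H2 G M)" "Y \<in> carrier (H2 G M)"
  then obtain c d where c: "c \<in> Z2 G M" and X: "X = class2 G M c"
    and d: "d \<in> Z2 G M" and Y: "Y = class2 G M d"
    unfolding M.H2_carrier by blast
  have "(\<lambda>s\<in>pairs G. \<phi> ((\<lambda>s\<in>pairs G. c s \<oplus>\<^bsub>M\<^esub> d s) s)) =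
      (\<lambda>s\<in>pairs G. (\<lambda>s\<in>pairs G. \<phi> (c s)) s \<oplus>\<^bsub>P\<^esub> (\<lambda>s\<in>pairs G. \<phi> (d s)) s)"
    by (rule restrict_ext) (simp add: map_add M.Z2_eval_closed[OF c] M.Z2_eval_closed[OF d])
  then show "H2_map G P \<phi> (X \<oplus>\<^bsub>H2 G M\<^esub> Y) = H2_map G P \<phi> X \<oplus>\<^bsub>H2 G P\<^esub> H2_map G P \<phi> Y"
    using c d by (simp only: X Y M.H2_add H2_map_class2 M.Z2_add P.H2_add map_Z2)
next
  fix r X assume r: "r \<in> carrier R" and "X \<in> carrier (H2 G M)"
  then obtain c where c: "c \<in> Z2 G M" and X: "X = class2 G M c"
    unfolding M.H2_carrier by blast
  have "(\<lambda>s\<in>pairs G. \<phi> ((\<lambda>s\<in>pairs G. r \<odot>\<^bsub>M\<^esub> c s) s)) =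
      (\<lambda>s\<in>pairs G. r \<odot>\<^bsub>P\<^esub> (\<lambda>s\<in>pairs G. \<phi> (c s)) s)"
    by (rule restrict_ext) (simp add: map_smult M.Z2_eval_closed[OF c] r)
  then show "H2_map G P \<phi> (r \<odot>\<^bsub>H2 G M\<^esub> X) = r \<odot>\<^bsub>H2 G P\<^esub> H2_map G P \<phi> X"
    using r c by (simp only: X M.H2_smult H2_map_class2 M.Z2_smult P.H2_smult map_Z2)
qed

end

lemma H2_map_left_inverse:
  assumes "gmodule_hom R G M P \<phi>" "gmodule_hom R G P M \<psi>" "\<And>m. m \<in> carrier M \<Longrightarrow> \<psi> (\<phi> m) = m"
    and "X \<in> carrier (H2 G M)"
  shows "H2_map G M \<psi> (H2_map G P \<phi> X) = X"
proof -
  interpret \<phi>: gmodule_hom R G M P \<phi> by fact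
  interpret \<psi>: gmodule_hom R G P M \<psi> by fact
  obtain c where c: "c \<in> Z2 G M" "X = class2 G M c"
    using assms(4) by (auto simp: \<phi>.M.H2_carrier)
  have "(\<lambda>s\<in>pairs G. \<psi> ((\<lambda>s\<in>pairs G. \<phi> (c s)) s)) = c"
    by (rule extensionalityI[OF _ \<phi>.M.Z2_D(2)[OF c(1)]])
      (auto simp: assms(3) \<phi>.M.Z2_eval_closed[OF c(1)])
  then show ?thesis
    using c by (simp only: \<phi>.H2_map_class2 \<psi>.H2_map_class2 \<phi>.map_Z2)
qed

text \<open>Exactness in the middle is expressed through a continuous retraction \<open>r\<close> of \<open>i\<close>, which need not
  be equivariant.\<close>

locale gmodule_exact_sequence = I: gmodule_hom R G M' M i + J: gmodule_hom R G M M'' j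
  for R :: "('r, 'x) topring_scheme" and G :: "('g, 'y) topgroup_scheme"
    and M' :: "('r, 'l, 'g, 'u) gmodule_scheme" and M :: "('r, 'm, 'g, 'z) gmodule_scheme"
    and M'' :: "('r, 'k, 'g, 'w) gmodule_scheme" and i j +
  fixes r :: "'m \<Rightarrow> 'l"
  assumes retraction: "y \<in> carrier M' \<Longrightarrow> r (i y) = y"
    and retraction_continuous: "continuous_map (mod_top M) (mod_top M') r"
    and exact: "m \<in> carrier M \<Longrightarrow> j m = \<zero>\<^bsub>M''\<^esub> \<Longrightarrow> i (r m) = m"
    and surjective: "z \<in> carrier M'' \<Longrightarrow> \<exists>m\<in>carrier M. j m = z"
begin

lemmas retraction_comp = continuous_map_compose[OF _ retraction_continuous, unfolded o_def]

lemma i_inj: "y \<in> carrier M' \<Longrightarrow> y' \<in> carrier M' \<Longrightarrow> i y = i y' \<Longrightarrow> y = y'"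
  using retraction by metis

lemma coboundary1_lift:
  assumes b: "b \<in> C1 G M" and jb: "(\<lambda>g\<in>carrier G. j (b g)) \<in> Z1 G M''"
  shows coboundary1_lift_Z2: "(\<lambda>s\<in>pairs G. r (coboundary1 G M b s)) \<in> Z2 G M'"
    and coboundary1_lift_eq: "\<And>s. s \<in> pairs G \<Longrightarrow> i (r (coboundary1 G M b s)) = coboundary1 G M b s"
proof -
  let ?db = "coboundary1 G M b"
  note db = I.P.Z2_eval_closed[OF I.P.coboundary1_Z2[OF b]]
  show i_r: "i (r (?db s)) = ?db s" if "s \<in> pairs G" for s
  proof (rule exact[OF db[OF that]])
    show "j (?db s) = \<zero>\<^bsub>M''\<^esub>"
      using that J.map_coboundary1[OF I.P.C1_eval_closed[OF b]] J.P.coboundary1_Z1[OF jb] by auto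
  qed
  have cont: "continuous_map (prod_topology (grp_top G) (grp_top G)) (mod_top M') (\<lambda>s. r (?db s))"
    by (rule retraction_comp[OF I.P.Z2_D(1)[OF I.P.coboundary1_Z2[OF b]]])
  then have r_closed: "r (?db s) \<in> carrier M'" if "s \<in> pairs G" for s
    using I.M.continuous_closed[OF cont] that I.M.topspace_pairs by blast
  show "(\<lambda>s\<in>pairs G. r (?db s)) \<in> Z2 G M'"
  proof (rule I.M.Z2_I[OF cont], rule i_inj)
    fix g h k assume ghk: "g \<in> carrier G" "h \<in> carrier G" "k \<in> carrier G"
    then show "i (act M' g (r (?db (h, k))) \<oplus>\<^bsub>M'\<^esub> r (?db (g, h \<otimes>\<^bsub>G\<^esub> k))) =
        i (r (?db (g \<otimes>\<^bsub>G\<^esub> h, k)) \<oplus>\<^bsub>M'\<^esub> r (?db (g, h)))"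
      using r_closed I.P.coboundary1_cocycle[OF I.P.C1_eval_closed[OF b] ghk]
      by (simp add: I.map_add I.equivariant I.M.act_closed i_r)
  qed (use r_closed I.M.act_closed in auto)
qed

lemma class2_eq_of_lifts:
  assumes a: "a \<in> Z2 G M'" "a' \<in> Z2 G M'" and b: "b \<in> C1 G M" "b' \<in> C1 G M"
    and j_eq: "\<And>g. g \<in> carrier G \<Longrightarrow> j (b' g) = j (b g)"
    and ia: "\<And>s. s \<in> pairs G \<Longrightarrow> i (a s) = coboundary1 G M b s"
      "\<And>s. s \<in> pairs G \<Longrightarrow> i (a' s) = coboundary1 G M b' s"
  shows "class2 G M' a' = class2 G M' a"
proof -
  note closed = I.P.C1_eval_closed[OF b(1)] I.P.C1_eval_closed[OF b(2)]
  define c where "c = (\<lambda>g\<in>carrier G. r (b' g \<ominus>\<^bsub>M\<^esub> b g))"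
  have c: "c \<in> C1 G M'"
    unfolding c_def by (intro I.M.C1_I retraction_comp I.P.continuous_minus I.P.C1_continuous b)
  have i_c: "i (c g) = b' g \<ominus>\<^bsub>M\<^esub> b g" if "g \<in> carrier G" for g
    using that closed J.map_closed j_eq
    by (simp add: c_def exact J.map_minus J.P.M.minus_eq_zero_iff)
  show ?thesis
  proof (rule I.M.class2_eqI[OF a(2,1) c], rule i_inj)
    fix g h assume gh: "g \<in> carrier G" "h \<in> carrier G"
    have "i (coboundary1 G M' c (g, h)) = coboundary1 G M (\<lambda>g\<in>carrier G. i (c g)) (g, h)"
      by (rule I.map_coboundary1[OF I.M.C1_eval_closed[OF c] gh])
    moreover have "coboundary1 G M b' (g, h) =
        coboundary1 G M (\<lambda>g\<in>carrier G. i (c g)) (g, h) \<oplus>\<^bsub>M\<^esub> coboundary1 G M b (g, h)"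
      by (rule I.P.coboundary1_add[OF I.map_C1[OF c] b(1) _ gh])
        (use closed in \<open>simp add: i_c I.P.M.minus_add_cancel\<close>)
    ultimately show "i (a' (g, h)) = i (coboundary1 G M' c (g, h) \<oplus>\<^bsub>M'\<^esub> a (g, h))"
      using ia gh I.M.Z2_eval_closed[OF a(1)] I.M.Z2_eval_closed[OF I.M.coboundary1_Z2[OF c]]
      by (simp add: I.map_add)
  qed (use a I.M.Z2_eval_closed I.M.coboundary1_Z2[OF c] in auto)
qed

lemma class2_unique:
  assumes a: "a \<in> Z2 G M'" "a' \<in> Z2 G M'" and b: "b \<in> C1 G M" "b' \<in> C1 G M"
    and jb: "(\<lambda>g\<in>carrier G. j (b g)) = f" "(\<lambda>g\<in>carrier G. j (b' g)) \<in> class1 G M'' f"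
    and ia: "\<And>s. s \<in> pairs G \<Longrightarrow> i (a s) = coboundary1 G M b s"
      "\<And>s. s \<in> pairs G \<Longrightarrow> i (a' s) = coboundary1 G M b' s"
  shows "class2 G M' a' = class2 G M' a"
proof -
  obtain t where t: "t \<in> carrier M''"
    "\<And>g. g \<in> carrier G \<Longrightarrow> (\<lambda>g\<in>carrier G. j (b' g)) g = coboundary0 G M'' t g \<oplus>\<^bsub>M''\<^esub> f g"
    using J.P.class1_E[OF jb(2)] by blast
  obtain m where m: "m \<in> carrier M" "j m = t"
    using surjective[OF t(1)] by blast
  let ?dm = "coboundary0 G M m" and ?b = "\<lambda>g\<in>carrier G. coboundary0 G M m g \<oplus>\<^bsub>M\<^esub> b g"
  note dm = I.P.coboundary0_C1[OF m(1)]
  have C1: "?b \<in> C1 G M"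
    by (intro I.P.C1_I I.P.continuous_add I.P.C1_continuous b dm)
  show ?thesis
  proof (rule class2_eq_of_lifts[OF a C1 b(2)])
    fix g assume g: "g \<in> carrier G"
    then show "j (b' g) = j (?b g)"
      using t(2)[OF g] jb(1)[symmetric] I.P.C1_eval_closed[OF b(1)] m
      by (simp add: J.map_minus J.map_add coboundary0_def J.equivariant I.P.act_closed)
  next
    fix s assume s: "s \<in> pairs G"
    then obtain g h where gh: "s = (g, h)" "g \<in> carrier G" "h \<in> carrier G" by blast
    have "coboundary1 G M ?b s = coboundary1 G M ?dm s \<oplus>\<^bsub>M\<^esub> coboundary1 G M b s"
      unfolding gh(1) by (rule I.P.coboundary1_add[OF dm b(1) _ gh(2,3)]) simp
    then show "i (a s) = coboundary1 G M ?b s"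
      using s gh ia(1) I.P.coboundary1_coboundary0[OF m(1)] I.P.Z2_eval_closed[OF I.P.coboundary1_Z2[OF b(1)]]
      by simp
  qed (rule ia(2))
qed

lemma connecting_eq:
  assumes b: "b \<in> C1 G M" and jb: "(\<lambda>g\<in>carrier G. j (b g)) = f" and f: "f \<in> Z1 G M''"
  shows "connecting G M' M i j (class1 G M'' f) =
    class2 G M' (\<lambda>s\<in>pairs G. r (coboundary1 G M b s))" (is "_ = class2 G M' ?a")
proof -
  note lift = coboundary1_lift[OF b f[folded jb]]
  let ?S = "{class2 G M' a | a b. a \<in> Z2 G M' \<and> b \<in> C1 G M \<and>
      (\<lambda>g\<in>carrier G. j (b g)) \<in> class1 G M'' f \<and> (\<lambda>s\<in>pairs G. i (a s)) = coboundary1 G M b}"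
  have "(\<lambda>s\<in>pairs G. i (?a s)) = coboundary1 G M b"
    by (rule extensionalityI[OF _ I.P.Z2_D(2)[OF I.P.coboundary1_Z2[OF b]]]) (auto simp: lift(2))
  then have "class2 G M' ?a \<in> ?S"
    using b lift(1) J.P.class1_self[OF f] jb by blast
  moreover have "X = class2 G M' ?a" if X: "X \<in> ?S" for X
  proof -
    obtain a' b' where ab: "X = class2 G M' a'" "a' \<in> Z2 G M'" "b' \<in> C1 G M"
      "(\<lambda>g\<in>carrier G. j (b' g)) \<in> class1 G M'' f" "(\<lambda>s\<in>pairs G. i (a' s)) = coboundary1 G M b'"
      using X by blast
    have "i (a' s) = coboundary1 G M b' s" if "s \<in> pairs G" for s
      using fun_cong[OF ab(5), of s] that by simp
    then show ?thesis
      unfolding ab(1) by (intro class2_unique[OF lift(1) ab(2) b ab(3) jb ab(4)]) (auto simp: lift(2))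
  qed
  ultimately have "?S = {class2 G M' ?a}" by blast
  then show ?thesis unfolding connecting_def by simp
qed

end

section \<open>Tensor products with a based module carrying a group action\<close>

text \<open>In the chosen basis, \<open>G\<close> acts on \<open>N\<close> through lower triangular Toeplitz matrices. The example to
  keep in mind is \<open>N = R[x]/(x^d)\<close> with \<open>g\<close> acting as multiplication by \<open>\<Sum>k. B k g \<cdot> x^k\<close>.\<close>

locale tensor_action = T: top_gmodule R G T + tensor_based R T N d e eps
  for R :: "('r, 'x) topring_scheme" and G :: "('g, 'y) topgroup_scheme"
    and T :: "('r, 'm, 'g, 'z) gmodule_scheme" and N :: "('r, 'n, 'w) module_scheme"
    and d :: nat and e :: "nat \<Rightarrow> 'n" and eps :: "nat \<Rightarrow> 'n \<Rightarrow> 'r" +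
  fixes a :: "'g \<Rightarrow> 'n \<Rightarrow> 'n" and B :: "nat \<Rightarrow> 'g \<Rightarrow> 'r"
  assumes a_closed: "g \<in> carrier G \<Longrightarrow> \<nu> \<in> carrier N \<Longrightarrow> a g \<nu> \<in> carrier N"
    and a_add: "g \<in> carrier G \<Longrightarrow> \<nu> \<in> carrier N \<Longrightarrow> \<mu> \<in> carrier N \<Longrightarrow>
      a g (\<nu> \<oplus>\<^bsub>N\<^esub> \<mu>) = a g \<nu> \<oplus>\<^bsub>N\<^esub> a g \<mu>"
    and a_smult: "g \<in> carrier G \<Longrightarrow> r \<in> carrier R \<Longrightarrow> \<nu> \<in> carrier N \<Longrightarrow>
      a g (r \<odot>\<^bsub>N\<^esub> \<nu>) = r \<odot>\<^bsub>N\<^esub> a g \<nu>"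
    and a_one: "\<nu> \<in> carrier N \<Longrightarrow> a \<one>\<^bsub>G\<^esub> \<nu> = \<nu>"
    and a_mult: "g \<in> carrier G \<Longrightarrow> h \<in> carrier G \<Longrightarrow> \<nu> \<in> carrier N \<Longrightarrow> a (g \<otimes>\<^bsub>G\<^esub> h) \<nu> = a g (a h \<nu>)"
    and B_closed: "k < d \<Longrightarrow> g \<in> carrier G \<Longrightarrow> B k g \<in> carrier R"
    and B_cont: "k < d \<Longrightarrow> continuous_map (grp_top G) (ring_top R) (B k)"
    and eps_a: "k < d \<Longrightarrow> g \<in> carrier G \<Longrightarrow> \<nu> \<in> carrier N \<Longrightarrow>
      eps k (a g \<nu>) = (\<Oplus>\<^bsub>R\<^esub> l\<in>{..k}. B (k - l) g \<otimes>\<^bsub>R\<^esub> eps l \<nu>)"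
begin

abbreviation "TN \<equiv> tensor_gmodule R T N a"

lemma TN_simps:
  "carrier TN = carrier MN" "zero TN = zero MN" "add TN = add MN" "smult TN = smult MN"
  "mod_top TN = tensor_topology R T N"
  "act TN g = tensor_lift R T N MN (\<lambda>t \<nu>. pure (act T g t) (a g \<nu>))"
  by (simp_all add: tensor_gmodule_def)

lemma TN_module: "module R TN"
proof (rule moduleI[OF module.axioms(1)[OF T.module_axioms]])
  show "abelian_group TN"
    by (rule abelian_groupI) (auto simp: TN_simps MN.M.a_ac intro: MN.M.add.l_inv_ex)
qed (auto simp: TN_simps MN.smult_l_distr MN.smult_r_distr MN.smult_assoc1)

lemma pure_TN_closed: "t \<in> carrier T \<Longrightarrow> \<nu> \<in> carrier N \<Longrightarrow> pure t \<nu> \<in> carrier TN"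
  by (simp add: TN_simps)

lemma coord_TN_hom: "k < d \<Longrightarrow> coord k \<in> module_hom R TN T"
  using coord_hom[of k] unfolding module_hom_def TN_simps .

lemmas coord_TN_closed = module_homD(1)[OF coord_TN_hom]
lemmas coord_TN_add = module_homD(2)[OF coord_TN_hom]
lemmas coord_TN_smult = module_homD(3)[OF coord_TN_hom]
lemmas coord_TN_zero = module_hom_zero[OF TN_module T.module_axioms coord_TN_hom]
lemmas coord_TN_minus = module_hom_minus[OF TN_module T.module_axioms coord_TN_hom]

lemma TN_eqI: "y \<in> carrier TN \<Longrightarrow> z \<in> carrier TN \<Longrightarrow> (\<And>k. k < d \<Longrightarrow> coord k y = coord k z) \<Longrightarrow> y = z"
  unfolding TN_simps by (rule tensor_eqI)

definition of_coords :: "(nat \<Rightarrow> 'm) \<Rightarrow> ('m \<times> 'n \<Rightarrow> 'r) set" where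
  "of_coords t = (\<Oplus>\<^bsub>MN\<^esub>k\<in>{..<d}. pure (t k) (e k))"

lemma of_coords_closed: "(\<And>k. k < d \<Longrightarrow> t k \<in> carrier T) \<Longrightarrow> of_coords t \<in> carrier TN"
  unfolding of_coords_def TN_simps by (rule MN.M.finsum_closed) (auto simp: e_closed)

lemma coord_of_coords: "(\<And>k. k < d \<Longrightarrow> t k \<in> carrier T) \<Longrightarrow> l < d \<Longrightarrow> coord l (of_coords t) = t l"
  unfolding of_coords_def by (rule coord_sum)

subsection \<open>The diagonal action in coordinates\<close>

lemma act_lift:
  assumes g: "g \<in> carrier G"
  shows act_hom: "act TN g \<in> module_hom R TN TN"
    and act_pure: "\<And>t \<nu>. t \<in> carrier T \<Longrightarrow> \<nu> \<in> carrier N \<Longrightarrow> act TN g (pure t \<nu>) = pure (act T g t) (a g \<nu>)"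
proof -
  note bilinear = T.act_closed[OF g] a_closed[OF g] T.act_add a_add T.act_smult a_smult pure_bilinear
  have "act TN g \<in> module_hom R MN MN"
    unfolding TN_simps
    by (rule tensor_lift_hom[OF MN.module_axioms]) (simp_all add: g bilinear)
  then show "act TN g \<in> module_hom R TN TN" unfolding module_hom_def TN_simps .
  show "act TN g (pure t \<nu>) = pure (act T g t) (a g \<nu>)" if "t \<in> carrier T" "\<nu> \<in> carrier N" for t \<nu>
    unfolding TN_simps
    by (rule tensor_lift_pure[OF MN.module_axioms]) (simp_all add: that g bilinear)
qed

lemmas act_TN_closed = module_homD(1)[OF act_hom]
lemmas act_TN_add = module_homD(2)[OF act_hom]

lemma act_TN_one:
  assumes "z \<in> carrier TN"
  shows "act TN \<one>\<^bsub>G\<^esub> z = z"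
  using assms unfolding TN_simps(1)
proof (induction z rule: tensor_induct)
  case (pure t \<nu>)
  then show ?case by (simp add: act_pure T.act_one a_one)
next
  case (add y z)
  then show ?case using act_TN_add[OF T.G.one_closed, of y z] by (simp add: TN_simps(1,3))
qed

lemma act_TN_mult:
  assumes g: "g \<in> carrier G" and h: "h \<in> carrier G" and "z \<in> carrier TN"
  shows "act TN (g \<otimes>\<^bsub>G\<^esub> h) z = act TN g (act TN h z)"
  using assms(3) unfolding TN_simps(1)
proof (induction z rule: tensor_induct)
  case (pure t \<nu>)
  then show ?case
    using g h by (simp add: act_pure T.act_closed a_closed T.act_mult a_mult)
next
  case (add y z)
  then have "y \<in> carrier TN" "z \<in> carrier TN" by (simp_all add: TN_simps)
  then have "act TN g' (y \<oplus>\<^bsub>TN\<^esub> z) = act TN g' y \<oplus>\<^bsub>TN\<^esub> act TN g' z" if "g' \<in> carrier G" for g'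
    using that by (rule act_TN_add[rotated])
  then show ?case
    using add g h act_TN_add[OF g act_TN_closed[OF h] act_TN_closed[OF h]] by (simp add: TN_simps(1,3))
qed

lemma coord_act_pure:
  assumes k: "k < d" and g: "g \<in> carrier G" and t: "t \<in> carrier T" and \<nu>: "\<nu> \<in> carrier N"
  shows "coord k (act TN g (pure t \<nu>)) = (\<Oplus>\<^bsub>T\<^esub> l\<in>{..k}. B (k - l) g \<odot>\<^bsub>T\<^esub> act T g (coord l (pure t \<nu>)))"
proof -
  have B_eps: "B (k - l) g \<in> carrier R" "eps l \<nu> \<in> carrier R" if "l \<le> k" for l
    using that k g \<nu> by (simp_all add: B_closed eps_closed)
  note gt = T.act_closed[OF g t]
  have "coord k (act TN g (pure t \<nu>)) = (\<Oplus>\<^bsub>R\<^esub> l\<in>{..k}. B (k - l) g \<otimes>\<^bsub>R\<^esub> eps l \<nu>) \<odot>\<^bsub>T\<^esub> act T g t"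
    using k g t \<nu> gt by (simp add: act_pure coord_pure a_closed eps_a)
  also have "\<dots> = (\<Oplus>\<^bsub>T\<^esub> l\<in>{..k}. (B (k - l) g \<otimes>\<^bsub>R\<^esub> eps l \<nu>) \<odot>\<^bsub>T\<^esub> act T g t)"
    by (rule additive_finsum[OF T.R.abelian_monoid_axioms T.M.abelian_monoid_axioms, of _ _ "\<lambda>r. r \<odot>\<^bsub>T\<^esub> act T g t"])
      (use gt B_eps in \<open>auto simp: T.smult_l_distr\<close>)
  also have "\<dots> = (\<Oplus>\<^bsub>T\<^esub> l\<in>{..k}. B (k - l) g \<odot>\<^bsub>T\<^esub> act T g (coord l (pure t \<nu>)))"
    by (rule T.M.finsum_cong')
      (use k g t \<nu> gt B_eps in \<open>auto simp: coord_pure T.act_smult T.smult_assoc1\<close>)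
  finally show ?thesis .
qed

lemma coord_act:
  assumes k: "k < d" and g: "g \<in> carrier G" and z: "z \<in> carrier TN"
  shows "coord k (act TN g z) = (\<Oplus>\<^bsub>T\<^esub> l\<in>{..k}. B (k - l) g \<odot>\<^bsub>T\<^esub> act T g (coord l z))"
proof (rule tensor_maps_eq[where P = T])
  fix y z assume "y \<in> carrier MN" "z \<in> carrier MN"
  then have yz: "y \<in> carrier TN" "z \<in> carrier TN" by (simp_all add: TN_simps)
  show "coord k (act TN g (y \<oplus>\<^bsub>MN\<^esub> z)) = coord k (act TN g y) \<oplus>\<^bsub>T\<^esub> coord k (act TN g z)"
    using act_TN_add[OF g yz] coord_TN_add[OF k act_TN_closed[OF g yz(1)] act_TN_closed[OF g yz(2)]]
    by (simp only: TN_simps(3))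
  have B: "B (k - l) g \<in> carrier R" for l using k g by (intro B_closed) auto
  have coord: "coord l y \<in> carrier T" "coord l z \<in> carrier T" if "l \<le> k" for l
    using coord_TN_closed[of l] yz k that by simp_all
  have "(\<Oplus>\<^bsub>T\<^esub> l\<in>{..k}. B (k - l) g \<odot>\<^bsub>T\<^esub> act T g (coord l (y \<oplus>\<^bsub>MN\<^esub> z))) =
      (\<Oplus>\<^bsub>T\<^esub> l\<in>{..k}. B (k - l) g \<odot>\<^bsub>T\<^esub> act T g (coord l y) \<oplus>\<^bsub>T\<^esub> B (k - l) g \<odot>\<^bsub>T\<^esub> act T g (coord l z))"
  proof (rule T.M.finsum_cong')
    fix l assume l: "l \<in> {..k}"
    then show "B (k - l) g \<odot>\<^bsub>T\<^esub> act T g (coord l (y \<oplus>\<^bsub>MN\<^esub> z)) =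
        B (k - l) g \<odot>\<^bsub>T\<^esub> act T g (coord l y) \<oplus>\<^bsub>T\<^esub> B (k - l) g \<odot>\<^bsub>T\<^esub> act T g (coord l z)"
      using coord_TN_add[OF _ yz, of l] coord[of l] B g k
      by (simp add: TN_simps(3) T.act_add T.act_closed T.smult_r_distr)
  qed (use coord B g T.act_closed in auto)
  also have "\<dots> = (\<Oplus>\<^bsub>T\<^esub> l\<in>{..k}. B (k - l) g \<odot>\<^bsub>T\<^esub> act T g (coord l y)) \<oplus>\<^bsub>T\<^esub>
      (\<Oplus>\<^bsub>T\<^esub> l\<in>{..k}. B (k - l) g \<odot>\<^bsub>T\<^esub> act T g (coord l z))"
    by (rule T.M.finsum_addf) (use coord B g T.act_closed in auto)
  finally show "(\<Oplus>\<^bsub>T\<^esub> l\<in>{..k}. B (k - l) g \<odot>\<^bsub>T\<^esub> act T g (coord l (y \<oplus>\<^bsub>MN\<^esub> z))) = \<dots>" .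
qed (use z coord_act_pure[OF k g] in \<open>simp_all add: TN_simps(1)\<close>)

subsection \<open>The tensor topology\<close>

abbreviation "tuples m \<equiv> product_topology (\<lambda>_. mod_top T) {..<m::nat}"
abbreviation "comb m \<nu> t \<equiv> \<Oplus>\<^bsub>MN\<^esub>i\<in>{..<m::nat}. pure (t i) (\<nu> i)"

lemma comb_closed:
  assumes "\<nu> \<in> {..<m} \<rightarrow> carrier N" "t \<in> topspace (tuples m)"
  shows "comb m \<nu> t \<in> carrier MN"
  by (rule MN.M.finsum_closed) (use assms T.top_T in \<open>auto intro!: pure_closed\<close>)

lemma openin_tensor:
  "openin (tensor_topology R T N) U \<longleftrightarrow> U \<subseteq> carrier MN \<and>
     (\<forall>m. \<forall>\<nu>\<in>{..<m} \<rightarrow> carrier N. openin (tuples m) {t \<in> topspace (tuples m). comb m \<nu> t \<in> U})"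
proof -
  let ?pre = "\<lambda>m \<nu> U. {t \<in> topspace (tuples m). comb m \<nu> t \<in> U}"
  let ?P = "\<lambda>U. U \<subseteq> carrier MN \<and> (\<forall>m. \<forall>\<nu>\<in>{..<m} \<rightarrow> carrier N. openin (tuples m) (?pre m \<nu> U))"
  have pre: "?pre m \<nu> (U \<inter> V) = ?pre m \<nu> U \<inter> ?pre m \<nu> V" "?pre m \<nu> (\<Union>\<U>) = \<Union> (?pre m \<nu> ` \<U>)"
    for m \<nu> U V \<U> by blast+
  have "?P (U \<inter> V)" if "?P U" "?P V" for U V
    unfolding pre using that by (blast intro: openin_Int)
  moreover have "?P (\<Union>\<U>)" if "\<forall>U\<in>\<U>. ?P U" for \<U>
    unfolding pre using that by (blast intro: openin_Union)
  ultimately have "istopology ?P"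
    unfolding istopology_def by blast
  then show ?thesis
    unfolding tensor_topology_def by (simp add: topology_inverse')
qed

lemma topspace_TN: "topspace (mod_top TN) = carrier TN"
proof -
  have pre: "{t \<in> topspace (tuples m). comb m \<nu> t \<in> carrier MN} = topspace (tuples m)"
    if "\<nu> \<in> {..<m} \<rightarrow> carrier N" for m \<nu>
    using comb_closed[OF that] by blast
  have "openin (tensor_topology R T N) (carrier MN)"
    unfolding openin_tensor by (intro conjI subset_refl allI ballI) (simp only: pre openin_topspace)
  then show ?thesis
    using conjunct1[OF iffD1[OF openin_tensor openin_topspace]]
    unfolding TN_simps(1,5) by (intro subset_antisym openin_subset)
qed

lemma continuous_comb:
  assumes "\<nu> \<in> {..<m} \<rightarrow> carrier N"
  shows "continuous_map (tuples m) (mod_top TN) (comb m \<nu>)"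
  using assms comb_closed[OF assms]
  by (auto simp: continuous_map_def topspace_TN) (auto simp: TN_simps openin_tensor)

lemma continuous_map_from_TN:
  assumes "\<And>z. z \<in> carrier TN \<Longrightarrow> f z \<in> topspace Y"
    and "\<And>m \<nu>. \<nu> \<in> {..<m} \<rightarrow> carrier N \<Longrightarrow> continuous_map (tuples m) Y (\<lambda>t. f (comb m \<nu> t))"
  shows "continuous_map (mod_top TN) Y f"
  unfolding continuous_map_def
proof (intro conjI allI impI)
  fix U assume U: "openin Y U"
  have "{t \<in> topspace (tuples m). comb m \<nu> t \<in> {z \<in> carrier MN. f z \<in> U}} =
      {t \<in> topspace (tuples m). f (comb m \<nu> t) \<in> U}" if "\<nu> \<in> {..<m} \<rightarrow> carrier N" for m \<nu>
    using comb_closed[OF that] by blast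
  then have "openin (tensor_topology R T N) {z \<in> carrier MN. f z \<in> U}"
    unfolding openin_tensor using openin_continuous_map_preimage[OF assms(2) U] by simp
  then show "openin (mod_top TN) {z \<in> topspace (mod_top TN). f z \<in> U}"
    unfolding topspace_TN unfolding TN_simps .
qed (use assms(1) in \<open>simp add: topspace_TN\<close>)

lemma coord_continuous:
  assumes k: "k < d"
  shows "continuous_map (mod_top TN) (mod_top T) (coord k)"
proof (rule continuous_map_from_TN)
  fix m :: nat and \<nu> assume \<nu>: "\<nu> \<in> {..<m} \<rightarrow> carrier N"
  have coord_comb: "coord k (comb m \<nu> t) = (\<Oplus>\<^bsub>T\<^esub>i\<in>{..<m}. eps k (\<nu> i) \<odot>\<^bsub>T\<^esub> t i)"
    if "t \<in> topspace (tuples m)" for t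
  proof -
    have closed: "t i \<in> carrier T" "\<nu> i \<in> carrier N" if "i < m" for i
      using \<nu> that \<open>t \<in> _\<close> T.top_T by auto
    have "coord k (comb m \<nu> t) = (\<Oplus>\<^bsub>T\<^esub> i\<in>{..<m}. coord k (pure (t i) (\<nu> i)))"
      by (rule module_hom_finsum[OF MN.module_axioms T.module_axioms coord_hom[OF k]]) (auto simp: closed)
    also have "\<dots> = (\<Oplus>\<^bsub>T\<^esub>i\<in>{..<m}. eps k (\<nu> i) \<odot>\<^bsub>T\<^esub> t i)"
      by (rule T.M.finsum_cong') (use closed k in \<open>auto simp: coord_pure eps_closed\<close>)
    finally show ?thesis .
  qed
  have "continuous_map (tuples m) (mod_top T) (\<lambda>t. \<Oplus>\<^bsub>T\<^esub>i\<in>{..<m}. eps k (\<nu> i) \<odot>\<^bsub>T\<^esub> t i)"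
    using \<nu> eps_closed[OF k]
    by (intro T.continuous_finsum T.continuous_smult continuous_map_product_projection)
      (auto simp: T.top_R)
  then show "continuous_map (tuples m) (mod_top T) (\<lambda>t. coord k (comb m \<nu> t))"
    by (rule continuous_map_eq) (simp only: coord_comb)
qed (simp add: coord_TN_closed k T.top_T)

lemmas continuous_coord = continuous_map_compose[OF _ coord_continuous, unfolded o_def]

lemma continuous_of_coords:
  assumes b: "\<And>k. k < d \<Longrightarrow> continuous_map X (mod_top T) (b k)"
  shows "continuous_map X (mod_top TN) (\<lambda>y. of_coords (\<lambda>k. b k y))"
proof (rule continuous_map_eq)
  have "continuous_map X (tuples d) (\<lambda>y. \<lambda>k\<in>{..<d}. b k y)"
    unfolding continuous_map_componentwise using b by auto
  then show "continuous_map X (mod_top TN) (\<lambda>y. comb d e (\<lambda>k\<in>{..<d}. b k y))"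
    by (rule continuous_map_compose[OF _ continuous_comb, unfolded o_def]) (simp add: e_closed)
  show "comb d e (\<lambda>k\<in>{..<d}. b k y) = of_coords (\<lambda>k. b k y)" if "y \<in> topspace X" for y
    unfolding of_coords_def
    by (rule MN.M.finsum_cong') (use T.continuous_closed[OF b that] e_closed in auto)
qed

lemma continuous_map_into_TN:
  assumes "\<And>y. y \<in> topspace X \<Longrightarrow> F y \<in> carrier TN"
    and c: "\<And>k. k < d \<Longrightarrow> continuous_map X (mod_top T) (c k)"
    and "\<And>k y. k < d \<Longrightarrow> y \<in> topspace X \<Longrightarrow> coord k (F y) = c k y"
  shows "continuous_map X (mod_top TN) F"
proof (rule continuous_map_eq[OF continuous_of_coords[OF c]])
  fix y assume y: "y \<in> topspace X"
  note c_closed = T.continuous_closed[OF c y]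
  show "of_coords (\<lambda>k. c k y) = F y"
    by (rule TN_eqI) (simp_all add: of_coords_closed coord_of_coords c_closed assms(1,3) y)
qed

lemma TN_top_gmodule: "top_gmodule R G TN"
proof (intro top_gmodule.intro top_gmodule_axioms.intro TN_module T.G.group_axioms)
  interpret TN: module R TN by (rule TN_module)
  let ?TN2 = "prod_topology (mod_top TN) (mod_top TN)"
  show "continuous_map ?TN2 (mod_top TN) (\<lambda>(z, w). z \<oplus>\<^bsub>TN\<^esub> w)"
    by (rule continuous_map_into_TN[where c = "\<lambda>k x. coord k (fst x) \<oplus>\<^bsub>T\<^esub> coord k (snd x)"];
        (intro T.continuous_add continuous_coord continuous_map_fst continuous_map_snd)?)
      (auto simp: topspace_TN coord_TN_add)
  show "continuous_map (mod_top TN) (mod_top TN) (\<lambda>z. \<ominus>\<^bsub>TN\<^esub> z)"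
  proof (rule continuous_map_into_TN)
    show "continuous_map (mod_top TN) (mod_top T) (\<lambda>z. \<zero>\<^bsub>T\<^esub> \<ominus>\<^bsub>T\<^esub> coord k z)" if "k < d" for k
      using that by (intro T.continuous_minus T.continuous_const coord_continuous) simp_all
    show "coord k (\<ominus>\<^bsub>TN\<^esub> z) = \<zero>\<^bsub>T\<^esub> \<ominus>\<^bsub>T\<^esub> coord k z" if "k < d" "z \<in> topspace (mod_top TN)" for k z
      using coord_TN_minus[OF that(1), of "\<zero>\<^bsub>TN\<^esub>" z] that coord_TN_zero[OF that(1)]
      by (simp add: topspace_TN a_minus_def)
  qed (simp add: topspace_TN)
  show "continuous_map (prod_topology (ring_top R) (mod_top TN)) (mod_top TN) (\<lambda>(r, z). r \<odot>\<^bsub>TN\<^esub> z)"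
    by (rule continuous_map_into_TN[where c = "\<lambda>k x. fst x \<odot>\<^bsub>T\<^esub> coord k (snd x)"];
        (intro T.continuous_smult continuous_coord continuous_map_fst continuous_map_snd)?)
      (auto simp: topspace_TN T.top_R coord_TN_smult)
  show "continuous_map (prod_topology (grp_top G) (mod_top TN)) (mod_top TN) (\<lambda>(g, z). act TN g z)"
  proof (rule continuous_map_into_TN)
    fix k assume "k < d"
    then show "continuous_map (prod_topology (grp_top G) (mod_top TN)) (mod_top T)
        (\<lambda>x. \<Oplus>\<^bsub>T\<^esub>l\<in>{..k}. B (k - l) (fst x) \<odot>\<^bsub>T\<^esub> act T (fst x) (coord l (snd x)))"
      by (intro T.continuous_finsum T.continuous_smult T.continuous_act continuous_coord
          continuous_map_compose[OF continuous_map_fst B_cont, unfolded o_def]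
          continuous_map_fst continuous_map_snd) auto
  qed (auto simp: topspace_TN T.top_G act_TN_closed coord_act)
qed (use module_homD[OF act_hom] act_TN_one act_TN_mult topspace_TN T.top_G T.top_R T.cont_mult in auto)

sublocale TN: top_gmodule R G TN
  by (rule TN_top_gmodule)

lemma coord_coboundary1:
  assumes k: "k < d" and b: "b \<in> C1 G TN" and g: "g \<in> carrier G" and h: "h \<in> carrier G"
  shows "coord k (coboundary1 G TN b (g, h)) =
    ((\<Oplus>\<^bsub>T\<^esub> l\<in>{..k}. B (k - l) g \<odot>\<^bsub>T\<^esub> act T g (coord l (b h))) \<ominus>\<^bsub>T\<^esub> coord k (b (g \<otimes>\<^bsub>G\<^esub> h))) \<oplus>\<^bsub>T\<^esub> coord k (b g)"
  using TN.C1_eval_closed[OF b] k g h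
  by (simp add: TN.coboundary1_eval coord_TN_add coord_TN_minus coord_act act_TN_closed)

end

locale tensor_action_hom =
  A: tensor_action R G T N d e eps a B + A': tensor_action R G T N' d' e' eps' a' B'
  for R :: "('r, 'x) topring_scheme" and G :: "('g, 'y) topgroup_scheme"
    and T :: "('r, 'm, 'g, 'z) gmodule_scheme"
    and N :: "('r, 'n, 'w) module_scheme" and d e eps a B
    and N' :: "('r, 'k, 'v) module_scheme" and d' e' eps' a' B' +
  fixes p :: "'n \<Rightarrow> 'k"
  assumes p_hom: "p \<in> module_hom R N N'"
    and p_equivariant: "g \<in> carrier G \<Longrightarrow> \<nu> \<in> carrier N \<Longrightarrow> p (a g \<nu>) = a' g (p \<nu>)"
begin

definition tensor_map :: "('m \<times> 'n \<Rightarrow> 'r) set \<Rightarrow> ('m \<times> 'k \<Rightarrow> 'r) set" where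
  "tensor_map = tensor_lift R T N A'.TN (\<lambda>t \<nu>. A'.pure t (p \<nu>))"

lemma tensor_map:
  shows tensor_map_hom: "tensor_map \<in> module_hom R A.TN A'.TN"
    and tensor_map_pure: "\<And>t \<nu>. t \<in> carrier T \<Longrightarrow> \<nu> \<in> carrier N \<Longrightarrow>
      tensor_map (A.pure t \<nu>) = A'.pure t (p \<nu>)"
proof -
  note bilinear = module_homD[OF p_hom] A'.TN_simps(1,3,4) A'.pure_bilinear
  have "tensor_map \<in> module_hom R A.MN A'.TN"
    unfolding tensor_map_def by (rule A.tensor_lift_hom[OF A'.TN_module]) (simp_all add: bilinear)
  then show "tensor_map \<in> module_hom R A.TN A'.TN"
    unfolding module_hom_def A.TN_simps(1,3,4) .
  show "tensor_map (A.pure t \<nu>) = A'.pure t (p \<nu>)" if "t \<in> carrier T" "\<nu> \<in> carrier N" for t \<nu>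
    unfolding tensor_map_def
    by (rule A.tensor_lift_pure[OF A'.TN_module]) (simp_all add: that bilinear)
qed

lemma tensor_map_equivariant:
  assumes g: "g \<in> carrier G" and "z \<in> carrier A.TN"
  shows "tensor_map (act A.TN g z) = act A'.TN g (tensor_map z)"
  using assms(2) unfolding A.TN_simps(1)
proof (induction z rule: A.tensor_induct)
  case (pure t \<nu>)
  then show ?case
    using g module_homD(1)[OF p_hom]
    by (simp add: A.act_pure A'.act_pure A.T.act_closed A.a_closed tensor_map_pure p_equivariant)
next
  case (add y z)
  then have "y \<in> carrier A.TN" "z \<in> carrier A.TN" by (simp_all add: A.TN_simps)
  then show ?case
    using add g module_homD(1,2)[OF tensor_map_hom] A.act_TN_closed A.act_TN_add A'.act_TN_add
    by (simp flip: A.TN_simps(3))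
qed

lemma tensor_map_gmodule_hom: "gmodule_hom R G A.TN A'.TN tensor_map"
proof (intro gmodule_hom.intro gmodule_hom_axioms.intro A.TN_top_gmodule A'.TN_top_gmodule tensor_map_hom)
  show "continuous_map (mod_top A.TN) (mod_top A'.TN) tensor_map"
  proof (rule A.continuous_map_from_TN)
    fix m :: nat and \<nu> assume \<nu>: "\<nu> \<in> {..<m} \<rightarrow> carrier N"
    then have p\<nu>: "(\<lambda>i. p (\<nu> i)) \<in> {..<m} \<rightarrow> carrier N'" using module_homD(1)[OF p_hom] by auto
    have "tensor_map (A.comb m \<nu> t) = A'.comb m (\<lambda>i. p (\<nu> i)) t" if "t \<in> topspace (A.tuples m)" for t
    proof -
      have closed: "t i \<in> carrier T" "\<nu> i \<in> carrier N" "p (\<nu> i) \<in> carrier N'" if "i < m" for i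
        using \<nu> p\<nu> that \<open>t \<in> _\<close> A.T.top_T by auto
      have "tensor_map (A.comb m \<nu> t) = (\<Oplus>\<^bsub>A'.MN\<^esub>i\<in>{..<m}. tensor_map (A.pure (t i) (\<nu> i)))"
        using tensor_map_hom unfolding module_hom_def A.TN_simps A'.TN_simps
        by (intro module_hom_finsum[OF A.MN.module_axioms A'.MN.module_axioms])
          (auto simp: closed module_hom_def)
      also have "\<dots> = A'.comb m (\<lambda>i. p (\<nu> i)) t"
        by (rule A'.MN.M.finsum_cong') (use closed in \<open>auto simp: tensor_map_pure\<close>)
      finally show ?thesis .
    qed
    then show "continuous_map (A.tuples m) (mod_top A'.TN) (\<lambda>t. tensor_map (A.comb m \<nu> t))"
      by (intro continuous_map_eq[OF A'.continuous_comb[OF p\<nu>]]) simp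
  qed (simp add: A'.topspace_TN module_homD(1)[OF tensor_map_hom])
qed (rule tensor_map_equivariant)

end

subsection \<open>Tensoring with a free module of rank one and trivial action\<close>

locale tensor_line = tensor_action R G T N 1 e eps a B
  for R :: "('r, 'x) topring_scheme" and G :: "('g, 'y) topgroup_scheme"
    and T :: "('r, 'm, 'g, 'z) gmodule_scheme" and N :: "('r, 'n, 'w) module_scheme"
    and e eps a B +
  assumes B_0: "g \<in> carrier G \<Longrightarrow> B 0 g = \<one>\<^bsub>R\<^esub>"
begin

lemma coord_act_eq: "g \<in> carrier G \<Longrightarrow> z \<in> carrier TN \<Longrightarrow> coord 0 (act TN g z) = act T g (coord 0 z)"
  by (simp add: coord_act B_0 coord_TN_closed T.act_closed)

lemma coord_gmodule_hom: "gmodule_hom R G TN T (coord 0)"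
  by (intro gmodule_hom.intro gmodule_hom_axioms.intro TN_top_gmodule T.top_gmodule_axioms)
    (simp_all add: coord_TN_hom coord_act_eq coord_continuous)

lemma pure_gmodule_hom:
  assumes m: "m \<in> carrier N"
  shows "gmodule_hom R G T TN (\<lambda>t. pure t m)"
proof (intro gmodule_hom.intro gmodule_hom_axioms.intro TN_top_gmodule T.top_gmodule_axioms)
  show "(\<lambda>t. pure t m) \<in> module_hom R T TN"
    by (rule module_homI) (simp_all add: m TN_simps pure_bilinear)
  show "pure (act T g t) m = act TN g (pure t m)" if "g \<in> carrier G" "t \<in> carrier T" for g t
    by (rule TN_eqI)
      (simp_all add: that m pure_TN_closed T.act_closed act_TN_closed coord_act_eq coord_pure
        T.act_smult eps_closed)
  show "continuous_map (mod_top T) (mod_top TN) (\<lambda>t. pure t m)"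
    by (rule continuous_map_into_TN[where c = "\<lambda>k t. eps k m \<odot>\<^bsub>T\<^esub> t"];
        (intro T.continuous_smult)?)
      (simp_all add: T.top_T T.top_R m pure_TN_closed coord_pure eps_closed)
qed

lemma coord_pure_basis: "t \<in> carrier T \<Longrightarrow> coord 0 (pure t (e 0)) = t"
  by (simp add: coord_pure e_closed eps_e)

lemma pure_coord_basis: "z \<in> carrier TN \<Longrightarrow> pure (coord 0 z) (e 0) = z"
  using expand_rank_one TN_simps by simp

definition tensor_H2_map :: "(('g \<times> 'g \<Rightarrow> 'm) set \<times> 'n \<Rightarrow> 'r) set \<Rightarrow> ('g \<times> 'g \<Rightarrow> ('m \<times> 'n \<Rightarrow> 'r) set) set" where
  "tensor_H2_map = tensor_lift R (H2 G T) N (H2 G TN) (\<lambda>X m. H2_map G TN (\<lambda>t. pure t m) X)"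

lemma H2_tensor_based: "tensor_based R (H2 G T) N 1 e eps"
  by (intro tensor_based.intro tensor_modules.intro T.H2_module N.module_axioms based_module_axioms)

lemma H2_map_pure_right:
  assumes X: "X \<in> carrier (H2 G T)" and m: "m \<in> carrier N"
  shows H2_map_pure_add: "m' \<in> carrier N \<Longrightarrow> H2_map G TN (\<lambda>t. pure t (m \<oplus>\<^bsub>N\<^esub> m')) X =
      H2_map G TN (\<lambda>t. pure t m) X \<oplus>\<^bsub>H2 G TN\<^esub> H2_map G TN (\<lambda>t. pure t m') X"
    and H2_map_pure_smult: "r \<in> carrier R \<Longrightarrow> H2_map G TN (\<lambda>t. pure t (r \<odot>\<^bsub>N\<^esub> m)) X =
      r \<odot>\<^bsub>H2 G TN\<^esub> H2_map G TN (\<lambda>t. pure t m) X"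
proof -
  obtain c where c: "c \<in> Z2 G T" and X: "X = class2 G T c"
    using X by (auto simp: T.H2_carrier)
  note c_closed = T.Z2_eval_closed[OF c]
  note hom = gmodule_hom.H2_map_class2[OF pure_gmodule_hom c] gmodule_hom.map_Z2[OF pure_gmodule_hom c]
  show "H2_map G TN (\<lambda>t. pure t (m \<oplus>\<^bsub>N\<^esub> m')) X =
      H2_map G TN (\<lambda>t. pure t m) X \<oplus>\<^bsub>H2 G TN\<^esub> H2_map G TN (\<lambda>t. pure t m') X" if m': "m' \<in> carrier N"
  proof -
    have "(\<lambda>s\<in>pairs G. pure (c s) (m \<oplus>\<^bsub>N\<^esub> m')) =
        (\<lambda>s\<in>pairs G. (\<lambda>s\<in>pairs G. pure (c s) m) s \<oplus>\<^bsub>TN\<^esub> (\<lambda>s\<in>pairs G. pure (c s) m') s)"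
      by (rule restrict_ext) (simp add: c_closed m m' pure_add_right TN_simps)
    then show ?thesis
      using m m' by (simp only: X hom N.a_closed TN.H2_add)
  qed
  show "H2_map G TN (\<lambda>t. pure t (r \<odot>\<^bsub>N\<^esub> m)) X = r \<odot>\<^bsub>H2 G TN\<^esub> H2_map G TN (\<lambda>t. pure t m) X"
    if r: "r \<in> carrier R"
  proof -
    have "(\<lambda>s\<in>pairs G. pure (c s) (r \<odot>\<^bsub>N\<^esub> m)) = (\<lambda>s\<in>pairs G. r \<odot>\<^bsub>TN\<^esub> (\<lambda>s\<in>pairs G. pure (c s) m) s)"
      by (rule restrict_ext) (simp add: c_closed m r pure_smult_right TN_simps)
    then show ?thesis
      using m r by (simp only: X hom N.smult_closed TN.H2_smult)
  qed
qed

lemma tensor_H2_map_pure: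
  assumes "X \<in> carrier (H2 G T)" "m \<in> carrier N"
  shows "tensor_H2_map (pure_tensor R (H2 G T) N X m) = H2_map G TN (\<lambda>t. pure t m) X"
proof -
  interpret H: tensor_based R "H2 G T" N 1 e eps by (rule H2_tensor_based)
  show ?thesis
    unfolding tensor_H2_map_def
    by (rule H.tensor_lift_pure[OF TN.H2_module])
      (use assms module_homD[OF gmodule_hom.H2_map_hom[OF pure_gmodule_hom]] H2_map_pure_add
        H2_map_pure_smult in simp_all)
qed

lemma tensor_H2_map_inj: "inj_on tensor_H2_map (carrier (tensor R (H2 G T) N))"
proof -
  interpret H: tensor_based R "H2 G T" N 1 e eps by (rule H2_tensor_based)
  have e0: "e 0 \<in> carrier N" by (simp add: e_closed)
  have "H.pure (H2_map G T (coord 0) (tensor_H2_map z)) (e 0) = z" if z: "z \<in> carrier H.MN" for z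
  proof -
    have X: "H.coord 0 z \<in> carrier (H2 G T)" using z by (simp add: H.coord_closed)
    have "H2_map G T (coord 0) (tensor_H2_map (H.pure (H.coord 0 z) (e 0))) = H.coord 0 z"
      unfolding tensor_H2_map_pure[OF X e0]
      by (rule H2_map_left_inverse[OF pure_gmodule_hom[OF e0] coord_gmodule_hom coord_pure_basis X])
    then show ?thesis
      using H.expand_rank_one z by simp
  qed
  then show ?thesis by (rule inj_on_inverseI)
qed

lemma inv_tensor_H2_map:
  assumes X: "X \<in> carrier (H2 G T)"
  shows "inv_into (carrier (tensor R (H2 G T) N)) tensor_H2_map (H2_map G TN (\<lambda>t. pure t (e 0)) X) =
    pure_tensor R (H2 G T) N X (e 0)"
proof -
  interpret H: tensor_based R "H2 G T" N 1 e eps by (rule H2_tensor_based)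
  have e0: "e 0 \<in> carrier N" by (simp add: e_closed)
  show ?thesis
    using inv_into_f_f[OF tensor_H2_map_inj H.pure_closed[OF X e0]] tensor_H2_map_pure[OF X e0] by simp
qed

end

section \<open>The connecting map of a truncated tensor product\<close>

locale truncation_sequence =
  A1: tensor_action R G T N1 "Suc n" e1 eps1 a1 B +
  A0: tensor_action R G T N0 n e0 eps0 a0 B +
  Ag: tensor_line R G T Ng "\<lambda>_. e1 n" "\<lambda>_. eps1 n" a1 B
  for R :: "('r, 'x) topring_scheme" and G :: "('g, 'y) topgroup_scheme"
    and T :: "('r, 'm, 'g, 'z) gmodule_scheme" and N1 :: "('r, 'n, 'w) module_scheme"
    and n e1 eps1 a1 B
    and N0 :: "('r, 'k, 'v) module_scheme" and e0 eps0 a0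
    and Ng :: "('r, 'n, 'u) module_scheme" +
  fixes pr :: "'n \<Rightarrow> 'k"
  assumes Ng_subset: "carrier Ng \<subseteq> carrier N1" and Ng_add: "add Ng = add N1" and Ng_smult: "smult Ng = smult N1"
    and pr_hom: "pr \<in> module_hom R N1 N0"
    and pr_equivariant: "g \<in> carrier G \<Longrightarrow> \<nu> \<in> carrier N1 \<Longrightarrow> pr (a1 g \<nu>) = a0 g (pr \<nu>)"
    and pr_eps: "k < n \<Longrightarrow> \<nu> \<in> carrier N1 \<Longrightarrow> eps0 k (pr \<nu>) = eps1 k \<nu>"
begin

sublocale incl: tensor_action_hom R G T Ng 1 "\<lambda>_. e1 n" "\<lambda>_. eps1 n" a1 B N1 "Suc n" e1 eps1 a1 B "\<lambda>\<nu>. \<nu>"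
  by unfold_locales (use Ng_subset in \<open>auto simp: module_hom_def Ng_add Ng_smult\<close>)

sublocale proj: tensor_action_hom R G T N1 "Suc n" e1 eps1 a1 B N0 n e0 eps0 a0 B pr
  by unfold_locales (simp_all add: pr_hom pr_equivariant)

abbreviation "incl \<equiv> incl.tensor_map"
abbreviation "proj \<equiv> proj.tensor_map"

lemma coord_proj:
  assumes k: "k < n" and z: "z \<in> carrier A1.TN"
  shows "A0.coord k (proj z) = A1.coord k z"
  using z unfolding A1.TN_simps(1)
proof (induction z rule: A1.tensor_induct)
  case (pure t \<nu>)
  then show ?case
    using k module_homD(1)[OF pr_hom] by (simp add: proj.tensor_map_pure A0.coord_pure A1.coord_pure pr_eps)
next
  case (add y z)
  then have "y \<in> carrier A1.TN" "z \<in> carrier A1.TN" by (simp_all add: A1.TN_simps)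
  then show ?case
    using add k module_homD(1,2)[OF proj.tensor_map_hom] A1.coord_TN_add[of k] A0.coord_TN_add[of k]
    by (simp flip: A1.TN_simps(3))
qed

lemma coord_incl_pure:
  assumes "k \<le> n" "t \<in> carrier T"
  shows "A1.coord k (incl (Ag.pure t (e1 n))) = (if k = n then t else \<zero>\<^bsub>T\<^esub>)"
  using assms A1.e_closed[of n] A1.eps_e[of k n] Ag.e_closed[of 0]
  by (simp add: incl.tensor_map_pure A1.coord_pure A1.T.smult_l_null)

sublocale gmodule_exact_sequence R G Ag.TN A1.TN A0.TN incl proj "\<lambda>z. Ag.pure (A1.coord n z) (e1 n)"
proof (intro gmodule_exact_sequence.intro gmodule_exact_sequence_axioms.intro
    incl.tensor_map_gmodule_hom proj.tensor_map_gmodule_hom)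
  have basis: "e1 n \<in> carrier Ng" using Ag.e_closed[of 0] by simp
  interpret \<iota>: gmodule_hom R G T Ag.TN "\<lambda>t. Ag.pure t (e1 n)" by (rule Ag.pure_gmodule_hom[OF basis])
  show "Ag.pure (A1.coord n (incl y)) (e1 n) = y" if "y \<in> carrier Ag.TN" for y
    using coord_incl_pure[of n "Ag.coord 0 y"] Ag.pure_coord_basis[OF that] Ag.coord_TN_closed[OF _ that]
    by simp
  show "continuous_map (mod_top A1.TN) (mod_top Ag.TN) (\<lambda>z. Ag.pure (A1.coord n z) (e1 n))"
    by (rule \<iota>.continuous_comp[OF A1.coord_continuous]) simp
  show "incl (Ag.pure (A1.coord n m) (e1 n)) = m"
    if m: "m \<in> carrier A1.TN" and zero: "proj m = \<zero>\<^bsub>A0.TN\<^esub>" for m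
  proof (rule A1.TN_eqI)
    fix k assume "k < Suc n"
    then show "A1.coord k (incl (Ag.pure (A1.coord n m) (e1 n))) = A1.coord k m"
      using coord_proj[of k m] m A0.coord_TN_zero[of k]
      by (auto simp: coord_incl_pure A1.coord_TN_closed zero less_Suc_eq)
  qed (use m basis A1.coord_TN_closed Ag.pure_TN_closed module_homD(1)[OF incl.tensor_map_hom] in auto)
  show "\<exists>m\<in>carrier A1.TN. proj m = z" if z: "z \<in> carrier A0.TN" for z
  proof (rule bexI)
    let ?m = "A1.of_coords (\<lambda>k. if k < n then A0.coord k z else \<zero>\<^bsub>T\<^esub>)"
    have t: "(if k < n then A0.coord k z else \<zero>\<^bsub>T\<^esub>) \<in> carrier T" for k
      using A0.coord_TN_closed[OF _ z] by simp
    show m: "?m \<in> carrier A1.TN" by (intro A1.of_coords_closed t)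
    show "proj ?m = z"
      by (rule A0.TN_eqI)
        (use m z in \<open>simp_all add: coord_proj A1.coord_of_coords t module_homD(1)[OF proj.tensor_map_hom]\<close>)
  qed
qed

context
  fixes f :: "'g \<Rightarrow> ('m \<times> 'k \<Rightarrow> 'r) set" and lam :: "nat \<Rightarrow> 'g \<Rightarrow> 'm"
  assumes f: "f \<in> Z1 G A0.TN"
    and lam: "\<And>k g. k < n \<Longrightarrow> g \<in> carrier G \<Longrightarrow> lam k g \<in> carrier T"
    and f_lam: "\<And>g. g \<in> carrier G \<Longrightarrow> f g = A0.of_coords (\<lambda>k. lam k g)"
begin

lemma f_closed: "g \<in> carrier G \<Longrightarrow> f g \<in> carrier A0.TN"
  by (rule A0.TN.C1_eval_closed[OF A0.TN.Z1_C1[OF f]])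

lemma lam_eq: "k < n \<Longrightarrow> g \<in> carrier G \<Longrightarrow> lam k g = A0.coord k (f g)"
  using f_lam A0.coord_of_coords[of "\<lambda>k. lam k g" k] lam by simp

lemma lam_continuous:
  assumes "k < n"
  shows "continuous_map (grp_top G) (mod_top T) (lam k)"
  by (rule continuous_map_eq[OF A0.continuous_coord[OF A0.TN.C1_continuous[OF A0.TN.Z1_C1[OF f]] assms]])
    (simp add: lam_eq assms A1.T.top_G)

lemma lam_cocycle:
  assumes k: "k < n" and g: "g \<in> carrier G" and h: "h \<in> carrier G"
  shows "lam k (g \<otimes>\<^bsub>G\<^esub> h) = lam k g \<oplus>\<^bsub>T\<^esub> (\<Oplus>\<^bsub>T\<^esub> l\<in>{..k}. B (k - l) g \<odot>\<^bsub>T\<^esub> act T g (lam l h))"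
proof -
  have "f (g \<otimes>\<^bsub>G\<^esub> h) = f g \<oplus>\<^bsub>A0.TN\<^esub> act A0.TN g (f h)"
    using f g h by (simp add: Z1_def)
  then have "lam k (g \<otimes>\<^bsub>G\<^esub> h) = lam k g \<oplus>\<^bsub>T\<^esub> A0.coord k (act A0.TN g (f h))"
    using k g h f_closed by (simp add: lam_eq A0.coord_TN_add A0.act_TN_closed)
  also have "A0.coord k (act A0.TN g (f h)) = (\<Oplus>\<^bsub>T\<^esub> l\<in>{..k}. B (k - l) g \<odot>\<^bsub>T\<^esub> act T g (lam l h))"
    unfolding A0.coord_act[OF k g f_closed[OF h]]
    by (rule A1.T.M.finsum_cong')
      (use k g h lam A1.B_closed A1.T.act_closed in \<open>auto simp: lam_eq\<close>)
  finally show ?thesis .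
qed

definition lifted_cochain :: "'g \<Rightarrow> ('m \<times> 'n \<Rightarrow> 'r) set" where
  "lifted_cochain = (\<lambda>g\<in>carrier G. A1.of_coords (\<lambda>k. if k < n then lam k g else \<zero>\<^bsub>T\<^esub>))"

definition massey_cochain :: "'g \<times> 'g \<Rightarrow> 'm" where
  "massey_cochain = (\<lambda>(g, h)\<in>pairs G. \<Oplus>\<^bsub>T\<^esub> l\<in>{..<n}. B (n - l) g \<odot>\<^bsub>T\<^esub> act T g (lam l h))"

lemma lifted_cochain_C1: "lifted_cochain \<in> C1 G A1.TN"
  unfolding lifted_cochain_def
proof (intro A1.TN.C1_I A1.continuous_of_coords)
  fix k
  show "continuous_map (grp_top G) (mod_top T) (\<lambda>g. if k < n then lam k g else \<zero>\<^bsub>T\<^esub>)"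
    using lam_continuous[of k] A1.T.continuous_const[of "\<zero>\<^bsub>T\<^esub>"] by (cases "k < n") auto
qed

lemma coord_lifted_cochain:
  "k < Suc n \<Longrightarrow> g \<in> carrier G \<Longrightarrow> A1.coord k (lifted_cochain g) = (if k < n then lam k g else \<zero>\<^bsub>T\<^esub>)"
  unfolding lifted_cochain_def using lam by (simp add: A1.coord_of_coords)

lemma proj_lifted_cochain: "(\<lambda>g\<in>carrier G. proj (lifted_cochain g)) = f"
proof (rule extensionalityI)
  show "f \<in> extensional (carrier G)" using f by (simp add: Z1_def C1_def)
  fix g assume g: "g \<in> carrier G"
  show "(\<lambda>g\<in>carrier G. proj (lifted_cochain g)) g = f g"
    using g A1.TN.C1_eval_closed[OF lifted_cochain_C1 g] module_homD(1)[OF proj.tensor_map_hom]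
    by (intro A0.TN_eqI) (simp_all add: f_closed coord_proj coord_lifted_cochain lam_eq)
qed simp

lemma coord_coboundary1_lifted_cochain:
  assumes "s \<in> pairs G"
  shows "A1.coord n (coboundary1 G A1.TN lifted_cochain s) = massey_cochain s"
proof -
  obtain g h where s: "s = (g, h)" and g: "g \<in> carrier G" and h: "h \<in> carrier G"
    using assms by blast
  have sum: "(\<Oplus>\<^bsub>T\<^esub> l\<in>{..n}. B (n - l) g \<odot>\<^bsub>T\<^esub> act T g (A1.coord l (lifted_cochain h))) = massey_cochain s"
    unfolding massey_cochain_def s using g h
    by (simp, intro A1.T.M.add.finprod_mono_neutral_cong_right)
      (use lam A1.B_closed A1.T.act_closed A1.T.act_zero in \<open>auto simp: coord_lifted_cochain\<close>)
  have "massey_cochain s \<in> carrier T"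
    unfolding massey_cochain_def s using g h lam A1.B_closed A1.T.act_closed by (auto intro!: A1.T.M.finsum_closed)
  then show ?thesis
    using g h A1.coord_coboundary1[OF _ lifted_cochain_C1 g h, of n] sum
    by (simp add: s coord_lifted_cochain a_minus_def)
qed

lemma massey_cochain_Z2: "massey_cochain \<in> Z2 G T"
proof -
  interpret \<kappa>: gmodule_hom R G Ag.TN T "Ag.coord 0" by (rule Ag.coord_gmodule_hom)
  let ?c = "\<lambda>s\<in>pairs G. Ag.pure (A1.coord n (coboundary1 G A1.TN lifted_cochain s)) (e1 n)"
  have "(\<lambda>s\<in>pairs G. Ag.coord 0 (?c s)) \<in> Z2 G T"
    using f by (intro \<kappa>.map_Z2 coboundary1_lift_Z2[OF lifted_cochain_C1]) (simp add: proj_lifted_cochain)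
  moreover have "(\<lambda>s\<in>pairs G. Ag.coord 0 (?c s)) = massey_cochain"
  proof (rule extensionalityI)
    show "massey_cochain \<in> extensional (pairs G)" by (simp add: massey_cochain_def)
    fix s assume s: "s \<in> pairs G"
    have "A1.coord n (coboundary1 G A1.TN lifted_cochain s) \<in> carrier T"
      using A1.TN.Z2_eval_closed[OF A1.TN.coboundary1_Z2[OF lifted_cochain_C1] s] by (simp add: A1.coord_TN_closed)
    then show "(\<lambda>s\<in>pairs G. Ag.coord 0 (?c s)) s = massey_cochain s"
      using s coord_coboundary1_lifted_cochain[OF s] Ag.coord_pure_basis by simp
  qed simp
  ultimately show ?thesis by simp
qed

lemma connecting_class1:
  "connecting G Ag.TN A1.TN incl proj (class1 G A0.TN f) =
    H2_map G Ag.TN (\<lambda>t. Ag.pure t (e1 n)) (class2 G T massey_cochain)"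
proof -
  have basis: "e1 n \<in> carrier Ng" using Ag.e_closed[of 0] by simp
  have "connecting G Ag.TN A1.TN incl proj (class1 G A0.TN f) = class2 G Ag.TN
      (\<lambda>s\<in>pairs G. Ag.pure (A1.coord n (coboundary1 G A1.TN lifted_cochain s)) (e1 n))"
    by (rule connecting_eq[OF lifted_cochain_C1 proj_lifted_cochain f])
  also have "(\<lambda>s\<in>pairs G. Ag.pure (A1.coord n (coboundary1 G A1.TN lifted_cochain s)) (e1 n)) =
      (\<lambda>s\<in>pairs G. Ag.pure (massey_cochain s) (e1 n))"
    by (rule restrict_ext) (simp only: coord_coboundary1_lifted_cochain)
  also have "class2 G Ag.TN \<dots> = H2_map G Ag.TN (\<lambda>t. Ag.pure t (e1 n)) (class2 G T massey_cochain)"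
    by (rule gmodule_hom.H2_map_class2[OF Ag.pure_gmodule_hom[OF basis] massey_cochain_Z2, symmetric])
  finally show ?thesis .
qed

lemma inv_tensor_H2_map_connecting:
  "inv_into (carrier (tensor R (H2 G T) Ng)) Ag.tensor_H2_map
      (connecting G Ag.TN A1.TN incl proj (class1 G A0.TN f)) =
    pure_tensor R (H2 G T) Ng (class2 G T massey_cochain) (e1 n)"
  unfolding connecting_class1
  by (rule Ag.inv_tensor_H2_map[OF A1.T.class2_closed[OF massey_cochain_Z2]])

end

end

section \<open>The \<open>p\<close>-adic integers\<close>

lemma Zp_simps:
  "carrier (Zp p) = Zp_carrier p"
  "(a \<oplus>\<^bsub>Zp p\<^esub> b) k = (a k + b k) mod int p ^ k"
  "(a \<otimes>\<^bsub>Zp p\<^esub> b) k = (a k * b k) mod int p ^ k"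
  "\<zero>\<^bsub>Zp p\<^esub> k = 0" "\<one>\<^bsub>Zp p\<^esub> k = 1 mod int p ^ k"
  by (simp_all add: Zp_def)

lemma Zp_topspace: "topspace (ring_top (Zp p)) = carrier (Zp p)"
  by (simp add: Zp_def)

lemma Zp_component_continuous: "continuous_map (ring_top (Zp p)) (discrete_topology UNIV) (\<lambda>z. F (z j))"
proof -
  have "continuous_map (ring_top (Zp p)) (discrete_topology UNIV) (\<lambda>z. z j)"
    unfolding Zp_def using continuous_map_product_projection[of j UNIV "\<lambda>_. discrete_topology UNIV"]
    by (auto intro: continuous_map_from_subtopology)
  moreover have "continuous_map (discrete_topology UNIV) (discrete_topology UNIV) F" by simp
  ultimately show ?thesis using continuous_map_compose[of _ _ "\<lambda>z. z j" _ F] by (simp add: o_def)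
qed

lemma openin_Zp_component: "openin (ring_top (Zp p)) {z \<in> carrier (Zp p). z j \<in> V}"
  using openin_continuous_map_preimage[OF Zp_component_continuous[where F="\<lambda>i. i"], of V p j]
  by (simp add: Zp_topspace)

definition Zp_int :: "nat \<Rightarrow> int \<Rightarrow> nat \<Rightarrow> int" where
  "Zp_int p z = (\<lambda>k. z mod int p ^ k)"

text \<open>The ideal generated by \<open>p^j\<close>.\<close>

definition p_ideal :: "nat \<Rightarrow> nat \<Rightarrow> (nat \<Rightarrow> int) set" where
  "p_ideal p j = {z \<in> carrier (Zp p). z j = 0}"

locale p_adic =
  fixes p :: nat
  assumes prime_p: "prime p"
begin

lemma p_pos: "int p ^ k > 0"
  using prime_p by (simp add: prime_gt_0_nat)

lemma p_gt_1: "p > 1"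
  using prime_p by (rule prime_gt_1_nat)

lemma prime_int_p: "prime (int p)"
  using prime_p by simp

lemma ZpI:
  assumes "\<And>k. a k mod int p ^ k = a k" "\<And>k. a (Suc k) mod int p ^ k = a k"
  shows "a \<in> carrier (Zp p)"
proof -
  have "0 \<le> a k \<and> a k < int p ^ k" for k
    using pos_mod_bound[OF p_pos, of "a k" k] pos_mod_sign[OF p_pos, of "a k" k] assms(1)[of k] by simp
  then show ?thesis using assms(2) by (simp add: Zp_simps Zp_carrier_def)
qed

lemma ZpD:
  assumes "a \<in> carrier (Zp p)"
  shows "a k mod int p ^ k = a k" "a (Suc k) mod int p ^ k = a k" "0 \<le> a k" "a k < int p ^ k"
  using assms by (auto simp: Zp_simps Zp_carrier_def)

lemma Zp_mod:
  assumes "a \<in> carrier (Zp p)" "m \<le> k"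
  shows "a k mod int p ^ m = a m"
  using assms(2)
proof (induction k rule: dec_induct)
  case base
  then show ?case using ZpD(1)[OF assms(1)] .
next
  case (step k)
  have "a (Suc k) mod int p ^ m = a (Suc k) mod int p ^ k mod int p ^ m"
    using step by (simp add: mod_mod_cancel le_imp_power_dvd)
  then show ?case using step ZpD(2)[OF assms(1)] by simp
qed



lemma Zp_closedI:
  assumes "\<And>k. F (Suc k) mod int p ^ k = F k mod int p ^ k"
  shows "(\<lambda>k. F k mod int p ^ k) \<in> carrier (Zp p)"
  by (rule ZpI) (use assms in \<open>simp_all add: mod_mod_cancel\<close>)

lemma Zp_int_closed: "Zp_int p z \<in> carrier (Zp p)"
  unfolding Zp_int_def by (rule Zp_closedI) simp

lemma Zp_add_closed:
  assumes "a \<in> carrier (Zp p)" "b \<in> carrier (Zp p)"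
  shows "a \<oplus>\<^bsub>Zp p\<^esub> b \<in> carrier (Zp p)"
proof -
  have "(\<lambda>k. (a k + b k) mod int p ^ k) \<in> carrier (Zp p)"
    by (rule Zp_closedI) (metis ZpD(2)[OF assms(1)] ZpD(2)[OF assms(2)] mod_add_eq)
  moreover have "a \<oplus>\<^bsub>Zp p\<^esub> b = (\<lambda>k. (a k + b k) mod int p ^ k)" by (rule ext) (simp add: Zp_simps)
  ultimately show ?thesis by simp
qed

lemma Zp_mult_closed:
  assumes "a \<in> carrier (Zp p)" "b \<in> carrier (Zp p)"
  shows "a \<otimes>\<^bsub>Zp p\<^esub> b \<in> carrier (Zp p)"
proof -
  have "(\<lambda>k. (a k * b k) mod int p ^ k) \<in> carrier (Zp p)"
    by (rule Zp_closedI) (metis ZpD(2)[OF assms(1)] ZpD(2)[OF assms(2)] mod_mult_eq)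
  moreover have "a \<otimes>\<^bsub>Zp p\<^esub> b = (\<lambda>k. (a k * b k) mod int p ^ k)" by (rule ext) (simp add: Zp_simps)
  ultimately show ?thesis by simp
qed

lemma Zp_zero_eq: "\<zero>\<^bsub>Zp p\<^esub> = Zp_int p 0" and Zp_one_eq: "\<one>\<^bsub>Zp p\<^esub> = Zp_int p 1"
  by (simp_all add: Zp_int_def fun_eq_iff Zp_simps)

lemma Zp_cring: "cring (Zp p)"
proof (rule cringI)
  show "abelian_group (Zp p)"
  proof (rule abelian_groupI)
    fix a assume a: "a \<in> carrier (Zp p)"
    show "\<zero>\<^bsub>Zp p\<^esub> \<oplus>\<^bsub>Zp p\<^esub> a = a"
      by (rule ext) (simp add: Zp_simps ZpD(1)[OF a])
    let ?b = "\<lambda>k. (- a k) mod int p ^ k"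
    have "?b \<in> carrier (Zp p)"
      by (rule Zp_closedI) (metis ZpD(2)[OF a] mod_minus_eq)
    moreover have "?b \<oplus>\<^bsub>Zp p\<^esub> a = \<zero>\<^bsub>Zp p\<^esub>"
      by (rule ext) (simp add: Zp_simps mod_simps)
    ultimately show "\<exists>b\<in>carrier (Zp p). b \<oplus>\<^bsub>Zp p\<^esub> a = \<zero>\<^bsub>Zp p\<^esub>" by blast
  qed (auto simp: Zp_add_closed Zp_zero_eq Zp_int_closed fun_eq_iff Zp_simps(2-5) mod_simps algebra_simps)
  show "comm_monoid (Zp p)"
  proof (rule comm_monoidI)
    fix a assume a: "a \<in> carrier (Zp p)"
    show "\<one>\<^bsub>Zp p\<^esub> \<otimes>\<^bsub>Zp p\<^esub> a = a"
      by (rule ext) (simp add: Zp_simps mod_simps ZpD(1)[OF a])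
  qed (auto simp: Zp_mult_closed Zp_one_eq Zp_int_closed fun_eq_iff Zp_simps(2-5) mod_simps algebra_simps)
qed (auto simp: fun_eq_iff Zp_simps(2-5) mod_simps algebra_simps)

sublocale Z: cring "Zp p" by (rule Zp_cring)

lemma Zp_int_add: "Zp_int p (x + y) = Zp_int p x \<oplus>\<^bsub>Zp p\<^esub> Zp_int p y"
  and Zp_int_mult: "Zp_int p (x * y) = Zp_int p x \<otimes>\<^bsub>Zp p\<^esub> Zp_int p y"
  by (simp_all add: Zp_int_def fun_eq_iff Zp_simps mod_simps)

lemma Zp_neg: "a \<in> carrier (Zp p) \<Longrightarrow> (\<ominus>\<^bsub>Zp p\<^esub> a) k = (- a k) mod int p ^ k"
proof -
  assume a: "a \<in> carrier (Zp p)"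
  have "((\<ominus>\<^bsub>Zp p\<^esub> a) k + a k) mod int p ^ k = 0"
    using Z.l_neg[OF a] by (metis Zp_simps(2) Zp_simps(4))
  then have "(\<ominus>\<^bsub>Zp p\<^esub> a) k mod int p ^ k = (- a k) mod int p ^ k"
    by (metis (no_types) add_diff_cancel_right' diff_0 mod_diff_left_eq)
  then show ?thesis using ZpD(1)[OF Z.a_inv_closed[OF a]] by simp
qed

lemma Zp_minus: "a \<in> carrier (Zp p) \<Longrightarrow> b \<in> carrier (Zp p) \<Longrightarrow>
    (a \<ominus>\<^bsub>Zp p\<^esub> b) k = (a k - b k) mod int p ^ k"
  by (simp add: a_minus_def Zp_simps Zp_neg mod_simps)

lemma Zp_minus_eq_zero_iff:
  assumes "z \<in> carrier (Zp p)" "w \<in> carrier (Zp p)"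
  shows "(z \<ominus>\<^bsub>Zp p\<^esub> w) j = 0 \<longleftrightarrow> z j = w j"
proof -
  have "(z j - w j) mod int p ^ j = 0 \<longleftrightarrow> z j mod int p ^ j = w j mod int p ^ j"
    by (simp add: mod_eq_dvd_iff mod_eq_0_iff_dvd)
  then show ?thesis using assms ZpD(1) by (simp add: Zp_minus)
qed

lemma Zp_component_zero_mono: "z \<in> carrier (Zp p) \<Longrightarrow> z j = 0 \<Longrightarrow> i \<le> j \<Longrightarrow> z i = 0"
  using Zp_mod[of z i j] by simp

lemma Zp_int_p_power_nonzero: "Zp_int p (int p ^ a) \<noteq> \<zero>\<^bsub>Zp p\<^esub>"
proof
  assume "Zp_int p (int p ^ a) = \<zero>\<^bsub>Zp p\<^esub>"
  then have "Zp_int p (int p ^ a) (Suc a) = 0" by (simp add: Zp_simps)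
  then have "int p ^ a mod int p ^ Suc a = 0" by (simp add: Zp_int_def)
  moreover have "int p ^ a mod int p ^ Suc a = int p ^ a"
    using p_gt_1 by (intro mod_pos_pos_trivial) (auto intro: power_strict_increasing)
  ultimately show False using p_gt_1 by simp
qed

lemma Zp_add_pow: "a \<in> carrier (Zp p) \<Longrightarrow> ([(n::nat)] \<cdot>\<^bsub>Zp p\<^esub> a) = Zp_int p (int n) \<otimes>\<^bsub>Zp p\<^esub> a"
proof (induction n)
  case 0
  then show ?case by (simp add: Zp_zero_eq[symmetric])
next
  case (Suc n)
  have "Zp_int p (int (Suc n)) = Zp_int p (int n) \<oplus>\<^bsub>Zp p\<^esub> \<one>\<^bsub>Zp p\<^esub>"
    by (simp add: Zp_one_eq Zp_int_add[symmetric] add.commute)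
  then show ?case
    using Suc by (simp add: Z.add.nat_pow_Suc Z.l_distr Zp_int_closed)
qed

lemma Zp_int_mult_eval: "a \<in> carrier (Zp p) \<Longrightarrow> (Zp_int p x \<otimes>\<^bsub>Zp p\<^esub> a) k = (x * a k) mod int p ^ k"
  by (simp add: Zp_int_def Zp_simps mod_simps)

lemma p_ideal_E:
  assumes "z \<in> p_ideal p m"
  obtains y where "y \<in> carrier (Zp p)" "z = Zp_int p (int p ^ m) \<otimes>\<^bsub>Zp p\<^esub> y"
    "\<And>k. y k = z (k + m) div int p ^ m"
proof -
  have z: "z \<in> carrier (Zp p)" "z m = 0" using assms by (auto simp: p_ideal_def)
  have dvd: "int p ^ m dvd z (k + m)" for k
    using Zp_mod[OF z(1), of m "k + m"] z(2) by (simp add: mod_eq_0_iff_dvd)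
  define y where "y = (\<lambda>k. z (k + m) div int p ^ m)"
  have z_shift: "z (k + m) = int p ^ m * y k" for k
    using dvd by (simp add: y_def)
  have y: "y \<in> carrier (Zp p)"
  proof (rule ZpI)
    fix k
    have "int p ^ m * y k mod (int p ^ m * int p ^ k) = int p ^ m * y k"
      using ZpD(1)[OF z(1), of "k + m"] z_shift[of k] by (simp add: power_add mult.commute)
    then show "y k mod int p ^ k = y k"
      using p_gt_1 by (simp add: mult_mod_right[symmetric])
    have "int p ^ m * y (Suc k) mod (int p ^ m * int p ^ k) = int p ^ m * y k"
      using ZpD(2)[OF z(1), of "k + m"] z_shift[of "Suc k"] z_shift[of k]
      by (simp add: power_add mult.commute)
    then show "y (Suc k) mod int p ^ k = y k"
      using p_gt_1 by (simp add: mult_mod_right[symmetric])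
  qed
  have "z = Zp_int p (int p ^ m) \<otimes>\<^bsub>Zp p\<^esub> y"
  proof
    fix k
    have "(int p ^ m * y k) mod int p ^ k = z k"
      using Zp_mod[OF z(1), of k "k + m"] z_shift[of k] by simp
    then show "z k = (Zp_int p (int p ^ m) \<otimes>\<^bsub>Zp p\<^esub> y) k"
      by (simp add: Zp_int_mult_eval[OF y])
  qed
  from that[OF y this] show ?thesis by (simp add: y_def)
qed

lemma p_ideal_multiple: "y \<in> carrier (Zp p) \<Longrightarrow> Zp_int p (int p ^ m) \<otimes>\<^bsub>Zp p\<^esub> y \<in> p_ideal p m"
  by (simp add: p_ideal_def Zp_int_closed Zp_int_mult_eval)

lemma Zp_truncate:
  assumes "z \<in> carrier (Zp p)"
  obtains y where "y \<in> carrier (Zp p)"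
    "z = Zp_int p (z K) \<oplus>\<^bsub>Zp p\<^esub> Zp_int p (int p ^ K) \<otimes>\<^bsub>Zp p\<^esub> y"
proof -
  have "z \<ominus>\<^bsub>Zp p\<^esub> Zp_int p (z K) \<in> p_ideal p K"
    using assms by (simp add: p_ideal_def Zp_int_closed Zp_minus) (simp add: Zp_int_def mod_simps)
  then obtain y where "y \<in> carrier (Zp p)" "z \<ominus>\<^bsub>Zp p\<^esub> Zp_int p (z K) = Zp_int p (int p ^ K) \<otimes>\<^bsub>Zp p\<^esub> y"
    by (rule p_ideal_E)
  then show ?thesis
    using that Z.add_minus_cancel[OF Zp_int_closed assms] by metis
qed

lemma Zp_unit:
  assumes z: "z \<in> carrier (Zp p)" "z 1 \<noteq> 0"
  obtains w where "w \<in> carrier (Zp p)" "z \<otimes>\<^bsub>Zp p\<^esub> w = \<one>\<^bsub>Zp p\<^esub>"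
proof -
  have coprime: "coprime (z k) (int p ^ k)" for k
  proof (cases "k = 0")
    case False
    have "z k mod int p = z 1" using Zp_mod[OF z(1), of 1 k] False by simp
    then have "\<not> int p dvd z k" using z(2) by auto
    then have "coprime (int p) (z k)" by (rule prime_imp_coprime[OF prime_int_p])
    then show ?thesis by (simp add: coprime_commute)
  qed simp
  have "\<exists>w. [z k * w = 1] (mod int p ^ k)" for k
    using cong_solve_coprime_int[OF coprime] by blast
  then obtain w where w: "\<And>k. [z k * w k = 1] (mod int p ^ k)" by metis
  have "(\<lambda>k. w k mod int p ^ k) \<in> carrier (Zp p)"
  proof (rule Zp_closedI)
    fix k
    have "[z k = z (Suc k)] (mod int p ^ k)"
      using ZpD(1,2)[OF z(1), of k] by (simp add: cong_def)
    then have "[z k * w (Suc k) = z (Suc k) * w (Suc k)] (mod int p ^ k)"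
      by (rule cong_mult) simp
    also have "[z (Suc k) * w (Suc k) = 1] (mod int p ^ k)"
      by (rule cong_dvd_modulus[OF w[of "Suc k"]]) (simp add: le_imp_power_dvd)
    also have "[1 = z k * w k] (mod int p ^ k)"
      by (rule cong_sym[OF w])
    finally have "[w (Suc k) = w k] (mod int p ^ k)"
      using coprime[of k] by (simp add: cong_mult_lcancel)
    then show "w (Suc k) mod int p ^ k = w k mod int p ^ k" by (simp add: cong_def)
  qed
  moreover have "z \<otimes>\<^bsub>Zp p\<^esub> (\<lambda>k. w k mod int p ^ k) = \<one>\<^bsub>Zp p\<^esub>"
    using w by (simp add: fun_eq_iff Zp_simps mod_simps cong_def)
  ultimately show ?thesis using that by blast
qed

lemma Zp_factor:
  assumes "z \<in> carrier (Zp p)" "z i \<noteq> 0"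
  obtains v u where "v < i" "u \<in> carrier (Zp p)" "u 1 \<noteq> 0" "z = Zp_int p (int p ^ v) \<otimes>\<^bsub>Zp p\<^esub> u"
proof -
  define w where "w = (LEAST i. z i \<noteq> 0)"
  have w: "z w \<noteq> 0" "w \<le> i" and below_w: "\<And>j. j < w \<Longrightarrow> z j = 0"
    unfolding w_def using LeastI[of "\<lambda>i. z i \<noteq> 0", OF assms(2)] assms(2)
    by (auto intro: Least_le dest: not_less_Least)
  have "z 0 = 0" using ZpD(3,4)[OF assms(1), of 0] by simp
  then obtain v where v: "w = Suc v" using w(1) by (cases w) auto
  have "z \<in> p_ideal p v" using assms(1) below_w[of v] v by (simp add: p_ideal_def)
  then obtain u where u: "u \<in> carrier (Zp p)" "z = Zp_int p (int p ^ v) \<otimes>\<^bsub>Zp p\<^esub> u"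
    "\<And>k. u k = z (k + v) div int p ^ v"
    by (rule p_ideal_E) blast
  have "u 1 \<noteq> 0"
  proof
    assume "u 1 = 0"
    moreover have "int p ^ v dvd z (Suc v)"
      using Zp_mod[OF assms(1), of v "Suc v"] below_w[of v] v by (simp add: mod_eq_0_iff_dvd)
    ultimately have "z (Suc v) = 0" using u(3)[of 1] by (metis dvd_div_eq_0_iff plus_1_eq_Suc)
    with w(1) v show False by simp
  qed
  with u w(2) v that[of v u] show ?thesis by simp
qed

subsection \<open>Subgroups of finite index\<close>

lemma p_ideal_subset_multiples:
  assumes u: "u \<in> carrier (Zp p)" "u 1 \<noteq> 0" and "z \<in> p_ideal p v"
  obtains s where "s \<in> carrier (Zp p)" "z = (Zp_int p (int p ^ v) \<otimes>\<^bsub>Zp p\<^esub> u) \<otimes>\<^bsub>Zp p\<^esub> s"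
proof -
  obtain w where w: "w \<in> carrier (Zp p)" "u \<otimes>\<^bsub>Zp p\<^esub> w = \<one>\<^bsub>Zp p\<^esub>"
    using Zp_unit[OF u] .
  obtain y where y: "y \<in> carrier (Zp p)" "z = Zp_int p (int p ^ v) \<otimes>\<^bsub>Zp p\<^esub> y"
    using p_ideal_E[OF assms(3)] by metis
  have "(Zp_int p (int p ^ v) \<otimes>\<^bsub>Zp p\<^esub> u) \<otimes>\<^bsub>Zp p\<^esub> (w \<otimes>\<^bsub>Zp p\<^esub> y) =
      Zp_int p (int p ^ v) \<otimes>\<^bsub>Zp p\<^esub> ((u \<otimes>\<^bsub>Zp p\<^esub> w) \<otimes>\<^bsub>Zp p\<^esub> y)"
    using u(1) w(1) y(1) by (simp add: Z.m_assoc Zp_int_closed)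
  then show ?thesis
    using that[of "w \<otimes>\<^bsub>Zp p\<^esub> y"] w y by simp
qed

lemma ideal_contains_p_ideal:
  assumes mult: "\<And>b s. b \<in> B \<Longrightarrow> s \<in> carrier (Zp p) \<Longrightarrow> b \<otimes>\<^bsub>Zp p\<^esub> s \<in> B"
    and b: "b \<in> B" "b \<in> carrier (Zp p)" "b i \<noteq> 0"
  shows "\<exists>v<i. p_ideal p v \<subseteq> B"
proof -
  obtain v u where v: "v < i" and u: "u \<in> carrier (Zp p)" "u 1 \<noteq> 0"
    and b_eq: "b = Zp_int p (int p ^ v) \<otimes>\<^bsub>Zp p\<^esub> u"
    using Zp_factor[OF b(2,3)] by blast
  have "z \<in> B" if z: "z \<in> p_ideal p v" for z
    using p_ideal_subset_multiples[OF u z] mult[OF b(1)] unfolding b_eq by metis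
  then show ?thesis using v by blast
qed

lemma ideal_eq_p_ideal:
  assumes mult: "\<And>b s. b \<in> B \<Longrightarrow> s \<in> carrier (Zp p) \<Longrightarrow> b \<otimes>\<^bsub>Zp p\<^esub> s \<in> B"
    and B: "B \<subseteq> carrier (Zp p)" and j: "p_ideal p j \<subseteq> B"
  shows "\<exists>i. B = p_ideal p i"
proof -
  define i where "i = (LEAST i. p_ideal p i \<subseteq> B)"
  have i: "p_ideal p i \<subseteq> B" and least: "\<And>v. v < i \<Longrightarrow> \<not> p_ideal p v \<subseteq> B"
    unfolding i_def using LeastI[of "\<lambda>i. p_ideal p i \<subseteq> B", OF j] by (fast, auto dest: not_less_Least)
  have "b i = 0" if "b \<in> B" for b
    using ideal_contains_p_ideal[OF mult that, of i] least that B by blast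
  then have "B = p_ideal p i" using i B by (auto simp: p_ideal_def)
  then show ?thesis by blast
qed

lemma zero_or_p_ideal:
  assumes "\<And>b s. b \<in> B \<Longrightarrow> s \<in> carrier (Zp p) \<Longrightarrow> b \<otimes>\<^bsub>Zp p\<^esub> s \<in> B" and B: "B \<subseteq> carrier (Zp p)"
  shows "B \<subseteq> {\<zero>\<^bsub>Zp p\<^esub>} \<or> (\<exists>i. B = p_ideal p i)"
proof (cases "B \<subseteq> {\<zero>\<^bsub>Zp p\<^esub>}")
  case False
  then obtain z where "z \<in> B" "z \<noteq> \<zero>\<^bsub>Zp p\<^esub>" by blast
  then obtain i where z: "z \<in> B" "z i \<noteq> 0" using Zp_simps(4) by (metis ext)
  then show ?thesis
    using ideal_contains_p_ideal[OF assms(1) z(1) _ z(2)] ideal_eq_p_ideal[OF assms] B by blast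
qed simp

lemma Zp_int_smult_mem:
  assumes "\<And>a b. a \<in> B \<Longrightarrow> b \<in> B \<Longrightarrow> a \<oplus>\<^bsub>Zp p\<^esub> b \<in> B" "\<zero>\<^bsub>Zp p\<^esub> \<in> B" "B \<subseteq> carrier (Zp p)" "b \<in> B"
  shows "b \<otimes>\<^bsub>Zp p\<^esub> Zp_int p (int n) \<in> B"
proof (induction n)
  case 0
  then show ?case using assms by (auto simp: Zp_zero_eq[symmetric])
next
  case (Suc n)
  have "b \<otimes>\<^bsub>Zp p\<^esub> Zp_int p (int (Suc n)) = b \<otimes>\<^bsub>Zp p\<^esub> Zp_int p (int n) \<oplus>\<^bsub>Zp p\<^esub> b"
    using assms(3,4) by (simp add: Zp_int_add Zp_one_eq[symmetric] Z.r_distr Zp_int_closed Z.a_comm subset_eq)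
  then show ?case using Suc assms(1,4) by simp
qed

lemma subgroup_eq_p_ideal:
  assumes add: "\<And>a b. a \<in> B \<Longrightarrow> b \<in> B \<Longrightarrow> a \<oplus>\<^bsub>Zp p\<^esub> b \<in> B" and B: "B \<subseteq> carrier (Zp p)"
    and j: "p_ideal p j \<subseteq> B"
  shows "\<exists>i. B = p_ideal p i"
proof (rule ideal_eq_p_ideal[OF _ B j])
  fix b s assume b: "b \<in> B" and s: "s \<in> carrier (Zp p)"
  then have b': "b \<in> carrier (Zp p)" using B by blast
  have zero: "\<zero>\<^bsub>Zp p\<^esub> \<in> B" using j by (auto simp: p_ideal_def Zp_simps(4))
  obtain t where t: "t \<in> carrier (Zp p)" "s = Zp_int p (s j) \<oplus>\<^bsub>Zp p\<^esub> Zp_int p (int p ^ j) \<otimes>\<^bsub>Zp p\<^esub> t"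
    using Zp_truncate[OF s] .
  have "b \<otimes>\<^bsub>Zp p\<^esub> Zp_int p (s j) \<in> B"
    using Zp_int_smult_mem[OF add zero B b, of "nat (s j)"] ZpD(3)[OF s] by simp
  moreover have "Zp_int p (int p ^ j) \<otimes>\<^bsub>Zp p\<^esub> (b \<otimes>\<^bsub>Zp p\<^esub> t) \<in> B"
    using p_ideal_multiple[of "b \<otimes>\<^bsub>Zp p\<^esub> t" j] b' t(1) j by auto
  moreover have "b \<otimes>\<^bsub>Zp p\<^esub> s = b \<otimes>\<^bsub>Zp p\<^esub> Zp_int p (s j) \<oplus>\<^bsub>Zp p\<^esub> Zp_int p (int p ^ j) \<otimes>\<^bsub>Zp p\<^esub> (b \<otimes>\<^bsub>Zp p\<^esub> t)"
    by (subst t(2)) (use b' t(1) in \<open>simp add: Z.r_distr Zp_int_closed Z.m_lcomm\<close>)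
  ultimately show "b \<otimes>\<^bsub>Zp p\<^esub> s \<in> B" using add by simp
qed

lemma finite_index_contains_p_ideal:
  assumes m: "0 < m" and B: "\<And>z. z \<in> carrier (Zp p) \<Longrightarrow> Zp_int p (int m) \<otimes>\<^bsub>Zp p\<^esub> z \<in> B"
  shows "\<exists>j. p_ideal p j \<subseteq> B"
proof -
  obtain v u where u: "\<not> p dvd u" "m = p ^ v * u"
    using multiplicity_decompose'[of m p] m p_gt_1 prime_p by (metis gr_implies_not0 not_prime_unit)
  have unit: "Zp_int p (int u) 1 \<noteq> 0"
    using u(1) by (simp add: Zp_int_def) (metis int_dvd_int_iff mod_eq_0_iff_dvd of_nat_mod of_nat_0 of_nat_eq_0_iff)
  have "Zp_int p (int m) = Zp_int p (int p ^ v) \<otimes>\<^bsub>Zp p\<^esub> Zp_int p (int u)"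
    using u(2) by (simp add: Zp_int_mult)
  then have "z \<in> B" if "z \<in> p_ideal p v" for z
    using p_ideal_subset_multiples[OF Zp_int_closed unit that] B by metis
  then show ?thesis by blast
qed

subsection \<open>Recursion and binomial coefficients\<close>

lemma Zp_recursion:
  assumes d: "\<And>k. d k \<in> carrier (Zp p)"
  obtains c where "\<And>k. c k \<in> carrier (Zp p)"
    "\<And>k. c k = d k \<oplus>\<^bsub>Zp p\<^esub> Zp_int p (int p) \<otimes>\<^bsub>Zp p\<^esub> c (Suc k)"
proof -
  define c where "c k = (\<lambda>m. (\<Sum>l<m. int p ^ l * d (k + l) m) mod int p ^ m)" for k
  have c_closed: "c k \<in> carrier (Zp p)" for k
    unfolding c_def
  proof (rule Zp_closedI)
    fix m
    have "(\<Sum>l<Suc m. int p ^ l * d (k + l) (Suc m)) mod int p ^ m =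
        (\<Sum>l<m. int p ^ l * d (k + l) (Suc m)) mod int p ^ m"
      by (simp add: mod_add_right_eq[symmetric] mod_mult_self1_is_0)
    also have "\<dots> = (\<Sum>l<m. (int p ^ l * d (k + l) (Suc m)) mod int p ^ m) mod int p ^ m"
      by (simp add: mod_sum_eq)
    also have "(\<Sum>l<m. (int p ^ l * d (k + l) (Suc m)) mod int p ^ m) =
        (\<Sum>l<m. (int p ^ l * d (k + l) m) mod int p ^ m)"
      by (intro sum.cong refl) (metis ZpD(2)[OF d] mod_mult_right_eq)
    also have "\<dots> mod int p ^ m = (\<Sum>l<m. int p ^ l * d (k + l) m) mod int p ^ m"
      by (simp add: mod_sum_eq)
    finally show "(\<Sum>l<Suc m. int p ^ l * d (k + l) (Suc m)) mod int p ^ m =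
        (\<Sum>l<m. int p ^ l * d (k + l) m) mod int p ^ m" .
  qed
  have "c k = d k \<oplus>\<^bsub>Zp p\<^esub> Zp_int p (int p) \<otimes>\<^bsub>Zp p\<^esub> c (Suc k)" for k
  proof
    fix m
    have "(d k \<oplus>\<^bsub>Zp p\<^esub> Zp_int p (int p) \<otimes>\<^bsub>Zp p\<^esub> c (Suc k)) m =
        (d k m + int p * (\<Sum>l<m. int p ^ l * d (Suc k + l) m)) mod int p ^ m"
      by (simp add: Zp_simps(2) Zp_int_mult_eval[OF c_closed]) (simp add: c_def mod_simps)
    also have "d k m + int p * (\<Sum>l<m. int p ^ l * d (Suc k + l) m) = (\<Sum>l<Suc m. int p ^ l * d (k + l) m)"
      by (subst sum.lessThan_Suc_shift) (simp add: sum_distrib_left mult.assoc)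
    also have "\<dots> mod int p ^ m = (\<Sum>l<m. int p ^ l * d (k + l) m) mod int p ^ m"
      by (simp add: mod_add_right_eq[symmetric] mod_mult_self1_is_0)
    finally show "c k m = (d k \<oplus>\<^bsub>Zp p\<^esub> Zp_int p (int p) \<otimes>\<^bsub>Zp p\<^esub> c (Suc k)) m"
      by (simp add: c_def)
  qed
  with c_closed that show ?thesis by blast
qed

definition fact_multiplicity :: "nat \<Rightarrow> nat" where
  "fact_multiplicity k = multiplicity p (fact k :: nat)"

lemma fact_dvd_cancel:
  assumes "int p ^ (m + fact_multiplicity k) dvd fact k * x"
  shows "int p ^ m dvd x"
proof -
  let ?v = "fact_multiplicity k"
  obtain u where u: "\<not> p dvd u" "(fact k :: nat) = p ^ ?v * u"
    using multiplicity_decompose'[of "fact k :: nat" p] p_gt_1 prime_p unfolding fact_multiplicity_def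
    by (metis fact_nonzero not_prime_unit)
  have "(fact k :: int) = int p ^ ?v * int u"
    using arg_cong[OF u(2), of int] by simp
  then have "int p ^ ?v * int p ^ m dvd int p ^ ?v * (int u * x)"
    using assms by (simp add: power_add mult_ac)
  then have "int p ^ m dvd int u * x"
    using p_pos[of ?v] by (metis dvd_mult_cancel_left less_irrefl)
  moreover have "coprime (int p ^ m) (int u)"
    using prime_imp_coprime[OF prime_int_p, of "int u"] u(1) by simp
  ultimately show ?thesis
    by (simp add: coprime_dvd_mult_right_iff)
qed

lemma fact_mult_binomial: "(fact k :: int) * int (x choose k) = (\<Prod>i<k. int x - int i)"
proof -
  have "real_of_int (fact k * int (x choose k)) = fact k * (real x gchoose k)"
    by (simp add: binomial_gbinomial)
  also have "\<dots> = (\<Prod>i<k. real x - real i)"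
    by (simp add: gbinomial_mult_fact atLeast0LessThan)
  also have "\<dots> = real_of_int (\<Prod>i<k. int x - int i)" by simp
  finally show ?thesis by (simp only: of_int_eq_iff)
qed

lemma binomial_cong:
  assumes "[int x = int y] (mod int p ^ (m + fact_multiplicity k))"
  shows "[int (x choose k) = int (y choose k)] (mod int p ^ m)"
proof -
  have "[\<Prod>i<k. int x - int i = \<Prod>i<k. int y - int i] (mod int p ^ (m + fact_multiplicity k))"
    by (intro cong_prod cong_diff assms cong_refl)
  then have "int p ^ (m + fact_multiplicity k) dvd fact k * (int (x choose k) - int (y choose k))"
    unfolding fact_mult_binomial[symmetric] by (simp add: cong_iff_dvd_diff right_diff_distrib)
  from fact_dvd_cancel[OF this] show ?thesis
    by (simp add: cong_iff_dvd_diff)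
qed

lemma Zp_fact_mult: "c \<in> carrier (Zp p) \<Longrightarrow> ([(fact k :: nat)] \<cdot>\<^bsub>Zp p\<^esub> c) m = (fact k * c m) mod int p ^ m"
  by (simp add: Zp_add_pow Zp_int_mult_eval)

lemma Zp_fact_cancel:
  assumes c: "c \<in> carrier (Zp p)" and b: "b \<in> carrier (Zp p)"
    and eq: "[(fact k :: nat)] \<cdot>\<^bsub>Zp p\<^esub> c = [(fact k :: nat)] \<cdot>\<^bsub>Zp p\<^esub> b"
  shows "c = b"
proof
  fix m
  let ?K = "m + fact_multiplicity k"
  have "(fact k * c ?K) mod int p ^ ?K = (fact k * b ?K) mod int p ^ ?K"
    using fun_cong[OF eq, of ?K] by (simp add: Zp_fact_mult c b)
  then have "int p ^ m dvd c ?K - b ?K"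
    by (intro fact_dvd_cancel[of m k]) (simp add: mod_eq_dvd_iff right_diff_distrib)
  then show "c m = b m"
    using Zp_mod[OF c, of m ?K] Zp_mod[OF b, of m ?K] by (simp flip: mod_eq_dvd_iff)
qed

lemma Zp_finprod:
  fixes k :: nat
  assumes "\<And>i. i < k \<Longrightarrow> f i \<in> carrier (Zp p)"
  shows "(\<Otimes>\<^bsub>Zp p\<^esub>i\<in>{..<k}. f i) m = (\<Prod>i<k. f i m) mod int p ^ m"
  using assms
proof (induction k)
  case 0
  then show ?case by (simp add: Zp_simps)
next
  case (Suc k)
  have "(\<Otimes>\<^bsub>Zp p\<^esub>i\<in>{..<Suc k}. f i) = f k \<otimes>\<^bsub>Zp p\<^esub> (\<Otimes>\<^bsub>Zp p\<^esub>i\<in>{..<k}. f i)"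
    unfolding lessThan_Suc using Suc.prems by (intro Z.finprod_insert) auto
  then show ?case
    using Suc by (simp add: Zp_simps mod_simps mult.commute)
qed

lemma Zp_falling_factorial:
  assumes z: "z \<in> carrier (Zp p)"
  shows "(\<Otimes>\<^bsub>Zp p\<^esub>i\<in>{..<k}. z \<ominus>\<^bsub>Zp p\<^esub> ([i] \<cdot>\<^bsub>Zp p\<^esub> \<one>\<^bsub>Zp p\<^esub>)) m = (\<Prod>i<k. z m - int i) mod int p ^ m"
proof -
  have "[(z \<ominus>\<^bsub>Zp p\<^esub> ([i] \<cdot>\<^bsub>Zp p\<^esub> \<one>\<^bsub>Zp p\<^esub>)) m = z m - int i] (mod int p ^ m)" for i
    using z by (simp add: cong_def Zp_add_pow Zp_minus Zp_int_closed) (simp add: Zp_int_def mod_simps)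
  then have "[\<Prod>i<k. (z \<ominus>\<^bsub>Zp p\<^esub> ([i] \<cdot>\<^bsub>Zp p\<^esub> \<one>\<^bsub>Zp p\<^esub>)) m = \<Prod>i<k. z m - int i] (mod int p ^ m)"
    by (rule cong_prod)
  then show ?thesis
    using z by (subst Zp_finprod) (auto simp: cong_def)
qed

lemma binomial_residue_cong:
  assumes z: "z \<in> carrier (Zp p)" and K: "m + fact_multiplicity k \<le> K"
  shows "int (nat (z K) choose k) mod int p ^ m =
    int (nat (z (m + fact_multiplicity k)) choose k) mod int p ^ m"
  using Zp_mod[OF z K] ZpD(3)[OF z] ZpD(1)[OF z] binomial_cong by (simp add: cong_def)

lemma Zp_binom_eq:
  assumes z: "z \<in> carrier (Zp p)"
  shows "Zp_binom p z k \<in> carrier (Zp p) \<and>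
    Zp_binom p z k = (\<lambda>m. int (nat (z (m + fact_multiplicity k)) choose k) mod int p ^ m)"
proof -
  define b where "b = (\<lambda>m. int (nat (z (m + fact_multiplicity k)) choose k) mod int p ^ m)"
  have b: "b \<in> carrier (Zp p)"
    unfolding b_def by (rule Zp_closedI) (rule binomial_residue_cong[OF z], simp)
  have fact_b: "[(fact k :: nat)] \<cdot>\<^bsub>Zp p\<^esub> b = (\<Otimes>\<^bsub>Zp p\<^esub>i\<in>{..<k}. z \<ominus>\<^bsub>Zp p\<^esub> ([i] \<cdot>\<^bsub>Zp p\<^esub> \<one>\<^bsub>Zp p\<^esub>))"
  proof
    fix m
    let ?K = "m + fact_multiplicity k"
    have "([(fact k :: nat)] \<cdot>\<^bsub>Zp p\<^esub> b) m = (fact k * int (nat (z ?K) choose k)) mod int p ^ m"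
      by (simp add: Zp_fact_mult[OF b]) (simp add: b_def mod_simps)
    also have "\<dots> = (\<Prod>i<k. z ?K - int i) mod int p ^ m"
      using ZpD(3)[OF z] by (simp add: fact_mult_binomial)
    also have "\<dots> = (\<Prod>i<k. z m - int i) mod int p ^ m"
      unfolding cong_def[symmetric] using Zp_mod[OF z, of m ?K] ZpD(1)[OF z, of m]
      by (intro cong_prod cong_diff cong_refl) (simp add: cong_def)
    finally show "([(fact k :: nat)] \<cdot>\<^bsub>Zp p\<^esub> b) m =
        (\<Otimes>\<^bsub>Zp p\<^esub>i\<in>{..<k}. z \<ominus>\<^bsub>Zp p\<^esub> ([i] \<cdot>\<^bsub>Zp p\<^esub> \<one>\<^bsub>Zp p\<^esub>)) m"
      by (simp add: Zp_falling_factorial[OF z])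
  qed
  have "Zp_binom p z k = b"
    unfolding Zp_binom_def fact_b[symmetric] using b by (blast intro: the_equality Zp_fact_cancel)
  with b show ?thesis by (simp add: b_def)
qed

lemma Zp_binom_closed: "z \<in> carrier (Zp p) \<Longrightarrow> Zp_binom p z k \<in> carrier (Zp p)"
  using Zp_binom_eq by blast

lemma Zp_binom_component:
  assumes "z \<in> carrier (Zp p)" "m + fact_multiplicity k \<le> K"
  shows "Zp_binom p z k m = int (nat (z K) choose k) mod int p ^ m"
  using Zp_binom_eq[OF assms(1), of k] binomial_residue_cong[OF assms] by simp

lemma prime_power_dvd_binomial:
  assumes k: "1 \<le> k" "k \<le> n" and size: "n * p ^ r < p * p ^ a"
  shows "p ^ r dvd (p ^ a choose k)"
proof -
  define v where "v = multiplicity p k"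
  obtain u where u: "k = p ^ v * u" "\<not> p dvd u"
    using multiplicity_decompose'[of k p] k prime_p p_gt_1 unfolding v_def
    by (metis less_irrefl not_one_le_zero nat_dvd_1_iff_1)
  have "p ^ v \<le> k" using u k by (cases u) auto
  then have "p ^ v * p ^ r \<le> n * p ^ r" using k by (intro mult_right_mono) auto
  from le_less_trans[OF this size] have "p ^ (v + r) < p ^ Suc a" by (simp only: power_add power_Suc)
  from power_less_imp_less_exp[OF p_gt_1 this] have exponents: "v + r \<le> a" by simp
  have "k * (p ^ a choose k) = p ^ a * (p ^ a - 1 choose (k - 1))"
    using times_binomial_minus1_eq[of k "p ^ a"] k by simp
  moreover have "p ^ a = p ^ v * p ^ (a - v)" using exponents by (simp flip: power_add)
  ultimately have "p ^ v * (u * (p ^ a choose k)) = p ^ v * (p ^ (a - v) * (p ^ a - 1 choose (k - 1)))"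
    using u(1) by (metis mult.assoc)
  then have "u * (p ^ a choose k) = p ^ (a - v) * (p ^ a - 1 choose (k - 1))"
    using p_gt_1 by simp
  then have "p ^ (a - v) dvd u * (p ^ a choose k)" by simp
  moreover have "coprime (p ^ (a - v)) u"
    using u(2) prime_p by (simp add: prime_imp_coprime)
  ultimately have "p ^ (a - v) dvd (p ^ a choose k)" by (simp add: coprime_dvd_mult_right_iff)
  moreover have "p ^ r dvd p ^ (a - v)" using exponents by (intro le_imp_power_dvd) simp
  ultimately show ?thesis by (rule dvd_trans[rotated])
qed

lemma Zp_binom_continuous: "continuous_map (ring_top (Zp p)) (ring_top (Zp p)) (\<lambda>z. Zp_binom p z k)"
proof -
  have "continuous_map (ring_top (Zp p)) (discrete_topology UNIV) (\<lambda>z. Zp_binom p z k m)" for m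
    by (rule continuous_map_eq[OF Zp_component_continuous[where j="m + fact_multiplicity k"
        and F="\<lambda>i. int (nat i choose k) mod int p ^ m"]])
      (simp add: Zp_topspace Zp_binom_component[OF _ le_refl])
  then have "continuous_map (ring_top (Zp p)) (product_topology (\<lambda>_. discrete_topology UNIV) UNIV) (\<lambda>z. Zp_binom p z k)"
    by (simp add: continuous_map_componentwise_UNIV)
  moreover have "(\<lambda>z. Zp_binom p z k) \<in> topspace (ring_top (Zp p)) \<rightarrow> Zp_carrier p"
    using Zp_binom_closed[of _ k] by (auto simp: Zp_topspace Zp_simps(1))
  ultimately have "continuous_map (ring_top (Zp p))
      (subtopology (product_topology (\<lambda>_. discrete_topology UNIV) UNIV) (Zp_carrier p)) (\<lambda>z. Zp_binom p z k)"
    unfolding continuous_map_in_subtopology by blast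
  then show ?thesis by (simp add: Zp_def)
qed

end

section \<open>Truncated power series expansions\<close>

locale augmented_ring = S: cring S + R: cring R + const: ring_hom_cring R S \<iota> + aug: ring_hom_cring S R aug
  for S :: "('s, 'x) ring_scheme" (structure) and R :: "('r, 'y) ring_scheme"
    and \<iota> :: "'r \<Rightarrow> 's" and aug :: "'s \<Rightarrow> 'r" +
  fixes x :: 's
  assumes aug_const: "r \<in> carrier R \<Longrightarrow> aug (\<iota> r) = r"
    and x_closed: "x \<in> carrier S" and aug_x: "aug x = \<zero>\<^bsub>R\<^esub>"
    and aug_kernel: "a \<in> carrier S \<Longrightarrow> aug a = \<zero>\<^bsub>R\<^esub> \<Longrightarrow> \<exists>b\<in>carrier S. a = x \<otimes> b"
begin

primrec horner :: "nat \<Rightarrow> (nat \<Rightarrow> 'r) \<Rightarrow> 's" where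
  "horner 0 f = \<zero>"
| "horner (Suc m) f = \<iota> (f 0) \<oplus> x \<otimes> horner m (\<lambda>k. f (Suc k))"

lemma horner_closed: "(\<And>k. f k \<in> carrier R) \<Longrightarrow> horner m f \<in> carrier S"
  by (induction m arbitrary: f) (auto simp: x_closed)

lemma horner_add:
  assumes "\<And>k. f k \<in> carrier R" "\<And>k. g k \<in> carrier R"
  shows "horner m (\<lambda>k. f k \<oplus>\<^bsub>R\<^esub> g k) = horner m f \<oplus> horner m g"
  using assms
proof (induction m arbitrary: f g)
  case (Suc m)
  have "horner m (\<lambda>k. f (Suc k)) \<in> carrier S" "horner m (\<lambda>k. g (Suc k)) \<in> carrier S"
    using Suc.prems by (auto intro: horner_closed)
  then show ?case
    using Suc.prems Suc.IH[of "\<lambda>k. f (Suc k)" "\<lambda>k. g (Suc k)"]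
    by (simp add: x_closed S.r_distr S.a_ac)
qed simp

lemma horner_smult:
  assumes "\<And>k. f k \<in> carrier R" "r \<in> carrier R"
  shows "horner m (\<lambda>k. r \<otimes>\<^bsub>R\<^esub> f k) = \<iota> r \<otimes> horner m f"
  using assms
proof (induction m arbitrary: f)
  case (Suc m)
  have "horner m (\<lambda>k. f (Suc k)) \<in> carrier S"
    using Suc.prems by (auto intro: horner_closed)
  then show ?case
    using Suc.prems Suc.IH[of "\<lambda>k. f (Suc k)"]
    by (simp add: x_closed S.r_distr S.m_lcomm)
qed simp

lemma horner_cong: "(\<And>k. k < m \<Longrightarrow> f k = g k) \<Longrightarrow> horner m f = horner m g"
proof (induction m arbitrary: f g)
  case (Suc m)
  have "horner m (\<lambda>k. f (Suc k)) = horner m (\<lambda>k. g (Suc k))"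
    by (rule Suc.IH) (simp add: Suc.prems)
  then show ?case using Suc.prems[of 0] by simp
qed simp

lemma horner_zero: "horner m (\<lambda>k. \<zero>\<^bsub>R\<^esub>) = \<zero>"
  by (induction m) (auto simp: x_closed)

lemma horner_snoc:
  assumes "\<And>k. f k \<in> carrier R"
  shows "horner (Suc m) f = horner m f \<oplus> \<iota> (f m) \<otimes> x [^] m"
  using assms
proof (induction m arbitrary: f)
  case 0
  then show ?case by (simp add: x_closed)
next
  case (Suc m)
  have closed: "horner m (\<lambda>k. f (Suc k)) \<in> carrier S"
    using Suc.prems by (auto intro: horner_closed)
  have "horner (Suc (Suc m)) f = \<iota> (f 0) \<oplus> x \<otimes> horner (Suc m) (\<lambda>k. f (Suc k))" by simp
  also have "horner (Suc m) (\<lambda>k. f (Suc k)) = horner m (\<lambda>k. f (Suc k)) \<oplus> \<iota> (f (Suc m)) \<otimes> x [^] m"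
    using Suc.IH[of "\<lambda>k. f (Suc k)"] Suc.prems by simp
  finally show ?case
    using Suc.prems closed by (simp add: x_closed S.r_distr S.a_assoc S.m_ac)
qed

definition expands :: "nat \<Rightarrow> (nat \<Rightarrow> 'r) \<Rightarrow> 's \<Rightarrow> bool" where
  "expands m f a \<longleftrightarrow> (\<exists>y\<in>carrier S. a = horner m f \<oplus> x [^] m \<otimes> y)"

lemma expandsI: "y \<in> carrier S \<Longrightarrow> a = horner m f \<oplus> x [^] m \<otimes> y \<Longrightarrow> expands m f a"
  by (auto simp: expands_def)

lemma expandsE:
  assumes "expands m f a"
  obtains y where "y \<in> carrier S" "a = horner m f \<oplus> x [^] m \<otimes> y"
  using assms by (auto simp: expands_def)

lemma expands_add:
  assumes "\<And>k. f k \<in> carrier R" "\<And>k. g k \<in> carrier R" "expands m f a" "expands m g b"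
  shows "expands m (\<lambda>k. f k \<oplus>\<^bsub>R\<^esub> g k) (a \<oplus> b)"
proof -
  obtain y z where yz: "y \<in> carrier S" "a = horner m f \<oplus> x [^] m \<otimes> y"
    "z \<in> carrier S" "b = horner m g \<oplus> x [^] m \<otimes> z"
    using assms(3,4) by (blast elim: expandsE)
  show ?thesis
    by (rule expandsI[of "y \<oplus> z"])
      (use yz horner_closed[OF assms(1)] horner_closed[OF assms(2)] x_closed assms(1,2) in
        \<open>simp_all add: horner_add S.r_distr S.a_ac\<close>)
qed

lemma expands_smult:
  assumes "\<And>k. f k \<in> carrier R" "r \<in> carrier R" "expands m f a"
  shows "expands m (\<lambda>k. r \<otimes>\<^bsub>R\<^esub> f k) (\<iota> r \<otimes> a)"
proof -
  obtain y where y: "y \<in> carrier S" "a = horner m f \<oplus> x [^] m \<otimes> y"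
    using assms(3) by (rule expandsE)
  show ?thesis
    by (rule expandsI[of "\<iota> r \<otimes> y"])
      (use y horner_closed[OF assms(1)] x_closed assms(1,2) in
        \<open>simp_all add: horner_smult S.r_distr S.m_ac\<close>)
qed

lemma expands_shift:
  assumes "\<And>k. f k \<in> carrier R" "expands m f a"
  shows "expands m (\<lambda>k. if k = 0 then \<zero>\<^bsub>R\<^esub> else f (k - 1)) (x \<otimes> a)"
proof -
  obtain y where y: "y \<in> carrier S" "a = horner m f \<oplus> x [^] m \<otimes> y"
    using assms(2) by (rule expandsE)
  show ?thesis
  proof (cases m)
    case 0
    then show ?thesis
      using y x_closed by (intro expandsI[of "x \<otimes> y"]) simp_all
  next
    case (Suc m')
    have closed: "horner m' f \<in> carrier S" "\<iota> (f m') \<in> carrier S"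
      using assms(1) by (auto intro: horner_closed)
    have "x \<otimes> a = x \<otimes> horner m' f \<oplus> x [^] m \<otimes> (\<iota> (f m') \<oplus> x \<otimes> y)"
      unfolding y(2) Suc horner_snoc[OF assms(1)]
      using y(1) closed x_closed by (simp add: S.r_distr S.m_ac S.a_assoc)
    moreover have "horner m (\<lambda>k. if k = 0 then \<zero>\<^bsub>R\<^esub> else f (k - 1)) = x \<otimes> horner m' f"
      using closed x_closed by (simp add: Suc)
    ultimately show ?thesis
      using y closed x_closed by (intro expandsI[of "\<iota> (f m') \<oplus> x \<otimes> y"]) auto
  qed
qed

lemma expands_const:
  assumes "r \<in> carrier R"
  shows "expands m (\<lambda>k. if k = 0 then r else \<zero>\<^bsub>R\<^esub>) (\<iota> r)"
proof (cases m)
  case 0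
  then show ?thesis
    using assms by (intro expandsI[of "\<iota> r"]) simp_all
next
  case (Suc m')
  then show ?thesis
    using assms x_closed by (intro expandsI[of \<zero>]) (simp_all add: horner_zero)
qed

lemma expands_exists:
  assumes "a \<in> carrier S"
  shows "\<exists>f. (\<forall>k. f k \<in> carrier R) \<and> expands m f a"
  using assms
proof (induction m arbitrary: a)
  case 0
  then show ?case by (intro exI[of _ "\<lambda>k. \<zero>\<^bsub>R\<^esub>"]) (auto simp: expands_def)
next
  case (Suc m)
  have closed: "aug a \<in> carrier R" "\<iota> (aug a) \<in> carrier S" using Suc.prems by simp_all
  have "aug (a \<ominus> \<iota> (aug a)) = \<zero>\<^bsub>R\<^esub>"
    using Suc.prems by (simp add: a_minus_def aug_const R.r_neg)
  then obtain b where b: "b \<in> carrier S" "a \<ominus> \<iota> (aug a) = x \<otimes> b"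
    using aug_kernel[of "a \<ominus> \<iota> (aug a)"] Suc.prems by auto
  obtain f y where f: "\<And>k. f k \<in> carrier R" and y: "y \<in> carrier S" "b = horner m f \<oplus> x [^] m \<otimes> y"
    using Suc.IH[OF b(1)] by (auto simp: expands_def)
  let ?g = "\<lambda>k. case k of 0 \<Rightarrow> aug a | Suc k \<Rightarrow> f k"
  have "a = \<iota> (aug a) \<oplus> (a \<ominus> \<iota> (aug a))"
    using S.add_minus_cancel[OF closed(2) Suc.prems] by simp
  also have "\<dots> = horner (Suc m) ?g \<oplus> x [^] Suc m \<otimes> y"
    unfolding b(2) y(2) using y(1) horner_closed[OF f] x_closed closed
    by (simp add: S.r_distr S.a_assoc S.m_ac)
  finally have "expands (Suc m) ?g a"
    using y(1) by (rule expandsI[rotated])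
  then show ?case
    using f closed by (intro exI[of _ ?g]) (auto split: nat.split)
qed

end

text \<open>If multiplication by \<open>x\<close> is injective up to \<open>x^n S\<close>, the coefficients of order at most \<open>n\<close>
  are unique.\<close>

locale augmented_ring_trunc = augmented_ring S R \<iota> aug x
  for S :: "('s, 'x) ring_scheme" (structure) and R :: "('r, 'y) ring_scheme" and \<iota> aug x +
  fixes n :: nat
  assumes annihilator: "b \<in> carrier S \<Longrightarrow> x \<otimes> b = \<zero> \<Longrightarrow> \<exists>y\<in>carrier S. b = x [^] n \<otimes> y"
begin

lemma expands_zero_unique:
  assumes "m \<le> Suc n" "\<And>k. f k \<in> carrier R" "expands m f \<zero>" "k < m"
  shows "f k = \<zero>\<^bsub>R\<^esub>"
  using assms
proof (induction m arbitrary: f k)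
  case (Suc m)
  obtain y where y: "y \<in> carrier S" "\<zero> = horner (Suc m) f \<oplus> x [^] Suc m \<otimes> y"
    using Suc.prems(3) by (rule expandsE)
  let ?g = "\<lambda>k. f (Suc k)"
  have g: "horner m ?g \<in> carrier S" using Suc.prems(2) by (auto intro: horner_closed)
  have "aug \<zero> = f 0"
    unfolding y(2) using y(1) g Suc.prems(2) x_closed by (simp add: aug_const aug_x)
  then have f0: "f 0 = \<zero>\<^bsub>R\<^esub>" by simp
  let ?b = "horner m ?g \<oplus> x [^] m \<otimes> y"
  have b: "?b \<in> carrier S" using g y(1) x_closed by simp
  have "x \<otimes> ?b = \<zero>"
    using y f0 g x_closed by (simp add: S.r_distr S.m_ac)
  then obtain z where z: "z \<in> carrier S" "?b = x [^] n \<otimes> z"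
    using annihilator[OF b] by blast
  have x_pow_n: "x [^] n = x [^] m \<otimes> x [^] (n - m)"
    using Suc.prems(1) x_closed by (simp add: S.nat_pow_mult)
  have "horner m ?g \<oplus> x [^] m \<otimes> (y \<ominus> x [^] (n - m) \<otimes> z) = ?b \<ominus> x [^] n \<otimes> z"
    unfolding x_pow_n using g y(1) z(1) x_closed
    by (simp add: a_minus_def S.r_distr S.r_minus S.m_assoc S.a_assoc)
  also have "\<dots> = \<zero>"
    unfolding z(2) using z(1) x_closed by (simp add: a_minus_def S.r_neg)
  finally have "expands m ?g \<zero>"
    using y(1) z(1) x_closed by (intro expandsI[of "y \<ominus> x [^] (n - m) \<otimes> z"]) auto
  then have "?g k = \<zero>\<^bsub>R\<^esub>" if "k < m" for k
    using Suc.IH[of ?g k] Suc.prems(1,2) that by simp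
  then show ?case
    using f0 Suc.prems(4) by (cases k) auto
qed simp

lemma expands_unique:
  assumes "m \<le> Suc n" "\<And>k. f k \<in> carrier R" "\<And>k. g k \<in> carrier R" "a \<in> carrier S"
    "expands m f a" "expands m g a" "k < m"
  shows "f k = g k"
proof -
  have "expands m (\<lambda>k. f k \<oplus>\<^bsub>R\<^esub> \<ominus>\<^bsub>R\<^esub> \<one>\<^bsub>R\<^esub> \<otimes>\<^bsub>R\<^esub> g k) (a \<oplus> \<iota> (\<ominus>\<^bsub>R\<^esub> \<one>\<^bsub>R\<^esub>) \<otimes> a)"
    using assms by (intro expands_add expands_smult) auto
  also have "a \<oplus> \<iota> (\<ominus>\<^bsub>R\<^esub> \<one>\<^bsub>R\<^esub>) \<otimes> a = \<zero>"
    using assms(4) by (simp add: S.l_minus S.r_neg)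
  finally have "f k \<oplus>\<^bsub>R\<^esub> \<ominus>\<^bsub>R\<^esub> \<one>\<^bsub>R\<^esub> \<otimes>\<^bsub>R\<^esub> g k = \<zero>\<^bsub>R\<^esub>"
    using assms by (intro expands_zero_unique[of m]) auto
  then have "f k \<ominus>\<^bsub>R\<^esub> g k = \<zero>\<^bsub>R\<^esub>"
    using assms(2,3) by (simp add: a_minus_def R.l_minus)
  then show ?thesis
    using assms(2,3) by (simp add: R.minus_eq_zero_iff)
qed

definition x_coeff :: "'s \<Rightarrow> nat \<Rightarrow> 'r" where
  "x_coeff a = (SOME f. (\<forall>k. f k \<in> carrier R) \<and> expands (Suc n) f a)"

lemma x_coeff:
  assumes "a \<in> carrier S"
  shows x_coeff_closed: "x_coeff a k \<in> carrier R" and x_coeff_expands: "expands (Suc n) (x_coeff a) a"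
  using someI_ex[OF expands_exists[OF assms, of "Suc n"]] by (auto simp: x_coeff_def)

lemma x_coeff_eqI:
  assumes "a \<in> carrier S" "\<And>k. f k \<in> carrier R" "expands (Suc n) f a" "k \<le> n"
  shows "x_coeff a k = f k"
  using assms x_coeff[OF assms(1)] by (intro expands_unique[of "Suc n" "x_coeff a" f a k]) auto

lemma x_coeff_add:
  assumes "a \<in> carrier S" "b \<in> carrier S" "k \<le> n"
  shows "x_coeff (a \<oplus> b) k = x_coeff a k \<oplus>\<^bsub>R\<^esub> x_coeff b k"
  using assms x_coeff
  by (intro x_coeff_eqI[of "a \<oplus> b" "\<lambda>k. x_coeff a k \<oplus>\<^bsub>R\<^esub> x_coeff b k" k] expands_add) auto

lemma x_coeff_smult:
  assumes "a \<in> carrier S" "r \<in> carrier R" "k \<le> n"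
  shows "x_coeff (\<iota> r \<otimes> a) k = r \<otimes>\<^bsub>R\<^esub> x_coeff a k"
  using assms x_coeff
  by (intro x_coeff_eqI[of "\<iota> r \<otimes> a" "\<lambda>k. r \<otimes>\<^bsub>R\<^esub> x_coeff a k" k] expands_smult) auto

lemma x_coeff_x:
  assumes "a \<in> carrier S" "k \<le> n"
  shows "x_coeff (x \<otimes> a) k = (if k = 0 then \<zero>\<^bsub>R\<^esub> else x_coeff a (k - 1))"
  using assms x_coeff x_closed
  by (intro x_coeff_eqI[of "x \<otimes> a" "\<lambda>k. if k = 0 then \<zero>\<^bsub>R\<^esub> else x_coeff a (k - 1)" k] expands_shift) auto

lemma x_coeff_const:
  assumes "r \<in> carrier R" "k \<le> n"
  shows "x_coeff (\<iota> r) k = (if k = 0 then r else \<zero>\<^bsub>R\<^esub>)"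
  using assms
  by (intro x_coeff_eqI[of "\<iota> r" "\<lambda>k. if k = 0 then r else \<zero>\<^bsub>R\<^esub>" k] expands_const) auto

lemma x_coeff_one: "k \<le> n \<Longrightarrow> x_coeff \<one> k = (if k = 0 then \<one>\<^bsub>R\<^esub> else \<zero>\<^bsub>R\<^esub>)"
  using x_coeff_const[of "\<one>\<^bsub>R\<^esub>" k] by simp

lemma x_coeff_zero: "k \<le> n \<Longrightarrow> x_coeff \<zero> k = \<zero>\<^bsub>R\<^esub>"
  using x_coeff_const[of "\<zero>\<^bsub>R\<^esub>" k] by simp

lemma x_coeff_x_pow_mult:
  assumes "a \<in> carrier S" "k \<le> n"
  shows "x_coeff (x [^] l \<otimes> a) k = (if k < l then \<zero>\<^bsub>R\<^esub> else x_coeff a (k - l))"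
  using assms
proof (induction l arbitrary: k)
  case (Suc l)
  have "x [^] Suc l \<otimes> a = x \<otimes> (x [^] l \<otimes> a)"
    using Suc.prems x_closed by (simp add: S.m_ac)
  then show ?case
    using Suc x_closed by (auto simp: x_coeff_x)
qed (simp add: x_coeff)

lemma x_coeff_x_pow: "k \<le> n \<Longrightarrow> x_coeff (x [^] l) k = (if k = l then \<one>\<^bsub>R\<^esub> else \<zero>\<^bsub>R\<^esub>)"
  using x_coeff_x_pow_mult[OF S.one_closed, of k l] x_coeff_one[of "k - l"] x_closed by auto

lemma x_coeff_minus:
  assumes "a \<in> carrier S" "b \<in> carrier S" "k \<le> n"
  shows "x_coeff (a \<ominus> b) k = x_coeff a k \<ominus>\<^bsub>R\<^esub> x_coeff b k"
  by (rule additive_minus[OF S.abelian_group_axioms R.abelian_group_axioms, of "\<lambda>a. x_coeff a k"])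
    (use assms in \<open>auto simp: x_coeff_closed x_coeff_add\<close>)

lemma x_coeff_horner:
  assumes "\<And>k. g k \<in> carrier R" "k \<le> n"
  shows "x_coeff (horner l g) k = (if k < l then g k else \<zero>\<^bsub>R\<^esub>)"
  using assms
proof (induction l arbitrary: g k)
  case 0
  then show ?case by (simp add: x_coeff_zero)
next
  case (Suc l)
  have "horner l (\<lambda>k. g (Suc k)) \<in> carrier S" using Suc.prems by (auto intro: horner_closed)
  then show ?case
    using Suc.prems Suc.IH[of "\<lambda>k. g (Suc k)" "k - 1"] x_closed
    by (cases k) (auto simp: x_coeff_add x_coeff_const x_coeff_x)
qed

lemma x_pow_dvd_iff:
  assumes "a \<in> carrier S" "m \<le> Suc n"
  shows "(\<exists>y\<in>carrier S. a = x [^] m \<otimes> y) \<longleftrightarrow> (\<forall>k<m. x_coeff a k = \<zero>\<^bsub>R\<^esub>)"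
proof
  assume "\<exists>y\<in>carrier S. a = x [^] m \<otimes> y"
  then show "\<forall>k<m. x_coeff a k = \<zero>\<^bsub>R\<^esub>"
    using assms(2) by (auto simp: x_coeff_x_pow_mult)
next
  assume vanish: "\<forall>k<m. x_coeff a k = \<zero>\<^bsub>R\<^esub>"
  obtain f where f: "\<And>k. f k \<in> carrier R" "expands m f a"
    using expands_exists[OF assms(1)] by blast
  obtain y where y: "y \<in> carrier S" "a = horner m f \<oplus> x [^] m \<otimes> y"
    using f(2) by (rule expandsE)
  have "f k = \<zero>\<^bsub>R\<^esub>" if "k < m" for k
  proof -
    have "x_coeff a k = f k \<oplus>\<^bsub>R\<^esub> \<zero>\<^bsub>R\<^esub>"
      unfolding y(2) using that assms(2) y(1) x_closed horner_closed[OF f(1)]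
      by (subst x_coeff_add) (auto simp: x_coeff_horner f x_coeff_x_pow_mult)
    then show ?thesis using vanish that f by simp
  qed
  then have "horner m f = \<zero>"
    using horner_cong[of m f "\<lambda>k. \<zero>\<^bsub>R\<^esub>"] by (simp add: horner_zero)
  then show "\<exists>y\<in>carrier S. a = x [^] m \<otimes> y"
    using y x_closed by auto
qed

lemma x_coeff_mult_horner:
  assumes a: "a \<in> carrier S" and g: "\<And>k. g k \<in> carrier R" and k: "k \<le> n"
  shows "x_coeff (a \<otimes> horner m g) k = (\<Oplus>\<^bsub>R\<^esub>l\<in>{..<m}. if l \<le> k then x_coeff a (k - l) \<otimes>\<^bsub>R\<^esub> g l else \<zero>\<^bsub>R\<^esub>)"
proof (induction m)
  case 0
  then show ?case
    using a k by (simp add: x_coeff_zero)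
next
  case (Suc m)
  have "a \<otimes> horner (Suc m) g = a \<otimes> horner m g \<oplus> \<iota> (g m) \<otimes> (x [^] m \<otimes> a)"
    unfolding horner_snoc[OF g] using a g x_closed horner_closed[OF g]
    by (simp add: S.r_distr S.m_ac)
  then have "x_coeff (a \<otimes> horner (Suc m) g) k =
      x_coeff (a \<otimes> horner m g) k \<oplus>\<^bsub>R\<^esub> g m \<otimes>\<^bsub>R\<^esub> (if k < m then \<zero>\<^bsub>R\<^esub> else x_coeff a (k - m))"
    using a g x_closed horner_closed[OF g] k by (simp add: x_coeff_add x_coeff_smult x_coeff_x_pow_mult)
  also have "\<dots> = (\<Oplus>\<^bsub>R\<^esub>l\<in>{..<Suc m}. if l \<le> k then x_coeff a (k - l) \<otimes>\<^bsub>R\<^esub> g l else \<zero>\<^bsub>R\<^esub>)"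
    unfolding Suc lessThan_Suc using a g x_coeff_closed[OF a]
    by (subst R.finsum_insert) (auto simp: R.m_comm R.a_comm)
  finally show ?case .
qed

lemma x_coeff_mult:
  assumes a: "a \<in> carrier S" and b: "b \<in> carrier S" and k: "k \<le> n"
  shows "x_coeff (a \<otimes> b) k = (\<Oplus>\<^bsub>R\<^esub>l\<in>{..k}. x_coeff a (k - l) \<otimes>\<^bsub>R\<^esub> x_coeff b l)"
proof -
  let ?h = "horner (Suc n) (x_coeff b)"
  note coeffs = x_coeff_closed[OF a] x_coeff_closed[OF b]
  obtain y where y: "y \<in> carrier S" "b = ?h \<oplus> x [^] Suc n \<otimes> y"
    using x_coeff_expands[OF b] by (rule expandsE)
  have h: "?h \<in> carrier S" using coeffs(2) by (rule horner_closed)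
  have "a \<otimes> b = a \<otimes> ?h \<oplus> x [^] Suc n \<otimes> (a \<otimes> y)"
    by (subst y(2)) (use a y(1) x_closed h in \<open>simp add: S.r_distr S.m_ac del: horner.simps\<close>)
  then have "x_coeff (a \<otimes> b) k = x_coeff (a \<otimes> ?h) k \<oplus>\<^bsub>R\<^esub> \<zero>\<^bsub>R\<^esub>"
    using a y(1) x_closed h k x_coeff_x_pow_mult[of "a \<otimes> y" k "Suc n"]
    by (simp add: x_coeff_add del: horner.simps S.nat_pow_Suc)
  also have "\<dots> = (\<Oplus>\<^bsub>R\<^esub>l\<in>{..<Suc n}. if l \<le> k then x_coeff a (k - l) \<otimes>\<^bsub>R\<^esub> x_coeff b l else \<zero>\<^bsub>R\<^esub>)"
    using x_coeff_mult_horner[OF a coeffs(2) k, of "Suc n"] coeffs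
    by (simp add: R.finsum_closed Pi_def del: horner.simps)
  also have "\<dots> = (\<Oplus>\<^bsub>R\<^esub>l\<in>{..k}. x_coeff a (k - l) \<otimes>\<^bsub>R\<^esub> x_coeff b l)"
    using k coeffs by (intro R.add.finprod_mono_neutral_cong_right) auto
  finally show ?thesis .
qed

end

section \<open>Quotients of the \<open>p\<close>-adic integers\<close>

locale Zp_quotient = p_adic p + R: cring R + q: ring_hom_cring "Zp p" R q
  for p :: nat and R :: "('r, 'y) ring_scheme" (structure) and q :: "(nat \<Rightarrow> int) \<Rightarrow> 'r" +
  assumes q_surj: "q ` carrier (Zp p) = carrier R"
begin

lemma q_surjE:
  assumes "r \<in> carrier R"
  obtains z where "z \<in> carrier (Zp p)" "q z = r"
  using assms unfolding q_surj[symmetric] by blast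

lemma q_eq_iff: "z \<in> carrier (Zp p) \<Longrightarrow> w \<in> carrier (Zp p) \<Longrightarrow> q z = q w \<longleftrightarrow> q (z \<ominus>\<^bsub>Zp p\<^esub> w) = \<zero>"
  using R.minus_eq_zero_iff[of "q z" "q w"] by (simp add: a_minus_def)

lemma q_kernel_cases:
  "(\<forall>z\<in>carrier (Zp p). q z = \<zero> \<longrightarrow> z = \<zero>\<^bsub>Zp p\<^esub>) \<or> (\<exists>a. \<forall>z\<in>carrier (Zp p). q z = \<zero> \<longleftrightarrow> z a = 0)"
proof -
  let ?B = "{z \<in> carrier (Zp p). q z = \<zero>}"
  have "?B \<subseteq> {\<zero>\<^bsub>Zp p\<^esub>} \<or> (\<exists>i. ?B = p_ideal p i)"
    by (rule zero_or_p_ideal) auto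
  then show ?thesis
  proof
    assume "\<exists>i. ?B = p_ideal p i"
    then obtain i where "?B = p_ideal p i" ..
    then have "\<forall>z\<in>carrier (Zp p). q z = \<zero> \<longleftrightarrow> z i = 0"
      by (auto simp: p_ideal_def set_eq_iff)
    then show ?thesis by blast
  next
    assume "?B \<subseteq> {\<zero>\<^bsub>Zp p\<^esub>}"
    then show ?thesis by blast
  qed
qed

lemma card_carrier:
  assumes kernel: "\<forall>z\<in>carrier (Zp p). q z = \<zero> \<longleftrightarrow> z a = 0"
  shows "card (carrier R) = p ^ a"
proof -
  have eq: "q z = q w \<longleftrightarrow> z a = w a" if "z \<in> carrier (Zp p)" "w \<in> carrier (Zp p)" for z w
    using q_eq_iff[OF that] kernel Z.minus_closed[OF that] Zp_minus_eq_zero_iff[OF that] by blast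
  have "bij_betw (\<lambda>i. q (Zp_int p i)) {0..<int p ^ a} (carrier R)"
    unfolding bij_betw_def
  proof (intro conjI equalityI subsetI)
    show "inj_on (\<lambda>i. q (Zp_int p i)) {0..<int p ^ a}"
      by (rule inj_onI) (simp add: eq Zp_int_closed, simp add: Zp_int_def)
    fix r assume "r \<in> carrier R"
    then obtain z where z: "z \<in> carrier (Zp p)" "q z = r" by (rule q_surjE)
    have "q (Zp_int p (z a)) = r" using z eq[OF Zp_int_closed z(1)] by (simp add: Zp_int_def ZpD(1))
    then show "r \<in> (\<lambda>i. q (Zp_int p i)) ` {0..<int p ^ a}" using ZpD(3,4)[OF z(1), of a] by force
  qed (auto simp: Zp_int_closed)
  from bij_betw_same_card[OF this] show ?thesis by (simp flip: of_nat_power)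
qed

definition int_img :: "int \<Rightarrow> 'r" where "int_img z = q (Zp_int p z)"

lemma int_img_simps:
  "int_img i \<in> carrier R" "int_img (i + j) = int_img i \<oplus> int_img j"
  "int_img (i * j) = int_img i \<otimes> int_img j" "int_img 1 = \<one>" "int_img 0 = \<zero>"
  by (simp_all add: int_img_def Zp_int_closed Zp_int_add Zp_int_mult
      Zp_one_eq[symmetric] Zp_zero_eq[symmetric])

lemma finsum_const_int_img:
  assumes "c \<in> carrier R"
  shows "(\<Oplus>l\<in>{..<m}. c) = int_img (int m) \<otimes> c"
proof (induction m)
  case (Suc m)
  have "(\<Oplus>l\<in>{..<Suc m}. c) = c \<oplus> int_img (int m) \<otimes> c"
    unfolding lessThan_Suc Suc[symmetric] using assms by (subst R.finsum_insert) auto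
  then show ?case using assms by (simp add: int_img_simps R.l_distr)
qed (simp add: int_img_simps assms)

definition p_pow_dvd :: "nat \<Rightarrow> 'r \<Rightarrow> bool" where
  "p_pow_dvd K r \<longleftrightarrow> (\<exists>s\<in>carrier R. r = int_img (int p ^ K) \<otimes> s)"

lemma p_pow_dvdI: "s \<in> carrier R \<Longrightarrow> p_pow_dvd K (int_img (int p ^ K) \<otimes> s)"
  by (auto simp: p_pow_dvd_def)

lemma p_pow_dvd_closed: "p_pow_dvd K r \<Longrightarrow> r \<in> carrier R"
  by (auto simp: p_pow_dvd_def int_img_simps)

lemma p_pow_dvd_0: "r \<in> carrier R \<Longrightarrow> p_pow_dvd 0 r"
  using p_pow_dvdI[of r 0] by (simp add: int_img_simps)

lemma p_pow_dvd_zero: "p_pow_dvd K \<zero>"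
  using p_pow_dvdI[of \<zero> K] by (simp add: int_img_simps)

lemma p_pow_dvd_mult:
  assumes "p_pow_dvd K r" "p_pow_dvd L t"
  shows "p_pow_dvd (K + L) (r \<otimes> t)"
proof -
  obtain s s' where "s \<in> carrier R" "r = int_img (int p ^ K) \<otimes> s"
    "s' \<in> carrier R" "t = int_img (int p ^ L) \<otimes> s'"
    using assms by (auto simp: p_pow_dvd_def)
  then show ?thesis
    using p_pow_dvdI[of "s \<otimes> s'" "K + L"] by (simp add: power_add int_img_simps R.m_ac)
qed

lemma p_pow_dvd_mono:
  assumes "p_pow_dvd K r" "L \<le> K"
  shows "p_pow_dvd L r"
proof -
  obtain s where s: "s \<in> carrier R" "r = int_img (int p ^ K) \<otimes> s"
    using assms(1) by (auto simp: p_pow_dvd_def)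
  have "int p ^ K = int p ^ L * int p ^ (K - L)" using assms(2) by (simp add: power_add[symmetric])
  then show ?thesis
    using s p_pow_dvdI[of "int_img (int p ^ (K - L)) \<otimes> s" L] by (simp add: int_img_simps R.m_assoc)
qed

lemma p_pow_dvd_add:
  assumes "p_pow_dvd K r" "p_pow_dvd K t"
  shows "p_pow_dvd K (r \<oplus> t)"
proof -
  obtain s s' where "s \<in> carrier R" "r = int_img (int p ^ K) \<otimes> s"
    "s' \<in> carrier R" "t = int_img (int p ^ K) \<otimes> s'"
    using assms by (auto simp: p_pow_dvd_def)
  then show ?thesis
    using p_pow_dvdI[of "s \<oplus> s'" K] by (simp add: int_img_simps R.r_distr)
qed

lemma p_pow_dvd_finsum:
  assumes "finite A" "\<And>l. l \<in> A \<Longrightarrow> p_pow_dvd K (f l)"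
  shows "p_pow_dvd K (\<Oplus>l\<in>A. f l)"
  using assms
proof (induction A rule: finite_induct)
  case (insert l A)
  then have "f \<in> insert l A \<rightarrow> carrier R"
    using p_pow_dvd_closed by blast
  then have "(\<Oplus>l\<in>insert l A. f l) = f l \<oplus> (\<Oplus>l\<in>A. f l)"
    using insert.hyps by (intro R.finsum_insert) auto
  then show ?case
    using insert by (simp add: p_pow_dvd_add)
qed (simp add: p_pow_dvd_zero)

lemma zero_if_p_pow_dvd:
  assumes dvd: "\<And>i. p_pow_dvd i r"
  shows "r = \<zero>"
  using q_kernel_cases
proof
  assume inj: "\<forall>z\<in>carrier (Zp p). q z = \<zero> \<longrightarrow> z = \<zero>\<^bsub>Zp p\<^esub>"
  obtain z where z: "z \<in> carrier (Zp p)" "q z = r" using q_surjE[OF p_pow_dvd_closed[OF dvd]] .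
  have "z i = 0" for i
  proof -
    obtain s where s: "s \<in> carrier R" "r = int_img (int p ^ i) \<otimes> s"
      using dvd[of i] by (auto simp: p_pow_dvd_def)
    obtain y where y: "y \<in> carrier (Zp p)" "q y = s" using q_surjE[OF s(1)] .
    let ?w = "Zp_int p (int p ^ i) \<otimes>\<^bsub>Zp p\<^esub> y"
    have w: "?w \<in> carrier (Zp p)" using y by (simp add: Zp_int_closed)
    have "q z = q ?w" using s z(2) y by (simp add: int_img_def Zp_int_closed)
    then have "z \<ominus>\<^bsub>Zp p\<^esub> ?w = \<zero>\<^bsub>Zp p\<^esub>"
      using inj q_eq_iff[OF z(1) w] Z.minus_closed[OF z(1) w] by blast
    then have "z = ?w" using z(1) w by (simp add: Z.minus_eq_zero_iff)
    then show ?thesis using p_ideal_multiple[OF y(1), of i] by (simp add: p_ideal_def)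
  qed
  then have "z = \<zero>\<^bsub>Zp p\<^esub>" by (simp add: fun_eq_iff Zp_simps)
  then show ?thesis using z by simp
next
  assume "\<exists>a. \<forall>z\<in>carrier (Zp p). q z = \<zero> \<longleftrightarrow> z a = 0"
  then obtain a where a: "\<forall>z\<in>carrier (Zp p). q z = \<zero> \<longleftrightarrow> z a = 0" by blast
  have "int_img (int p ^ a) = \<zero>"
    unfolding int_img_def using a by (simp add: Zp_int_closed) (simp add: Zp_int_def)
  then show ?thesis using dvd[of a] by (auto simp: p_pow_dvd_def)
qed

lemma p_recursion:
  assumes "\<And>k. d k \<in> carrier R"
  obtains c where "\<And>k. c k \<in> carrier R" "\<And>k. c k = d k \<oplus> int_img (int p) \<otimes> c (Suc k)"
proof -
  have "\<exists>z. z \<in> carrier (Zp p) \<and> q z = d k" for k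
    using q_surjE[OF assms[of k]] by metis
  then obtain e where e: "\<And>k. e k \<in> carrier (Zp p)" "\<And>k. q (e k) = d k" by metis
  obtain c where c: "\<And>k. c k \<in> carrier (Zp p)"
    "\<And>k. c k = e k \<oplus>\<^bsub>Zp p\<^esub> Zp_int p (int p) \<otimes>\<^bsub>Zp p\<^esub> c (Suc k)"
    using Zp_recursion[of e] e(1) by blast
  show ?thesis
  proof (rule that[of "\<lambda>k. q (c k)"])
    fix k
    show "q (c k) = d k \<oplus> int_img (int p) \<otimes> q (c (Suc k))"
      by (subst c(2)) (simp add: c(1) e Zp_int_closed int_img_def)
  qed (simp add: c(1))
qed

end

section \<open>The completed group ring of a procyclic pro-\<open>p\<close> group\<close>

locale Zp_tower = cgr_base H R + Zp_quotient p R q + HC: comm_group H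
  for H :: "('h, 'x) topgroup_scheme" and R :: "('r, 'y) topring_scheme" (structure) and p q +
  fixes hpow :: "(nat \<Rightarrow> int) \<Rightarrow> 'h"
  assumes hpow_closed: "z \<in> carrier (Zp p) \<Longrightarrow> hpow z \<in> carrier H"
    and hpow_add: "z \<in> carrier (Zp p) \<Longrightarrow> w \<in> carrier (Zp p) \<Longrightarrow>
      hpow (z \<oplus>\<^bsub>Zp p\<^esub> w) = hpow z \<otimes>\<^bsub>H\<^esub> hpow w"
    and hpow_surj: "C \<in> carrier H \<Longrightarrow> \<exists>z\<in>carrier (Zp p). hpow z = C"
    and open_normals_eq: "open_normals H = range (\<lambda>j. hpow ` p_ideal p j)"
    and hpow_kernel: "(\<forall>z\<in>carrier (Zp p). hpow z = \<one>\<^bsub>H\<^esub> \<longrightarrow> z = \<zero>\<^bsub>Zp p\<^esub>) \<or>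
      (\<exists>a. \<forall>z\<in>carrier (Zp p). hpow z = \<one>\<^bsub>H\<^esub> \<longleftrightarrow> z a = 0)"
begin

definition pow_subgroup :: "nat \<Rightarrow> 'h set" where "pow_subgroup j = hpow ` p_ideal p j"

text \<open>The levels \<open>j\<close> at which \<open>H\<close> has a quotient of order \<open>p^j\<close>.\<close>

definition levels :: "nat set" where
  "levels = {j. \<forall>z\<in>carrier (Zp p). hpow z = \<one>\<^bsub>H\<^esub> \<longrightarrow> z j = 0}"

definition pow_coset :: "nat \<Rightarrow> int \<Rightarrow> 'h set" where
  "pow_coset j i = pow_subgroup j #>\<^bsub>H\<^esub> hpow (Zp_int p i)"

definition level_coeff :: "('h set \<Rightarrow> 'h set \<Rightarrow> 'r) \<Rightarrow> nat \<Rightarrow> int \<Rightarrow> 'r" where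
  "level_coeff a j i = a (pow_subgroup j) (pow_coset j i)"

lemma hpow_zero: "hpow \<zero>\<^bsub>Zp p\<^esub> = \<one>\<^bsub>H\<^esub>"
  using hpow_add[of "\<zero>\<^bsub>Zp p\<^esub>" "\<zero>\<^bsub>Zp p\<^esub>"] hpow_closed[of "\<zero>\<^bsub>Zp p\<^esub>"] G.l_cancel_one by simp

lemma hpow_minus:
  assumes "z \<in> carrier (Zp p)" "w \<in> carrier (Zp p)"
  shows "hpow (z \<ominus>\<^bsub>Zp p\<^esub> w) = hpow z \<otimes>\<^bsub>H\<^esub> inv\<^bsub>H\<^esub> hpow w"
proof -
  have "hpow (\<ominus>\<^bsub>Zp p\<^esub> w) = inv\<^bsub>H\<^esub> hpow w"
    using hpow_add[of "\<ominus>\<^bsub>Zp p\<^esub> w" w] assms hpow_closed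
    by (intro G.inv_equality[symmetric]) (auto simp: Z.l_neg hpow_zero)
  then show ?thesis using assms by (simp add: a_minus_def hpow_add)
qed

lemma pow_subgroup_open: "pow_subgroup j \<in> open_normals H"
  unfolding pow_subgroup_def open_normals_eq by blast

lemma levels_down: "j \<in> levels \<Longrightarrow> i \<le> j \<Longrightarrow> i \<in> levels"
  unfolding levels_def using Zp_component_zero_mono by blast

lemma hpow_mem_pow_subgroup:
  assumes "j \<in> levels" "z \<in> carrier (Zp p)"
  shows "hpow z \<in> pow_subgroup j \<longleftrightarrow> z j = 0"
proof
  assume "hpow z \<in> pow_subgroup j"
  then obtain w where w: "w \<in> carrier (Zp p)" "w j = 0" "hpow z = hpow w"
    by (auto simp: pow_subgroup_def p_ideal_def)
  then have "hpow (z \<ominus>\<^bsub>Zp p\<^esub> w) = \<one>\<^bsub>H\<^esub>"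
    using assms(2) hpow_closed[of w] by (simp add: hpow_minus)
  then have "(z \<ominus>\<^bsub>Zp p\<^esub> w) j = 0" using assms w(1) by (auto simp: levels_def)
  then show "z j = 0" using Zp_minus_eq_zero_iff[OF assms(2) w(1)] w(2) by simp
qed (use assms(2) in \<open>auto simp: pow_subgroup_def p_ideal_def\<close>)

lemma pow_subgroup_mono: "i \<le> j \<Longrightarrow> pow_subgroup j \<subseteq> pow_subgroup i"
  unfolding pow_subgroup_def p_ideal_def using Zp_component_zero_mono by blast

lemma Zp_int_p_power_eq_zero_iff: "Zp_int p (int p ^ j) i = 0 \<longleftrightarrow> i \<le> j"
proof -
  have "Zp_int p (int p ^ j) i = 0 \<longleftrightarrow> p ^ i dvd p ^ j"
    unfolding Zp_int_def by (metis mod_eq_0_iff_dvd of_nat_dvd_iff of_nat_power)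
  then show ?thesis using p_gt_1 by (auto simp: power_dvd_imp_le le_imp_power_dvd)
qed

lemma pow_subgroup_subset_iff:
  assumes "i \<in> levels" "j \<in> levels"
  shows "pow_subgroup j \<subseteq> pow_subgroup i \<longleftrightarrow> i \<le> j"
proof
  assume "pow_subgroup j \<subseteq> pow_subgroup i"
  moreover have "hpow (Zp_int p (int p ^ j)) \<in> pow_subgroup j"
    using assms by (simp add: hpow_mem_pow_subgroup Zp_int_closed Zp_int_p_power_eq_zero_iff)
  ultimately show "i \<le> j"
    using hpow_mem_pow_subgroup[OF assms(1) Zp_int_closed] Zp_int_p_power_eq_zero_iff by blast
qed (rule pow_subgroup_mono)

lemma level_le:
  assumes a: "\<forall>z\<in>carrier (Zp p). hpow z = \<one>\<^bsub>H\<^esub> \<longleftrightarrow> z a = 0" and j: "j \<in> levels"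
  shows "j \<le> a"
proof -
  have "hpow (Zp_int p (int p ^ a)) = \<one>\<^bsub>H\<^esub>"
    using a by (simp add: Zp_int_closed Zp_int_p_power_eq_zero_iff)
  then show ?thesis
    using j Zp_int_closed by (auto simp: levels_def simp flip: Zp_int_p_power_eq_zero_iff)
qed

lemma open_normalE:
  assumes "N \<in> open_normals H"
  obtains j where "j \<in> levels" "N = pow_subgroup j"
proof -
  obtain j where j: "N = pow_subgroup j" using assms by (auto simp: open_normals_eq pow_subgroup_def)
  show ?thesis using hpow_kernel
  proof
    assume "\<forall>z\<in>carrier (Zp p). hpow z = \<one>\<^bsub>H\<^esub> \<longrightarrow> z = \<zero>\<^bsub>Zp p\<^esub>"
    then have "j \<in> levels" by (auto simp: levels_def Zp_simps(4))
    with j that show ?thesis by blast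
  next
    assume "\<exists>a. \<forall>z\<in>carrier (Zp p). hpow z = \<one>\<^bsub>H\<^esub> \<longleftrightarrow> z a = 0"
    then obtain a where a: "\<forall>z\<in>carrier (Zp p). hpow z = \<one>\<^bsub>H\<^esub> \<longleftrightarrow> z a = 0" by blast
    then have a_level: "a \<in> levels" by (auto simp: levels_def)
    have trivial: "pow_subgroup i = {\<one>\<^bsub>H\<^esub>}" if "a \<le> i" for i
    proof -
      have "\<zero>\<^bsub>Zp p\<^esub> \<in> p_ideal p i" by (simp add: p_ideal_def Zp_simps(4))
      then show ?thesis
        unfolding pow_subgroup_def using hpow_zero a Zp_component_zero_mono[OF _ _ that]
        by (auto simp: p_ideal_def hpow_zero intro!: image_eqI[of _ _ "\<zero>\<^bsub>Zp p\<^esub>"])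
    qed
    show ?thesis
    proof (cases "j \<le> a")
      case True
      then show ?thesis using that j levels_down[OF a_level] by blast
    next
      case False
      then show ?thesis using that[OF a_level] j trivial[of j] trivial[of a] by simp
    qed
  qed
qed

subsection \<open>Cosets and coefficients at a level\<close>

lemma hpow_coset_eq_iff:
  assumes "j \<in> levels" "z \<in> carrier (Zp p)" "w \<in> carrier (Zp p)"
  shows "pow_subgroup j #>\<^bsub>H\<^esub> hpow z = pow_subgroup j #>\<^bsub>H\<^esub> hpow w \<longleftrightarrow> z j = w j"
  using assms hpow_mem_pow_subgroup[OF assms(1), of "z \<ominus>\<^bsub>Zp p\<^esub> w"] Zp_minus_eq_zero_iff[OF assms(2,3)]
  by (subst G.rcos_eq_iff[OF open_normal_subgroup[OF pow_subgroup_open]]) (auto simp: hpow_closed hpow_minus)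

lemma hpow_coset:
  assumes "j \<in> levels" "z \<in> carrier (Zp p)"
  shows "pow_subgroup j #>\<^bsub>H\<^esub> hpow z = pow_coset j (z j)"
  unfolding pow_coset_def
  using assms by (subst hpow_coset_eq_iff) (auto simp: Zp_int_closed, simp add: Zp_int_def ZpD(1))

lemma pow_coset_closed: "pow_coset j i \<in> carrier (H Mod pow_subgroup j)"
  unfolding pow_coset_def Mod_carrier using hpow_closed[OF Zp_int_closed] by blast

lemma pow_coset_eq_iff: "j \<in> levels \<Longrightarrow> pow_coset j i = pow_coset j i' \<longleftrightarrow> [i = i'] (mod int p ^ j)"
  unfolding pow_coset_def cong_def
  by (subst hpow_coset_eq_iff) (auto simp: Zp_int_closed, simp_all add: Zp_int_def)

lemma pow_cosetE:
  assumes "j \<in> levels" "C \<in> carrier (H Mod pow_subgroup j)"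
  obtains i where "0 \<le> i" "i < int p ^ j" "C = pow_coset j i"
proof -
  obtain c where c: "c \<in> carrier H" "C = pow_subgroup j #>\<^bsub>H\<^esub> c" using assms(2) by (auto simp: Mod_carrier)
  then obtain z where z: "z \<in> carrier (Zp p)" "c = hpow z" using hpow_surj by blast
  then show ?thesis
    using that[of "z j"] hpow_coset[OF assms(1) z(1)] ZpD(3,4)[OF z(1), of j] c by simp
qed

lemma pow_coset_trans: "j \<le> k \<Longrightarrow> (\<Union>d\<in>pow_coset k i. pow_subgroup j #>\<^bsub>H\<^esub> d) = pow_coset j i"
  unfolding pow_coset_def
  by (rule coset_trans[OF pow_subgroup_open pow_subgroup_open pow_subgroup_mono hpow_closed[OF Zp_int_closed]])

lemma pow_coset_fibre:
  assumes "Suc j \<in> levels"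
  shows "{D \<in> carrier (H Mod pow_subgroup (Suc j)). D \<subseteq> pow_coset j i} =
      (\<lambda>l. pow_coset (Suc j) (i + int l * int p ^ j)) ` {..<p}" (is "?fibre = ?f ` _")
proof -
  have j: "j \<in> levels" using levels_down[OF assms, of j] by simp
  have fibre: "?fibre = {D \<in> carrier (H Mod pow_subgroup (Suc j)).
      (\<Union>d\<in>D. pow_subgroup j #>\<^bsub>H\<^esub> d) = pow_coset j i}"
    by (rule coset_fibre[OF pow_subgroup_open pow_subgroup_open pow_subgroup_mono pow_coset_closed]) simp
  show ?thesis
    unfolding fibre
  proof (intro equalityI subsetI)
    fix D assume "D \<in> {D \<in> carrier (H Mod pow_subgroup (Suc j)).
      (\<Union>d\<in>D. pow_subgroup j #>\<^bsub>H\<^esub> d) = pow_coset j i}"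
    then have "D \<in> carrier (H Mod pow_subgroup (Suc j))"
      and image: "(\<Union>d\<in>D. pow_subgroup j #>\<^bsub>H\<^esub> d) = pow_coset j i" by auto
    then obtain i' where D: "D = pow_coset (Suc j) i'"
      using pow_cosetE[OF assms] by metis
    have "[i' = i] (mod int p ^ j)"
      using image pow_coset_trans[of j "Suc j" i'] by (simp add: D pow_coset_eq_iff[OF j])
    then obtain k where k: "i' = i + k * int p ^ j"
      by (metis cong_iff_lin cong_sym mult.commute)
    define l where "l = nat (k mod int p)"
    have l: "l < p" "[k = int l] (mod int p)"
      using p_gt_1 by (simp_all add: l_def nat_less_iff cong_def)
    have "[i' = i + int l * int p ^ j] (mod int p * int p ^ j)"
      unfolding k using l(2) by (intro cong_add cong_refl) (simp add: cong_modulus_mult mod_mult_mult2 cong_def)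
    then show "D \<in> ?f ` {..<p}"
      unfolding D using pow_coset_eq_iff[OF assms] l(1) by auto
  next
    fix D assume "D \<in> ?f ` {..<p}"
    then obtain l where D: "D = pow_coset (Suc j) (i + int l * int p ^ j)" by blast
    have "pow_coset j (i + int l * int p ^ j) = pow_coset j i"
      by (simp add: pow_coset_eq_iff[OF j] cong_def)
    then show "D \<in> {D \<in> carrier (H Mod pow_subgroup (Suc j)).
      (\<Union>d\<in>D. pow_subgroup j #>\<^bsub>H\<^esub> d) = pow_coset j i}"
      unfolding D using pow_coset_closed pow_coset_trans[of j "Suc j" "i + int l * int p ^ j"] by simp
  qed
qed

lemma pow_coset_fibre_inj:
  assumes "Suc j \<in> levels"
  shows "inj_on (\<lambda>l. pow_coset (Suc j) (i + int l * int p ^ j)) {..<p}"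
proof (rule inj_onI)
  fix l m assume lm: "l \<in> {..<p}" "m \<in> {..<p}"
    "pow_coset (Suc j) (i + int l * int p ^ j) = pow_coset (Suc j) (i + int m * int p ^ j)"
  then have "int p * int p ^ j dvd (int l - int m) * int p ^ j"
    using pow_coset_eq_iff[OF assms] by (simp add: cong_iff_dvd_diff algebra_simps)
  then have "int p dvd int l - int m" using p_gt_1 by simp
  then have "int l mod int p = int m mod int p" by (simp add: mod_eq_dvd_iff)
  then show "l = m" using lm(1,2) by simp
qed

lemma level_coeff_closed: "a \<in> carrier CG \<Longrightarrow> level_coeff a j i \<in> carrier R"
  unfolding level_coeff_def by (rule CG_eval_closed[OF _ pow_subgroup_open pow_coset_closed])

lemma finsum_pow_coset_fibre:
  assumes "Suc j \<in> levels" "\<And>C. C \<in> carrier (H Mod pow_subgroup (Suc j)) \<Longrightarrow> b C \<in> carrier R"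
  shows "(\<Oplus>D\<in>{D \<in> carrier (H Mod pow_subgroup (Suc j)). D \<subseteq> pow_coset j i}. b D) =
    (\<Oplus>l\<in>{..<p}. b (pow_coset (Suc j) (i + int l * int p ^ j)))"
  unfolding pow_coset_fibre[OF assms(1)]
  using assms(2)[OF pow_coset_closed] by (intro R.finsum_reindex pow_coset_fibre_inj[OF assms(1)]) auto

lemma level_coeff_compatible:
  assumes "a \<in> carrier CG" "Suc j \<in> levels"
  shows "level_coeff a j i = (\<Oplus>l\<in>{..<p}. level_coeff a (Suc j) (i + int l * int p ^ j))"
proof -
  have "level_coeff a j i =
      (\<Oplus>D\<in>{D \<in> carrier (H Mod pow_subgroup (Suc j)). D \<subseteq> pow_coset j i}. a (pow_subgroup (Suc j)) D)"
    unfolding level_coeff_def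
    by (rule CG_memD(2)[OF assms(1) pow_subgroup_open pow_subgroup_open pow_subgroup_mono pow_coset_closed]) simp
  then show ?thesis
    unfolding level_coeff_def
    by (simp only: finsum_pow_coset_fibre[OF assms(2) CG_eval_closed[OF assms(1) pow_subgroup_open]])
qed

lemma level_coeff_ext:
  assumes "a \<in> carrier CG" "b \<in> carrier CG" "\<And>j i. j \<in> levels \<Longrightarrow> level_coeff a j i = level_coeff b j i"
  shows "a = b"
proof (rule CG_ext_eval[OF assms(1,2)])
  fix N C assume N: "N \<in> open_normals H" and C: "C \<in> carrier (H Mod N)"
  obtain j where j: "j \<in> levels" "N = pow_subgroup j" using open_normalE[OF N] .
  obtain i where "C = pow_coset j i" using pow_cosetE[OF j(1)] C j(2) by blast
  then show "a N C = b N C" using assms(3)[OF j(1), of i] j(2) by (simp add: level_coeff_def)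
qed

lemma level_coeff_cong:
  "j \<in> levels \<Longrightarrow> [i = i'] (mod int p ^ j) \<Longrightarrow> level_coeff a j i = level_coeff a j i'"
  unfolding level_coeff_def using pow_coset_eq_iff by metis

lemma levelwise_eval_exists:
  assumes closed: "\<And>j i. s j i \<in> carrier R"
    and periodic: "\<And>j i i'. j \<in> levels \<Longrightarrow> [i = i'] (mod int p ^ j) \<Longrightarrow> s j i = s j i'"
  obtains a where "\<And>N C. C \<in> carrier (H Mod N) \<Longrightarrow> a N C \<in> carrier R"
    "\<And>N. a N \<in> extensional (carrier (H Mod N))" "\<And>j i. j \<in> levels \<Longrightarrow> a (pow_subgroup j) (pow_coset j i) = s j i"
proof -
  define level where "level N = (SOME j. j \<in> levels \<and> N = pow_subgroup j)" for N
  define exponent where "exponent N C = (SOME i. C = pow_coset (level N) i)" for N C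
  define a where "a N = (\<lambda>C\<in>carrier (H Mod N). s (level N) (exponent N C))" for N
  have level: "level (pow_subgroup j) = j" if "j \<in> levels" for j
  proof -
    have "level (pow_subgroup j) \<in> levels \<and> pow_subgroup j = pow_subgroup (level (pow_subgroup j))"
      unfolding level_def by (rule someI[of _ j]) (use that in simp)
    then show ?thesis
      using pow_subgroup_subset_iff[of j "level (pow_subgroup j)"]
        pow_subgroup_subset_iff[of "level (pow_subgroup j)" j] that by auto
  qed
  have "a (pow_subgroup j) (pow_coset j i) = s j i" if j: "j \<in> levels" for j i
  proof -
    have "pow_coset j i = pow_coset j (exponent (pow_subgroup j) (pow_coset j i))"
      unfolding exponent_def level[OF j] by (rule someI[of _ i]) simp
    from periodic[OF j iffD1[OF pow_coset_eq_iff[OF j] this]] show ?thesis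
      by (simp add: a_def level[OF j] pow_coset_closed)
  qed
  then show ?thesis
    by (intro that[of a]) (simp_all add: a_def closed)
qed

lemma compatible_of_adjacent:
  assumes a_closed: "\<And>N C. C \<in> carrier (H Mod N) \<Longrightarrow> a N C \<in> carrier R"
    and adjacent: "\<And>j. Suc j \<in> levels \<Longrightarrow> compatible a (pow_subgroup (Suc j)) (pow_subgroup j)"
    and "j \<le> k" "k \<in> levels"
  shows "compatible a (pow_subgroup k) (pow_subgroup j)"
  using assms(3,4)
proof (induction k rule: dec_induct)
  case base
  show ?case by (rule compatible_refl[OF pow_subgroup_open a_closed])
next
  case (step k)
  have k: "k \<in> levels" using levels_down[OF step.prems, of k] by simp
  show ?case
    by (rule compatible_trans[OF pow_subgroup_open pow_subgroup_open pow_subgroup_open pow_subgroup_mono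
          pow_subgroup_mono[OF step.hyps(1)] adjacent[OF step.prems] step.IH[OF k] a_closed]) simp_all
qed

lemma CG_mem_of_adjacent:
  assumes a_closed: "\<And>N C. C \<in> carrier (H Mod N) \<Longrightarrow> a N C \<in> carrier R"
    and a_ext: "\<And>N. a N \<in> extensional (carrier (H Mod N))"
    and adjacent: "\<And>j. Suc j \<in> levels \<Longrightarrow> compatible a (pow_subgroup (Suc j)) (pow_subgroup j)"
  shows "(\<lambda>N\<in>open_normals H. a N) \<in> carrier CG"
proof (rule CG_memI)
  fix N assume "N \<in> open_normals H"
  then show "a N \<in> carrier (GR N)"
    using a_closed a_ext by (simp add: finite_group_ring.RQ_carrier[OF finite_group_ring_Mod] PiE_def)
next
  fix N M C assume NM: "N \<in> open_normals H" "M \<in> open_normals H" "N \<subseteq> M" and C: "C \<in> carrier (H Mod M)"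
  obtain k where "k \<in> levels" "N = pow_subgroup k" using open_normalE[OF NM(1)] .
  moreover obtain j where "j \<in> levels" "M = pow_subgroup j" using open_normalE[OF NM(2)] .
  ultimately have "compatible a N M"
    using compatible_of_adjacent[OF a_closed adjacent, of j k] NM(3) pow_subgroup_subset_iff by simp
  then show "a M C = (\<Oplus>D\<in>{D \<in> carrier (H Mod N). D \<subseteq> C}. a N D)"
    using C by (simp add: compatible_def)
qed

lemma compatible_family_exists:
  assumes closed: "\<And>j i. s j i \<in> carrier R"
    and periodic: "\<And>j i i'. j \<in> levels \<Longrightarrow> [i = i'] (mod int p ^ j) \<Longrightarrow> s j i = s j i'"
    and step: "\<And>j i. Suc j \<in> levels \<Longrightarrow> 0 \<le> i \<Longrightarrow> i < int p ^ j \<Longrightarrow>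
      s j i = (\<Oplus>l\<in>{..<p}. s (Suc j) (i + int l * int p ^ j))"
  obtains a where "a \<in> carrier CG" "\<And>j i. j \<in> levels \<Longrightarrow> level_coeff a j i = s j i"
proof -
  obtain a where a_closed: "\<And>N C. C \<in> carrier (H Mod N) \<Longrightarrow> a N C \<in> carrier R"
    and a_ext: "\<And>N. a N \<in> extensional (carrier (H Mod N))"
    and a_eq: "\<And>j i. j \<in> levels \<Longrightarrow> a (pow_subgroup j) (pow_coset j i) = s j i"
    using levelwise_eval_exists[of s, OF closed periodic] by blast
  have adjacent: "compatible a (pow_subgroup (Suc j)) (pow_subgroup j)" if j: "Suc j \<in> levels" for j
    unfolding compatible_def
  proof
    fix C assume C: "C \<in> carrier (H Mod pow_subgroup j)"
    have j': "j \<in> levels" using levels_down[OF j, of j] by simp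
    obtain i where i: "0 \<le> i" "i < int p ^ j" "C = pow_coset j i" using pow_cosetE[OF j' C] .
    show "a (pow_subgroup j) C =
        (\<Oplus>D\<in>{D \<in> carrier (H Mod pow_subgroup (Suc j)). D \<subseteq> C}. a (pow_subgroup (Suc j)) D)"
      using step[OF j i(1,2)]
      by (simp only: i(3) finsum_pow_coset_fibre[OF j a_closed] a_eq[OF j'] a_eq[OF j])
  qed
  have "(\<lambda>N\<in>open_normals H. a N) \<in> carrier CG"
    by (rule CG_mem_of_adjacent[OF a_closed a_ext adjacent])
  then show ?thesis
    by (rule that) (simp add: level_coeff_def pow_subgroup_open a_eq)
qed

subsection \<open>The generator of the augmentation ideal\<close>

abbreviation "elt z \<equiv> cgr_elt R H (hpow z)"
abbreviation "gen_elt \<equiv> elt \<one>\<^bsub>Zp p\<^esub>"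

definition aug_gen :: "'h set \<Rightarrow> 'h set \<Rightarrow> 'r" where
  "aug_gen = gen_elt \<ominus>\<^bsub>CG\<^esub> \<one>\<^bsub>CG\<^esub>"

sublocale CG: cring CG
  by (rule CG_cring[OF HC.comm_group_axioms])

lemma elt_hpow_closed: "z \<in> carrier (Zp p) \<Longrightarrow> elt z \<in> carrier CG"
  by (simp add: elt_closed hpow_closed)

lemma aug_gen_closed: "aug_gen \<in> carrier CG"
  unfolding aug_gen_def by (simp add: elt_hpow_closed)

lemma gen_elt_eq: "gen_elt = \<one>\<^bsub>CG\<^esub> \<oplus>\<^bsub>CG\<^esub> aug_gen"
  unfolding aug_gen_def using elt_hpow_closed by (simp add: CG.add_minus_cancel)

lemma elt_add: "z \<in> carrier (Zp p) \<Longrightarrow> w \<in> carrier (Zp p) \<Longrightarrow> elt (z \<oplus>\<^bsub>Zp p\<^esub> w) = elt z \<otimes>\<^bsub>CG\<^esub> elt w"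
  by (simp add: hpow_add elt_mult hpow_closed)

lemma elt_nat_smult:
  assumes "z \<in> carrier (Zp p)"
  shows "elt (Zp_int p (int m) \<otimes>\<^bsub>Zp p\<^esub> z) = elt z [^]\<^bsub>CG\<^esub> m"
proof (induction m)
  case 0
  then show ?case using assms by (simp add: Zp_zero_eq[symmetric] hpow_zero elt_one)
next
  case (Suc m)
  have "Zp_int p (int (Suc m)) \<otimes>\<^bsub>Zp p\<^esub> z = Zp_int p (int m) \<otimes>\<^bsub>Zp p\<^esub> z \<oplus>\<^bsub>Zp p\<^esub> z"
    using assms by (simp add: Zp_int_add Zp_one_eq[symmetric] Z.l_distr Zp_int_closed Z.a_comm)
  then show ?case
    using assms Suc by (simp add: elt_add Zp_int_closed)
qed

lemma gen_elt_pow: "gen_elt [^]\<^bsub>CG\<^esub> m = elt (Zp_int p (int m))"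
  using elt_nat_smult[OF Z.one_closed, of m] by (simp add: Zp_int_closed)

lemma level_coeff_single_mult:
  assumes r: "r \<in> carrier R" and b: "b \<in> carrier CG"
  shows "level_coeff (cgr_single R H r (hpow (Zp_int p k)) \<otimes>\<^bsub>CG\<^esub> b) j i = r \<otimes> level_coeff b j (i - k)"
proof -
  interpret F: finite_group_ring R "H Mod pow_subgroup j" by (rule finite_group_ring_Mod[OF pow_subgroup_open])
  have "hpow (Zp_int p k) \<otimes>\<^bsub>H\<^esub> hpow (Zp_int p (i - k)) = hpow (Zp_int p i)"
    using hpow_add[OF Zp_int_closed Zp_int_closed, of k "i - k"] Zp_int_add[of k "i - k"] by simp
  then have mult: "pow_coset j k \<otimes>\<^bsub>H Mod pow_subgroup j\<^esub> pow_coset j (i - k) = pow_coset j i"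
    unfolding pow_coset_def
    using Mod_mult[OF pow_subgroup_open hpow_closed[OF Zp_int_closed] hpow_closed[OF Zp_int_closed]] by simp
  have "inv\<^bsub>H Mod pow_subgroup j\<^esub> pow_coset j k \<otimes>\<^bsub>H Mod pow_subgroup j\<^esub> pow_coset j i = pow_coset j (i - k)"
    unfolding mult[symmetric]
    by (rule F.Q.inv_solve_left'[THEN iffD2])
      (auto simp: pow_coset_closed intro: F.Q.m_closed simp del: mult_FactGroup)
  then show ?thesis
    unfolding level_coeff_def CG_simps(3)[OF pow_subgroup_open] single_component[OF pow_subgroup_open]
      pow_coset_def[of j k, symmetric]
    by (subst F.single_mult[OF r pow_coset_closed CG_memD(1)[OF b pow_subgroup_open] pow_coset_closed])
      (simp only:)
qed

lemma level_coeff_add: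
  "a \<in> carrier CG \<Longrightarrow> b \<in> carrier CG \<Longrightarrow>
    level_coeff (a \<oplus>\<^bsub>CG\<^esub> b) j i = level_coeff a j i \<oplus> level_coeff b j i"
  unfolding level_coeff_def CG_simps(2)[OF pow_subgroup_open]
  by (rule finite_group_ring.RQ_add[OF finite_group_ring_Mod[OF pow_subgroup_open] pow_coset_closed])

lemma level_coeff_zero: "level_coeff \<zero>\<^bsub>CG\<^esub> j i = \<zero>"
  unfolding level_coeff_def CG_simps(4)[OF pow_subgroup_open]
  by (rule finite_group_ring.RQ_zero[OF finite_group_ring_Mod[OF pow_subgroup_open] pow_coset_closed])

lemma level_coeff_minus:
  "a \<in> carrier CG \<Longrightarrow> b \<in> carrier CG \<Longrightarrow>
    level_coeff (a \<ominus>\<^bsub>CG\<^esub> b) j i = level_coeff a j i \<ominus> level_coeff b j i"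
  by (rule additive_minus[OF CG.abelian_group_axioms R.abelian_group_axioms, of "\<lambda>a. level_coeff a j i"])
    (auto simp: level_coeff_closed level_coeff_add)

lemma level_coeff_finsum:
  assumes "finite A" "f \<in> A \<rightarrow> carrier CG"
  shows "level_coeff (\<Oplus>\<^bsub>CG\<^esub>l\<in>A. f l) j i = (\<Oplus>l\<in>A. level_coeff (f l) j i)"
  by (rule additive_finsum[OF CG.abelian_monoid_axioms R.abelian_monoid_axioms assms, of "\<lambda>a. level_coeff a j i"])
    (auto simp: level_coeff_closed level_coeff_zero level_coeff_add)

lemma level_coeff_aug_gen_mult:
  assumes b: "b \<in> carrier CG"
  shows "level_coeff (aug_gen \<otimes>\<^bsub>CG\<^esub> b) j i = level_coeff b j (i - 1) \<ominus> level_coeff b j i"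
proof -
  have "aug_gen \<otimes>\<^bsub>CG\<^esub> b = gen_elt \<otimes>\<^bsub>CG\<^esub> b \<ominus>\<^bsub>CG\<^esub> b"
    unfolding aug_gen_def using b elt_hpow_closed[OF Z.one_closed]
    by (simp add: a_minus_def CG.l_distr CG.l_minus)
  then show ?thesis
    using level_coeff_single_mult[OF R.one_closed b, of 1 j i] b elt_hpow_closed[OF Z.one_closed]
      level_coeff_closed[OF b]
    by (simp add: level_coeff_minus elt_eq Zp_one_eq)
qed

lemma augmentation_aug_gen: "augmentation aug_gen = \<zero>"
proof -
  interpret aug: ring_hom_cring CG R augmentation
    by (intro ring_hom_cring.intro ring_hom_cring_axioms.intro CG.is_cring R.is_cring augmentation_hom)
  show ?thesis
    using elt_hpow_closed[OF Z.one_closed]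
    by (simp add: aug_gen_def a_minus_def R.r_neg augmentation_single elt_eq hpow_closed)
qed

end

subsection \<open>Divisibility by the generator\<close>

definition (in abelian_monoid) partial_sum :: "(int \<Rightarrow> 'a) \<Rightarrow> nat \<Rightarrow> 'a" where
  "partial_sum f m = (\<Oplus>t\<in>{..<m}. f (int t + 1))"

context abelian_monoid
begin

lemma partial_sum_closed: "(\<And>i. f i \<in> carrier G) \<Longrightarrow> partial_sum f m \<in> carrier G"
  unfolding partial_sum_def by (intro finsum_closed) auto

lemma partial_sum_zero: "partial_sum f 0 = \<zero>"
  by (simp add: partial_sum_def)

lemma partial_sum_Suc:
  "(\<And>i. f i \<in> carrier G) \<Longrightarrow> partial_sum f (Suc m) = partial_sum f m \<oplus> f (int m + 1)"
  unfolding partial_sum_def lessThan_Suc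
  by (subst finsum_insert) (auto simp: a_comm Pi_def intro: finsum_closed)

lemma partial_sum_add:
  assumes "\<And>i. f i \<in> carrier G"
  shows "partial_sum f (m + k) = partial_sum f m \<oplus> partial_sum (\<lambda>i. f (i + int m)) k"
proof (induction k)
  case 0
  then show ?case using partial_sum_closed[of f m] assms by (simp add: partial_sum_zero)
next
  case (Suc k)
  then show ?case
    using assms by (simp add: partial_sum_Suc partial_sum_closed a_assoc add_ac)
qed

lemma partial_sum_periodic:
  assumes f: "\<And>i. f i \<in> carrier G" and periodic: "\<And>i i'. [i = i'] (mod int P) \<Longrightarrow> f i = f i'"
    and P: "0 < P" "partial_sum f P = \<zero>"
  shows "partial_sum f (nat (i mod int P)) = partial_sum f (nat ((i - 1) mod int P)) \<oplus> f i"
proof -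
  define m where "m = nat ((i - 1) mod int P)"
  have m: "m < P" "int m = (i - 1) mod int P"
    using P(1) by (simp_all add: m_def nat_less_iff)
  then have i: "[int m + 1 = i] (mod int P)"
    by (simp add: cong_def mod_simps)
  have "partial_sum f (nat (i mod int P)) = partial_sum f (Suc m)"
  proof (cases "Suc m = P")
    case True
    then have "i mod int P = 0" using i by (simp add: cong_def add.commute flip: of_nat_Suc)
    then show ?thesis by (simp add: True P(2) partial_sum_zero)
  next
    case False
    then have "i mod int P = int (Suc m)" using i m(1) by (simp add: cong_def)
    then show ?thesis by (simp only: nat_int)
  qed
  also have "\<dots> = partial_sum f m \<oplus> f i"
    using partial_sum_Suc[OF f] periodic[OF i] by simp
  finally show ?thesis by (simp add: m_def)
qed

end

context Zp_tower
begin

lemma bij_betw_pow_coset: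
  assumes j: "j \<in> levels"
  shows "bij_betw (\<lambda>t. pow_coset j (int t + 1)) {..<p ^ j} (carrier (H Mod pow_subgroup j))"
proof (rule bij_betw_imageI)
  show "inj_on (\<lambda>t. pow_coset j (int t + 1)) {..<p ^ j}"
  proof (rule inj_onI)
    fix s t assume st: "s \<in> {..<p ^ j}" "t \<in> {..<p ^ j}" "pow_coset j (int s + 1) = pow_coset j (int t + 1)"
    then have "[int s = int t] (mod int p ^ j)"
      using pow_coset_eq_iff[OF j] cong_add_rcancel by blast
    then show "s = t" using st(1,2) by (simp add: cong_def flip: of_nat_power)
  qed
  show "(\<lambda>t. pow_coset j (int t + 1)) ` {..<p ^ j} = carrier (H Mod pow_subgroup j)"
  proof (intro equalityI subsetI)
    fix C assume "C \<in> carrier (H Mod pow_subgroup j)"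
    then obtain i where i: "C = pow_coset j i" using pow_cosetE[OF j] by blast
    let ?t = "nat ((i - 1) mod int p ^ j)"
    have t: "?t < p ^ j" "int ?t = (i - 1) mod int p ^ j"
      using p_pos[of j] by (simp_all add: nat_less_iff)
    have "C = pow_coset j (int ?t + 1)"
      unfolding i t(2) pow_coset_eq_iff[OF j] by (simp add: cong_def mod_simps)
    then show "C \<in> (\<lambda>t. pow_coset j (int t + 1)) ` {..<p ^ j}" using t(1) by blast
  qed (use pow_coset_closed in auto)
qed

lemma partial_sum_level_coeff:
  assumes a: "a \<in> carrier CG" and j: "j \<in> levels"
  shows "R.partial_sum (level_coeff a j) (p ^ j) = augmentation a"
proof -
  have subset: "pow_subgroup j \<subseteq> carrier H"
    using subgroup.subset[OF open_normal_subgroup[OF pow_subgroup_open]] .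
  have "augmentation a = (\<Oplus>D\<in>{D \<in> carrier (H Mod pow_subgroup j). D \<subseteq> carrier H}. a (pow_subgroup j) D)"
    unfolding augmentation_def
    by (rule CG_memD(2)[OF a pow_subgroup_open carrier_open_normal subset]) (simp add: Mod_carrier_group)
  also have "{D \<in> carrier (H Mod pow_subgroup j). D \<subseteq> carrier H} = carrier (H Mod pow_subgroup j)"
    using G.rcosets_subset_PowG[OF open_normal_subgroup[OF pow_subgroup_open]] by (auto simp: FactGroup_def)
  also have "(\<Oplus>D\<in>carrier (H Mod pow_subgroup j). a (pow_subgroup j) D) = R.partial_sum (level_coeff a j) (p ^ j)"
    unfolding R.partial_sum_def level_coeff_def
    by (rule R.finsum_reindex_bij[OF bij_betw_pow_coset[OF j]]) (use CG_eval_closed[OF a pow_subgroup_open] in auto)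
  finally show ?thesis by simp
qed

lemma finsum_partial_sums:
  assumes a: "a \<in> carrier CG" and j: "Suc j \<in> levels"
  shows "(\<Oplus>l\<in>{..<p}. R.partial_sum (level_coeff a (Suc j)) (l * p ^ j + r)) =
    (\<Oplus>l\<in>{..<p}. R.partial_sum (level_coeff a (Suc j)) (l * p ^ j)) \<oplus> R.partial_sum (level_coeff a j) r"
proof -
  let ?f = "level_coeff a (Suc j)"
  note closed = level_coeff_closed[OF a] R.partial_sum_closed[of ?f, OF level_coeff_closed[OF a]]
  have split: "R.partial_sum ?f (l * p ^ j + r) =
      R.partial_sum ?f (l * p ^ j) \<oplus> (\<Oplus>t\<in>{..<r}. ?f (int t + 1 + int l * int p ^ j))" for l
    by (subst R.partial_sum_add) (simp_all add: closed, simp add: R.partial_sum_def)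
  have "(\<Oplus>l\<in>{..<p}. R.partial_sum ?f (l * p ^ j + r)) = (\<Oplus>l\<in>{..<p}. R.partial_sum ?f (l * p ^ j)) \<oplus>
      (\<Oplus>l\<in>{..<p}. \<Oplus>t\<in>{..<r}. ?f (int t + 1 + int l * int p ^ j))"
    unfolding split using closed by (intro R.finsum_addf) (auto intro: R.finsum_closed)
  also have "(\<Oplus>l\<in>{..<p}. \<Oplus>t\<in>{..<r}. ?f (int t + 1 + int l * int p ^ j)) =
      (\<Oplus>t\<in>{..<r}. \<Oplus>l\<in>{..<p}. ?f (int t + 1 + int l * int p ^ j))"
    using closed by (intro R.finsum_swap) auto
  also have "\<dots> = R.partial_sum (level_coeff a j) r"
    unfolding R.partial_sum_def level_coeff_compatible[OF a j] ..
  finally show ?thesis .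
qed

lemma nat_residue_shift:
  assumes "r < p ^ j" "l < p"
  shows "nat ((int r + int l * int p ^ j) mod int p ^ Suc j) = l * p ^ j + r"
proof -
  have "l * p ^ j + r < Suc l * p ^ j" using assms(1) by simp
  also have "\<dots> \<le> p * p ^ j" using assms(2) by (intro mult_le_mono1) simp
  finally have "int (l * p ^ j + r) < int p ^ Suc j" by (metis of_nat_less_iff of_nat_power power_Suc)
  moreover have "int r + int l * int p ^ j = int (l * p ^ j + r)" by simp
  ultimately show ?thesis by (metis mod_pos_pos_trivial nat_int of_nat_0_le_iff)
qed

text \<open>The quotient of \<open>a\<close> by \<open>h - 1\<close> has, up to a constant \<open>c j\<close> at each level, the negated partial
  sums of \<open>a\<close> as coefficients; compatibility of the levels is a recursion for the constants.\<close>

lemma antiderivative_exists: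
  assumes a: "a \<in> carrier CG"
  obtains b c where "b \<in> carrier CG" "\<And>j. c j \<in> carrier R"
    "\<And>j i. j \<in> levels \<Longrightarrow>
      level_coeff b j i = c j \<ominus> R.partial_sum (level_coeff a j) (nat (i mod int p ^ j))"
proof -
  let ?S = "\<lambda>j. R.partial_sum (level_coeff a j)"
  have S: "?S j m \<in> carrier R" for j m by (rule R.partial_sum_closed[OF level_coeff_closed[OF a]])
  define E where "E j = (\<Oplus>l\<in>{..<p}. ?S (Suc j) (l * p ^ j))" for j
  have E: "E j \<in> carrier R" for j unfolding E_def using S by (intro R.finsum_closed) auto
  obtain c where c: "\<And>k. c k \<in> carrier R" "\<And>k. c k = \<ominus> E k \<oplus> int_img (int p) \<otimes> c (Suc k)"
    using p_recursion[of "\<lambda>k. \<ominus> E k"] E by blast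
  define s where "s j i = c j \<ominus> ?S j (nat (i mod int p ^ j))" for j i
  have step: "s j i = (\<Oplus>l\<in>{..<p}. s (Suc j) (i + int l * int p ^ j))"
    if j: "Suc j \<in> levels" and i: "0 \<le> i" "i < int p ^ j" for j i
  proof -
    obtain r where r: "i = int r" "r < p ^ j" using i by (metis nat_less_iff nat_0_le of_nat_power)
    have "(\<Oplus>l\<in>{..<p}. s (Suc j) (i + int l * int p ^ j)) =
        (\<Oplus>l\<in>{..<p}. c (Suc j) \<oplus> \<ominus> ?S (Suc j) (l * p ^ j + r))"
      using c(1) S by (intro R.finsum_cong')
        (auto simp: s_def r(1) nat_residue_shift[OF r(2)] a_minus_def simp del: power_Suc)
    also have "\<dots> = int_img (int p) \<otimes> c (Suc j) \<oplus> (\<Oplus>l\<in>{..<p}. \<ominus> ?S (Suc j) (l * p ^ j + r))"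
      using c(1) S by (subst R.finsum_addf) (auto simp: finsum_const_int_img)
    also have "(\<Oplus>l\<in>{..<p}. \<ominus> ?S (Suc j) (l * p ^ j + r)) = \<ominus> (\<Oplus>l\<in>{..<p}. ?S (Suc j) (l * p ^ j + r))"
      using S by (intro additive_finsum[symmetric, of R R])
        (auto simp: R.minus_add R.abelian_monoid_axioms R.a_comm)
    also have "\<dots> = \<ominus> E j \<oplus> \<ominus> ?S j r"
      using S E by (simp add: finsum_partial_sums[OF a j] E_def[symmetric] R.minus_add)
    also have "int_img (int p) \<otimes> c (Suc j) \<oplus> (\<ominus> E j \<oplus> \<ominus> ?S j r) = c j \<oplus> \<ominus> ?S j r"
      by (subst (2) c(2)) (use c(1) S E in \<open>simp add: int_img_simps R.a_ac\<close>)
    also have "\<dots> = s j i"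
      using r by (simp add: s_def a_minus_def)
    finally show ?thesis by simp
  qed
  have s_closed: "s j i \<in> carrier R" for j i using c(1) S by (simp add: s_def)
  have periodic: "s j i = s j i'" if "[i = i'] (mod int p ^ j)" for j i i'
    using that by (simp add: s_def cong_def)
  obtain b where "b \<in> carrier CG" "\<And>j i. j \<in> levels \<Longrightarrow> level_coeff b j i = s j i"
    using compatible_family_exists[of s, OF s_closed periodic step] by blast
  then show ?thesis using that c(1) unfolding s_def by blast
qed

lemma aug_gen_dvd:
  assumes a: "a \<in> carrier CG" and aug: "augmentation a = \<zero>"
  shows "\<exists>b\<in>carrier CG. a = aug_gen \<otimes>\<^bsub>CG\<^esub> b"
proof -
  obtain b c where b: "b \<in> carrier CG" and c: "\<And>j. c j \<in> carrier R"
    and b_coeff: "\<And>j i. j \<in> levels \<Longrightarrow>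
      level_coeff b j i = c j \<ominus> R.partial_sum (level_coeff a j) (nat (i mod int p ^ j))"
    using antiderivative_exists[OF a] by blast
  have "a = aug_gen \<otimes>\<^bsub>CG\<^esub> b"
  proof (rule level_coeff_ext[OF a CG.m_closed[OF aug_gen_closed b]])
    fix j i assume j: "j \<in> levels"
    let ?f = "level_coeff a j"
    let ?S = "R.partial_sum ?f (nat ((i - 1) mod int p ^ j))"
    have S: "?S \<in> carrier R" by (rule R.partial_sum_closed[OF level_coeff_closed[OF a]])
    have "R.partial_sum ?f (nat (i mod int p ^ j)) = ?S \<oplus> ?f i"
      using R.partial_sum_periodic[of ?f "p ^ j" i] level_coeff_closed[OF a] level_coeff_cong[OF j]
        partial_sum_level_coeff[OF a j] aug p_gt_1 by simp
    then have "level_coeff (aug_gen \<otimes>\<^bsub>CG\<^esub> b) j i = (c j \<ominus> ?S) \<ominus> (c j \<ominus> (?S \<oplus> ?f i))"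
      using j by (simp add: level_coeff_aug_gen_mult[OF b] b_coeff)
    also have "\<dots> = ?f i"
      using c[of j] S level_coeff_closed[OF a, of j i]
      by (simp add: a_minus_def R.minus_add R.a_ac R.r_neg R.r_neg1 R.r_neg2)
    finally show "?f i = level_coeff (aug_gen \<otimes>\<^bsub>CG\<^esub> b) j i" by simp
  qed
  with b show ?thesis by blast
qed

sublocale AR: augmented_ring CG R "cgr_const R H" augmentation aug_gen
  by unfold_locales
    (auto simp: const_hom augmentation_hom const_eq augmentation_single aug_gen_closed
      augmentation_aug_gen aug_gen_dvd)

subsection \<open>The annihilator of the generator\<close>

lemma expands_gen_elt_pow:
  "AR.expands m (\<lambda>k. int_img (int (N choose k))) (gen_elt [^]\<^bsub>CG\<^esub> N)"
proof (induction N)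
  case 0
  have "(\<lambda>k. int_img (int (0 choose k))) = (\<lambda>k. if k = 0 then \<one> else \<zero>)"
  proof
    fix k show "int_img (int (0 choose k)) = (if k = 0 then \<one> else \<zero>)"
      by (cases k) (auto simp: int_img_simps)
  qed
  then show ?case
    using AR.expands_const[OF R.one_closed, of m] by simp
next
  case (Suc N)
  have gen: "gen_elt \<in> carrier CG" using elt_hpow_closed by simp
  have "gen_elt [^]\<^bsub>CG\<^esub> Suc N = gen_elt [^]\<^bsub>CG\<^esub> N \<otimes>\<^bsub>CG\<^esub> (\<one>\<^bsub>CG\<^esub> \<oplus>\<^bsub>CG\<^esub> aug_gen)"
    using gen_elt_eq by simp
  then have "gen_elt [^]\<^bsub>CG\<^esub> Suc N = gen_elt [^]\<^bsub>CG\<^esub> N \<oplus>\<^bsub>CG\<^esub> aug_gen \<otimes>\<^bsub>CG\<^esub> gen_elt [^]\<^bsub>CG\<^esub> N"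
    using gen aug_gen_closed by (simp add: CG.r_distr CG.m_comm)
  moreover have "(\<lambda>k. int_img (int (Suc N choose k))) = (\<lambda>k. int_img (int (N choose k)) \<oplus>
      (if k = 0 then \<zero> else int_img (int (N choose (k - 1)))))"
  proof
    fix k
    show "int_img (int (Suc N choose k)) = int_img (int (N choose k)) \<oplus>
        (if k = 0 then \<zero> else int_img (int (N choose (k - 1))))"
      by (cases k) (auto simp: int_img_simps R.a_comm)
  qed
  ultimately show ?case
    using AR.expands_add[OF _ _ Suc AR.expands_shift[OF _ Suc]] by (simp add: int_img_simps)
qed

definition norm_elt :: "nat \<Rightarrow> 'h set \<Rightarrow> 'h set \<Rightarrow> 'r" where
  "norm_elt N = (\<Oplus>\<^bsub>CG\<^esub>i\<in>{..<N}. gen_elt [^]\<^bsub>CG\<^esub> i)"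

lemma norm_elt_closed: "norm_elt N \<in> carrier CG"
  unfolding norm_elt_def using elt_hpow_closed[OF Z.one_closed] by (intro CG.finsum_closed) auto

lemma norm_elt_Suc: "norm_elt (Suc N) = norm_elt N \<oplus>\<^bsub>CG\<^esub> gen_elt [^]\<^bsub>CG\<^esub> N"
  unfolding norm_elt_def lessThan_Suc using elt_hpow_closed[OF Z.one_closed]
  by (subst CG.finsum_insert) (auto simp: CG.a_comm)

lemma expands_norm_elt: "AR.expands m (\<lambda>k. int_img (int (N choose Suc k))) (norm_elt N)"
proof (induction N)
  case 0
  show ?case
    using AR.expands_const[OF R.zero_closed, of m]
    by (simp add: norm_elt_def int_img_simps if_distrib cong: if_cong)
next
  case (Suc N)
  have "(\<lambda>k. int_img (int (Suc N choose Suc k))) =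
      (\<lambda>k. int_img (int (N choose Suc k)) \<oplus> int_img (int (N choose k)))"
    by (auto simp: int_img_simps R.a_comm)
  then show ?case
    using AR.expands_add[OF _ _ Suc expands_gen_elt_pow] by (simp add: norm_elt_Suc int_img_simps)
qed

lemma level_coeff_gen_elt_pow:
  assumes j: "j \<in> levels"
  shows "level_coeff (gen_elt [^]\<^bsub>CG\<^esub> l) j i = (if [i = int l] (mod int p ^ j) then \<one> else \<zero>)"
proof -
  have "level_coeff (gen_elt [^]\<^bsub>CG\<^esub> l) j i =
      gr_single R (H Mod pow_subgroup j) \<one> (pow_coset j (int l)) (pow_coset j i)"
    unfolding gen_elt_pow unfolding elt_eq level_coeff_def single_component[OF pow_subgroup_open] pow_coset_def ..
  then show ?thesis
    using pow_coset_closed pow_coset_eq_iff[OF j] by (simp add: gr_single_def)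
qed

lemma level_coeff_norm_elt:
  assumes j: "j \<in> levels"
  shows "level_coeff (norm_elt (p ^ j)) j i = \<one>"
proof -
  let ?m = "nat (i mod int p ^ j)"
  have m: "?m < p ^ j" using p_pos[of j] by (simp add: nat_less_iff)
  have iff: "[i = int l] (mod int p ^ j) \<longleftrightarrow> ?m = l" if "l < p ^ j" for l
    using that p_pos[of j] by (auto simp: cong_def simp flip: of_nat_power)
  have "level_coeff (norm_elt (p ^ j)) j i = (\<Oplus>l\<in>{..<p ^ j}. level_coeff (gen_elt [^]\<^bsub>CG\<^esub> l) j i)"
    unfolding norm_elt_def using elt_hpow_closed[OF Z.one_closed] by (intro level_coeff_finsum) auto
  also have "\<dots> = (\<Oplus>l\<in>{..<p ^ j}. if ?m = l then \<one> else \<zero>)"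
    by (rule R.finsum_cong') (auto simp: level_coeff_gen_elt_pow[OF j] iff)
  also have "\<dots> = \<one>"
    using m by (intro R.finsum_singleton) auto
  finally show ?thesis .
qed

lemma level_coeff_annihilator:
  assumes b: "b \<in> carrier CG" "aug_gen \<otimes>\<^bsub>CG\<^esub> b = \<zero>\<^bsub>CG\<^esub>"
  shows "level_coeff b j i = level_coeff b j 0"
proof -
  have eq: "level_coeff b j (i - 1) = level_coeff b j i" for i
  proof -
    have "level_coeff b j (i - 1) \<ominus> level_coeff b j i = \<zero>"
      by (simp only: level_coeff_aug_gen_mult[OF b(1), symmetric] b(2) level_coeff_zero)
    then show ?thesis using level_coeff_closed[OF b(1)] by (simp add: R.minus_eq_zero_iff)
  qed
  show ?thesis
  proof (induction i rule: int_induct[of _ 0])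
    case (step1 i)
    then show ?case using eq[of "i + 1"] by simp
  next
    case (step2 i)
    then show ?case using eq[of i] by simp
  qed simp
qed

lemma annihilator_level_step:
  assumes b: "b \<in> carrier CG" "aug_gen \<otimes>\<^bsub>CG\<^esub> b = \<zero>\<^bsub>CG\<^esub>" and j: "Suc j \<in> levels"
  shows "level_coeff b j 0 = int_img (int p) \<otimes> level_coeff b (Suc j) 0"
proof -
  note closed = level_coeff_closed[OF b(1)]
  have "level_coeff b j 0 = (\<Oplus>l\<in>{..<p}. level_coeff b (Suc j) (0 + int l * int p ^ j))"
    by (rule level_coeff_compatible[OF b(1) j])
  also have "\<dots> = (\<Oplus>l\<in>{..<p}. level_coeff b (Suc j) 0)"
    by (intro R.finsum_cong' refl level_coeff_annihilator[OF b]) (use closed in auto)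
  also have "\<dots> = int_img (int p) \<otimes> level_coeff b (Suc j) 0" using closed by (rule finsum_const_int_img)
  finally show ?thesis .
qed

lemma annihilator_zero:
  assumes inj: "\<forall>z\<in>carrier (Zp p). hpow z = \<one>\<^bsub>H\<^esub> \<longrightarrow> z = \<zero>\<^bsub>Zp p\<^esub>"
    and b: "b \<in> carrier CG" "aug_gen \<otimes>\<^bsub>CG\<^esub> b = \<zero>\<^bsub>CG\<^esub>"
  shows "b = \<zero>\<^bsub>CG\<^esub>"
proof (rule level_coeff_ext[OF b(1) CG.zero_closed])
  note closed = level_coeff_closed[OF b(1)]
  have levels: "j \<in> levels" for j using inj by (auto simp: levels_def Zp_simps(4))
  have "level_coeff b j 0 = int_img (int p ^ i) \<otimes> level_coeff b (j + i) 0" for i j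
  proof (induction i)
    case 0
    then show ?case using closed by (simp add: int_img_simps)
  next
    case (Suc i)
    then show ?case
      using annihilator_level_step[OF b levels, of "j + i"] closed by (simp add: int_img_simps R.m_ac)
  qed
  then have "p_pow_dvd i (level_coeff b j 0)" for i j
    using closed unfolding p_pow_dvd_def by blast
  then show "level_coeff b j i = level_coeff \<zero>\<^bsub>CG\<^esub> j i" for j i
    unfolding level_coeff_annihilator[OF b, of j i] level_coeff_zero by (rule zero_if_p_pow_dvd)
qed

lemma annihilator_norm_multiple:
  assumes a: "\<forall>z\<in>carrier (Zp p). hpow z = \<one>\<^bsub>H\<^esub> \<longleftrightarrow> z a = 0"
    and b: "b \<in> carrier CG" "aug_gen \<otimes>\<^bsub>CG\<^esub> b = \<zero>\<^bsub>CG\<^esub>"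
  shows "b = cgr_const R H (level_coeff b a 0) \<otimes>\<^bsub>CG\<^esub> norm_elt (p ^ a)" (is "b = ?d")
proof -
  note closed = level_coeff_closed[OF b(1)]
  have a_level: "a \<in> levels" using a by (auto simp: levels_def)
  have d: "?d \<in> carrier CG" by (intro CG.m_closed const_closed closed norm_elt_closed)
  have "level_coeff b j i = level_coeff ?d j i" if "j \<le> a" for j i
    using that
  proof (induction j arbitrary: i rule: inc_induct)
    case base
    show ?case
      using level_coeff_single_mult[OF closed norm_elt_closed, of a 0 0 "p ^ a" a i] closed
        level_coeff_annihilator[OF b, of a i] level_coeff_norm_elt[OF a_level]
      by (simp add: const_eq Zp_zero_eq[symmetric] hpow_zero)
  next
    case (step j)
    have "Suc j \<in> levels" using levels_down[OF a_level] step.hyps by simp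
    then show ?case
      using level_coeff_compatible[OF b(1)] level_coeff_compatible[OF d] step.IH by simp
  qed
  then show ?thesis
    using level_le[OF a] by (intro level_coeff_ext[OF b(1) d]) blast
qed

lemma annihilator_in_power:
  assumes binomials: "\<And>a k. \<forall>z\<in>carrier (Zp p). hpow z = \<one>\<^bsub>H\<^esub> \<longleftrightarrow> z a = 0 \<Longrightarrow> 1 \<le> k \<Longrightarrow> k \<le> n \<Longrightarrow>
      int_img (int (p ^ a choose k)) = \<zero>"
    and b: "b \<in> carrier CG" "aug_gen \<otimes>\<^bsub>CG\<^esub> b = \<zero>\<^bsub>CG\<^esub>"
  shows "\<exists>y\<in>carrier CG. b = aug_gen [^]\<^bsub>CG\<^esub> n \<otimes>\<^bsub>CG\<^esub> y"
  using hpow_kernel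
proof
  assume "\<forall>z\<in>carrier (Zp p). hpow z = \<one>\<^bsub>H\<^esub> \<longrightarrow> z = \<zero>\<^bsub>Zp p\<^esub>"
  then have "b = \<zero>\<^bsub>CG\<^esub>" using annihilator_zero b by blast
  then show ?thesis
    using aug_gen_closed by (intro bexI[of _ "\<zero>\<^bsub>CG\<^esub>"]) auto
next
  assume "\<exists>a. \<forall>z\<in>carrier (Zp p). hpow z = \<one>\<^bsub>H\<^esub> \<longleftrightarrow> z a = 0"
  then obtain a where a: "\<forall>z\<in>carrier (Zp p). hpow z = \<one>\<^bsub>H\<^esub> \<longleftrightarrow> z a = 0" by blast
  obtain y where y: "y \<in> carrier CG"
    "norm_elt (p ^ a) = AR.horner n (\<lambda>k. int_img (int (p ^ a choose Suc k))) \<oplus>\<^bsub>CG\<^esub> aug_gen [^]\<^bsub>CG\<^esub> n \<otimes>\<^bsub>CG\<^esub> y"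
    using expands_norm_elt[of n "p ^ a"] by (rule AR.expandsE)
  have "AR.horner n (\<lambda>k. int_img (int (p ^ a choose Suc k))) = \<zero>\<^bsub>CG\<^esub>"
    unfolding AR.horner_zero[of n, symmetric] by (rule AR.horner_cong) (use binomials[OF a] in simp)
  then have norm: "norm_elt (p ^ a) = aug_gen [^]\<^bsub>CG\<^esub> n \<otimes>\<^bsub>CG\<^esub> y"
    using y aug_gen_closed by simp
  let ?c = "cgr_const R H (level_coeff b a 0)"
  have "?c \<in> carrier CG" by (rule const_closed[OF level_coeff_closed[OF b(1)]])
  then show ?thesis
    using annihilator_norm_multiple[OF a b] norm y(1) aug_gen_closed
    by (intro bexI[of _ "?c \<otimes>\<^bsub>CG\<^esub> y"]) (simp_all add: CG.m_lcomm)
qed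

end

subsection \<open>Expansion of group elements\<close>

locale Zp_tower_trunc = Zp_tower H R p q hpow
  for H :: "('h, 'x) topgroup_scheme" and R :: "('r, 'y) topring_scheme" (structure) and p q hpow +
  fixes n :: nat
  assumes binomials_vanish: "\<forall>z\<in>carrier (Zp p). hpow z = \<one>\<^bsub>H\<^esub> \<longleftrightarrow> z a = 0 \<Longrightarrow> 1 \<le> k \<Longrightarrow> k \<le> n \<Longrightarrow>
      int_img (int (p ^ a choose k)) = \<zero>"
begin

sublocale AT: augmented_ring_trunc CG R "cgr_const R H" augmentation aug_gen n
  by unfold_locales (rule annihilator_in_power[OF binomials_vanish])

text \<open>Membership in the \<open>K\<close>-th power of the ideal \<open>(p, x)\<close>, modulo \<open>x^(n+1)\<close>; truncated subtraction
  makes the condition void for \<open>k \<ge> K\<close>.\<close>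

definition px_filtration :: "nat \<Rightarrow> ('h set \<Rightarrow> 'h set \<Rightarrow> 'r) \<Rightarrow> bool" where
  "px_filtration K a \<longleftrightarrow> (\<forall>k\<le>n. p_pow_dvd (K - k) (AT.x_coeff a k))"

lemma px_filtration_mult:
  assumes a: "a \<in> carrier CG" "px_filtration K a" and b: "b \<in> carrier CG" "px_filtration L b"
  shows "px_filtration (K + L) (a \<otimes>\<^bsub>CG\<^esub> b)"
  unfolding px_filtration_def
proof (intro allI impI)
  fix k assume k: "k \<le> n"
  show "p_pow_dvd (K + L - k) (AT.x_coeff (a \<otimes>\<^bsub>CG\<^esub> b) k)"
    unfolding AT.x_coeff_mult[OF a(1) b(1) k]
  proof (rule p_pow_dvd_finsum)
    fix l assume l: "l \<in> {..k}"
    then have "k - l \<le> n" "l \<le> n" using k by simp_all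
    then have "p_pow_dvd ((K - (k - l)) + (L - l)) (AT.x_coeff a (k - l) \<otimes> AT.x_coeff b l)"
      using a(2) b(2) unfolding px_filtration_def by (blast intro: p_pow_dvd_mult)
    then show "p_pow_dvd (K + L - k) (AT.x_coeff a (k - l) \<otimes> AT.x_coeff b l)"
      by (rule p_pow_dvd_mono) (use l in auto)
  qed simp
qed

lemma px_filtration_add:
  "a \<in> carrier CG \<Longrightarrow> px_filtration K a \<Longrightarrow> b \<in> carrier CG \<Longrightarrow> px_filtration K b \<Longrightarrow>
    px_filtration K (a \<oplus>\<^bsub>CG\<^esub> b)"
  unfolding px_filtration_def by (auto simp: AT.x_coeff_add intro!: p_pow_dvd_add)

lemma px_filtration_mono: "px_filtration K a \<Longrightarrow> L \<le> K \<Longrightarrow> px_filtration L a"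
  unfolding px_filtration_def using p_pow_dvd_mono diff_le_mono by meson

lemma px_filtration_0: "a \<in> carrier CG \<Longrightarrow> px_filtration 0 a"
  unfolding px_filtration_def using AT.x_coeff_closed by (auto intro: p_pow_dvd_0)

lemma px_filtration_p: "px_filtration 1 (cgr_const R H (int_img (int p)))"
  unfolding px_filtration_def
proof (intro allI impI)
  fix k assume "k \<le> n"
  then show "p_pow_dvd (1 - k) (AT.x_coeff (cgr_const R H (int_img (int p))) k)"
    using p_pow_dvdI[of \<one> 1] by (cases "k = 0") (simp_all add: AT.x_coeff_const int_img_simps p_pow_dvd_zero)
qed

lemma px_filtration_aug_kernel:
  assumes a: "a \<in> carrier CG" "augmentation a = \<zero>"
  shows "px_filtration 1 a"
  unfolding px_filtration_def
proof (intro allI impI)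
  obtain b where b: "b \<in> carrier CG" "a = aug_gen \<otimes>\<^bsub>CG\<^esub> b" using aug_gen_dvd[OF a] by blast
  fix k assume "k \<le> n"
  then show "p_pow_dvd (1 - k) (AT.x_coeff a k)"
    using AT.x_coeff_x[OF b(1), of k] AT.x_coeff_closed[OF b(1)] b(2)
    by (cases "k = 0") (simp_all add: p_pow_dvd_zero p_pow_dvd_0)
qed

lemma one_plus_pow_expand:
  assumes j: "j \<in> carrier CG"
  shows "\<exists>s\<in>carrier CG. (\<one>\<^bsub>CG\<^esub> \<oplus>\<^bsub>CG\<^esub> j) [^]\<^bsub>CG\<^esub> (N::nat) =
    \<one>\<^bsub>CG\<^esub> \<oplus>\<^bsub>CG\<^esub> (cgr_const R H (int_img (int N)) \<otimes>\<^bsub>CG\<^esub> j \<oplus>\<^bsub>CG\<^esub> j \<otimes>\<^bsub>CG\<^esub> j \<otimes>\<^bsub>CG\<^esub> s)"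
proof (induction N)
  case 0
  then show ?case
    using j by (intro bexI[of _ "\<zero>\<^bsub>CG\<^esub>"]) (auto simp: int_img_simps)
next
  case (Suc N)
  let ?c = "cgr_const R H (int_img (int N))"
  obtain s where s: "s \<in> carrier CG" "(\<one>\<^bsub>CG\<^esub> \<oplus>\<^bsub>CG\<^esub> j) [^]\<^bsub>CG\<^esub> N =
    \<one>\<^bsub>CG\<^esub> \<oplus>\<^bsub>CG\<^esub> (?c \<otimes>\<^bsub>CG\<^esub> j \<oplus>\<^bsub>CG\<^esub> j \<otimes>\<^bsub>CG\<^esub> j \<otimes>\<^bsub>CG\<^esub> s)" using Suc by blast
  have c: "?c \<in> carrier CG" "cgr_const R H (int_img (int (Suc N))) = \<one>\<^bsub>CG\<^esub> \<oplus>\<^bsub>CG\<^esub> ?c"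
    by (simp_all add: int_img_simps const_closed)
  let ?t = "?c \<oplus>\<^bsub>CG\<^esub> s \<oplus>\<^bsub>CG\<^esub> j \<otimes>\<^bsub>CG\<^esub> s"
  have "(\<one>\<^bsub>CG\<^esub> \<oplus>\<^bsub>CG\<^esub> j) [^]\<^bsub>CG\<^esub> Suc N =
      \<one>\<^bsub>CG\<^esub> \<oplus>\<^bsub>CG\<^esub> (cgr_const R H (int_img (int (Suc N))) \<otimes>\<^bsub>CG\<^esub> j \<oplus>\<^bsub>CG\<^esub> j \<otimes>\<^bsub>CG\<^esub> j \<otimes>\<^bsub>CG\<^esub> ?t)"
    unfolding CG.nat_pow_Suc s(2) c(2) using j c(1) s(1)
    by (simp add: CG.r_distr CG.l_distr CG.m_ac CG.a_ac)
  then show ?case using j c s(1) by (intro bexI[of _ ?t]) auto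
qed

lemma one_plus_p_power:
  assumes j: "j \<in> carrier CG" "px_filtration 1 j"
  shows "\<exists>i\<in>carrier CG. px_filtration (Suc K) i \<and> (\<one>\<^bsub>CG\<^esub> \<oplus>\<^bsub>CG\<^esub> j) [^]\<^bsub>CG\<^esub> (p ^ K) = \<one>\<^bsub>CG\<^esub> \<oplus>\<^bsub>CG\<^esub> i"
proof (induction K)
  case 0
  then show ?case using j by auto
next
  case (Suc K)
  let ?p = "cgr_const R H (int_img (int p))"
  have p: "?p \<in> carrier CG" by (simp add: int_img_simps const_closed)
  obtain i where i: "i \<in> carrier CG" "px_filtration (Suc K) i"
    "(\<one>\<^bsub>CG\<^esub> \<oplus>\<^bsub>CG\<^esub> j) [^]\<^bsub>CG\<^esub> (p ^ K) = \<one>\<^bsub>CG\<^esub> \<oplus>\<^bsub>CG\<^esub> i" using Suc by blast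
  obtain s where s: "s \<in> carrier CG" "(\<one>\<^bsub>CG\<^esub> \<oplus>\<^bsub>CG\<^esub> i) [^]\<^bsub>CG\<^esub> p =
    \<one>\<^bsub>CG\<^esub> \<oplus>\<^bsub>CG\<^esub> (?p \<otimes>\<^bsub>CG\<^esub> i \<oplus>\<^bsub>CG\<^esub> i \<otimes>\<^bsub>CG\<^esub> i \<otimes>\<^bsub>CG\<^esub> s)"
    using one_plus_pow_expand[OF i(1), of p] by blast
  have "px_filtration (Suc K + Suc K + 0) (i \<otimes>\<^bsub>CG\<^esub> i \<otimes>\<^bsub>CG\<^esub> s)"
    using i s(1) by (intro px_filtration_mult px_filtration_0) auto
  then have "px_filtration (Suc (Suc K)) (i \<otimes>\<^bsub>CG\<^esub> i \<otimes>\<^bsub>CG\<^esub> s)" by (rule px_filtration_mono) simp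
  then have "px_filtration (Suc (Suc K)) (?p \<otimes>\<^bsub>CG\<^esub> i \<oplus>\<^bsub>CG\<^esub> i \<otimes>\<^bsub>CG\<^esub> i \<otimes>\<^bsub>CG\<^esub> s)"
    using px_filtration_mult[OF p px_filtration_p i(1,2)] i(1) s(1) p by (intro px_filtration_add) auto
  moreover have "(\<one>\<^bsub>CG\<^esub> \<oplus>\<^bsub>CG\<^esub> j) [^]\<^bsub>CG\<^esub> (p ^ Suc K) = \<one>\<^bsub>CG\<^esub> \<oplus>\<^bsub>CG\<^esub> (?p \<otimes>\<^bsub>CG\<^esub> i \<oplus>\<^bsub>CG\<^esub> i \<otimes>\<^bsub>CG\<^esub> i \<otimes>\<^bsub>CG\<^esub> s)"
    using CG.nat_pow_pow[of "\<one>\<^bsub>CG\<^esub> \<oplus>\<^bsub>CG\<^esub> j" "p ^ K" p] j(1) i(3) s(2) by (simp add: mult.commute)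
  ultimately show ?case
    using i(1) s(1) p by (intro bexI[of _ "?p \<otimes>\<^bsub>CG\<^esub> i \<oplus>\<^bsub>CG\<^esub> i \<otimes>\<^bsub>CG\<^esub> i \<otimes>\<^bsub>CG\<^esub> s"]) auto
qed

lemma elt_truncate:
  assumes z: "z \<in> carrier (Zp p)"
  obtains e where "e \<in> carrier CG" "px_filtration (Suc K) e"
    "elt z = gen_elt [^]\<^bsub>CG\<^esub> nat (z K) \<oplus>\<^bsub>CG\<^esub> e"
proof -
  let ?u = "gen_elt [^]\<^bsub>CG\<^esub> nat (z K)"
  have N: "int (nat (z K)) = z K" using ZpD(3)[OF z] by simp
  obtain y where y: "y \<in> carrier (Zp p)" "z = Zp_int p (z K) \<oplus>\<^bsub>Zp p\<^esub> Zp_int p (int p ^ K) \<otimes>\<^bsub>Zp p\<^esub> y"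
    using Zp_truncate[OF z] .
  have "elt z = elt (Zp_int p (z K)) \<otimes>\<^bsub>CG\<^esub> elt (Zp_int p (int p ^ K) \<otimes>\<^bsub>Zp p\<^esub> y)"
    by (subst y(2)) (simp add: elt_add Zp_int_closed y(1))
  then have elt_z: "elt z = ?u \<otimes>\<^bsub>CG\<^esub> elt y [^]\<^bsub>CG\<^esub> (p ^ K)"
    using elt_nat_smult[OF y(1), of "p ^ K"] unfolding gen_elt_pow N by simp
  have closed: "elt y \<in> carrier CG" "?u \<in> carrier CG" using elt_hpow_closed y by auto
  let ?j = "elt y \<ominus>\<^bsub>CG\<^esub> \<one>\<^bsub>CG\<^esub>"
  have j: "?j \<in> carrier CG" "elt y = \<one>\<^bsub>CG\<^esub> \<oplus>\<^bsub>CG\<^esub> ?j"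
    using closed by (simp_all add: CG.add_minus_cancel)
  have "augmentation ?j = \<zero>"
    using closed y(1) by (simp add: a_minus_def R.r_neg elt_eq augmentation_single hpow_closed)
  then obtain e where e: "e \<in> carrier CG" "px_filtration (Suc K) e"
    "elt y [^]\<^bsub>CG\<^esub> (p ^ K) = \<one>\<^bsub>CG\<^esub> \<oplus>\<^bsub>CG\<^esub> e"
    using one_plus_p_power[OF j(1) px_filtration_aug_kernel[OF j(1)], of K, folded j(2)] by blast
  have "px_filtration (0 + Suc K) (?u \<otimes>\<^bsub>CG\<^esub> e)"
    using closed e by (intro px_filtration_mult px_filtration_0) auto
  then show ?thesis
    using that[of "?u \<otimes>\<^bsub>CG\<^esub> e"] closed e elt_z by (simp add: CG.r_distr)
qed

lemma binomial_approximation: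
  assumes z: "z \<in> carrier (Zp p)" and K: "i + fact_multiplicity k \<le> K"
  shows "p_pow_dvd i (int_img (int (nat (z K) choose k)) \<ominus> q (Zp_binom p z k))"
proof -
  let ?b = "Zp_binom p z k" and ?c = "Zp_int p (int (nat (z K) choose k))"
  have b: "?b \<in> carrier (Zp p)" by (rule Zp_binom_closed[OF z])
  have "?c \<ominus>\<^bsub>Zp p\<^esub> ?b \<in> p_ideal p i"
    using b Zp_binom_component[OF z K] Zp_minus_eq_zero_iff[OF Zp_int_closed b]
    by (simp add: p_ideal_def Zp_int_closed) (simp add: Zp_int_def)
  then obtain w where w: "w \<in> carrier (Zp p)" "?c \<ominus>\<^bsub>Zp p\<^esub> ?b = Zp_int p (int p ^ i) \<otimes>\<^bsub>Zp p\<^esub> w"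
    by (rule p_ideal_E)
  have "q (?c \<ominus>\<^bsub>Zp p\<^esub> ?b) = int_img (int (nat (z K) choose k)) \<ominus> q ?b"
    using b by (simp add: a_minus_def int_img_def Zp_int_closed)
  then show ?thesis
    using w p_pow_dvdI[of "q w" i] by (simp add: int_img_def Zp_int_closed)
qed

lemma x_coeff_elt:
  assumes z: "z \<in> carrier (Zp p)" and k: "k \<le> n"
  shows "AT.x_coeff (elt z) k = q (Zp_binom p z k)"
proof -
  let ?b = "q (Zp_binom p z k)"
  have closed: "elt z \<in> carrier CG" "?b \<in> carrier R" using elt_hpow_closed z Zp_binom_closed by auto
  have "AT.x_coeff (elt z) k \<ominus> ?b = \<zero>"
  proof (rule zero_if_p_pow_dvd)
    fix i
    define K where "K = i + fact_multiplicity k + n"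
    let ?u = "gen_elt [^]\<^bsub>CG\<^esub> nat (z K)"
    obtain e where e: "e \<in> carrier CG" "px_filtration (Suc K) e" "elt z = ?u \<oplus>\<^bsub>CG\<^esub> e"
      using elt_truncate[OF z] .
    have u: "?u \<in> carrier CG" using elt_hpow_closed[OF Z.one_closed] by simp
    have "AT.x_coeff ?u k = int_img (int (nat (z K) choose k))"
      using AT.x_coeff_eqI[OF u _ expands_gen_elt_pow k] by (simp add: int_img_simps)
    then have "AT.x_coeff (elt z) k \<ominus> ?b =
        AT.x_coeff e k \<oplus> (int_img (int (nat (z K) choose k)) \<ominus> ?b)"
      using u e k closed(2) AT.x_coeff_closed[OF e(1)]
      by (simp add: AT.x_coeff_add int_img_simps a_minus_def R.a_ac)
    moreover have "p_pow_dvd i (AT.x_coeff e k)"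
      using e(2) k p_pow_dvd_mono[of "Suc K - k" _ i] by (simp add: px_filtration_def K_def)
    moreover have "p_pow_dvd i (int_img (int (nat (z K) choose k)) \<ominus> ?b)"
      by (rule binomial_approximation[OF z]) (simp add: K_def)
    ultimately show "p_pow_dvd i (AT.x_coeff (elt z) k \<ominus> ?b)"
      using p_pow_dvd_add by simp
  qed
  then show ?thesis
    using AT.x_coeff_closed[OF closed(1)] closed(2) by (simp add: R.minus_eq_zero_iff)
qed

end

section \<open>The modules \<open>\<Omega>/I^m\<close>\<close>

declare ideal_pow.simps [simp del]

context cring
begin

lemma ideal_prod_cgenideal:
  assumes "a \<in> carrier R" "b \<in> carrier R"
  shows "ideal_prod R (PIdl a) (PIdl b) = PIdl (a \<otimes> b)"
proof
  interpret I: ideal "PIdl (a \<otimes> b)" R using assms by (intro cgenideal_ideal) simp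
  show "ideal_prod R (PIdl a) (PIdl b) \<subseteq> PIdl (a \<otimes> b)"
  proof
    fix s assume "s \<in> ideal_prod R (PIdl a) (PIdl b)"
    then show "s \<in> PIdl (a \<otimes> b)"
    proof (induction s rule: ideal_prod.induct)
      case (prod i j)
      then show ?case unfolding cgenideal_prod[OF assms, symmetric] set_mult_def by blast
    qed (rule I.a_closed)
  qed
  show "PIdl (a \<otimes> b) \<subseteq> ideal_prod R (PIdl a) (PIdl b)"
    unfolding cgenideal_prod[OF assms, symmetric] set_mult_def by (auto intro: ideal_prod.prod)
qed

lemma ideal_pow_cgenideal:
  assumes "a \<in> carrier R"
  shows "ideal_pow R (PIdl a) m = PIdl (a [^] m)"
proof (induction m)
  case 0
  have "PIdl \<one> = carrier R" unfolding cgenideal_def by force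
  then show ?case by (simp add: ideal_pow.simps)
next
  case (Suc m)
  then show ?case using assms by (simp add: ideal_pow.simps ideal_prod_cgenideal)
qed

lemma mem_cgenideal_iff: "a \<in> carrier R \<Longrightarrow> b \<in> PIdl a \<longleftrightarrow> (\<exists>y\<in>carrier R. b = a \<otimes> y)"
  unfolding cgenideal_def by (auto simp: m_comm)

end

context Zp_tower_trunc
begin

abbreviation "Ipow m \<equiv> aug_pow R H m"
abbreviation "omega_class m a \<equiv> Ipow m +>\<^bsub>CG\<^esub> a"
abbreviation "Omega m \<equiv> omega_quot R H m"

definition class_coeff :: "nat \<Rightarrow> nat \<Rightarrow> ('h set \<Rightarrow> 'h set \<Rightarrow> 'r) set \<Rightarrow> 'r" where
  "class_coeff m k X = AT.x_coeff (SOME a. a \<in> carrier CG \<and> X = omega_class m a) k"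

definition class_act :: "nat \<Rightarrow> 'h \<Rightarrow> ('h set \<Rightarrow> 'h set \<Rightarrow> 'r) set \<Rightarrow> ('h set \<Rightarrow> 'h set \<Rightarrow> 'r) set" where
  "class_act m C X = omega_class m (cgr_elt R H C) \<otimes>\<^bsub>CG Quot Ipow m\<^esub> X"

lemma aug_ideal_principal: "aug_ideal R H = PIdl\<^bsub>CG\<^esub> aug_gen"
proof (rule Set.set_eqI)
  fix a
  have "a \<in> aug_ideal R H \<longleftrightarrow> a \<in> carrier CG \<and> augmentation a = \<zero>"
    by (simp add: aug_ideal_def augmentation_def)
  also have "\<dots> \<longleftrightarrow> (\<exists>y\<in>carrier CG. a = aug_gen \<otimes>\<^bsub>CG\<^esub> y)"
    using aug_gen_dvd[of a] aug_gen_closed augmentation_aug_gen by auto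
  finally show "a \<in> aug_ideal R H \<longleftrightarrow> a \<in> PIdl\<^bsub>CG\<^esub> aug_gen"
    by (simp add: CG.mem_cgenideal_iff aug_gen_closed)
qed

lemma Ipow_principal: "Ipow m = PIdl\<^bsub>CG\<^esub> (aug_gen [^]\<^bsub>CG\<^esub> m)"
  unfolding aug_ideal_principal by (rule CG.ideal_pow_cgenideal[OF aug_gen_closed])

lemma Ipow_ideal: "ideal (Ipow m) CG"
  unfolding Ipow_principal using aug_gen_closed by (intro CG.cgenideal_ideal) simp

lemma Ipow_subgroup: "subgroup (Ipow m) (add_monoid CG)"
  by (rule additive_subgroup.a_subgroup[OF ideal.axioms(1)[OF Ipow_ideal]])

lemma Ipow_closed: "a \<in> Ipow m \<Longrightarrow> a \<in> carrier CG"
  by (rule ideal.Icarr[OF Ipow_ideal])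

lemma mem_Ipow_iff:
  assumes "m \<le> Suc n" "a \<in> carrier CG"
  shows "a \<in> Ipow m \<longleftrightarrow> (\<forall>k<m. AT.x_coeff a k = \<zero>)"
  unfolding Ipow_principal CG.mem_cgenideal_iff[OF CG.nat_pow_closed[OF aug_gen_closed]]
  by (rule AT.x_pow_dvd_iff[OF assms(2,1)])

lemma omega_class_add:
  "a \<in> carrier CG \<Longrightarrow> b \<in> carrier CG \<Longrightarrow> omega_class m a <+>\<^bsub>CG\<^esub> omega_class m b = omega_class m (a \<oplus>\<^bsub>CG\<^esub> b)"
  by (rule CG.coset_add[OF Ipow_subgroup])

lemma omega_class_mult:
  "a \<in> carrier CG \<Longrightarrow> b \<in> carrier CG \<Longrightarrow>
    omega_class m a \<otimes>\<^bsub>CG Quot Ipow m\<^esub> omega_class m b = omega_class m (a \<otimes>\<^bsub>CG\<^esub> b)"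
  using ideal.rcoset_mult_add[OF Ipow_ideal] by (simp add: FactRing_def)

lemma omega_class_eq_iff:
  assumes "m \<le> Suc n" "a \<in> carrier CG" "b \<in> carrier CG"
  shows "omega_class m a = omega_class m b \<longleftrightarrow> (\<forall>k<m. AT.x_coeff a k = AT.x_coeff b k)"
proof -
  have "AT.x_coeff (a \<ominus>\<^bsub>CG\<^esub> b) k = \<zero> \<longleftrightarrow> AT.x_coeff a k = AT.x_coeff b k" if "k < m" for k
    using assms that by (simp add: AT.x_coeff_minus AT.x_coeff_closed R.minus_eq_zero_iff)
  then show ?thesis
    unfolding CG.coset_eq_iff[OF Ipow_subgroup assms(2,3)] using assms by (simp add: mem_Ipow_iff)
qed

lemma class_coeff_omega_class:
  assumes "m \<le> Suc n" "k < m" "a \<in> carrier CG"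
  shows "class_coeff m k (omega_class m a) = AT.x_coeff a k"
proof -
  have "\<exists>b. b \<in> carrier CG \<and> omega_class m a = omega_class m b" using assms(3) by blast
  note b = someI_ex[OF this]
  show ?thesis
    unfolding class_coeff_def
    using iffD1[OF omega_class_eq_iff[OF assms(1,3) conjunct1[OF b]] conjunct2[OF b]] assms(2) by simp
qed

lemma Omega_carrier: "carrier (Omega m) = omega_class m ` carrier CG"
  by (simp add: omega_quot_def Let_def FactRing_def a_rcosets_eq_image)

lemma omega_class_closed: "a \<in> carrier CG \<Longrightarrow> omega_class m a \<in> carrier (Omega m)"
  unfolding Omega_carrier by (rule imageI)

lemma OmegaE:
  assumes "X \<in> carrier (Omega m)"
  obtains a where "a \<in> carrier CG" "X = omega_class m a"
  using assms unfolding Omega_carrier by blast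

lemma Omega_zero: "\<zero>\<^bsub>Omega m\<^esub> = omega_class m \<zero>\<^bsub>CG\<^esub>"
  using CG.a_coset_add_zero[of "Ipow m"] subgroup.subset[OF Ipow_subgroup]
  by (simp add: omega_quot_def Let_def FactRing_def)

lemma Omega_add:
  "a \<in> carrier CG \<Longrightarrow> b \<in> carrier CG \<Longrightarrow>
    omega_class m a \<oplus>\<^bsub>Omega m\<^esub> omega_class m b = omega_class m (a \<oplus>\<^bsub>CG\<^esub> b)"
  by (simp add: omega_quot_def Let_def FactRing_def omega_class_add)

lemma Omega_smult:
  "r \<in> carrier R \<Longrightarrow> a \<in> carrier CG \<Longrightarrow>
    r \<odot>\<^bsub>Omega m\<^esub> omega_class m a = omega_class m (cgr_const R H r \<otimes>\<^bsub>CG\<^esub> a)"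
  using omega_class_mult[OF const_closed] by (simp add: omega_quot_def Let_def)

lemma Omega_module: "module R (Omega m)"
proof -
  have "abelian_group (Omega m)"
  proof (rule abelian_groupI)
    show "\<exists>Y\<in>carrier (Omega m). Y \<oplus>\<^bsub>Omega m\<^esub> X = \<zero>\<^bsub>Omega m\<^esub>" if "X \<in> carrier (Omega m)" for X
      using that omega_class_closed[OF CG.a_inv_closed]
      by (elim OmegaE) (metis CG.a_inv_closed CG.l_neg Omega_add Omega_zero)
  qed ((elim OmegaE)?, simp add: Omega_add Omega_zero omega_class_closed CG.a_ac)+
  then show ?thesis
    by (rule moduleI[OF R.is_cring]; elim OmegaE)
      (simp_all add: Omega_add Omega_smult omega_class_closed const_closed CG.l_distr CG.r_distr CG.m_assoc)
qed

lemma class_coeff_hom: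
  assumes m: "m \<le> Suc n" and k: "k < m"
  shows "class_coeff m k \<in> module_hom R (Omega m) (regular_module R)"
proof (rule module_homI; elim OmegaE)
  fix X Y a b
  assume "a \<in> carrier CG" "b \<in> carrier CG" "X = omega_class m a" "Y = omega_class m b"
  then show "class_coeff m k (X \<oplus>\<^bsub>Omega m\<^esub> Y) = class_coeff m k X \<oplus>\<^bsub>regular_module R\<^esub> class_coeff m k Y"
    using m k by (simp add: Omega_add class_coeff_omega_class AT.x_coeff_add regular_module_def)
next
  fix r X a assume "r \<in> carrier R" "a \<in> carrier CG" "X = omega_class m a"
  then show "class_coeff m k (r \<odot>\<^bsub>Omega m\<^esub> X) = r \<odot>\<^bsub>regular_module R\<^esub> class_coeff m k X"
    using m k by (simp add: Omega_smult const_closed class_coeff_omega_class AT.x_coeff_smult regular_module_def)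
qed (use m k in \<open>simp add: class_coeff_omega_class AT.x_coeff_closed regular_module_def\<close>)

lemma class_coeff_closed:
  "m \<le> Suc n \<Longrightarrow> k < m \<Longrightarrow> X \<in> carrier (Omega m) \<Longrightarrow> class_coeff m k X \<in> carrier R"
  using module_homD(1)[OF class_coeff_hom] by (simp add: regular_module_def)

lemma Omega_based:
  assumes m: "m \<le> Suc n"
  shows "based_module R (Omega m) m (\<lambda>k. omega_class m (aug_gen [^]\<^bsub>CG\<^esub> k)) (class_coeff m)"
proof (rule based_module_of_separating_coordinates[OF Omega_module _ class_coeff_hom[OF m]])
  show "X = Y" if "X \<in> carrier (Omega m)" "Y \<in> carrier (Omega m)"
    "\<And>k. k < m \<Longrightarrow> class_coeff m k X = class_coeff m k Y" for X Y
    using that m by (elim OmegaE) (simp add: class_coeff_omega_class omega_class_eq_iff)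
qed (use m aug_gen_closed in \<open>simp_all add: omega_class_closed class_coeff_omega_class AT.x_coeff_x_pow\<close>)

subsection \<open>Reduction and the graded piece\<close>

abbreviation "reduce X \<equiv> Ipow n <+>\<^bsub>CG\<^esub> X"
abbreviation "graded \<equiv> aug_graded R H n"

lemma reduce_omega_class:
  assumes "a \<in> carrier CG"
  shows "reduce (omega_class (Suc n) a) = omega_class n a"
proof -
  have "Ipow (Suc n) \<subseteq> Ipow n"
    by (intro subsetI) (metis Ipow_closed mem_Ipow_iff le_SucI less_SucI order_refl)
  then have "Ipow n <+>\<^bsub>CG\<^esub> Ipow (Suc n) = Ipow n"
    unfolding set_add_def
    by (intro CG.add.set_mult_subgroup_idem CG.add.subgroup_incl Ipow_subgroup)
  then show ?thesis
    using CG.a_setmult_rcos_assoc[OF _ _ assms] subgroup.subset[OF Ipow_subgroup] by simp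
qed

lemma reduce_hom: "reduce \<in> module_hom R (Omega (Suc n)) (Omega n)"
  by (rule module_homI; elim OmegaE)
    (simp_all add: Omega_add Omega_smult const_closed reduce_omega_class omega_class_closed)

lemma class_coeff_reduce:
  "X \<in> carrier (Omega (Suc n)) \<Longrightarrow> k < n \<Longrightarrow> class_coeff n k (reduce X) = class_coeff (Suc n) k X"
  by (elim OmegaE) (simp add: reduce_omega_class class_coeff_omega_class)

lemma graded_simps:
  "\<zero>\<^bsub>graded\<^esub> = \<zero>\<^bsub>Omega (Suc n)\<^esub>" "add graded = add (Omega (Suc n))" "smult graded = smult (Omega (Suc n))"
  by (simp_all add: aug_graded_def)

lemma graded_carrier: "carrier graded = {X \<in> carrier (Omega (Suc n)). reduce X = \<zero>\<^bsub>Omega n\<^esub>}"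
proof -
  have "reduce (omega_class (Suc n) a) = \<zero>\<^bsub>Omega n\<^esub> \<longleftrightarrow> a \<in> Ipow n" if "a \<in> carrier CG" for a
    unfolding reduce_omega_class[OF that] Omega_zero CG.coset_eq_iff[OF Ipow_subgroup that CG.zero_closed]
    using that by (simp add: a_minus_def)
  then show ?thesis
    using Ipow_closed by (auto simp: aug_graded_def Omega_carrier)
qed

lemma graded_subset: "carrier graded \<subseteq> carrier (Omega (Suc n))"
  unfolding graded_carrier by blast

lemma graded_module: "module R graded"
proof -
  have "graded = Omega (Suc n)\<lparr>carrier := {X \<in> carrier (Omega (Suc n)). reduce X = \<zero>\<^bsub>Omega n\<^esub>}\<rparr>"
    unfolding graded_carrier[symmetric] by (simp add: aug_graded_def)
  then show ?thesis
    using submodule.submodule_is_module[OF module_hom_kernel_submodule[OF Omega_module Omega_module reduce_hom]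
        Omega_module] by simp
qed

lemma class_coeff_graded:
  assumes X: "X \<in> carrier graded" and k: "k < n"
  shows "class_coeff (Suc n) k X = \<zero>"
proof -
  have "X \<in> carrier (Omega (Suc n))" "reduce X = \<zero>\<^bsub>Omega n\<^esub>" using X by (auto simp: graded_carrier)
  then have "class_coeff (Suc n) k X = class_coeff n k (omega_class n \<zero>\<^bsub>CG\<^esub>)"
    using k class_coeff_reduce[of X k] by (simp add: Omega_zero)
  then show ?thesis
    using k by (simp add: class_coeff_omega_class AT.x_coeff_zero)
qed

lemma graded_based:
  "based_module R graded 1 (\<lambda>_. omega_class (Suc n) (aug_gen [^]\<^bsub>CG\<^esub> n)) (\<lambda>_. class_coeff (Suc n) n)"
proof (rule based_module_of_separating_coordinates[OF graded_module])
  interpret Omega: based_module R "Omega (Suc n)" "Suc n" "\<lambda>k. omega_class (Suc n) (aug_gen [^]\<^bsub>CG\<^esub> k)"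
    "class_coeff (Suc n)"
    by (rule Omega_based) simp
  show "class_coeff (Suc n) n \<in> module_hom R graded (regular_module R)"
    by (rule module_homI)
      (simp_all add: graded_simps subsetD[OF graded_subset] module_homD[OF class_coeff_hom])
  have x_pow: "aug_gen [^]\<^bsub>CG\<^esub> n \<in> carrier CG" using aug_gen_closed by simp
  have "aug_gen [^]\<^bsub>CG\<^esub> n \<in> Ipow n"
    unfolding Ipow_principal by (rule CG.cgenideal_self[OF x_pow])
  then show "omega_class (Suc n) (aug_gen [^]\<^bsub>CG\<^esub> n) \<in> carrier graded" by (simp add: aug_graded_def)
  show "class_coeff (Suc n) n (omega_class (Suc n) (aug_gen [^]\<^bsub>CG\<^esub> n)) = (if k = l then \<one> else \<zero>)"
    if "k < 1" "l < 1" for k l :: nat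
    using that x_pow by (simp add: class_coeff_omega_class AT.x_coeff_x_pow)
  show "X = Y" if XY: "X \<in> carrier graded" "Y \<in> carrier graded"
    and coeff: "\<And>k. k < (1::nat) \<Longrightarrow> class_coeff (Suc n) n X = class_coeff (Suc n) n Y" for X Y
  proof -
    have "X \<in> carrier (Omega (Suc n))" "Y \<in> carrier (Omega (Suc n))" using XY graded_subset by auto
    moreover have "class_coeff (Suc n) k X = class_coeff (Suc n) k Y" if "k < Suc n" for k
      using that coeff[of 0] class_coeff_graded[OF XY(1)] class_coeff_graded[OF XY(2)]
      by (cases "k = n") auto
    ultimately show ?thesis
      by (elim OmegaE) (simp add: class_coeff_omega_class omega_class_eq_iff)
  qed
qed

subsection \<open>The action of the group\<close>

lemma class_act_omega_class:
  "C \<in> carrier H \<Longrightarrow> a \<in> carrier CG \<Longrightarrow>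
    class_act m C (omega_class m a) = omega_class m (cgr_elt R H C \<otimes>\<^bsub>CG\<^esub> a)"
  unfolding class_act_def by (rule omega_class_mult[OF elt_closed])

lemma class_act_hom: "C \<in> carrier H \<Longrightarrow> class_act m C \<in> module_hom R (Omega m) (Omega m)"
  by (rule module_homI; elim OmegaE)
    (simp_all add: Omega_add Omega_smult const_closed elt_closed class_act_omega_class omega_class_closed
      CG.r_distr CG.m_lcomm)

lemma class_act_one: "X \<in> carrier (Omega m) \<Longrightarrow> class_act m \<one>\<^bsub>H\<^esub> X = X"
  by (elim OmegaE) (simp add: class_act_omega_class elt_one)

lemma class_act_mult:
  "C \<in> carrier H \<Longrightarrow> D \<in> carrier H \<Longrightarrow> X \<in> carrier (Omega m) \<Longrightarrow>
    class_act m (C \<otimes>\<^bsub>H\<^esub> D) X = class_act m C (class_act m D X)"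
  by (elim OmegaE) (simp add: class_act_omega_class elt_mult elt_closed CG.m_assoc)

lemma reduce_class_act:
  "C \<in> carrier H \<Longrightarrow> X \<in> carrier (Omega (Suc n)) \<Longrightarrow>
    reduce (class_act (Suc n) C X) = class_act n C (reduce X)"
  by (elim OmegaE) (simp add: class_act_omega_class reduce_omega_class elt_closed)

lemma class_coeff_class_act:
  assumes C: "C \<in> carrier H" and X: "X \<in> carrier (Omega m)" and m: "m \<le> Suc n" and k: "k < m"
  shows "class_coeff m k (class_act m C X) =
    (\<Oplus>l\<in>{..k}. AT.x_coeff (cgr_elt R H C) (k - l) \<otimes> class_coeff m l X)"
proof -
  obtain a where a: "a \<in> carrier CG" "X = omega_class m a" using X by (rule OmegaE)
  have "class_coeff m k (class_act m C X) = AT.x_coeff (cgr_elt R H C \<otimes>\<^bsub>CG\<^esub> a) k"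
    using C m k a by (simp add: class_act_omega_class class_coeff_omega_class elt_closed)
  also have "\<dots> = (\<Oplus>l\<in>{..k}. AT.x_coeff (cgr_elt R H C) (k - l) \<otimes> AT.x_coeff a l)"
    using k m by (intro AT.x_coeff_mult[OF elt_closed[OF C] a(1)]) simp
  also have "\<dots> = (\<Oplus>l\<in>{..k}. AT.x_coeff (cgr_elt R H C) (k - l) \<otimes> class_coeff m l X)"
    using C m k a by (intro R.finsum_cong') (auto simp: class_coeff_omega_class AT.x_coeff_closed elt_closed)
  finally show ?thesis .
qed

lemma class_act_graded:
  assumes C: "C \<in> carrier H" and X: "X \<in> carrier graded"
  shows "class_act (Suc n) C X \<in> carrier graded"
proof -
  have "class_act n C \<zero>\<^bsub>Omega n\<^esub> = \<zero>\<^bsub>Omega n\<^esub>"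
    by (rule module_hom_zero[OF Omega_module Omega_module class_act_hom[OF C]])
  then show ?thesis
    using X reduce_class_act[OF C] module_homD(1)[OF class_act_hom[OF C]] by (simp add: graded_carrier)
qed

lemma class_coeff_class_act_graded:
  assumes C: "C \<in> carrier H" and X: "X \<in> carrier graded"
  shows "class_coeff (Suc n) n (class_act (Suc n) C X) =
    AT.x_coeff (cgr_elt R H C) 0 \<otimes> class_coeff (Suc n) n X"
proof -
  have X': "X \<in> carrier (Omega (Suc n))" using X graded_subset by blast
  have closed: "AT.x_coeff (cgr_elt R H C) k \<in> carrier R" for k
    by (rule AT.x_coeff_closed[OF elt_closed[OF C]])
  have "class_coeff (Suc n) n (class_act (Suc n) C X) =
      (\<Oplus>l\<in>{..n}. AT.x_coeff (cgr_elt R H C) (n - l) \<otimes> class_coeff (Suc n) l X)"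
    by (rule class_coeff_class_act[OF C X']) simp_all
  also have "\<dots> = AT.x_coeff (cgr_elt R H C) 0 \<otimes> class_coeff (Suc n) n X"
    using closed X' by (subst R.finsum_delta[of _ n]) (auto simp: class_coeff_graded[OF X] class_coeff_closed)
  finally show ?thesis .
qed

end

section \<open>The coimage of a character\<close>

lemma (in group_hom) kernel_coset_eq:
  assumes g: "g \<in> carrier G"
  shows "kernel G H h #> g = {g' \<in> carrier G. h g' = h g}"
proof (intro equalityI subsetI)
  fix g' assume "g' \<in> {g' \<in> carrier G. h g' = h g}"
  then have "g' \<in> carrier G" "g' \<otimes> inv g \<in> kernel G H h"
    using g by (auto simp: kernel_def)
  moreover from this have "g' = (g' \<otimes> inv g) \<otimes> g" using g by (simp add: G.m_assoc)
  ultimately show "g' \<in> kernel G H h #> g" unfolding r_coset_def by blast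
qed (use g in \<open>auto simp: r_coset_def kernel_def\<close>)

lemma quot_topgroup_carrier: "carrier (quot_topgroup G K) = (\<lambda>g. K #>\<^bsub>G\<^esub> g) ` carrier G"
  by (auto simp: quot_topgroup_def FactGroup_def RCOSETS_def)

lemma quot_topgroup_one: "\<one>\<^bsub>quot_topgroup G K\<^esub> = K"
  by (simp add: quot_topgroup_def)

lemma quot_topgroup_mult:
  "normal K G \<Longrightarrow> g \<in> carrier G \<Longrightarrow> h \<in> carrier G \<Longrightarrow>
    (K #>\<^bsub>G\<^esub> g) \<otimes>\<^bsub>quot_topgroup G K\<^esub> (K #>\<^bsub>G\<^esub> h) = K #>\<^bsub>G\<^esub> (g \<otimes>\<^bsub>G\<^esub> h)"
  by (simp add: quot_topgroup_def normal.rcos_sum)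

lemma quot_topgroup_group:
  assumes "normal K G"
  shows "group (quot_topgroup G K)"
  using normal.factorgroup_is_group[OF assms]
  unfolding group_def group_axioms_def monoid_def Units_def by (simp add: quot_topgroup_def)

lemma openin_quot_topgroup:
  assumes "topspace (grp_top G) = carrier G"
  shows "openin (grp_top (quot_topgroup G K)) U \<longleftrightarrow>
    U \<subseteq> carrier (quot_topgroup G K) \<and> openin (grp_top G) {g \<in> carrier G. K #>\<^bsub>G\<^esub> g \<in> U}"
  using assms unfolding quot_topgroup_carrier by (simp add: quot_topgroup_def openin_quot_topology)

lemma cgr_base_quot_topgroup:
  assumes G: "profinite_group G" and K: "normal K G" and R: "cring R"
  shows "cgr_base (quot_topgroup G K) R"
proof (rule cgr_base_of_compact_group[OF quot_topgroup_group[OF K] _ _ _ R])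
  let ?Q = "quot_topgroup G K" and ?coset = "\<lambda>g. K #>\<^bsub>G\<^esub> g"
  note GD = profinite_groupD[OF G]
  have quotient: "quotient_map (grp_top G) (grp_top ?Q) ?coset"
    by (simp add: quot_topgroup_def quotient_map_quot_topology)
  show top: "topspace (grp_top ?Q) = carrier ?Q"
    using quotient_imp_surjective_map[OF quotient] by (simp add: quot_topgroup_carrier GD(2))
  have "compactin (grp_top ?Q) (?coset ` carrier G)"
    using GD(2,3) by (intro image_compactin[OF _ quotient_imp_continuous_map[OF quotient]]) (simp add: compact_space_def)
  then show "compact_space (grp_top ?Q)"
    by (simp add: compact_space_def top quot_topgroup_carrier)
  fix C assume "C \<in> carrier ?Q"
  then obtain a where a: "a \<in> carrier G" "C = ?coset a" by (auto simp: quot_topgroup_carrier)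
  have "continuous_map (grp_top G) (grp_top ?Q) (\<lambda>g. ?coset (g \<otimes>\<^bsub>G\<^esub> a))"
    using continuous_map_compose[OF profinite_translation[OF G a(1)] quotient_imp_continuous_map[OF quotient]]
    by (simp add: o_def)
  then have "continuous_map (grp_top G) (grp_top ?Q) ((\<lambda>D. D \<otimes>\<^bsub>?Q\<^esub> C) \<circ> ?coset)"
    by (rule continuous_map_eq) (simp add: GD(2) a quot_topgroup_mult[OF K])
  then show "continuous_map (grp_top ?Q) (grp_top ?Q) (\<lambda>D. D \<otimes>\<^bsub>?Q\<^esub> C)"
    by (rule continuous_compose_quotient_map[OF quotient])
qed

lemma (in p_adic) p_ideal_subgroup: "subgroup (p_ideal p j) (add_monoid (Zp p))"
proof (rule Z.add.subgroupI)
  show "p_ideal p j \<noteq> {}" using Z.zero_closed by (force simp: p_ideal_def Zp_simps)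
qed (auto simp: p_ideal_def Zp_simps(2) Zp_neg a_inv_def[symmetric])

locale Zp_character = p_adic p
  for p :: nat +
  fixes n :: nat and G :: "('g, 'x) topgroup_scheme" and A :: "('a, 'y) topring_scheme"
    and R :: "('r, 'z) topring_scheme" and q :: "(nat \<Rightarrow> int) \<Rightarrow> 'a" and \<pi> :: "'a \<Rightarrow> 'r" and chi :: "'g \<Rightarrow> 'a"
  assumes profinite_G: "profinite_group G"
    and quotient_A: "topring_quotient (Zp p) A q" and quotient_R: "topring_quotient A R \<pi>"
    and size: "q \<in> ring_iso (Zp p) A \<or> finite (carrier A) \<and> n * card (carrier R) < p * card (carrier A)"
    and chi_hom: "chi \<in> hom G (add_monoid A)" and chi_surj: "chi ` carrier G = carrier A"
    and chi_continuous: "continuous_map (grp_top G) (ring_top A) chi"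
begin

abbreviation "K \<equiv> kernel G (add_monoid A) chi"
abbreviation "H \<equiv> quot_topgroup G K"

lemmas top_G = profinite_groupD(2)[OF profinite_G]

lemma quotient_rings:
  shows A_cring: "cring A" and R_cring: "cring R"
    and q_hom: "q \<in> ring_hom (Zp p) A" and pi_hom: "\<pi> \<in> ring_hom A R"
    and q_quotient: "quotient_map (ring_top (Zp p)) (ring_top A) q"
    and pi_quotient: "quotient_map (ring_top A) (ring_top R) \<pi>"
    and top_R: "topspace (ring_top R) = carrier R"
    and q_image: "q ` carrier (Zp p) = carrier A" and pi_image: "\<pi> ` carrier A = carrier R"
  using quotient_A quotient_R quotient_imp_surjective_map[of "ring_top (Zp p)" "ring_top A" q]
    quotient_imp_surjective_map[of "ring_top A" "ring_top R" \<pi>]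
  by (auto simp: topring_quotient_def Zp_topspace)

sublocale A: Zp_quotient p A q
  by (intro Zp_quotient.intro Zp_quotient_axioms.intro ring_hom_cring.intro ring_hom_cring_axioms.intro
      p_adic_axioms Z.is_cring A_cring q_hom q_image)

sublocale R: Zp_quotient p R "\<pi> \<circ> q"
proof (intro Zp_quotient.intro Zp_quotient_axioms.intro ring_hom_cring.intro ring_hom_cring_axioms.intro
    p_adic_axioms Z.is_cring R_cring)
  show "\<pi> \<circ> q \<in> ring_hom (Zp p) R" by (rule ring_hom_trans[OF q_hom pi_hom])
  show "(\<pi> \<circ> q) ` carrier (Zp p) = carrier R" by (simp only: image_comp[symmetric] q_image pi_image)
qed

sublocale chi: group_hom G "add_monoid A" chi
  using profinite_groupD(1)[OF profinite_G] chi_hom A.R.add.group_axioms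
  by (simp add: group_hom_def group_hom_axioms_def)

lemma chi_closed: "g \<in> carrier G \<Longrightarrow> chi g \<in> carrier A"
  using chi.hom_closed by simp

lemma chi_lift:
  assumes "z \<in> carrier (Zp p)"
  obtains g where "g \<in> carrier G" "chi g = q z"
proof -
  have "q z \<in> chi ` carrier G" unfolding chi_surj by (rule A.q.hom_closed[OF assms])
  then show ?thesis using that by auto
qed

definition chi_fibre :: "(nat \<Rightarrow> int) \<Rightarrow> 'g set" where
  "chi_fibre z = {g \<in> carrier G. chi g = q z}"

lemma coset_eq_chi_fibre: "g \<in> carrier G \<Longrightarrow> chi g = q z \<Longrightarrow> K #>\<^bsub>G\<^esub> g = chi_fibre z"
  by (simp add: chi.kernel_coset_eq chi_fibre_def)

lemma coset_closed: "g \<in> carrier G \<Longrightarrow> K #>\<^bsub>G\<^esub> g \<in> carrier H"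
  unfolding quot_topgroup_carrier by (rule imageI)

lemmas coset_mult = quot_topgroup_mult[OF chi.normal_kernel]

lemma coset_one: "K #>\<^bsub>G\<^esub> \<one>\<^bsub>G\<^esub> = \<one>\<^bsub>H\<^esub>"
  by (simp add: quot_topgroup_one chi.G.coset_mult_one subgroup.subset[OF chi.subgroup_kernel])

lemma chi_fibre_closed: "z \<in> carrier (Zp p) \<Longrightarrow> chi_fibre z \<in> carrier H"
  by (rule chi_lift[of z]) (auto simp: coset_closed simp flip: coset_eq_chi_fibre)

lemma chi_fibre_surj:
  assumes "C \<in> carrier H"
  obtains z where "z \<in> carrier (Zp p)" "C = chi_fibre z"
proof -
  obtain g where g: "g \<in> carrier G" "C = K #>\<^bsub>G\<^esub> g" using assms by (auto simp: quot_topgroup_carrier)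
  obtain z where "z \<in> carrier (Zp p)" "q z = chi g" by (rule A.q_surjE[OF chi_closed[OF g(1)]])
  then show ?thesis using that coset_eq_chi_fibre[of g z] g by simp
qed

lemma chi_fibre_add:
  assumes "z \<in> carrier (Zp p)" "w \<in> carrier (Zp p)"
  shows "chi_fibre (z \<oplus>\<^bsub>Zp p\<^esub> w) = chi_fibre z \<otimes>\<^bsub>H\<^esub> chi_fibre w"
proof -
  obtain g where g: "g \<in> carrier G" "chi g = q z" by (rule chi_lift[OF assms(1)])
  obtain h where h: "h \<in> carrier G" "chi h = q w" by (rule chi_lift[OF assms(2)])
  have "K #>\<^bsub>G\<^esub> (g \<otimes>\<^bsub>G\<^esub> h) = chi_fibre (z \<oplus>\<^bsub>Zp p\<^esub> w)"
    using g h assms by (intro coset_eq_chi_fibre) simp_all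
  then show ?thesis using coset_mult[OF g(1) h(1)] by (simp add: coset_eq_chi_fibre g h)
qed

lemma H_comm_group: "comm_group H"
proof (rule group.group_comm_groupI[OF quot_topgroup_group[OF chi.normal_kernel]])
  fix C D assume C: "C \<in> carrier H" and D: "D \<in> carrier H"
  obtain z w where "z \<in> carrier (Zp p)" "C = chi_fibre z" "w \<in> carrier (Zp p)" "D = chi_fibre w"
    using chi_fibre_surj[OF C] chi_fibre_surj[OF D] by metis
  then show "C \<otimes>\<^bsub>H\<^esub> D = D \<otimes>\<^bsub>H\<^esub> C" by (simp add: Z.a_comm flip: chi_fibre_add)
qed

sublocale H: comm_group H by (rule H_comm_group)

sublocale H: cgr_base H R
  by (rule cgr_base_quot_topgroup[OF profinite_G chi.normal_kernel R_cring])

sublocale fibre: group_hom "add_monoid (Zp p)" H chi_fibre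
  unfolding group_hom_def group_hom_axioms_def hom_def
  using Z.add.group_axioms H.group_axioms chi_fibre_closed chi_fibre_add by auto

lemma chi_fibre_one_iff:
  assumes z: "z \<in> carrier (Zp p)"
  shows "chi_fibre z = \<one>\<^bsub>H\<^esub> \<longleftrightarrow> q z = \<zero>\<^bsub>A\<^esub>"
proof -
  obtain g where g: "g \<in> carrier G" "chi g = q z" by (rule chi_lift[OF z])
  then have "chi_fibre z = K #>\<^bsub>G\<^esub> g" "g \<in> chi_fibre z" by (simp_all add: coset_eq_chi_fibre chi_fibre_def)
  then have "chi_fibre z = K \<longleftrightarrow> g \<in> K"
    using chi.G.coset_join2[OF g(1) chi.subgroup_kernel] by blast
  then show ?thesis
    using g by (simp add: quot_topgroup_one kernel_def)
qed

lemma coset_mem_chi_fibres_iff: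
  assumes "g \<in> carrier G"
  shows "K #>\<^bsub>G\<^esub> g \<in> chi_fibre ` Z \<longleftrightarrow> chi g \<in> q ` Z"
proof
  assume "K #>\<^bsub>G\<^esub> g \<in> chi_fibre ` Z"
  then obtain z where "z \<in> Z" "g \<in> chi_fibre z"
    using chi.G.rcos_self[OF assms chi.subgroup_kernel] by blast
  then show "chi g \<in> q ` Z" by (auto simp: chi_fibre_def)
qed (use coset_eq_chi_fibre[OF assms] in blast)

lemma openin_q_p_ideal: "openin (ring_top A) (q ` p_ideal p j)"
proof -
  let ?Y = "{z \<in> carrier (Zp p). q z \<in> q ` p_ideal p j}"
  let ?V = "(\<lambda>y. y j) ` {y \<in> carrier (Zp p). q y = \<zero>\<^bsub>A\<^esub>}"
  have "q z \<in> q ` p_ideal p j \<longleftrightarrow> z j \<in> ?V" if z: "z \<in> carrier (Zp p)" for z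
  proof
    assume "q z \<in> q ` p_ideal p j"
    then obtain w where w: "w \<in> carrier (Zp p)" "w j = 0" "q z = q w" by (auto simp: p_ideal_def)
    have "z \<ominus>\<^bsub>Zp p\<^esub> (z \<ominus>\<^bsub>Zp p\<^esub> w) = w"
      using z w(1) by (simp add: a_minus_def Z.minus_add Z.r_neg1 Z.a_assoc[symmetric] Z.r_neg)
    then have "z j = (z \<ominus>\<^bsub>Zp p\<^esub> w) j"
      using Zp_minus_eq_zero_iff[OF z Z.minus_closed[OF z w(1)]] w(2) by simp
    moreover have "q (z \<ominus>\<^bsub>Zp p\<^esub> w) = \<zero>\<^bsub>A\<^esub>" using A.q_eq_iff[OF z w(1)] w(3) by simp
    ultimately show "z j \<in> ?V" using z w(1) by blast
  next
    assume "z j \<in> ?V"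
    then obtain y where y: "y \<in> carrier (Zp p)" "q y = \<zero>\<^bsub>A\<^esub>" "z j = y j" by auto
    then have "z \<ominus>\<^bsub>Zp p\<^esub> y \<in> p_ideal p j" using z by (simp add: p_ideal_def Zp_minus_eq_zero_iff)
    moreover have "q z = q (z \<ominus>\<^bsub>Zp p\<^esub> y)" using z y(1,2) by (simp add: a_minus_def)
    ultimately show "q z \<in> q ` p_ideal p j" by blast
  qed
  then have "?Y = {z \<in> carrier (Zp p). z j \<in> ?V}" by blast
  then have "openin (ring_top (Zp p)) ?Y" using openin_Zp_component[of p j ?V] by simp
  moreover have "q ` p_ideal p j \<subseteq> topspace (ring_top A)"
    using quotient_A by (auto simp: topring_quotient_def p_ideal_def)
  ultimately show ?thesis
    using q_quotient unfolding quotient_map_def Zp_topspace by blast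
qed

lemma chi_fibre_p_ideal_open_normal: "chi_fibre ` p_ideal p j \<in> open_normals H"
proof -
  let ?N = "chi_fibre ` p_ideal p j"
  have "subgroup ?N H" by (rule fibre.subgroup_img_is_subgroup[OF p_ideal_subgroup])
  then have "normal ?N H" "?N \<subseteq> carrier H"
    by (simp add: H.normal_iff_subgroup, rule subgroup.subset)
  moreover have "openin (grp_top G) {g \<in> carrier G. K #>\<^bsub>G\<^esub> g \<in> ?N}"
    using openin_continuous_map_preimage[OF chi_continuous openin_q_p_ideal]
    by (simp add: top_G coset_mem_chi_fibres_iff cong: conj_cong)
  ultimately show ?thesis
    by (simp add: open_normals_def openin_quot_topgroup[OF top_G])
qed

text \<open>The preimage of \<open>N\<close> in \<open>Zp\<close> is a subgroup containing \<open>m Zp\<close> for the order \<open>m\<close> of \<open>H/N\<close>.\<close>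

lemma open_normal_eq_chi_fibre_p_ideal:
  assumes N: "N \<in> open_normals H"
  shows "\<exists>j. N = chi_fibre ` p_ideal p j"
proof -
  have normal: "normal N H" and sub: "subgroup N H"
    using N by (auto simp: open_normals_def normal_imp_subgroup)
  interpret Q: group "H Mod N" by (rule normal.factorgroup_is_group[OF normal])
  interpret proj: group_hom H "H Mod N" "\<lambda>C. N #>\<^bsub>H\<^esub> C"
    using normal.r_coset_hom_Mod[OF normal] by unfold_locales
  let ?m = "order (H Mod N)" and ?B = "{z \<in> carrier (Zp p). chi_fibre z \<in> N}"
  have "Zp_int p (int ?m) \<otimes>\<^bsub>Zp p\<^esub> z \<in> ?B" if z: "z \<in> carrier (Zp p)" for z
  proof -
    have "N #>\<^bsub>H\<^esub> (chi_fibre z [^]\<^bsub>H\<^esub> ?m) = (N #>\<^bsub>H\<^esub> chi_fibre z) [^]\<^bsub>H Mod N\<^esub> ?m"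
      using proj.hom_nat_pow[OF chi_fibre_closed[OF z]] by simp
    also have "\<dots> = N" using Q.pow_order_eq_1[OF proj.hom_closed[OF chi_fibre_closed[OF z]]] by simp
    finally have "chi_fibre z [^]\<^bsub>H\<^esub> ?m \<in> N"
      using H.rcos_self[OF H.nat_pow_closed[OF chi_fibre_closed[OF z]] sub] by blast
    moreover have "chi_fibre ([?m] \<cdot>\<^bsub>Zp p\<^esub> z) = chi_fibre z [^]\<^bsub>H\<^esub> ?m"
      using fibre.hom_nat_pow[of z ?m] z by (simp add: add_pow_def)
    ultimately show ?thesis using z by (simp add: Zp_add_pow Zp_int_closed)
  qed
  moreover have "0 < ?m"
    using finite_group_ring.finite_group[OF H.finite_group_ring_Mod[OF N]] Q.order_gt_0_iff_finite by simp
  ultimately obtain j where "p_ideal p j \<subseteq> ?B" using finite_index_contains_p_ideal by blast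
  then obtain i where "?B = p_ideal p i"
    using subgroup_eq_p_ideal[of ?B j] subgroup.m_closed[OF sub] by (auto simp: chi_fibre_add)
  moreover have "N = chi_fibre ` ?B"
    using chi_fibre_surj subgroup.subset[OF sub] by blast
  ultimately show ?thesis by auto
qed

lemma pi_q_kernel_level:
  assumes kernel: "\<forall>z\<in>carrier (Zp p). q z = \<zero>\<^bsub>A\<^esub> \<longleftrightarrow> z a = 0"
  obtains r where "\<forall>z\<in>carrier (Zp p). (\<pi> \<circ> q) z = \<zero>\<^bsub>R\<^esub> \<longleftrightarrow> z r = 0"
proof -
  have "q (Zp_int p (int p ^ a)) = \<zero>\<^bsub>A\<^esub>" using kernel Zp_int_closed by (simp add: Zp_int_def)
  then have "(\<pi> \<circ> q) (Zp_int p (int p ^ a)) = \<zero>\<^bsub>R\<^esub>"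
    using ring_hom_zero[OF pi_hom A.R.ring_axioms R.R.ring_axioms] by simp
  then show ?thesis
    using R.q_kernel_cases that Zp_int_p_power_nonzero Zp_int_closed by blast
qed

lemma q_not_iso:
  assumes "\<forall>z\<in>carrier (Zp p). q z = \<zero>\<^bsub>A\<^esub> \<longleftrightarrow> z a = 0"
  shows "q \<notin> ring_iso (Zp p) A"
proof
  assume "q \<in> ring_iso (Zp p) A"
  then have "inj_on q (carrier (Zp p))" by (simp add: ring_iso_def bij_betw_def)
  moreover have "q (Zp_int p (int p ^ a)) = q \<zero>\<^bsub>Zp p\<^esub>"
    using assms Zp_int_closed by (simp add: Zp_int_def)
  ultimately show False
    using inj_onD Zp_int_closed Z.zero_closed Zp_int_p_power_nonzero by metis
qed

lemma binomials_vanish: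
  assumes kernel: "\<forall>z\<in>carrier (Zp p). chi_fibre z = \<one>\<^bsub>H\<^esub> \<longleftrightarrow> z a = 0" and k: "1 \<le> k" "k \<le> n"
  shows "R.int_img (int (p ^ a choose k)) = \<zero>\<^bsub>R\<^esub>"
proof -
  have kernel: "\<forall>z\<in>carrier (Zp p). q z = \<zero>\<^bsub>A\<^esub> \<longleftrightarrow> z a = 0" using kernel by (simp add: chi_fibre_one_iff)
  obtain r where r: "\<forall>z\<in>carrier (Zp p). (\<pi> \<circ> q) z = \<zero>\<^bsub>R\<^esub> \<longleftrightarrow> z r = 0"
    using pi_q_kernel_level[OF kernel] .
  have "n * p ^ r < p * p ^ a"
    using size q_not_iso[OF kernel] A.card_carrier[OF kernel] R.card_carrier[OF r] by simp
  from prime_power_dvd_binomial[OF k this] have "Zp_int p (int (p ^ a choose k)) r = 0"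
    unfolding Zp_int_def by (metis dvd_imp_mod_0 int_dvd_int_iff of_nat_power)
  then show ?thesis using r Zp_int_closed by (simp add: R.int_img_def)
qed

sublocale tower: Zp_tower_trunc H R p "\<pi> \<circ> q" chi_fibre n
proof (intro Zp_tower_trunc.intro Zp_tower_trunc_axioms.intro Zp_tower.intro Zp_tower_axioms.intro
    H.cgr_base_axioms R.Zp_quotient_axioms H_comm_group chi_fibre_closed chi_fibre_add)
  show "\<exists>z\<in>carrier (Zp p). chi_fibre z = C" if "C \<in> carrier H" for C
    using chi_fibre_surj[OF that] by metis
  show "open_normals H = range (\<lambda>j. chi_fibre ` p_ideal p j)"
    using open_normal_eq_chi_fibre_p_ideal chi_fibre_p_ideal_open_normal by blast
  show "(\<forall>z\<in>carrier (Zp p). chi_fibre z = \<one>\<^bsub>H\<^esub> \<longrightarrow> z = \<zero>\<^bsub>Zp p\<^esub>) \<or>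
      (\<exists>a. \<forall>z\<in>carrier (Zp p). chi_fibre z = \<one>\<^bsub>H\<^esub> \<longleftrightarrow> z a = 0)"
    using A.q_kernel_cases by (simp add: chi_fibre_one_iff)
qed (assumption | rule binomials_vanish)+

subsection \<open>Binomial coefficients of the character\<close>

definition chi_binom :: "nat \<Rightarrow> 'g \<Rightarrow> 'r" where
  "chi_binom k g = tower.AT.x_coeff (cgr_elt R H (K #>\<^bsub>G\<^esub> g)) k"

lemma chi_binom_closed: "g \<in> carrier G \<Longrightarrow> chi_binom k g \<in> carrier R"
  unfolding chi_binom_def by (rule tower.AT.x_coeff_closed[OF H.elt_closed[OF coset_closed]])

lemma chi_binom_eq:
  "g \<in> carrier G \<Longrightarrow> z \<in> carrier (Zp p) \<Longrightarrow> q z = chi g \<Longrightarrow> k \<le> n \<Longrightarrow> chi_binom k g = \<pi> (q (Zp_binom p z k))"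
  unfolding chi_binom_def using tower.x_coeff_elt[of z k] coset_eq_chi_fibre[of g z] by simp

lemma quot_binom_eq_chi_binom:
  assumes g: "g \<in> carrier G" and k: "k \<le> n"
  shows "quot_binom p q \<pi> (chi g) k = chi_binom k g"
proof -
  obtain z where "z \<in> carrier (Zp p)" "q z = chi g" by (rule A.q_surjE[OF chi_closed[OF g]])
  then have "(\<lambda>z. \<pi> (q (Zp_binom p z k))) ` {z \<in> carrier (Zp p). q z = chi g} = {chi_binom k g}"
    using chi_binom_eq[OF g _ _ k, symmetric] by (intro equalityI subsetI) auto
  then show ?thesis by (simp add: quot_binom_def)
qed

lemma chi_binom_mult:
  assumes "g \<in> carrier G" "h \<in> carrier G" "k \<le> n"
  shows "chi_binom k (g \<otimes>\<^bsub>G\<^esub> h) = (\<Oplus>\<^bsub>R\<^esub> l\<in>{..k}. chi_binom (k - l) g \<otimes>\<^bsub>R\<^esub> chi_binom l h)"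
  unfolding chi_binom_def using assms
  by (simp add: coset_closed H.elt_closed H.elt_mult tower.AT.x_coeff_mult flip: coset_mult)

lemma chi_binom_0:
  assumes g: "g \<in> carrier G"
  shows "chi_binom 0 g = \<one>\<^bsub>R\<^esub>"
proof -
  obtain z where z: "z \<in> carrier (Zp p)" "q z = chi g" by (rule A.q_surjE[OF chi_closed[OF g]])
  have "Zp_binom p z 0 = \<one>\<^bsub>Zp p\<^esub>"
    by (rule ext) (simp add: Zp_binom_component[OF z(1) le_refl] Zp_simps)
  then show ?thesis using chi_binom_eq[OF g z, of 0] R.q.hom_one by simp
qed

lemma chi_binom_continuous:
  assumes k: "k \<le> n"
  shows "continuous_map (grp_top G) (ring_top R) (chi_binom k)"
proof -
  let ?binom = "\<lambda>c. quot_binom p q \<pi> c k"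
  have "continuous_map (ring_top (Zp p)) (ring_top R) (\<pi> \<circ> (q \<circ> (\<lambda>z. Zp_binom p z k)))"
    by (rule continuous_map_compose[OF continuous_map_compose[OF Zp_binom_continuous
          quotient_imp_continuous_map[OF q_quotient]] quotient_imp_continuous_map[OF pi_quotient]])
  moreover have "(\<pi> \<circ> (q \<circ> (\<lambda>z. Zp_binom p z k))) z = (?binom \<circ> q) z"
    if "z \<in> topspace (ring_top (Zp p))" for z
  proof -
    have z: "z \<in> carrier (Zp p)" using that by (simp add: Zp_topspace)
    obtain g where g: "g \<in> carrier G" "chi g = q z" by (rule chi_lift[OF z])
    show ?thesis using chi_binom_eq[OF g(1) z g(2)[symmetric] k] quot_binom_eq_chi_binom[OF g(1) k] g(2) by simp
  qed
  ultimately have "continuous_map (ring_top (Zp p)) (ring_top R) (?binom \<circ> q)"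
    by (rule continuous_map_eq)
  then have "continuous_map (ring_top A) (ring_top R) ?binom"
    by (rule continuous_compose_quotient_map[OF q_quotient])
  from continuous_map_compose[OF chi_continuous this]
  show ?thesis
    by (rule continuous_map_eq) (simp add: quot_binom_eq_chi_binom k top_G)
qed

end

section \<open>The defining system attached to a cocycle\<close>

lemma (in abelian_monoid) finsum_supported_interval:
  assumes "finite A" "{i..j::nat} \<subseteq> A" "i \<le> j"
    and closed: "\<And>k. k \<in> {i..j} \<Longrightarrow> f k \<in> carrier G" and zero: "\<And>k. k \<in> A - {i..j} \<Longrightarrow> f k = \<zero>"
  shows "(\<Oplus>k\<in>A. f k) = (\<Oplus>l\<in>{..j - i}. f (j - l))"
proof -
  have "f k \<in> carrier G" if "k \<in> A" for k
    using closed[of k] zero[of k] that by (cases "k \<in> {i..j}") auto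
  then have "(\<Oplus>k\<in>A. f k) = (\<Oplus>k\<in>{i..j}. f k)"
    using assms by (intro add.finprod_mono_neutral_cong_right) auto
  also have "\<dots> = (\<Oplus>l\<in>{..j - i}. f (j - l))"
  proof (rule finsum_reindex_bij)
    show "bij_betw (\<lambda>l. j - l) {..j - i} {i..j}"
      using assms(3) by (intro bij_betw_byWitness[where f' = "\<lambda>k. j - k"]) auto
  qed (use closed in auto)
  finally show ?thesis .
qed

context top_gmodule
begin

abbreviation "Block m \<equiv> block_group R T m"

lemma Block_carrier: "(P, v) \<in> carrier (Block m) \<longleftrightarrow> P \<in> unitriangular R m \<and> v \<in> {1..m} \<rightarrow>\<^sub>E carrier T"
  by (simp add: block_group_def)

lemma Block_mult: "(P, v) \<otimes>\<^bsub>Block m\<^esub> (Q, w) =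
    (\<lambda>(i, j)\<in>{1..m} \<times> {1..m}. \<Oplus>\<^bsub>R\<^esub>k\<in>{1..m}. P (i, k) \<otimes>\<^bsub>R\<^esub> Q (k, j),
     \<lambda>i\<in>{1..m}. (\<Oplus>k\<in>{1..m}. P (i, k) \<odot> w k) \<oplus> v i)"
  by (simp add: block_group_def)

lemma Block_one_entry:
  "i \<in> {1..m} \<Longrightarrow> k \<in> {1..m} \<Longrightarrow> fst \<one>\<^bsub>Block m\<^esub> (i, k) = (if i = k then \<one>\<^bsub>R\<^esub> else \<zero>\<^bsub>R\<^esub>)"
  by (simp add: block_group_def)

lemma Block_one_mult_matrix:
  assumes P: "P \<in> {1..m} \<times> {1..m} \<rightarrow>\<^sub>E carrier R"
  shows "(\<lambda>(i, j)\<in>{1..m} \<times> {1..m}. \<Oplus>\<^bsub>R\<^esub>k\<in>{1..m}. fst \<one>\<^bsub>Block m\<^esub> (i, k) \<otimes>\<^bsub>R\<^esub> P (k, j)) = P" (is "?L = P")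
proof (rule extensionalityI)
  show "P \<in> extensional ({1..m} \<times> {1..m})" using P by (simp add: PiE_def)
  fix s assume "s \<in> {1..m} \<times> {1..m}"
  then obtain i j where ij: "s = (i, j)" "i \<in> {1..m}" "j \<in> {1..m}" by blast
  have entry: "P (k, j) \<in> carrier R" if "k \<in> {1..m}" for k using PiE_mem[OF P] that ij(3) by blast
  have "(\<Oplus>\<^bsub>R\<^esub>k\<in>{1..m}. fst \<one>\<^bsub>Block m\<^esub> (i, k) \<otimes>\<^bsub>R\<^esub> P (k, j)) = P (i, j)"
    using ij(2) entry by (subst R.finsum_delta[of _ i]) (simp_all add: Block_one_entry del: atLeastAtMost_iff)
  then show "?L s = P s" using ij by simp
qed simp

lemma Block_one_mult_column:
  assumes v: "v \<in> {1..m} \<rightarrow>\<^sub>E carrier T" and i: "i \<in> {1..m}"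
  shows "(\<Oplus>k\<in>{1..m}. fst \<one>\<^bsub>Block m\<^esub> (i, k) \<odot> v k) = v i"
  using i PiE_mem[OF v] by (subst M.finsum_delta[of _ i]) (simp_all add: Block_one_entry del: atLeastAtMost_iff)

lemma corner_mult:
  assumes c: "c \<in> block_corner R T m" and u: "(P, v) \<in> carrier (Block m)"
  shows "c \<otimes>\<^bsub>Block m\<^esub> (P, v) = (P, \<lambda>i\<in>{1..m}. v i \<oplus> snd c i)"
proof -
  have P: "P \<in> {1..m} \<times> {1..m} \<rightarrow>\<^sub>E carrier R" and v: "v \<in> {1..m} \<rightarrow>\<^sub>E carrier T"
    using u by (simp_all add: Block_carrier unitriangular_def)
  have "c = (fst \<one>\<^bsub>Block m\<^esub>, snd c)" using c by (simp add: block_corner_def prod_eq_iff)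
  then have "c \<otimes>\<^bsub>Block m\<^esub> (P, v) = (fst \<one>\<^bsub>Block m\<^esub>, snd c) \<otimes>\<^bsub>Block m\<^esub> (P, v)" by simp
  also have "\<dots> = (P, \<lambda>i\<in>{1..m}. v i \<oplus> snd c i)"
    unfolding Block_mult Block_one_mult_matrix[OF P]
    by (intro arg_cong[of _ _ "Pair P"] restrict_ext) (simp only: Block_one_mult_column[OF v])
  finally show ?thesis .
qed

lemma corner_coset:
  assumes u: "(P, v) \<in> carrier (Block m)"
  shows "block_corner R T m #>\<^bsub>Block m\<^esub> (P, v) =
    {(P, w) | w. w \<in> {1..m} \<rightarrow>\<^sub>E carrier T \<and> (\<forall>i\<in>{2..m}. w i = v i)}" (is "_ = ?W")
proof (intro equalityI subsetI)
  have v: "v i \<in> carrier T" if "i \<in> {1..m}" for i using u PiE_mem that by (auto simp: Block_carrier)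
  fix y assume "y \<in> block_corner R T m #>\<^bsub>Block m\<^esub> (P, v)"
  then obtain c where c: "c \<in> block_corner R T m" "y = (P, \<lambda>i\<in>{1..m}. v i \<oplus> snd c i)"
    using corner_mult[OF _ u] by (auto simp: r_coset_def)
  then have "snd c \<in> {1..m} \<rightarrow>\<^sub>E carrier T" "\<forall>i\<in>{2..m}. snd c i = \<zero>"
    by (auto simp: block_corner_def block_group_def)
  then show "y \<in> ?W"
    unfolding c(2) using v by (auto simp: PiE_mem)
next
  have v: "v i \<in> carrier T" if "i \<in> {1..m}" for i using u PiE_mem that by (auto simp: Block_carrier)
  fix y assume "y \<in> ?W"
  then obtain w where w: "y = (P, w)" "w \<in> {1..m} \<rightarrow>\<^sub>E carrier T" "\<forall>i\<in>{2..m}. w i = v i" by blast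
  define c where "c = (fst \<one>\<^bsub>Block m\<^esub>, \<lambda>i\<in>{1..m}. if i = 1 then w i \<ominus> v i else \<zero>)"
  have "c \<in> block_corner R T m"
    using PiE_mem[OF w(2), of 1] v[of 1]
    by (auto simp: c_def block_corner_def block_group_def unitriangular_def)
  moreover have "(\<lambda>i\<in>{1..m}. v i \<oplus> snd c i) = w"
  proof (rule extensionalityI[of _ "{1..m}"])
    show "w \<in> extensional {1..m}" using w(2) by (simp add: PiE_def)
    fix i assume i: "i \<in> {1..m}"
    show "(\<lambda>i\<in>{1..m}. v i \<oplus> snd c i) i = w i"
      using i v[OF i] PiE_mem[OF w(2) i] w(3) by (cases "i = 1") (auto simp: c_def M.add_minus_cancel)
  qed simp
  ultimately show "y \<in> block_corner R T m #>\<^bsub>Block m\<^esub> (P, v)"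
    unfolding r_coset_def w(1) using corner_mult[OF _ u] by fastforce
qed

lemma corner_zero_lift_coset:
  assumes u: "(P, v) \<in> carrier (Block m)" and v_1: "v 1 = \<zero>"
  shows "corner_zero_lift T (block_corner R T m #>\<^bsub>Block m\<^esub> (P, v)) = (P, v)"
  unfolding corner_zero_lift_def corner_coset[OF u]
proof (rule the_equality)
  have v: "v \<in> {1..m} \<rightarrow>\<^sub>E carrier T" using u by (simp add: Block_carrier)
  let ?is_lift = "\<lambda>y. y \<in> {(P, w) | w. w \<in> {1..m} \<rightarrow>\<^sub>E carrier T \<and> (\<forall>i\<in>{2..m}. w i = v i)} \<and> snd y 1 = \<zero>"
  show "?is_lift (P, v)" using v v_1 by simp
  fix y assume "?is_lift y"
  then obtain w where w: "y = (P, w)" "w \<in> {1..m} \<rightarrow>\<^sub>E carrier T" "\<forall>i\<in>{2..m}. w i = v i" "w 1 = \<zero>" by auto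
  have "w = v"
  proof (rule PiE_ext[OF w(2) v])
    fix i assume "i \<in> {1..m}"
    then show "w i = v i" using w(3,4) v_1 by (cases "i = 1") auto
  qed
  then show "y = (P, v)" using w(1) by simp
qed

end

text \<open>\<open>B k\<close> plays the role of the \<open>k\<close>-th binomial coefficient of the character: comultiplicativity of the
  sequence \<open>B\<close> makes the Toeplitz matrices \<open>\<theta> g\<close> a homomorphism, and the twisted cocycle rule for \<open>lam\<close> is
  the cocycle rule for the last column.\<close>

locale toeplitz_system = top_gmodule R G T
  for R :: "('r, 'x) topring_scheme" and G :: "('g, 'y) topgroup_scheme"
    and T :: "('r, 'm, 'g, 'z) gmodule_scheme" (structure) +
  fixes n :: nat and B :: "nat \<Rightarrow> 'g \<Rightarrow> 'r" and lam :: "nat \<Rightarrow> 'g \<Rightarrow> 'm" and \<theta> :: "'g \<Rightarrow> nat \<times> nat \<Rightarrow> 'r"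
  assumes B_closed: "g \<in> carrier G \<Longrightarrow> B k g \<in> carrier R"
    and B_0: "g \<in> carrier G \<Longrightarrow> B 0 g = \<one>\<^bsub>R\<^esub>"
    and B_mult: "g \<in> carrier G \<Longrightarrow> h \<in> carrier G \<Longrightarrow> k \<le> n \<Longrightarrow>
      B k (g \<otimes>\<^bsub>G\<^esub> h) = (\<Oplus>\<^bsub>R\<^esub> l\<in>{..k}. B (k - l) g \<otimes>\<^bsub>R\<^esub> B l h)"
    and B_continuous: "k \<le> n \<Longrightarrow> continuous_map (grp_top G) (ring_top R) (B k)"
    and lam_closed: "k < n \<Longrightarrow> g \<in> carrier G \<Longrightarrow> lam k g \<in> carrier T"
    and lam_continuous: "k < n \<Longrightarrow> continuous_map (grp_top G) (mod_top T) (lam k)"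
    and lam_cocycle: "k < n \<Longrightarrow> g \<in> carrier G \<Longrightarrow> h \<in> carrier G \<Longrightarrow>
      lam k (g \<otimes>\<^bsub>G\<^esub> h) = lam k g \<oplus> (\<Oplus>l\<in>{..k}. B (k - l) g \<odot> act T g (lam l h))"
    and theta: "g \<in> carrier G \<Longrightarrow>
      \<theta> g = (\<lambda>(i, j)\<in>{1..n+1} \<times> {1..n+1}. if i \<le> j then B (j - i) g else \<zero>\<^bsub>R\<^esub>)"
begin

definition last_column :: "'g \<Rightarrow> nat \<Rightarrow> 'm" where
  "last_column g = (\<lambda>i\<in>{1..n+1}. if i = 1 then \<zero> else lam (n + 1 - i) g)"

abbreviation "rho \<equiv> attached_system R T n \<theta> lam"

lemma last_column_mem: "g \<in> carrier G \<Longrightarrow> last_column g \<in> {1..n+1} \<rightarrow>\<^sub>E carrier T"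
  using lam_closed by (auto simp: last_column_def)

lemma theta_entry: "g \<in> carrier G \<Longrightarrow> i \<in> {1..n+1} \<Longrightarrow> j \<in> {1..n+1} \<Longrightarrow>
    \<theta> g (i, j) = (if i \<le> j then B (j - i) g else \<zero>\<^bsub>R\<^esub>)"
  by (simp add: theta)

lemma theta_closed: "g \<in> carrier G \<Longrightarrow> i \<in> {1..n+1} \<Longrightarrow> j \<in> {1..n+1} \<Longrightarrow> \<theta> g (i, j) \<in> carrier R"
  by (simp add: theta_entry B_closed)

lemma theta_unitriangular: "g \<in> carrier G \<Longrightarrow> \<theta> g \<in> unitriangular R (n+1)"
  unfolding unitriangular_def using theta_closed by (auto simp: theta B_0 B_closed)

lemma lift_closed: "g \<in> carrier G \<Longrightarrow> (\<theta> g, last_column g) \<in> carrier (Block (n+1))"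
  unfolding Block_carrier using theta_unitriangular last_column_mem by blast

lemma rho_coset: "rho g = block_corner R T (n+1) #>\<^bsub>Block (n+1)\<^esub> (\<theta> g, last_column g)"
  by (simp add: attached_system_def last_column_def)

lemma mem_rho_iff:
  "g \<in> carrier G \<Longrightarrow> (P, w) \<in> rho g \<longleftrightarrow>
    P = \<theta> g \<and> w \<in> {1..n+1} \<rightarrow>\<^sub>E carrier T \<and> (\<forall>i\<in>{2..n+1}. w i = lam (n + 1 - i) g)"
  unfolding rho_coset corner_coset[OF lift_closed] by (auto simp: last_column_def)

lemma corner_zero_lift_rho: "g \<in> carrier G \<Longrightarrow> corner_zero_lift T (rho g) = (\<theta> g, last_column g)"
  unfolding rho_coset by (rule corner_zero_lift_coset[OF lift_closed]) (simp_all add: last_column_def)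

subsection \<open>The cocycle condition\<close>

lemma theta_mult_entry:
  assumes g: "g \<in> carrier G" and h: "h \<in> carrier G" and i: "i \<in> {1..n+1}" and j: "j \<in> {1..n+1}"
  shows "(\<Oplus>\<^bsub>R\<^esub>k\<in>{1..n+1}. \<theta> g (i, k) \<otimes>\<^bsub>R\<^esub> \<theta> h (k, j)) = \<theta> (g \<otimes>\<^bsub>G\<^esub> h) (i, j)"
proof (cases "i \<le> j")
  case True
  have "(\<Oplus>\<^bsub>R\<^esub>k\<in>{1..n+1}. \<theta> g (i, k) \<otimes>\<^bsub>R\<^esub> \<theta> h (k, j)) =
      (\<Oplus>\<^bsub>R\<^esub>l\<in>{..j - i}. \<theta> g (i, j - l) \<otimes>\<^bsub>R\<^esub> \<theta> h (j - l, j))"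
    using True g h i j by (intro R.finsum_supported_interval) (auto simp: theta_entry B_closed)
  also have "\<dots> = (\<Oplus>\<^bsub>R\<^esub>l\<in>{..j - i}. B (j - i - l) g \<otimes>\<^bsub>R\<^esub> B l h)"
  proof (rule R.finsum_cong')
    fix l assume "l \<in> {..j - i}"
    then have "j - l \<in> {1..n+1}" "i \<le> j - l" "j - l - i = j - i - l" "j - (j - l) = l"
      using True i j by auto
    then show "\<theta> g (i, j - l) \<otimes>\<^bsub>R\<^esub> \<theta> h (j - l, j) = B (j - i - l) g \<otimes>\<^bsub>R\<^esub> B l h"
      using g h i j by (simp add: theta_entry del: One_nat_def atLeastAtMost_iff)
  qed (use g h in \<open>auto simp: B_closed\<close>)
  also have "\<dots> = B (j - i) (g \<otimes>\<^bsub>G\<^esub> h)"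
    using i j by (intro B_mult[OF g h, symmetric]) auto
  finally show ?thesis using True g h i j by (simp add: theta_entry)
next
  case False
  have "(\<Oplus>\<^bsub>R\<^esub>k\<in>{1..n+1}. \<theta> g (i, k) \<otimes>\<^bsub>R\<^esub> \<theta> h (k, j)) = (\<Oplus>\<^bsub>R\<^esub>k\<in>{1..n+1}. \<zero>\<^bsub>R\<^esub>)"
    using False g h i j by (intro R.finsum_cong') (auto simp: theta_entry B_closed)
  then show ?thesis using False g h i j by (simp add: theta_entry)
qed

lemma theta_mult:
  assumes "g \<in> carrier G" "h \<in> carrier G"
  shows "(\<lambda>(i, j)\<in>{1..n+1} \<times> {1..n+1}. \<Oplus>\<^bsub>R\<^esub>k\<in>{1..n+1}. \<theta> g (i, k) \<otimes>\<^bsub>R\<^esub> \<theta> h (k, j)) = \<theta> (g \<otimes>\<^bsub>G\<^esub> h)"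
proof (rule extensionalityI)
  show "\<theta> (g \<otimes>\<^bsub>G\<^esub> h) \<in> extensional ({1..n+1} \<times> {1..n+1})" using assms by (simp add: theta)
qed (use theta_mult_entry[OF assms] in auto)

lemma theta_row_closed: "g \<in> carrier G \<Longrightarrow> i \<in> {1..n+1} \<Longrightarrow> w \<in> {1..n+1} \<rightarrow> carrier T \<Longrightarrow>
    (\<Oplus>k\<in>{1..n+1}. \<theta> g (i, k) \<odot> w k) \<in> carrier T"
  using theta_closed[of g i] by (intro M.finsum_closed) auto

lemma theta_row_mult:
  assumes g: "g \<in> carrier G" and h: "h \<in> carrier G" and i: "i \<in> {2..n+1}"
    and w: "w \<in> {1..n+1} \<rightarrow> carrier T" "\<forall>k\<in>{2..n+1}. w k = act T g (lam (n + 1 - k) h)"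
  shows "(\<Oplus>k\<in>{1..n+1}. \<theta> g (i, k) \<odot> w k) \<oplus> lam (n + 1 - i) g = lam (n + 1 - i) (g \<otimes>\<^bsub>G\<^esub> h)"
proof -
  let ?d = "n + 1 - i"
  have d: "?d < n" using i by auto
  have act_lam: "act T g (lam l h) \<in> carrier T" if "l < n" for l using act_closed[OF g lam_closed[OF that h]] .
  have w_closed: "w k \<in> carrier T" if "k \<in> {1..n+1}" for k using w(1) that by blast
  have "(\<Oplus>k\<in>{1..n+1}. \<theta> g (i, k) \<odot> w k) = (\<Oplus>l\<in>{..?d}. \<theta> g (i, n + 1 - l) \<odot> w (n + 1 - l))"
    using i g w_closed by (intro M.finsum_supported_interval) (auto simp: theta_entry B_closed)
  also have "\<dots> = (\<Oplus>l\<in>{..?d}. B (?d - l) g \<odot> act T g (lam l h))"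
    using i g w(2) act_lam d
    by (intro M.finsum_cong') (auto simp: theta_entry B_closed diff_diff_eq add.commute)
  finally have row: "(\<Oplus>k\<in>{1..n+1}. \<theta> g (i, k) \<odot> w k) = (\<Oplus>l\<in>{..?d}. B (?d - l) g \<odot> act T g (lam l h))" .
  have "(\<Oplus>k\<in>{1..n+1}. \<theta> g (i, k) \<odot> w k) \<in> carrier T"
    using i by (intro theta_row_closed[OF g _ w(1)]) auto
  then show ?thesis
    using lam_cocycle[OF d g h] lam_closed[OF d g] row by (simp add: M.a_comm)
qed

lemma lift_mult:
  "g \<in> carrier G \<Longrightarrow> h \<in> carrier G \<Longrightarrow> (\<theta> g, u) \<otimes>\<^bsub>Block (n+1)\<^esub> (\<theta> h, w) =
    (\<theta> (g \<otimes>\<^bsub>G\<^esub> h), \<lambda>i\<in>{1..n+1}. (\<Oplus>k\<in>{1..n+1}. \<theta> g (i, k) \<odot> w k) \<oplus> u i)"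
  unfolding Block_mult by (simp only: theta_mult)

lemma rho_mult_subset:
  assumes g: "g \<in> carrier G" and h: "h \<in> carrier G"
  shows "rho g <#>\<^bsub>Block (n+1)\<^esub> (block_act T (n+1) g ` rho h) \<subseteq> rho (g \<otimes>\<^bsub>G\<^esub> h)"
proof
  fix y assume "y \<in> rho g <#>\<^bsub>Block (n+1)\<^esub> (block_act T (n+1) g ` rho h)"
  then obtain P u Q v where u: "(P, u) \<in> rho g" and v: "(Q, v) \<in> rho h"
    and y: "y = (P, u) \<otimes>\<^bsub>Block (n+1)\<^esub> block_act T (n+1) g (Q, v)"
    unfolding set_mult_def by auto
  note u = u[unfolded mem_rho_iff[OF g]] and v = v[unfolded mem_rho_iff[OF h]]
  define w where "w = (\<lambda>i\<in>{1..n+1}. act T g (v i))"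
  have w: "w \<in> {1..n+1} \<rightarrow> carrier T" "\<forall>k\<in>{2..n+1}. w k = act T g (lam (n + 1 - k) h)"
    using v act_closed[OF g] by (auto simp: w_def PiE_mem)
  have "y = (\<theta> (g \<otimes>\<^bsub>G\<^esub> h), \<lambda>i\<in>{1..n+1}. (\<Oplus>k\<in>{1..n+1}. \<theta> g (i, k) \<odot> w k) \<oplus> u i)"
    using u v lift_mult[OF g h, of u w] by (simp add: y block_act_def w_def del: restrict_apply)
  also have "\<dots> \<in> rho (g \<otimes>\<^bsub>G\<^esub> h)"
    using u g h theta_row_closed[OF g _ w(1)] theta_row_mult[OF g h _ w]
    by (auto simp: mem_rho_iff PiE_mem simp del: One_nat_def)
  finally show "y \<in> rho (g \<otimes>\<^bsub>G\<^esub> h)" .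
qed

lemma rho_subset_mult:
  assumes g: "g \<in> carrier G" and h: "h \<in> carrier G"
  shows "rho (g \<otimes>\<^bsub>G\<^esub> h) \<subseteq> rho g <#>\<^bsub>Block (n+1)\<^esub> (block_act T (n+1) g ` rho h)"
proof
  fix y assume "y \<in> rho (g \<otimes>\<^bsub>G\<^esub> h)"
  then obtain v where y: "y = (\<theta> (g \<otimes>\<^bsub>G\<^esub> h), v)" "v \<in> {1..n+1} \<rightarrow>\<^sub>E carrier T"
    "\<forall>i\<in>{2..n+1}. v i = lam (n + 1 - i) (g \<otimes>\<^bsub>G\<^esub> h)"
    using g h by (cases y) (auto simp: mem_rho_iff)
  define w where "w = (\<lambda>i\<in>{1..n+1}. act T g (last_column h i))"
  have w: "w \<in> {1..n+1} \<rightarrow> carrier T" "\<forall>k\<in>{2..n+1}. w k = act T g (lam (n + 1 - k) h)"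
    using PiE_mem[OF last_column_mem[OF h]] act_closed[OF g] by (auto simp: w_def last_column_def)
  let ?row = "\<lambda>i. \<Oplus>k\<in>{1..n+1}. \<theta> g (i, k) \<odot> w k"
  define u where "u = (\<lambda>i\<in>{1..n+1}. if i = 1 then v i \<ominus> ?row i else lam (n + 1 - i) g)"
  have closed: "v i \<in> carrier T" "?row i \<in> carrier T" if "i \<in> {1..n+1}" for i
    using that by (rule PiE_mem[OF y(2)], rule theta_row_closed[OF g _ w(1)])
  have "u \<in> {1..n+1} \<rightarrow>\<^sub>E carrier T"
    unfolding u_def using closed lam_closed[OF _ g] by (intro restrict_PiE_iff[THEN iffD2]) auto
  then have u_mem: "(\<theta> g, u) \<in> rho g" by (simp add: mem_rho_iff g u_def)
  have "(\<theta> h, last_column h) \<in> rho h"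
    using last_column_mem[OF h] by (simp add: mem_rho_iff h last_column_def)
  then have w_mem: "(\<theta> h, w) \<in> block_act T (n+1) g ` rho h"
    by (rule rev_image_eqI) (simp add: block_act_def w_def)
  have "(\<lambda>i\<in>{1..n+1}. ?row i \<oplus> u i) = v"
  proof (rule extensionalityI[of _ "{1..n+1}"])
    show "v \<in> extensional {1..n+1}" using y(2) by (simp add: PiE_def)
    fix i assume i: "i \<in> {1..n+1}"
    show "(\<lambda>i\<in>{1..n+1}. ?row i \<oplus> u i) i = v i"
    proof (cases "i = 1")
      case True
      then show ?thesis using i closed[OF i] by (simp add: u_def M.add_minus_cancel del: One_nat_def)
    next
      case False
      then show ?thesis using i y(3) theta_row_mult[OF g h _ w, of i] by (simp add: u_def)
    qed
  qed simp
  then have "(\<theta> g, u) \<otimes>\<^bsub>Block (n+1)\<^esub> (\<theta> h, w) = y"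
    unfolding lift_mult[OF g h] y(1) by simp
  then show "y \<in> rho g <#>\<^bsub>Block (n+1)\<^esub> (block_act T (n+1) g ` rho h)"
    unfolding set_mult_def using u_mem w_mem by blast
qed

lemma lift_continuous: "continuous_map (grp_top G) (grp_top (Block (n+1))) (\<lambda>g. (\<theta> g, last_column g))"
proof -
  have "continuous_map (grp_top G) (ring_top R) (\<lambda>g. \<theta> g (i, j))" if "i \<in> {1..n+1}" "j \<in> {1..n+1}" for i j
    by (rule continuous_map_eq[of _ _ "\<lambda>g. if i \<le> j then B (j - i) g else \<zero>\<^bsub>R\<^esub>"])
      (use that B_continuous[of "j - i"] top_R in \<open>auto simp: top_G theta_entry\<close>)
  moreover have "continuous_map (grp_top G) (mod_top T) (\<lambda>g. last_column g i)" if "i \<in> {1..n+1}" for i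
    using that lam_continuous[of "n + 1 - i"] continuous_const[of \<zero>] by (auto simp: last_column_def)
  moreover have "\<theta> g \<in> extensional ({1..n+1} \<times> {1..n+1})" "last_column g \<in> extensional {1..n+1}"
    if "g \<in> carrier G" for g
    using theta_unitriangular[OF that] last_column_mem[OF that] by (auto simp: unitriangular_def PiE_def)
  ultimately have "continuous_map (grp_top G)
      (prod_topology (product_topology (\<lambda>_. ring_top R) ({1..n+1} \<times> {1..n+1}))
        (product_topology (\<lambda>_. mod_top T) {1..n+1})) (\<lambda>g. (\<theta> g, last_column g))"
    by (intro continuous_map_pairedI) (auto simp: continuous_map_componentwise top_G)
  then show ?thesis
    using theta_unitriangular last_column_mem
    by (auto simp: block_group_def continuous_map_in_subtopology top_G)
qed

theorem attached_system_proper: "proper_defining_system R G T n \<theta> rho"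
  unfolding proper_defining_system_def
proof (intro conjI ballI)
  let ?coset = "\<lambda>u. block_corner R T (n+1) #>\<^bsub>Block (n+1)\<^esub> u"
  have "continuous_map (grp_top G) (quot_topology (grp_top (Block (n+1))) ?coset)
      (?coset \<circ> (\<lambda>g. (\<theta> g, last_column g)))"
    by (rule continuous_map_compose[OF lift_continuous continuous_map_quot_topology])
  moreover have "?coset \<circ> (\<lambda>g. (\<theta> g, last_column g)) = rho"
    by (rule ext) (simp add: rho_coset)
  ultimately show "continuous_map (grp_top G) (grp_top (block_quot R T (n+1))) rho"
    by (simp add: block_quot_def quot_topgroup_def)
next
  fix g assume g: "g \<in> carrier G"
  then show "rho g \<in> carrier (block_quot R T (n+1))"
    unfolding rho_coset block_quot_def quot_topgroup_carrier by (intro imageI lift_closed)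
next
  fix g h assume "g \<in> carrier G" "h \<in> carrier G"
  then show "rho (g \<otimes>\<^bsub>G\<^esub> h) = rho g \<otimes>\<^bsub>block_quot R T (n+1)\<^esub> (block_act T (n+1) g ` rho h)"
    using rho_mult_subset[of g h] rho_subset_mult[of g h]
    by (simp add: block_quot_def quot_topgroup_def FactGroup_def)
next
  fix g u assume "g \<in> carrier G" "u \<in> rho g"
  then show "fst u = \<theta> g" by (cases u) (simp add: mem_rho_iff)
qed

subsection \<open>The Massey product\<close>

lemma massey_sum:
  assumes g: "g \<in> carrier G" and h: "h \<in> carrier G"
  shows "(\<Oplus>i\<in>{2..n+1}. \<theta> g (1, i) \<odot> act T g (last_column h i)) =
    (\<Oplus>l\<in>{..<n}. B (n - l) g \<odot> act T g (lam l h))"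
proof -
  have act_lam: "act T g (lam l h) \<in> carrier T" if "l < n" for l using act_closed[OF g lam_closed[OF that h]] .
  have "(\<Oplus>i\<in>{2..n+1}. \<theta> g (1, i) \<odot> act T g (last_column h i)) =
      (\<Oplus>l\<in>{..<n}. \<theta> g (1, n + 1 - l) \<odot> act T g (last_column h (n + 1 - l)))"
  proof (rule M.finsum_reindex_bij)
    show "bij_betw (\<lambda>l. n + 1 - l) {..<n} {2..n+1}"
      by (rule bij_betw_byWitness[where f' = "\<lambda>i. n + 1 - i"]) auto
  qed (use g act_lam in \<open>auto simp: theta_entry last_column_def B_closed\<close>)
  also have "\<dots> = (\<Oplus>l\<in>{..<n}. B (n - l) g \<odot> act T g (lam l h))"
    using g act_lam by (intro M.finsum_cong') (auto simp: theta_entry last_column_def B_closed)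
  finally show ?thesis .
qed

lemma massey_product_rho: "massey_product G T n rho =
    class2 G T (\<lambda>(g, h)\<in>pairs G. \<Oplus>l\<in>{..<n}. B (n - l) g \<odot> act T g (lam l h))"
  unfolding massey_product_def
  by (intro arg_cong[where f = "class2 G T"] restrict_ext)
    (auto simp: corner_zero_lift_rho massey_sum simp del: One_nat_def)

end

section \<open>The connecting map for a character\<close>

locale Zp_character_module = Zp_character p n G A R q \<pi> chi + T: top_gmodule R G T
  for p n and G :: "('g, 'x) topgroup_scheme" and A :: "('a, 'y) topring_scheme"
    and R :: "('r, 'z) topring_scheme" and q and \<pi> and chi and T :: "('r, 'm, 'g, 'w) gmodule_scheme"
begin

abbreviation "basis m k \<equiv> tower.omega_class m (tower.aug_gen [^]\<^bsub>completed_group_ring R H\<^esub> (k::nat))"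

lemma omega_act_eq: "omega_act R G K m g X = tower.class_act m (K #>\<^bsub>G\<^esub> g) X"
  by (simp add: omega_act_def tower.class_act_def Let_def)

lemmas omega_act_hom = module_homD[OF tower.class_act_hom[OF coset_closed], folded omega_act_eq]

lemma omega_act_one: "X \<in> carrier (tower.Omega m) \<Longrightarrow> omega_act R G K m \<one>\<^bsub>G\<^esub> X = X"
  by (simp add: omega_act_eq coset_one tower.class_act_one)

lemma omega_act_mult:
  "g \<in> carrier G \<Longrightarrow> h \<in> carrier G \<Longrightarrow> X \<in> carrier (tower.Omega m) \<Longrightarrow>
    omega_act R G K m (g \<otimes>\<^bsub>G\<^esub> h) X = omega_act R G K m g (omega_act R G K m h X)"
  by (simp add: omega_act_eq coset_closed tower.class_act_mult flip: coset_mult)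

lemma omega_tensor_action:
  assumes m: "m \<le> Suc n"
  shows "tensor_action R G T (tower.Omega m) m (basis m) (tower.class_coeff m) (omega_act R G K m) chi_binom"
proof (intro tensor_action.intro tensor_based.intro tensor_modules.intro tensor_action_axioms.intro
    T.top_gmodule_axioms T.module_axioms tower.Omega_module tower.Omega_based[OF m]
    omega_act_hom omega_act_one omega_act_mult chi_binom_closed)
  fix k assume k: "k < m"
  show "continuous_map (grp_top G) (ring_top R) (chi_binom k)"
    by (rule chi_binom_continuous) (use k m in simp)
  show "tower.class_coeff m k (omega_act R G K m g X) =
      (\<Oplus>\<^bsub>R\<^esub>l\<in>{..k}. chi_binom (k - l) g \<otimes>\<^bsub>R\<^esub> tower.class_coeff m l X)"
    if "g \<in> carrier G" "X \<in> carrier (tower.Omega m)" for g X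
    unfolding omega_act_eq chi_binom_def
    by (rule tower.class_coeff_class_act[OF coset_closed[OF that(1)] that(2) m k])
qed

lemma graded_tensor_line:
  "tensor_line R G T tower.graded (\<lambda>_. basis (Suc n) n) (\<lambda>_. tower.class_coeff (Suc n) n)
    (omega_act R G K (Suc n)) chi_binom"
proof (intro tensor_line.intro tensor_line_axioms.intro tensor_action.intro tensor_based.intro
    tensor_modules.intro tensor_action_axioms.intro T.top_gmodule_axioms T.module_axioms
    tower.graded_module tower.graded_based chi_binom_0 chi_binom_closed)
  fix k :: nat assume k: "k < 1"
  show "continuous_map (grp_top G) (ring_top R) (chi_binom k)"
    by (rule chi_binom_continuous) (use k in simp)
  fix g X assume g: "g \<in> carrier G" and X: "X \<in> carrier tower.graded"
  have "tower.class_coeff (Suc n) n X \<in> carrier R"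
    using X tower.graded_subset by (intro tower.class_coeff_closed) auto
  then show "tower.class_coeff (Suc n) n (omega_act R G K (Suc n) g X) =
      (\<Oplus>\<^bsub>R\<^esub> l\<in>{..k}. chi_binom (k - l) g \<otimes>\<^bsub>R\<^esub> tower.class_coeff (Suc n) n X)"
    using k g tower.class_coeff_class_act_graded[OF coset_closed[OF g] X]
    by (simp add: chi_binom_closed omega_act_eq flip: chi_binom_def)
qed (simp_all add: tower.graded_simps subsetD[OF tower.graded_subset] omega_act_hom omega_act_one
    omega_act_mult tower.class_act_graded[OF coset_closed, folded omega_act_eq])

sublocale truncation: truncation_sequence R G T "tower.Omega (Suc n)" n "basis (Suc n)"
  "tower.class_coeff (Suc n)" "omega_act R G K (Suc n)" chi_binom "tower.Omega n" "basis n"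
  "tower.class_coeff n" "omega_act R G K n" tower.graded tower.reduce
  by (intro truncation_sequence.intro truncation_sequence_axioms.intro graded_tensor_line omega_tensor_action)
    (simp_all add: tower.graded_subset tower.graded_simps tower.reduce_hom tower.class_coeff_reduce
      omega_act_eq tower.reduce_class_act coset_closed)

context
  fixes f :: "'g \<Rightarrow> ('m \<times> ('g set set \<Rightarrow> 'g set set \<Rightarrow> 'r) set \<Rightarrow> 'r) set" and lam :: "nat \<Rightarrow> 'g \<Rightarrow> 'm"
  assumes f: "f \<in> Z1 G (T_omega R G K T n)"
    and lam: "\<And>k g. k < n \<Longrightarrow> g \<in> carrier G \<Longrightarrow> lam k g \<in> carrier T"
    and f_lam: "\<And>g. g \<in> carrier G \<Longrightarrow>
      f g = (\<Oplus>\<^bsub>T_omega R G K T n\<^esub>k\<in>{..<n}. pure_tensor R T (omega_quot R H n) (lam k g) (basis n k))"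
begin

lemma f_of_coords: "g \<in> carrier G \<Longrightarrow> f g = truncation.A0.of_coords (\<lambda>k. lam k g)"
  unfolding truncation.A0.of_coords_def
  using f_lam finsum_eq_of_add_monoid_eq[of truncation.A0.TN truncation.A0.MN]
  by (simp add: truncation.A0.TN_simps)

lemma binom_toeplitz_system: "toeplitz_system R G T n chi_binom lam (\<lambda>g. binom_mat R p q \<pi> n (chi g))"
proof (intro toeplitz_system.intro toeplitz_system_axioms.intro T.top_gmodule_axioms chi_binom_closed
    chi_binom_0 chi_binom_mult chi_binom_continuous lam
    truncation.lam_continuous[OF f lam f_of_coords] truncation.lam_cocycle[OF f lam f_of_coords])
  fix g assume "g \<in> carrier G"
  then show "binom_mat R p q \<pi> n (chi g) =
      (\<lambda>(i, j)\<in>{1..n+1} \<times> {1..n+1}. if i \<le> j then chi_binom (j - i) g else \<zero>\<^bsub>R\<^esub>)"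
    unfolding binom_mat_def by (intro restrict_ext) (auto simp: quot_binom_eq_chi_binom)
qed

lemma Psi_class1:
  "Psi R G K T n (class1 G (T_omega R G K T n) f) =
    pure_tensor R (H2 G T) (aug_graded R H n)
      (massey_product G T n (attached_system R T n (\<lambda>g. binom_mat R p q \<pi> n (chi g)) lam)) (basis (Suc n) n)"
proof -
  have "Psi R G K T n (class1 G (T_omega R G K T n) f) =
      inv_into (carrier (tensor R (H2 G T) tower.graded)) truncation.Ag.tensor_H2_map
        (connecting G truncation.Ag.TN truncation.A1.TN truncation.incl truncation.proj
          (class1 G truncation.A0.TN f))"
    by (simp add: Psi_def truncation.Ag.tensor_H2_map_def H2_tensor_map_def T_incl_def T_proj_def
        truncation.incl.tensor_map_def truncation.proj.tensor_map_def Let_def)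
  also have "\<dots> = pure_tensor R (H2 G T) tower.graded (class2 G T (truncation.massey_cochain lam)) (basis (Suc n) n)"
    by (rule truncation.inv_tensor_H2_map_connecting[OF f lam f_of_coords])
  also have "class2 G T (truncation.massey_cochain lam) =
      massey_product G T n (attached_system R T n (\<lambda>g. binom_mat R p q \<pi> n (chi g)) lam)"
    unfolding toeplitz_system.massey_product_rho[OF binom_toeplitz_system]
    by (rule arg_cong[OF truncation.massey_cochain_def[OF f lam f_of_coords]])
  finally show ?thesis .
qed

end

end

lemma (in Zp_character) generator_eq:
  assumes h: "h \<in> carrier H" "the_elem (chi ` h) = \<one>\<^bsub>A\<^esub>"
  shows "h = chi_fibre \<one>\<^bsub>Zp p\<^esub>"
proof -
  obtain g where g: "g \<in> carrier G" "h = K #>\<^bsub>G\<^esub> g" using h(1) by (auto simp: quot_topgroup_carrier)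
  then have "chi ` h = {chi g}" by (auto simp: chi.kernel_coset_eq)
  then have "chi g = q \<one>\<^bsub>Zp p\<^esub>" using h(2) by simp
  then show ?thesis using coset_eq_chi_fibre[OF g(1)] g(2) by simp
qed

theorem theorem4p4:
  fixes p n :: nat
    and G :: "'g topgroup"
    and A :: "'a topring" and R :: "'r topring"
    and q :: "(nat \<Rightarrow> int) \<Rightarrow> 'a" and \<pi> :: "'a \<Rightarrow> 'r"
    and chi :: "'g \<Rightarrow> 'a"
    and K :: "'g set" and H :: "'g set topgroup" and h :: "'g set"
    and \<Omega> :: "('g set set \<Rightarrow> 'g set set \<Rightarrow> 'r) topring"
    and x :: "'g set set \<Rightarrow> 'g set set \<Rightarrow> 'r"
    and M :: "('g set \<Rightarrow> 'g set \<Rightarrow> 'r, 't) topmodule"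
    and T :: "('r, 't, 'g) gmodule"
    and f :: "'g \<Rightarrow> ('t \<times> ('g set set \<Rightarrow> 'g set set \<Rightarrow> 'r) set \<Rightarrow> 'r) set"
    and lam :: "nat \<Rightarrow> 'g \<Rightarrow> 't"
    and \<theta> :: "'g \<Rightarrow> (nat \<times> nat \<Rightarrow> 'r)"
    and \<rho> :: "'g \<Rightarrow> ((nat \<times> nat \<Rightarrow> 'r) \<times> (nat \<Rightarrow> 't)) set"
  assumes p: "prime p" and n: "1 \<le> n"
    and G: "profinite_group G"
    and A: "topring_quotient (Zp p) A q" "\<one>\<^bsub>A\<^esub> \<noteq> \<zero>\<^bsub>A\<^esub>"
    and R: "topring_quotient A R \<pi>" "\<one>\<^bsub>R\<^esub> \<noteq> \<zero>\<^bsub>R\<^esub>"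
    and size: "q \<in> ring_iso (Zp p) A \<or>
               finite (carrier A) \<and> n * card (carrier R) < p * card (carrier A)"
    and chi: "chi \<in> hom G (add_monoid A)" "chi ` carrier G = carrier A"
            "continuous_map (grp_top G) (ring_top A) chi"
    and K: "K = kernel G (add_monoid A) chi" and H: "H = quot_topgroup G K"
    and \<Omega>: "\<Omega> = completed_group_ring R H"
    and h: "h \<in> carrier H" "the_elem (chi ` h) = \<one>\<^bsub>A\<^esub>"
    and x: "x = cgr_elt R H h \<ominus>\<^bsub>\<Omega>\<^esub> \<one>\<^bsub>\<Omega>\<^esub>"
    and M: "compact_module (completed_group_ring R G) M"
    and T: "T = coeff_module R G M" "fin_gen_over R T"
    and f: "f \<in> Z1 G (T_omega R G K T n)"
    and lam: "\<And>k g. k < n \<Longrightarrow> g \<in> carrier G \<Longrightarrow> lam k g \<in> carrier T"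
    and f_lam: "\<And>g. g \<in> carrier G \<Longrightarrow>
       f g = (\<Oplus>\<^bsub>T_omega R G K T n\<^esub>k\<in>{..<n}.
                pure_tensor R T (omega_quot R H n) (lam k g)
                  (aug_pow R H n +>\<^bsub>\<Omega>\<^esub> (x [^]\<^bsub>\<Omega>\<^esub> k)))"
    and \<theta>: "\<theta> = (\<lambda>g. binom_mat R p q \<pi> n (chi g))"
    and \<rho>: "\<rho> = attached_system R T n \<theta> lam"
  shows "proper_defining_system R G T n \<theta> \<rho> \<and>
         Psi R G K T n (class1 G (T_omega R G K T n) f) =
           pure_tensor R (H2 G T) (aug_graded R H n) (massey_product G T n \<rho>)
             (aug_pow R H (Suc n) +>\<^bsub>\<Omega>\<^esub> (x [^]\<^bsub>\<Omega>\<^esub> n))"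
proof -
  interpret Zp_character p n G A R q \<pi> chi
    by unfold_locales (use p G A(1) R(1) size chi in auto)
  have "top_gmodule R G T"
    unfolding T(1) by (rule coeff_module_top_gmodule[OF G R_cring top_R M])
  then interpret Zp_character_module p n G A R q \<pi> chi T
    by (intro Zp_character_module.intro Zp_character_axioms)
  note H_eq = H[unfolded K]
  have x_eq: "x = tower.aug_gen"
    unfolding x \<Omega> H_eq tower.aug_gen_def using generator_eq[OF h[unfolded H_eq]] by simp
  note cocycle = f[unfolded K] lam f_lam[unfolded x_eq \<Omega> H_eq K]
  have "proper_defining_system R G T n \<theta> \<rho>"
    unfolding \<rho> \<theta> by (rule toeplitz_system.attached_system_proper[OF binom_toeplitz_system[OF cocycle]])
  moreover have "Psi R G K T n (class1 G (T_omega R G K T n) f) =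
      pure_tensor R (H2 G T) (aug_graded R H n) (massey_product G T n \<rho>)
        (aug_pow R H (Suc n) +>\<^bsub>\<Omega>\<^esub> (x [^]\<^bsub>\<Omega>\<^esub> n))"
    unfolding \<rho> \<theta> x_eq \<Omega> H_eq K by (rule Psi_class1[OF cocycle])
  ultimately show ?thesis ..
qed

end
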